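(* Let $C$, $D$ and $E$ be abelian categories such that $C$ and $D$ have enough projectives, let $F\colon C\times D\to E$ be an additive bifunctor, covariant in both variables and right-exact in both variables, and let $I$ and $J$ be small categories. Suppose we are given a morphism of short exact sequences in $C^I$ from $0\to L\to M\to N\to 0$ to $0\to L'\to M'\to N'\to 0$ (with vertical maps $L\to L'$, $M\to M'$, $N\to N'$), and a morphism $f\colon A\to B$ in $D^J$. Then in $E^{I\times J}$ the sequences \[ \cdots\to F_{n+1}^{I\times J}(N,A)\xrightarrow{\delta_{n+1}^{I\times J}}F_n^{I\times J}(L,A)\to F_n^{I\times J}(M,A)\to F_n^{I\times J}(N,A)\xrightarrow{\delta_n^{I\times J}}F_{n-1}^{I\times J}(L,A)\to\cdots \] and \[ \cdots\to F_{n+1}^{I\times J}(N',B)\xrightarrow{\delta_{n+1}^{I\times J}}F_n^{I\times J}(L',B)\to F_n^{I\times J}(M',B)\to F_n^{I\times J}(N',B)\xrightarrow{\delta_n^{I\times J}}F_{n-1}^{I\times J}(L',B)\to\cdots \] are exact, and together with the vertical maps $F_n^{I\times J}(L,A)\to F_n^{I\times J}(L',B)$, $F_n^{I\times J}(M,A)\to F_n^{I\times J}(M',B)$, $F_n^{I\times J}(N,A)\to F_n^{I\times J}(N',B)$ induced by the given morphisms they form a commutative diagram (the rows being the two sequences). Similarly with the variables switched: given a morphism of short exact sequences in $D^J$ from $0\to L\to M\to N\to 0$ to $0\to L'\to M'\to N'\to 0$ and a morphism $A\to B$ in $C^I$, the sequences $\cdots\to F_{n+1}^{I\times J}(A,N)\xrightarrow{\delta_{n+1}^{I\times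 J}}F_n^{I\times J}(A,L)\to F_n^{I\times J}(A,M)\to F_n^{I\times J}(A,N)\xrightarrow{\delta_n^{I\times J}}F_{n-1}^{I\times J}(A,L)\to\cdots$ and $\cdots\to F_{n+1}^{I\times J}(B,N')\xrightarrow{\delta_{n+1}^{I\times J}}F_n^{I\times J}(B,L')\to F_n^{I\times J}(B,M')\to F_n^{I\times J}(B,N')\xrightarrow{\delta_n^{I\times J}}F_{n-1}^{I\times J}(B,L')\to\cdots$ are exact and form, with the induced vertical maps from the first to the second, a commutative diagram in $E^{I\times J}$.
   Context: $C^I$ denotes the (abelian) category of functors $I\to C$; for $X\in C^I$, $X^k$ is its value at $k\in I$. $F_n=L_nF\colon C\times D\to E$ denotes the $n$th left derived functor of the bifunctor $F$ in the sense of Cartan–Eilenberg: for $X\in C$, $Y\in D$ with projective resolutions $P_\ast\to X$ and $Q_\ast\to Y$, $F_n(X,Y)$ is the $n$th homology of the total complex of the double complex $F(P_\ast,Q_\ast)$; it is a bifunctor, and $F_n=0$ for $n<0$. For a short exact sequence $0\to L\to M\to N\to 0$ in $C$ and $Y\in D$ the connecting morphism $\delta_n\colon F_n(N,Y)\to F_{n-1}(L,Y)$ is the one arising from the short exact sequence of total complexes obtained by choosing projective resolutions of $L,M,N$ forming a (degreewise split) short exact sequence and a projective resolution of $Y$; similarly in the second variable. The functor $F_n^{I\times J}\colon C^I\times D^J\to E^{I\times J}$ is defined componentwise: $F_n^{I\times J}(X,Y)$ has value $F_n(X^k,Y^i)$ at $(k,i)\in I\times J$, with structure maps and action on morphisms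 induced by functoriality of $F_n$. For a short exact sequence $0\to L\to M\to N\to 0$ in $C^I$ and $A\in D^J$, $\delta_n^{I\times J}\colon F_n^{I\times J}(N,A)\to F_{n-1}^{I\times J}(L,A)$ is the morphism whose $(k,i)$ component is the connecting morphism $\delta_n\colon F_n(N^k,A^i)\to F_{n-1}(L^k,A^i)$ coming from $0\to L^k\to M^k\to N^k\to 0$; similarly, for a short exact sequence in $D^J$ and an object of $C^I$, its components are the connecting morphisms in the second variable. *)

theory Defs
  imports "HOL-Algebra.Group"
begin

section \<open>Categories and functors\<close>

text \<open>
  A category is a record with carrier sets of objects and arrows. The composite
  \<open>g \<cdot> f\<close> means ``first f, then g''; only its values on composable arrows matter.
\<close>

record ('o, 'a) cat =
  Obj :: "'o set"
  Arr :: "'a set"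
  Dom :: "'a \<Rightarrow> 'o"
  Cod :: "'a \<Rightarrow> 'o"
  Ide :: "'o \<Rightarrow> 'a"
  Cmp :: "'a \<Rightarrow> 'a \<Rightarrow> 'a"  (infixl "\<cdot>\<index>" 70)

definition Hom :: "('o, 'a, 'x) cat_scheme \<Rightarrow> 'o \<Rightarrow> 'o \<Rightarrow> 'a set" where
  "Hom C a b = {f \<in> Arr C. Dom C f = a \<and> Cod C f = b}"

locale category =
  fixes C :: "('o, 'a, 'x) cat_scheme" (structure)
  assumes Dom_in: "f \<in> Arr C \<Longrightarrow> Dom C f \<in> Obj C"
    and Cod_in: "f \<in> Arr C \<Longrightarrow> Cod C f \<in> Obj C"
    and Ide_in: "a \<in> Obj C \<Longrightarrow> Ide C a \<in> Hom C a a"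
    and Cmp_in: "\<lbrakk>f \<in> Hom C a b; g \<in> Hom C b c\<rbrakk> \<Longrightarrow> g \<cdot> f \<in> Hom C a c"
    and Cmp_Ide: "f \<in> Hom C a b \<Longrightarrow> f \<cdot> Ide C a = f"
    and Ide_Cmp: "f \<in> Hom C a b \<Longrightarrow> Ide C b \<cdot> f = f"
    and Cmp_assoc: "\<lbrakk>f \<in> Hom C a b; g \<in> Hom C b c; h \<in> Hom C c d\<rbrakk>
        \<Longrightarrow> (h \<cdot> g) \<cdot> f = h \<cdot> (g \<cdot> f)"

record ('o1, 'a1, 'o2, 'a2) ftr =
  OMap :: "'o1 \<Rightarrow> 'o2"
  AMap :: "'a1 \<Rightarrow> 'a2"

definition is_functor ::
  "('o1, 'a1, 'x) cat_scheme \<Rightarrow> ('o2, 'a2, 'y) cat_scheme \<Rightarrow> ('o1, 'a1, 'o2, 'a2) ftr \<Rightarrow> bool" where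
  "is_functor C D F \<longleftrightarrow>
     (\<forall>a \<in> Obj C. OMap F a \<in> Obj D \<and> AMap F (Ide C a) = Ide D (OMap F a)) \<and>
     (\<forall>f \<in> Arr C. AMap F f \<in> Hom D (OMap F (Dom C f)) (OMap F (Cod C f))) \<and>
     (\<forall>f \<in> Arr C. \<forall>g \<in> Arr C. Cod C f = Dom C g \<longrightarrow>
        AMap F (g \<cdot>\<^bsub>C\<^esub> f) = AMap F g \<cdot>\<^bsub>D\<^esub> AMap F f)"

definition prod_cat ::
  "('o1, 'a1, 'x) cat_scheme \<Rightarrow> ('o2, 'a2, 'y) cat_scheme \<Rightarrow> ('o1 \<times> 'o2, 'a1 \<times> 'a2) cat" where
  "prod_cat C D =
     \<lparr>Obj = Obj C \<times> Obj D, Arr = Arr C \<times> Arr D,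
      Dom = (\<lambda>(f, g). (Dom C f, Dom D g)), Cod = (\<lambda>(f, g). (Cod C f, Cod D g)),
      Ide = (\<lambda>(a, b). (Ide C a, Ide D b)),
      Cmp = (\<lambda>(f', g') (f, g). (f' \<cdot>\<^bsub>C\<^esub> f, g' \<cdot>\<^bsub>D\<^esub> g))\<rparr>"

definition mono_arr :: "('o, 'a, 'x) cat_scheme \<Rightarrow> 'a \<Rightarrow> bool" where
  "mono_arr C m \<longleftrightarrow> m \<in> Arr C \<and>
     (\<forall>a. \<forall>u \<in> Hom C a (Dom C m). \<forall>v \<in> Hom C a (Dom C m).
        m \<cdot>\<^bsub>C\<^esub> u = m \<cdot>\<^bsub>C\<^esub> v \<longrightarrow> u = v)"

definition epi_arr :: "('o, 'a, 'x) cat_scheme \<Rightarrow> 'a \<Rightarrow> bool" where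
  "epi_arr C e \<longleftrightarrow> e \<in> Arr C \<and>
     (\<forall>b. \<forall>u \<in> Hom C (Cod C e) b. \<forall>v \<in> Hom C (Cod C e) b.
        u \<cdot>\<^bsub>C\<^esub> e = v \<cdot>\<^bsub>C\<^esub> e \<longrightarrow> u = v)"

definition zero_object :: "('o, 'a, 'x) cat_scheme \<Rightarrow> 'o \<Rightarrow> bool" where
  "zero_object C z \<longleftrightarrow> z \<in> Obj C \<and>
     (\<forall>a \<in> Obj C. (\<exists>!f. f \<in> Hom C a z) \<and> (\<exists>!f. f \<in> Hom C z a))"

definition comm_square :: "('o, 'a, 'x) cat_scheme \<Rightarrow> 'a \<Rightarrow> 'a \<Rightarrow> 'a \<Rightarrow> 'a \<Rightarrow> bool" where
  \<comment> \<open>\<open>f\<close> top, \<open>u\<close> left, \<open>v\<close> right, \<open>f'\<close> bottom\<close>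
  "comm_square C f u v f' \<longleftrightarrow>
     f \<in> Hom C (Dom C u) (Dom C v) \<and> f' \<in> Hom C (Cod C u) (Cod C v) \<and>
     u \<in> Arr C \<and> v \<in> Arr C \<and> v \<cdot>\<^bsub>C\<^esub> f = f' \<cdot>\<^bsub>C\<^esub> u"

section \<open>Abelian categories\<close>

text \<open>The abelian group structure on the Hom sets is part of the data.\<close>

record ('o, 'a) addcat = "('o, 'a) cat" +
  Add :: "'a \<Rightarrow> 'a \<Rightarrow> 'a"
  Zero :: "'o \<Rightarrow> 'o \<Rightarrow> 'a"

definition hom_group :: "('o, 'a, 'x) addcat_scheme \<Rightarrow> 'o \<Rightarrow> 'o \<Rightarrow> 'a monoid" where
  "hom_group C a b = \<lparr>carrier = Hom C a b, monoid.mult = Add C, one = Zero C a b\<rparr>"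

locale preadditive_category = category C
  for C :: "('o, 'a, 'x) addcat_scheme" (structure) +
  assumes hom_comm_group: "\<lbrakk>a \<in> Obj C; b \<in> Obj C\<rbrakk> \<Longrightarrow> comm_group (hom_group C a b)"
    and Cmp_Add: "\<lbrakk>f \<in> Hom C a b; f' \<in> Hom C a b; g \<in> Hom C b c\<rbrakk>
        \<Longrightarrow> g \<cdot> Add C f f' = Add C (g \<cdot> f) (g \<cdot> f')"
    and Add_Cmp: "\<lbrakk>f \<in> Hom C a b; g \<in> Hom C b c; g' \<in> Hom C b c\<rbrakk>
        \<Longrightarrow> Add C g g' \<cdot> f = Add C (g \<cdot> f) (g' \<cdot> f)"

definition is_kernel :: "('o, 'a, 'x) addcat_scheme \<Rightarrow> 'a \<Rightarrow> 'a \<Rightarrow> bool" where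
  "is_kernel C f k \<longleftrightarrow>
     f \<in> Arr C \<and> k \<in> Arr C \<and> Cod C k = Dom C f \<and>
     f \<cdot>\<^bsub>C\<^esub> k = Zero C (Dom C k) (Cod C f) \<and>
     (\<forall>h \<in> Arr C. Cod C h = Dom C f \<and> f \<cdot>\<^bsub>C\<^esub> h = Zero C (Dom C h) (Cod C f) \<longrightarrow>
        (\<exists>!u. u \<in> Hom C (Dom C h) (Dom C k) \<and> k \<cdot>\<^bsub>C\<^esub> u = h))"

definition is_cokernel :: "('o, 'a, 'x) addcat_scheme \<Rightarrow> 'a \<Rightarrow> 'a \<Rightarrow> bool" where
  "is_cokernel C f c \<longleftrightarrow>
     f \<in> Arr C \<and> c \<in> Arr C \<and> Dom C c = Cod C f \<and>
     c \<cdot>\<^bsub>C\<^esub> f = Zero C (Dom C f) (Cod C c) \<and>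
     (\<forall>h \<in> Arr C. Dom C h = Cod C f \<and> h \<cdot>\<^bsub>C\<^esub> f = Zero C (Dom C f) (Cod C h) \<longrightarrow>
        (\<exists>!u. u \<in> Hom C (Cod C c) (Cod C h) \<and> u \<cdot>\<^bsub>C\<^esub> c = h))"

definition is_biproduct ::
  "('o, 'a, 'x) addcat_scheme \<Rightarrow> 's set \<Rightarrow> ('s \<Rightarrow> 'o) \<Rightarrow> 'o \<Rightarrow> ('s \<Rightarrow> 'a) \<Rightarrow> ('s \<Rightarrow> 'a) \<Rightarrow> bool" where
  \<comment> \<open>\<open>B\<close> with injections \<open>i\<close> and projections \<open>p\<close> is both coproduct and product of the family
     \<open>X\<close> indexed by \<open>S\<close>; for empty \<open>S\<close> this says that \<open>B\<close> is a zero object.\<close>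
  "is_biproduct C S X B i p \<longleftrightarrow>
     B \<in> Obj C \<and>
     (\<forall>s \<in> S. i s \<in> Hom C (X s) B \<and> p s \<in> Hom C B (X s)) \<and>
     (\<forall>s \<in> S. \<forall>t \<in> S. p t \<cdot>\<^bsub>C\<^esub> i s = (if s = t then Ide C (X s) else Zero C (X s) (X t))) \<and>
     (\<forall>a \<in> Obj C. \<forall>h. (\<forall>s \<in> S. h s \<in> Hom C a (X s)) \<longrightarrow>
        (\<exists>!u. u \<in> Hom C a B \<and> (\<forall>s \<in> S. p s \<cdot>\<^bsub>C\<^esub> u = h s))) \<and>
     (\<forall>a \<in> Obj C. \<forall>h. (\<forall>s \<in> S. h s \<in> Hom C (X s) a) \<longrightarrow>
        (\<exists>!u. u \<in> Hom C B a \<and> (\<forall>s \<in> S. u \<cdot>\<^bsub>C\<^esub> i s = h s)))"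

locale abelian_category = preadditive_category C
  for C :: "('o, 'a, 'x) addcat_scheme" (structure) +
  assumes has_zero: "\<exists>z. zero_object C z"
    and has_biproducts: "\<lbrakk>a \<in> Obj C; b \<in> Obj C\<rbrakk> \<Longrightarrow>
        \<exists>B i p. is_biproduct C (UNIV :: bool set) (\<lambda>s. if s then a else b) B i p"
    and has_kernels: "f \<in> Arr C \<Longrightarrow> \<exists>k. is_kernel C f k"
    and has_cokernels: "f \<in> Arr C \<Longrightarrow> \<exists>c. is_cokernel C f c"
    and mono_normal: "mono_arr C m \<Longrightarrow> \<exists>f. is_kernel C f m"
    and epi_normal: "epi_arr C e \<Longrightarrow> \<exists>f. is_cokernel C f e"

text \<open>Exactness of \<open>\<bullet> \<midarrow>f\<rightarrow> \<bullet> \<midarrow>g\<rightarrow> \<bullet>\<close>: the image of f, that is the kernel of its cokernel,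
  is the kernel of g.\<close>

definition exact_at :: "('o, 'a, 'x) addcat_scheme \<Rightarrow> 'a \<Rightarrow> 'a \<Rightarrow> bool" where
  "exact_at C f g \<longleftrightarrow>
     f \<in> Arr C \<and> g \<in> Arr C \<and> Cod C f = Dom C g \<and>
     (\<exists>c k. is_cokernel C f c \<and> is_kernel C c k \<and> is_kernel C g k)"

definition short_exact :: "('o, 'a, 'x) addcat_scheme \<Rightarrow> 'a \<Rightarrow> 'a \<Rightarrow> bool" where
  "short_exact C f g \<longleftrightarrow> mono_arr C f \<and> epi_arr C g \<and> exact_at C f g"

definition short_exact_map ::
  "('o, 'a, 'x) addcat_scheme \<Rightarrow> 'a \<Rightarrow> 'a \<Rightarrow> 'a \<Rightarrow> 'a \<Rightarrow> 'a \<Rightarrow> 'a \<Rightarrow> 'a \<Rightarrow> bool" where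
  "short_exact_map C f g f' g' l m r \<longleftrightarrow>
     short_exact C f g \<and> short_exact C f' g' \<and>
     comm_square C f l m f' \<and> comm_square C g m r g'"

definition projective :: "('o, 'a, 'x) cat_scheme \<Rightarrow> 'o \<Rightarrow> bool" where
  "projective C P \<longleftrightarrow> P \<in> Obj C \<and>
     (\<forall>e f. epi_arr C e \<and> f \<in> Hom C P (Cod C e) \<longrightarrow>
        (\<exists>h \<in> Hom C P (Dom C e). e \<cdot>\<^bsub>C\<^esub> h = f))"

definition enough_projectives :: "('o, 'a, 'x) cat_scheme \<Rightarrow> bool" where
  "enough_projectives C \<longleftrightarrow>
     (\<forall>X \<in> Obj C. \<exists>P e. projective C P \<and> e \<in> Hom C P X \<and> epi_arr C e)"

section \<open>Bifunctors\<close>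

definition fix_right ::
  "('o2, 'a2, 'y) cat_scheme \<Rightarrow> ('o1 \<times> 'o2, 'a1 \<times> 'a2, 'o3, 'a3) ftr \<Rightarrow> 'o2
    \<Rightarrow> ('o1, 'a1, 'o3, 'a3) ftr" where
  "fix_right D F Y = \<lparr>OMap = (\<lambda>X. OMap F (X, Y)), AMap = (\<lambda>f. AMap F (f, Ide D Y))\<rparr>"

definition fix_left ::
  "('o1, 'a1, 'x) cat_scheme \<Rightarrow> ('o1 \<times> 'o2, 'a1 \<times> 'a2, 'o3, 'a3) ftr \<Rightarrow> 'o1
    \<Rightarrow> ('o2, 'a2, 'o3, 'a3) ftr" where
  "fix_left C F X = \<lparr>OMap = (\<lambda>Y. OMap F (X, Y)), AMap = (\<lambda>g. AMap F (Ide C X, g))\<rparr>"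

definition additive_functor ::
  "('o1, 'a1, 'x) addcat_scheme \<Rightarrow> ('o2, 'a2, 'y) addcat_scheme
    \<Rightarrow> ('o1, 'a1, 'o2, 'a2) ftr \<Rightarrow> bool" where
  "additive_functor C E G \<longleftrightarrow> is_functor C E G \<and>
     (\<forall>a b. \<forall>f \<in> Hom C a b. \<forall>f' \<in> Hom C a b.
        AMap G (Add C f f') = Add E (AMap G f) (AMap G f'))"

definition right_exact ::
  "('o1, 'a1, 'x) addcat_scheme \<Rightarrow> ('o2, 'a2, 'y) addcat_scheme
    \<Rightarrow> ('o1, 'a1, 'o2, 'a2) ftr \<Rightarrow> bool" where
  "right_exact C E G \<longleftrightarrow>
     (\<forall>f g. short_exact C f g \<longrightarrow> exact_at E (AMap G f) (AMap G g) \<and> epi_arr E (AMap G g))"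

definition additive_bifunctor ::
  "('o1, 'a1, 'x) addcat_scheme \<Rightarrow> ('o2, 'a2, 'y) addcat_scheme \<Rightarrow> ('o3, 'a3, 'z) addcat_scheme
    \<Rightarrow> ('o1 \<times> 'o2, 'a1 \<times> 'a2, 'o3, 'a3) ftr \<Rightarrow> bool" where
  "additive_bifunctor C D E F \<longleftrightarrow>
     is_functor (prod_cat C D) E F \<and>
     (\<forall>Y \<in> Obj D. additive_functor C E (fix_right D F Y)) \<and>
     (\<forall>X \<in> Obj C. additive_functor D E (fix_left C F X))"

definition right_exact_bifunctor ::
  "('o1, 'a1, 'x) addcat_scheme \<Rightarrow> ('o2, 'a2, 'y) addcat_scheme \<Rightarrow> ('o3, 'a3, 'z) addcat_scheme
    \<Rightarrow> ('o1 \<times> 'o2, 'a1 \<times> 'a2, 'o3, 'a3) ftr \<Rightarrow> bool" where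
  "right_exact_bifunctor C D E F \<longleftrightarrow>
     (\<forall>Y \<in> Obj D. right_exact C E (fix_right D F Y)) \<and>
     (\<forall>X \<in> Obj C. right_exact D E (fix_left C F X))"

section \<open>Functor categories\<close>

text \<open>
  Functors and natural transformations that serve as objects and arrows of a functor category
  are normalised to be \<open>undefined\<close> outside the carriers (\<^const>\<open>extensional\<close>), so that
  HOL equality is the intended equality. A natural transformation carries its source and target.
\<close>

record ('o1, 'a1, 'o2, 'a2) ntr =
  Src :: "('o1, 'a1, 'o2, 'a2) ftr"
  Trg :: "('o1, 'a1, 'o2, 'a2) ftr"
  Cmpt :: "'o1 \<Rightarrow> 'a2"

definition ftr_set ::
  "('o1, 'a1, 'x) cat_scheme \<Rightarrow> ('o2, 'a2, 'y) cat_scheme \<Rightarrow> ('o1, 'a1, 'o2, 'a2) ftr set" where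
  "ftr_set I C = {X. is_functor I C X \<and>
     OMap X \<in> extensional (Obj I) \<and> AMap X \<in> extensional (Arr I)}"

definition ntr_set ::
  "('o1, 'a1, 'x) cat_scheme \<Rightarrow> ('o2, 'a2, 'y) cat_scheme \<Rightarrow> ('o1, 'a1, 'o2, 'a2) ntr set" where
  "ntr_set I C = {\<sigma>. Src \<sigma> \<in> ftr_set I C \<and> Trg \<sigma> \<in> ftr_set I C \<and>
     Cmpt \<sigma> \<in> extensional (Obj I) \<and>
     (\<forall>k \<in> Obj I. Cmpt \<sigma> k \<in> Hom C (OMap (Src \<sigma>) k) (OMap (Trg \<sigma>) k)) \<and>
     (\<forall>u \<in> Arr I. Cmpt \<sigma> (Cod I u) \<cdot>\<^bsub>C\<^esub> AMap (Src \<sigma>) u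
                = AMap (Trg \<sigma>) u \<cdot>\<^bsub>C\<^esub> Cmpt \<sigma> (Dom I u))}"

definition fun_cat ::
  "('o1, 'a1, 'x) cat_scheme \<Rightarrow> ('o2, 'a2, 'y) addcat_scheme
    \<Rightarrow> (('o1, 'a1, 'o2, 'a2) ftr, ('o1, 'a1, 'o2, 'a2) ntr) addcat" where
  "fun_cat I C =
     \<lparr>Obj = ftr_set I C, Arr = ntr_set I C, Dom = Src, Cod = Trg,
      Ide = (\<lambda>X. \<lparr>Src = X, Trg = X, Cmpt = (\<lambda>k \<in> Obj I. Ide C (OMap X k))\<rparr>),
      Cmp = (\<lambda>\<tau> \<sigma>. \<lparr>Src = Src \<sigma>, Trg = Trg \<tau>,
                      Cmpt = (\<lambda>k \<in> Obj I. Cmpt \<tau> k \<cdot>\<^bsub>C\<^esub> Cmpt \<sigma> k)\<rparr>),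
      Add = (\<lambda>\<sigma> \<tau>. \<lparr>Src = Src \<sigma>, Trg = Trg \<sigma>,
                      Cmpt = (\<lambda>k \<in> Obj I. Add C (Cmpt \<sigma> k) (Cmpt \<tau> k))\<rparr>),
      Zero = (\<lambda>X Y. \<lparr>Src = X, Trg = Y, Cmpt = (\<lambda>k \<in> Obj I. Zero C (OMap X k) (OMap Y k))\<rparr>)\<rparr>"

definition pointwise ::
  "('oi, 'ai, 'x) cat_scheme \<Rightarrow> ('oj, 'aj, 'y) cat_scheme
    \<Rightarrow> ('oc \<times> 'od, 'ac \<times> 'ad, 'oe, 'ae) ftr
    \<Rightarrow> (('oi, 'ai, 'oc, 'ac) ftr \<times> ('oj, 'aj, 'od, 'ad) ftr,
        ('oi, 'ai, 'oc, 'ac) ntr \<times> ('oj, 'aj, 'od, 'ad) ntr,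
        ('oi \<times> 'oj, 'ai \<times> 'aj, 'oe, 'ae) ftr,
        ('oi \<times> 'oj, 'ai \<times> 'aj, 'oe, 'ae) ntr) ftr" where
  \<comment> \<open>For a bifunctor \<open>G\<close> from \<open>C \<times> D\<close> to \<open>E\<close>, the induced bifunctor from
     \<open>C\<^sup>I \<times> D\<^sup>J\<close> to \<open>E\<^sup>I\<^sup>\<times>\<^sup>J\<close>.\<close>
  "pointwise I J G =
     (let on_obj = (\<lambda>(X, Y).
            \<lparr>OMap = (\<lambda>(k, i) \<in> Obj I \<times> Obj J. OMap G (OMap X k, OMap Y i)),
             AMap = (\<lambda>(u, v) \<in> Arr I \<times> Arr J. AMap G (AMap X u, AMap Y v))\<rparr>)
      in \<lparr>OMap = on_obj,
          AMap = (\<lambda>(\<sigma>, \<tau>).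
            \<lparr>Src = on_obj (Src \<sigma>, Src \<tau>), Trg = on_obj (Trg \<sigma>, Trg \<tau>),
             Cmpt = (\<lambda>(k, i) \<in> Obj I \<times> Obj J. AMap G (Cmpt \<sigma> k, Cmpt \<tau> i))\<rparr>)\<rparr>)"

section \<open>Homology of complexes\<close>

text \<open>
  Complexes are indexed by the integers, with \<open>CDif K n\<close> from \<open>CObj K n\<close> to
  \<open>CObj K (n - 1)\<close>. Objects determined only up to canonical isomorphism (homology, biproducts,
  resolutions) are fixed by the choice operator.
\<close>

record ('o, 'a) cpx =
  CObj :: "int \<Rightarrow> 'o"
  CDif :: "int \<Rightarrow> 'a"

text \<open>Homology in degree n: the cycles \<open>z\<close> are a kernel of the outgoing differential, and
  \<open>q\<close> is the quotient of the cycles by the boundaries.\<close>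

definition is_homology ::
  "('o, 'a, 'x) addcat_scheme \<Rightarrow> ('o, 'a) cpx \<Rightarrow> int \<Rightarrow> 'a \<Rightarrow> 'a \<Rightarrow> bool" where
  "is_homology E K n z q \<longleftrightarrow>
     is_kernel E (CDif K n) z \<and>
     (\<exists>b \<in> Hom E (CObj K (n + 1)) (Dom E z). z \<cdot>\<^bsub>E\<^esub> b = CDif K (n + 1) \<and> is_cokernel E b q)"

definition homology_data ::
  "('o, 'a, 'x) addcat_scheme \<Rightarrow> ('o, 'a) cpx \<Rightarrow> int \<Rightarrow> 'a \<times> 'a" where
  "homology_data E K n = (SOME (z, q). is_homology E K n z q)"

definition cyc :: "('o, 'a, 'x) addcat_scheme \<Rightarrow> ('o, 'a) cpx \<Rightarrow> int \<Rightarrow> 'a" where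
  "cyc E K n = fst (homology_data E K n)"

definition hquot :: "('o, 'a, 'x) addcat_scheme \<Rightarrow> ('o, 'a) cpx \<Rightarrow> int \<Rightarrow> 'a" where
  "hquot E K n = snd (homology_data E K n)"

definition homology :: "('o, 'a, 'x) addcat_scheme \<Rightarrow> ('o, 'a) cpx \<Rightarrow> int \<Rightarrow> 'o" where
  "homology E K n = Cod E (hquot E K n)"

definition homology_map ::
  "('o, 'a, 'x) addcat_scheme \<Rightarrow> ('o, 'a) cpx \<Rightarrow> ('o, 'a) cpx \<Rightarrow> (int \<Rightarrow> 'a) \<Rightarrow> int \<Rightarrow> 'a" where
  "homology_map E K K' \<phi> n =
     (THE h. h \<in> Hom E (homology E K n) (homology E K' n) \<and>
        (\<exists>\<zeta> \<in> Hom E (Dom E (cyc E K n)) (Dom E (cyc E K' n)).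
           cyc E K' n \<cdot>\<^bsub>E\<^esub> \<zeta> = \<phi> n \<cdot>\<^bsub>E\<^esub> cyc E K n \<and>
           h \<cdot>\<^bsub>E\<^esub> hquot E K n = hquot E K' n \<cdot>\<^bsub>E\<^esub> \<zeta>))"

text \<open>
  The connecting morphism of a short exact sequence of complexes
  \<open>K \<midarrow>i\<rightarrow> L \<midarrow>p\<rightarrow> M\<close> is the usual zigzag, phrased with generalised elements: if a cycle
  \<open>w\<close> of \<open>M\<close> lifts to \<open>x\<close> in \<open>L\<close>, and the boundary of \<open>x\<close> is the image of a
  cycle \<open>a\<close> of \<open>K\<close>, then the class of \<open>w\<close> is sent to the class of \<open>a\<close>. All of
  \<open>w\<close>, \<open>x\<close>, \<open>a\<close> are arrows out of an arbitrary object. Uniqueness comes from the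
  pullback of \<open>p n\<close> along the cycles of \<open>M\<close>, for which \<open>w\<close> is an epimorphism.
\<close>

definition connecting ::
  "('o, 'a, 'x) addcat_scheme \<Rightarrow> ('o, 'a) cpx \<Rightarrow> ('o, 'a) cpx \<Rightarrow> ('o, 'a) cpx
    \<Rightarrow> (int \<Rightarrow> 'a) \<Rightarrow> (int \<Rightarrow> 'a) \<Rightarrow> int \<Rightarrow> 'a" where
  "connecting E K L M i p n =
     (THE h. h \<in> Hom E (homology E M n) (homology E K (n - 1)) \<and>
        (\<forall>W. \<forall>w \<in> Hom E W (Dom E (cyc E M n)). \<forall>x \<in> Hom E W (CObj L n).
         \<forall>a \<in> Hom E W (Dom E (cyc E K (n - 1))).
           p n \<cdot>\<^bsub>E\<^esub> x = cyc E M n \<cdot>\<^bsub>E\<^esub> w \<and>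
           CDif L n \<cdot>\<^bsub>E\<^esub> x = i (n - 1) \<cdot>\<^bsub>E\<^esub> (cyc E K (n - 1) \<cdot>\<^bsub>E\<^esub> a) \<longrightarrow>
           h \<cdot>\<^bsub>E\<^esub> (hquot E M n \<cdot>\<^bsub>E\<^esub> w) = hquot E K (n - 1) \<cdot>\<^bsub>E\<^esub> a))"

section \<open>Projective resolutions\<close>

text \<open>\<open>RDif P n\<close> goes from degree \<open>Suc n\<close> to degree n; \<open>RAug\<close> is the augmentation.\<close>

record ('o, 'a) resol =
  RObj :: "nat \<Rightarrow> 'o"
  RDif :: "nat \<Rightarrow> 'a"
  RAug :: "'a"

definition is_proj_resolution ::
  "('o, 'a, 'x) addcat_scheme \<Rightarrow> 'o \<Rightarrow> ('o, 'a) resol \<Rightarrow> bool" where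
  "is_proj_resolution C X P \<longleftrightarrow>
     (\<forall>n. projective C (RObj P n) \<and> RDif P n \<in> Hom C (RObj P (Suc n)) (RObj P n)) \<and>
     RAug P \<in> Hom C (RObj P 0) X \<and> epi_arr C (RAug P) \<and>
     exact_at C (RDif P 0) (RAug P) \<and>
     (\<forall>n. exact_at C (RDif P (Suc n)) (RDif P n))"

definition is_resolution_map ::
  "('o, 'a, 'x) addcat_scheme \<Rightarrow> ('o, 'a) resol \<Rightarrow> ('o, 'a) resol \<Rightarrow> 'a \<Rightarrow> (nat \<Rightarrow> 'a) \<Rightarrow> bool" where
  "is_resolution_map C P P' f \<phi> \<longleftrightarrow>
     (\<forall>n. \<phi> n \<in> Hom C (RObj P n) (RObj P' n)) \<and>
     RAug P' \<cdot>\<^bsub>C\<^esub> \<phi> 0 = f \<cdot>\<^bsub>C\<^esub> RAug P \<and>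
     (\<forall>n. RDif P' n \<cdot>\<^bsub>C\<^esub> \<phi> (Suc n) = \<phi> n \<cdot>\<^bsub>C\<^esub> RDif P n)"

definition res :: "('o, 'a, 'x) addcat_scheme \<Rightarrow> 'o \<Rightarrow> ('o, 'a) resol" where
  "res C X = (SOME P. is_proj_resolution C X P)"

definition res_map :: "('o, 'a, 'x) addcat_scheme \<Rightarrow> 'a \<Rightarrow> nat \<Rightarrow> 'a" where
  "res_map C f = (SOME \<phi>. is_resolution_map C (res C (Dom C f)) (res C (Cod C f)) f \<phi>)"

definition res_id :: "('o, 'a, 'x) addcat_scheme \<Rightarrow> ('o, 'a) resol \<Rightarrow> nat \<Rightarrow> 'a" where
  "res_id C P n = Ide C (RObj P n)"

text \<open>
  For a short exact sequence \<open>L \<midarrow>f\<rightarrow> M \<midarrow>g\<rightarrow> N\<close>: a short exact sequence of projective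
  resolutions over it whose outer terms are the resolutions already chosen for \<open>L\<close> and
  \<open>N\<close>. It splits degreewise since the resolution of \<open>N\<close> is degreewise projective.
\<close>

definition horseshoe ::
  "('o, 'a, 'x) addcat_scheme \<Rightarrow> 'a \<Rightarrow> 'a \<Rightarrow> ('o, 'a) resol \<times> (nat \<Rightarrow> 'a) \<times> (nat \<Rightarrow> 'a)" where
  "horseshoe C f g = (SOME (P, i, p).
     is_proj_resolution C (Cod C f) P \<and>
     is_resolution_map C (res C (Dom C f)) P f i \<and>
     is_resolution_map C P (res C (Cod C g)) g p \<and>
     (\<forall>n. short_exact C (i n) (p n)))"

section \<open>Total complexes\<close>

definition biprod_data ::
  "('o, 'a, 'x) addcat_scheme \<Rightarrow> 's set \<Rightarrow> ('s \<Rightarrow> 'o) \<Rightarrow> 'o \<times> ('s \<Rightarrow> 'a) \<times> ('s \<Rightarrow> 'a)" where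
  "biprod_data E S X = (SOME (B, i, p). is_biproduct E S X B i p)"

definition biprod :: "('o, 'a, 'x) addcat_scheme \<Rightarrow> 's set \<Rightarrow> ('s \<Rightarrow> 'o) \<Rightarrow> 'o" where
  "biprod E S X = fst (biprod_data E S X)"

definition inj_arr :: "('o, 'a, 'x) addcat_scheme \<Rightarrow> 's set \<Rightarrow> ('s \<Rightarrow> 'o) \<Rightarrow> 's \<Rightarrow> 'a" where
  "inj_arr E S X = fst (snd (biprod_data E S X))"

definition proj_arr :: "('o, 'a, 'x) addcat_scheme \<Rightarrow> 's set \<Rightarrow> ('s \<Rightarrow> 'o) \<Rightarrow> 's \<Rightarrow> 'a" where
  "proj_arr E S X = snd (snd (biprod_data E S X))"

definition matrix_arr ::
  "('o, 'a, 'x) addcat_scheme \<Rightarrow> 's set \<Rightarrow> ('s \<Rightarrow> 'o) \<Rightarrow> 't set \<Rightarrow> ('t \<Rightarrow> 'o)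
    \<Rightarrow> ('s \<Rightarrow> 't \<Rightarrow> 'a) \<Rightarrow> 'a" where
  \<comment> \<open>The arrow between biproducts whose component from summand \<open>s\<close> to summand \<open>t\<close>
     is \<open>m s t\<close>.\<close>
  "matrix_arr E S X T Y m =
     (THE h. h \<in> Hom E (biprod E S X) (biprod E T Y) \<and>
        (\<forall>s \<in> S. \<forall>t \<in> T. proj_arr E T Y t \<cdot>\<^bsub>E\<^esub> (h \<cdot>\<^bsub>E\<^esub> inj_arr E S X s) = m s t))"

definition sign_arr :: "('o, 'a, 'x) addcat_scheme \<Rightarrow> nat \<Rightarrow> 'a \<Rightarrow> 'a" where
  \<comment> \<open>\<open>(-1)\<^sup>p h\<close>\<close>
  "sign_arr E p h = (if even p then h else m_inv (hom_group E (Dom E h) (Cod E h)) h)"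

definition tot_index :: "int \<Rightarrow> (nat \<times> nat) set" where
  "tot_index n = {(p, q). int p + int q = n}"

definition dbl ::
  "('o1 \<times> 'o2, 'a1 \<times> 'a2, 'o3, 'a3) ftr \<Rightarrow> ('o1, 'a1) resol \<Rightarrow> ('o2, 'a2) resol
    \<Rightarrow> nat \<times> nat \<Rightarrow> 'o3" where
  "dbl F P Q = (\<lambda>(p, q). OMap F (RObj P p, RObj Q q))"

text \<open>Total complex of the double complex \<open>F(P\<^sub>p, Q\<^sub>q)\<close>: on the summand with index
  \<open>(p, q)\<close> the differential is \<open>F(d, 1) + (-1)\<^sup>p F(1, d)\<close>. In negative degrees the index
  set is empty and the complex is zero.\<close>

definition tot ::
  "('o1, 'a1, 'x) cat_scheme \<Rightarrow> ('o2, 'a2, 'y) cat_scheme \<Rightarrow> ('o3, 'a3, 'z) addcat_scheme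
    \<Rightarrow> ('o1 \<times> 'o2, 'a1 \<times> 'a2, 'o3, 'a3) ftr \<Rightarrow> ('o1, 'a1) resol \<Rightarrow> ('o2, 'a2) resol
    \<Rightarrow> ('o3, 'a3) cpx" where
  "tot C D E F P Q =
     \<lparr>CObj = (\<lambda>n. biprod E (tot_index n) (dbl F P Q)),
      CDif = (\<lambda>n. matrix_arr E (tot_index n) (dbl F P Q) (tot_index (n - 1)) (dbl F P Q)
        (\<lambda>(p, q) (p', q').
           if p = Suc p' \<and> q = q' then AMap F (RDif P p', Ide D (RObj Q q))
           else if p = p' \<and> q = Suc q' then sign_arr E p (AMap F (Ide C (RObj P p), RDif Q q'))
           else Zero E (dbl F P Q (p, q)) (dbl F P Q (p', q'))))\<rparr>"

definition tot_map ::
  "('o3, 'a3, 'z) addcat_scheme \<Rightarrow> ('o1 \<times> 'o2, 'a1 \<times> 'a2, 'o3, 'a3) ftr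
    \<Rightarrow> ('o1, 'a1) resol \<Rightarrow> ('o2, 'a2) resol \<Rightarrow> ('o1, 'a1) resol \<Rightarrow> ('o2, 'a2) resol
    \<Rightarrow> (nat \<Rightarrow> 'a1) \<Rightarrow> (nat \<Rightarrow> 'a2) \<Rightarrow> int \<Rightarrow> 'a3" where
  "tot_map E F P Q P' Q' \<phi> \<psi> n =
     matrix_arr E (tot_index n) (dbl F P Q) (tot_index n) (dbl F P' Q')
       (\<lambda>(p, q) (p', q').
          if p = p' \<and> q = q' then AMap F (\<phi> p, \<psi> q)
          else Zero E (dbl F P Q (p, q)) (dbl F P' Q' (p', q')))"

section \<open>Left derived bifunctors and connecting morphisms\<close>

definition left_derived ::
  "('o1, 'a1, 'x) addcat_scheme \<Rightarrow> ('o2, 'a2, 'y) addcat_scheme \<Rightarrow> ('o3, 'a3, 'z) addcat_scheme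
    \<Rightarrow> ('o1 \<times> 'o2, 'a1 \<times> 'a2, 'o3, 'a3) ftr \<Rightarrow> int
    \<Rightarrow> ('o1 \<times> 'o2, 'a1 \<times> 'a2, 'o3, 'a3) ftr" where
  "left_derived C D E F n =
     \<lparr>OMap = (\<lambda>(X, Y). homology E (tot C D E F (res C X) (res D Y)) n),
      AMap = (\<lambda>(f, g).
        let P = res C (Dom C f); Q = res D (Dom D g);
            P' = res C (Cod C f); Q' = res D (Cod D g)
        in homology_map E (tot C D E F P Q) (tot C D E F P' Q')
             (tot_map E F P Q P' Q' (res_map C f) (res_map D g)) n)\<rparr>"

text \<open>For a short exact sequence \<open>L \<midarrow>f\<rightarrow> M \<midarrow>g\<rightarrow> N\<close> in \<open>C\<close> and \<open>Y\<close> in \<open>D\<close>, the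
  connecting morphism from \<open>F\<^sub>n(N, Y)\<close> to \<open>F\<^sub>n\<^sub>-\<^sub>1(L, Y)\<close>.\<close>

definition delta1 ::
  "('o1, 'a1, 'x) addcat_scheme \<Rightarrow> ('o2, 'a2, 'y) addcat_scheme \<Rightarrow> ('o3, 'a3, 'z) addcat_scheme
    \<Rightarrow> ('o1 \<times> 'o2, 'a1 \<times> 'a2, 'o3, 'a3) ftr \<Rightarrow> int \<Rightarrow> 'a1 \<Rightarrow> 'a1 \<Rightarrow> 'o2 \<Rightarrow> 'a3" where
  "delta1 C D E F n f g Y =
     (let Q = res D Y; PL = res C (Dom C f); PN = res C (Cod C g);
          (PM, i, p) = horseshoe C f g
      in connecting E (tot C D E F PL Q) (tot C D E F PM Q) (tot C D E F PN Q)
           (tot_map E F PL Q PM Q i (res_id D Q))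
           (tot_map E F PM Q PN Q p (res_id D Q)) n)"

text \<open>For \<open>X\<close> in \<open>C\<close> and a short exact sequence \<open>L \<midarrow>f\<rightarrow> M \<midarrow>g\<rightarrow> N\<close> in \<open>D\<close>, the
  connecting morphism from \<open>F\<^sub>n(X, N)\<close> to \<open>F\<^sub>n\<^sub>-\<^sub>1(X, L)\<close>.\<close>

definition delta2 ::
  "('o1, 'a1, 'x) addcat_scheme \<Rightarrow> ('o2, 'a2, 'y) addcat_scheme \<Rightarrow> ('o3, 'a3, 'z) addcat_scheme
    \<Rightarrow> ('o1 \<times> 'o2, 'a1 \<times> 'a2, 'o3, 'a3) ftr \<Rightarrow> int \<Rightarrow> 'o1 \<Rightarrow> 'a2 \<Rightarrow> 'a2 \<Rightarrow> 'a3" where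
  "delta2 C D E F n X f g =
     (let P = res C X; QL = res D (Dom D f); QN = res D (Cod D g);
          (QM, i, p) = horseshoe D f g
      in connecting E (tot C D E F P QL) (tot C D E F P QM) (tot C D E F P QN)
           (tot_map E F P QL P QM (res_id C P) i)
           (tot_map E F P QM P QN (res_id C P) p) n)"

definition left_derived_IJ ::
  "('oi, 'ai, 'u) cat_scheme \<Rightarrow> ('oj, 'aj, 'v) cat_scheme
    \<Rightarrow> ('oc, 'ac, 'x) addcat_scheme \<Rightarrow> ('od, 'ad, 'y) addcat_scheme \<Rightarrow> ('oe, 'ae, 'z) addcat_scheme
    \<Rightarrow> ('oc \<times> 'od, 'ac \<times> 'ad, 'oe, 'ae) ftr \<Rightarrow> int
    \<Rightarrow> (('oi, 'ai, 'oc, 'ac) ftr \<times> ('oj, 'aj, 'od, 'ad) ftr,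
        ('oi, 'ai, 'oc, 'ac) ntr \<times> ('oj, 'aj, 'od, 'ad) ntr,
        ('oi \<times> 'oj, 'ai \<times> 'aj, 'oe, 'ae) ftr,
        ('oi \<times> 'oj, 'ai \<times> 'aj, 'oe, 'ae) ntr) ftr" where
  "left_derived_IJ I J C D E F n = pointwise I J (left_derived C D E F n)"

definition delta1_IJ ::
  "('oi, 'ai, 'u) cat_scheme \<Rightarrow> ('oj, 'aj, 'v) cat_scheme
    \<Rightarrow> ('oc, 'ac, 'x) addcat_scheme \<Rightarrow> ('od, 'ad, 'y) addcat_scheme \<Rightarrow> ('oe, 'ae, 'z) addcat_scheme
    \<Rightarrow> ('oc \<times> 'od, 'ac \<times> 'ad, 'oe, 'ae) ftr \<Rightarrow> int
    \<Rightarrow> ('oi, 'ai, 'oc, 'ac) ntr \<Rightarrow> ('oi, 'ai, 'oc, 'ac) ntr \<Rightarrow> ('oj, 'aj, 'od, 'ad) ftr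
    \<Rightarrow> ('oi \<times> 'oj, 'ai \<times> 'aj, 'oe, 'ae) ntr" where
  "delta1_IJ I J C D E F n f g A =
     \<lparr>Src = OMap (left_derived_IJ I J C D E F n) (Trg g, A),
      Trg = OMap (left_derived_IJ I J C D E F (n - 1)) (Src f, A),
      Cmpt = (\<lambda>(k, i) \<in> Obj I \<times> Obj J.
                delta1 C D E F n (Cmpt f k) (Cmpt g k) (OMap A i))\<rparr>"

definition delta2_IJ ::
  "('oi, 'ai, 'u) cat_scheme \<Rightarrow> ('oj, 'aj, 'v) cat_scheme
    \<Rightarrow> ('oc, 'ac, 'x) addcat_scheme \<Rightarrow> ('od, 'ad, 'y) addcat_scheme \<Rightarrow> ('oe, 'ae, 'z) addcat_scheme
    \<Rightarrow> ('oc \<times> 'od, 'ac \<times> 'ad, 'oe, 'ae) ftr \<Rightarrow> int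
    \<Rightarrow> ('oi, 'ai, 'oc, 'ac) ftr \<Rightarrow> ('oj, 'aj, 'od, 'ad) ntr \<Rightarrow> ('oj, 'aj, 'od, 'ad) ntr
    \<Rightarrow> ('oi \<times> 'oj, 'ai \<times> 'aj, 'oe, 'ae) ntr" where
  "delta2_IJ I J C D E F n A f g =
     \<lparr>Src = OMap (left_derived_IJ I J C D E F n) (A, Trg g),
      Trg = OMap (left_derived_IJ I J C D E F (n - 1)) (A, Src f),
      Cmpt = (\<lambda>(k, i) \<in> Obj I \<times> Obj J.
                delta2 C D E F n (OMap A k) (Cmpt f i) (Cmpt g i))\<rparr>"

section \<open>Long exact sequences\<close>

text \<open>A sequence with \<open>f n\<close>, \<open>g n\<close> in degree n, followed by \<open>d n\<close> into degree
  \<open>n - 1\<close>, for every integer n.\<close>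

definition long_exact ::
  "('o, 'a, 'x) addcat_scheme \<Rightarrow> (int \<Rightarrow> 'a) \<Rightarrow> (int \<Rightarrow> 'a) \<Rightarrow> (int \<Rightarrow> 'a) \<Rightarrow> bool" where
  "long_exact K f g d \<longleftrightarrow>
     (\<forall>n. exact_at K (f n) (g n) \<and> exact_at K (g n) (d n) \<and> exact_at K (d n) (f (n - 1)))"

definition ladder_commutes ::
  "('o, 'a, 'x) addcat_scheme \<Rightarrow> (int \<Rightarrow> 'a) \<Rightarrow> (int \<Rightarrow> 'a) \<Rightarrow> (int \<Rightarrow> 'a)
    \<Rightarrow> (int \<Rightarrow> 'a) \<Rightarrow> (int \<Rightarrow> 'a) \<Rightarrow> (int \<Rightarrow> 'a)
    \<Rightarrow> (int \<Rightarrow> 'a) \<Rightarrow> (int \<Rightarrow> 'a) \<Rightarrow> (int \<Rightarrow> 'a) \<Rightarrow> bool" where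
  \<comment> \<open>rows \<open>f, g, d\<close> and \<open>f', g', d'\<close>; verticals \<open>l, m, r\<close>\<close>
  "ladder_commutes K f g d f' g' d' l m r \<longleftrightarrow>
     (\<forall>n. comm_square K (f n) (l n) (m n) (f' n) \<and>
          comm_square K (g n) (m n) (r n) (g' n) \<and>
          comm_square K (d n) (r n) (l (n - 1)) (d' n))"

end

theory Submission
  imports Defs
begin

text \<open>
  Kernels, cokernels and hence exactness in a functor category are computed pointwise, so
  everything reduces to the derived bifunctors of \<open>F\<close> itself and to the naturality of the
  connecting morphisms, which also makes them morphisms of \<open>E\<^sup>I\<^sup>\<times>\<^sup>J\<close>.
  Over a short exact sequence the horseshoe resolutions split degreewise, and the additive
  functor \<open>F\<close> preserves this, so the total complexes form a degreewise split short exact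
  sequence with its long exact homology sequence. The middle resolution produced by the
  horseshoe is replaced by the chosen one along a comparison map, because on homology only
  the underlying morphisms matter and not their lifts. A morphism of short exact sequences
  lifts to a strictly commuting morphism of horseshoes: the lift on the subobject extends to
  the middle term and induces a lift on the quotient.
\<close>

section \<open>Preadditive categories\<close>

text \<open>Exactness is defined through cokernels and kernels, and homology, biproducts and
  resolutions through choice, so neither elements nor canonical representatives are at hand. Arrows
  into an object play the role of its elements. Existence statements then hold only after
  composition with an epimorphism, and every diagram chase carries such a cover along. Homology is
  handled through the classes \<open>cls\<close> of generalised cycles, on which induced maps and
  connecting morphisms are determined.

  The connecting morphism is a zigzag at chain level, so its naturality needs squares of chain maps
  that commute strictly, whereas independently chosen lifts of a commuting square agree in general
  only up to homotopy. This is why the lift to the middle resolution is constructed with its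
  restriction to the subobject prescribed.

  Exactness in a functor category speaks of arbitrary kernels and cokernels there. The reduction to
  components therefore constructs pointwise ones and compares the given ones with them through their
  universal properties.\<close>

abbreviation add_arr :: "('o, 'a, 'x) addcat_scheme \<Rightarrow> 'a \<Rightarrow> 'a \<Rightarrow> 'a" (infixl "\<oplus>\<index>" 65)
  where "f \<oplus>\<^bsub>C\<^esub> g \<equiv> Add C f g"

text \<open>The inverse is formed in the hom group between the arrow's own source and target, so the
  notation carries no objects.\<close>

definition neg_arr :: "('o, 'a, 'x) addcat_scheme \<Rightarrow> 'a \<Rightarrow> 'a" ("\<ominus>\<index> _" [81] 80)
  where "\<ominus>\<^bsub>C\<^esub> f = m_inv (hom_group C (Dom C f) (Cod C f)) f"

text \<open>As a simp rule this reduces every typing statement to membership in \<open>Arr\<close>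
  and two equations between objects, so that composites can be typed by rewriting alone.\<close>

lemma Hom_iff [simp]: "f \<in> Hom C a b \<longleftrightarrow> f \<in> Arr C \<and> Dom C f = a \<and> Cod C f = b"
  by (simp add: Hom_def)

section \<open>Composition, monomorphisms and epimorphisms\<close>

context category
begin

lemma Dom_Obj [simp]: "f \<in> Arr C \<Longrightarrow> Dom C f \<in> Obj C"
  by (rule Dom_in)

lemma Cod_Obj [simp]: "f \<in> Arr C \<Longrightarrow> Cod C f \<in> Obj C"
  by (rule Cod_in)

lemma Hom_Obj:
  assumes "f \<in> Hom C a b"
  shows "a \<in> Obj C" and "b \<in> Obj C"
  using assms by auto

lemma Cmp_arr [simp]:
  assumes "f \<in> Arr C" "g \<in> Arr C" "Cod C f = Dom C g"
  shows "g \<cdot> f \<in> Arr C" "Dom C (g \<cdot> f) = Dom C f" "Cod C (g \<cdot> f) = Cod C g"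
  using Cmp_in[of f "Dom C f" "Cod C f" g "Cod C g"] assms by auto

lemma Ide_arr [simp]:
  assumes "a \<in> Obj C"
  shows "Ide C a \<in> Arr C" "Dom C (Ide C a) = a" "Cod C (Ide C a) = a"
  using Ide_in[OF assms] by auto

lemma Cmp_Ide' [simp]: "\<lbrakk>f \<in> Arr C; Dom C f = a\<rbrakk> \<Longrightarrow> f \<cdot> Ide C a = f"
  by (rule Cmp_Ide) auto

lemma Ide_Cmp' [simp]: "\<lbrakk>f \<in> Arr C; Cod C f = a\<rbrakk> \<Longrightarrow> Ide C a \<cdot> f = f"
  by (rule Ide_Cmp) auto

lemma Cmp_assoc' [simp]:
  "\<lbrakk>f \<in> Arr C; g \<in> Arr C; h \<in> Arr C; Cod C f = Dom C g; Cod C g = Dom C h\<rbrakk>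
    \<Longrightarrow> h \<cdot> g \<cdot> f = h \<cdot> (g \<cdot> f)"
  by (rule Cmp_assoc) auto

text \<open>Composites are normalised to the right by \<open>Cmp_assoc'\<close>, and a known
  equation between two composites then no longer matches once a further arrow \<open>x\<close>
  precedes it. This is the equation in the form that still matches; the variants below have a single
  arrow or a zero on the right-hand side.\<close>

lemma Cmp_reassoc:
  assumes "g \<cdot> f = g' \<cdot> f'"
    and "f \<in> Arr C" "g \<in> Arr C" "Cod C f = Dom C g"
    and "f' \<in> Arr C" "g' \<in> Arr C" "Cod C f' = Dom C g'"
    and "x \<in> Arr C" "Cod C x = Dom C f" "Dom C f = Dom C f'"
  shows "g \<cdot> (f \<cdot> x) = g' \<cdot> (f' \<cdot> x)"
  using assms by (metis Cmp_assoc')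

lemma Cmp_reassoc1:
  assumes "g \<cdot> f = h"
    and "f \<in> Arr C" "g \<in> Arr C" "Cod C f = Dom C g" "x \<in> Arr C" "Cod C x = Dom C f"
  shows "g \<cdot> (f \<cdot> x) = h \<cdot> x"
  using assms by (metis Cmp_assoc')

lemma mono_cancel:
  assumes "mono_arr C m" "u \<in> Hom C a (Dom C m)" "v \<in> Hom C a (Dom C m)" "m \<cdot> u = m \<cdot> v"
  shows "u = v"
  using assms unfolding mono_arr_def by blast

lemma epi_cancel:
  assumes "epi_arr C e" "u \<in> Hom C (Cod C e) b" "v \<in> Hom C (Cod C e) b" "u \<cdot> e = v \<cdot> e"
  shows "u = v"
  using assms unfolding epi_arr_def by blast

lemma epi_arr_Cmp:
  assumes "epi_arr C e" "epi_arr C e'" "Cod C e = Dom C e'"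
  shows "epi_arr C (e' \<cdot> e)"
proof -
  have a: "e \<in> Arr C" "e' \<in> Arr C"
    using assms by (auto simp: epi_arr_def)
  show ?thesis
    unfolding epi_arr_def
  proof (intro conjI allI ballI impI)
    fix b u v
    assume u: "u \<in> Hom C (Cod C (e' \<cdot> e)) b" and v: "v \<in> Hom C (Cod C (e' \<cdot> e)) b"
      and eq: "u \<cdot> (e' \<cdot> e) = v \<cdot> (e' \<cdot> e)"
    have "u \<cdot> e' = v \<cdot> e'"
      by (rule epi_cancel[OF assms(1), where b = b]) (use a u v eq assms(3) in simp_all)
    then show "u = v"
      using epi_cancel[OF assms(2), of u b v] a u v assms(3) by simp
  qed (use a assms in simp)
qed

lemma epi_arr_Ide: "a \<in> Obj C \<Longrightarrow> epi_arr C (Ide C a)"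
  by (auto simp: epi_arr_def)

lemma epi_arr_right_factor:
  assumes "epi_arr C (g \<cdot> f)" "f \<in> Arr C" "g \<in> Arr C" "Cod C f = Dom C g"
  shows "epi_arr C g"
  unfolding epi_arr_def
proof (intro conjI allI ballI impI)
  fix b u v
  assume u: "u \<in> Hom C (Cod C g) b" and v: "v \<in> Hom C (Cod C g) b" and eq: "u \<cdot> g = v \<cdot> g"
  have "u \<cdot> (g \<cdot> f) = v \<cdot> (g \<cdot> f)"
    by (rule Cmp_reassoc[OF eq]) (use u v assms in simp_all)
  then show "u = v"
    using epi_cancel[OF assms(1), of u b v] u v assms by simp
qed fact

end

lemma hom_group_simps:
  "carrier (hom_group C a b) = Hom C a b"
  "f \<otimes>\<^bsub>hom_group C a b\<^esub> g = f \<oplus>\<^bsub>C\<^esub> g"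
  "\<one>\<^bsub>hom_group C a b\<^esub> = Zero C a b"
  by (simp_all add: hom_group_def)

section \<open>Arithmetic in the hom groups\<close>

context preadditive_category
begin

lemma Zero_arr [simp]:
  assumes "a \<in> Obj C" "b \<in> Obj C"
  shows "Zero C a b \<in> Arr C" "Dom C (Zero C a b) = a" "Cod C (Zero C a b) = b"
proof -
  interpret comm_group "hom_group C a b" by (rule hom_comm_group[OF assms])
  show "Zero C a b \<in> Arr C" "Dom C (Zero C a b) = a" "Cod C (Zero C a b) = b"
    using one_closed by (simp_all add: hom_group_simps)
qed

lemma Add_arr [simp]:
  assumes "f \<in> Arr C" "g \<in> Arr C" "Dom C g = Dom C f" "Cod C g = Cod C f"
  shows "f \<oplus> g \<in> Arr C" "Dom C (f \<oplus> g) = Dom C f" "Cod C (f \<oplus> g) = Cod C f"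
proof -
  interpret comm_group "hom_group C (Dom C f) (Cod C f)" using assms by (simp add: hom_comm_group)
  show "f \<oplus> g \<in> Arr C" "Dom C (f \<oplus> g) = Dom C f" "Cod C (f \<oplus> g) = Cod C f"
    using m_closed[of f g] assms by (simp_all add: hom_group_simps)
qed

lemma Neg_arr [simp]:
  assumes "f \<in> Arr C"
  shows "\<ominus> f \<in> Arr C" "Dom C (\<ominus> f) = Dom C f" "Cod C (\<ominus> f) = Cod C f"
proof -
  interpret comm_group "hom_group C (Dom C f) (Cod C f)" using assms by (simp add: hom_comm_group)
  show "\<ominus> f \<in> Arr C" "Dom C (\<ominus> f) = Dom C f" "Cod C (\<ominus> f) = Cod C f"
    using inv_closed[of f] assms by (simp_all add: hom_group_simps neg_arr_def)
qed

lemma Add_commute: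
  assumes "f \<in> Arr C" "g \<in> Arr C" "Dom C g = Dom C f" "Cod C g = Cod C f"
  shows "f \<oplus> g = g \<oplus> f"
proof -
  interpret comm_group "hom_group C (Dom C f) (Cod C f)" using assms by (simp add: hom_comm_group)
  show ?thesis using m_comm[of f g] assms by (simp add: hom_group_simps)
qed

lemma Add_assoc [simp]:
  assumes "f \<in> Arr C" "g \<in> Arr C" "h \<in> Arr C" "Dom C g = Dom C f" "Cod C g = Cod C f"
    "Dom C h = Dom C f" "Cod C h = Cod C f"
  shows "f \<oplus> g \<oplus> h = f \<oplus> (g \<oplus> h)"
proof -
  interpret comm_group "hom_group C (Dom C f) (Cod C f)" using assms by (simp add: hom_comm_group)
  show ?thesis using m_assoc[of f g h] assms by (simp add: hom_group_simps)
qed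

lemma Add_left_commute:
  assumes "f \<in> Arr C" "g \<in> Arr C" "h \<in> Arr C" "Dom C g = Dom C f" "Cod C g = Cod C f"
    "Dom C h = Dom C f" "Cod C h = Cod C f"
  shows "f \<oplus> (g \<oplus> h) = g \<oplus> (f \<oplus> h)"
proof -
  interpret comm_group "hom_group C (Dom C f) (Cod C f)" using assms by (simp add: hom_comm_group)
  show ?thesis using m_lcomm[of f g h] assms by (simp add: hom_group_simps)
qed

lemmas Add_ac = Add_commute Add_left_commute

lemma Add_Zero [simp]:
  assumes "f \<in> Arr C" "Dom C f = a" "Cod C f = b"
  shows "f \<oplus> Zero C a b = f" "Zero C a b \<oplus> f = f"
proof -
  interpret comm_group "hom_group C a b" using assms by (intro hom_comm_group) auto
  show "f \<oplus> Zero C a b = f" "Zero C a b \<oplus> f = f"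
    using l_one[of f] r_one[of f] assms by (simp_all add: hom_group_simps)
qed

lemma Add_Neg [simp]:
  assumes "f \<in> Arr C"
  shows "f \<oplus> \<ominus> f = Zero C (Dom C f) (Cod C f)" "\<ominus> f \<oplus> f = Zero C (Dom C f) (Cod C f)"
proof -
  interpret comm_group "hom_group C (Dom C f) (Cod C f)" using assms by (simp add: hom_comm_group)
  show "f \<oplus> \<ominus> f = Zero C (Dom C f) (Cod C f)" "\<ominus> f \<oplus> f = Zero C (Dom C f) (Cod C f)"
    using l_inv[of f] r_inv[of f] assms by (simp_all add: hom_group_simps neg_arr_def)
qed

lemma Add_Neg_cancel [simp]:
  assumes "f \<in> Arr C" "g \<in> Arr C" "Dom C g = Dom C f" "Cod C g = Cod C f"
  shows "f \<oplus> (\<ominus> f \<oplus> g) = g" "\<ominus> f \<oplus> (f \<oplus> g) = g"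
  using assms by (simp_all flip: Add_assoc)

lemma Add_left_cancel:
  assumes "f \<oplus> g = f \<oplus> h" "f \<in> Arr C" "g \<in> Arr C" "h \<in> Arr C" "Dom C g = Dom C f"
    "Cod C g = Cod C f" "Dom C h = Dom C f" "Cod C h = Cod C f"
  shows "g = h"
  using assms Add_Neg_cancel(2) by metis

lemma Neg_unique:
  assumes "f \<oplus> g = Zero C (Dom C f) (Cod C f)" "f \<in> Arr C" "g \<in> Arr C" "Dom C g = Dom C f"
    "Cod C g = Cod C f"
  shows "\<ominus> f = g"
  by (rule Add_left_cancel[where f = f]) (use assms in simp_all)

lemma Add_Neg_eq_Zero:
  assumes "f \<oplus> \<ominus> g = Zero C a b" "f \<in> Hom C a b" "g \<in> Hom C a b"
  shows "f = g"
proof -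
  have "\<ominus> g \<oplus> f = \<ominus> g \<oplus> g"
    using assms by (simp add: Add_commute)
  then show ?thesis
    by (rule Add_left_cancel) (use assms in simp_all)
qed

lemma Neg_Neg [simp]: "f \<in> Arr C \<Longrightarrow> \<ominus> (\<ominus> f) = f"
  by (rule Neg_unique) simp_all

lemma Neg_Add [simp]:
  assumes "f \<in> Arr C" "g \<in> Arr C" "Dom C g = Dom C f" "Cod C g = Cod C f"
  shows "\<ominus> (f \<oplus> g) = \<ominus> f \<oplus> \<ominus> g"
proof (rule Neg_unique)
  have "f \<oplus> g \<oplus> (\<ominus> f \<oplus> \<ominus> g) = f \<oplus> (\<ominus> f \<oplus> (g \<oplus> \<ominus> g))"
    using assms by (simp add: Add_left_commute)
  also have "\<dots> = Zero C (Dom C (f \<oplus> g)) (Cod C (f \<oplus> g))"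
    using assms by simp
  finally show "f \<oplus> g \<oplus> (\<ominus> f \<oplus> \<ominus> g) = Zero C (Dom C (f \<oplus> g)) (Cod C (f \<oplus> g))" .
qed (use assms in simp_all)

lemma Neg_Zero [simp]: "\<lbrakk>a \<in> Obj C; b \<in> Obj C\<rbrakk> \<Longrightarrow> \<ominus> Zero C a b = Zero C a b"
  by (rule Neg_unique) simp_all

lemma Cmp_Add' [simp]:
  assumes "f \<in> Arr C" "f' \<in> Arr C" "g \<in> Arr C" "Dom C f' = Dom C f" "Cod C f' = Cod C f"
    "Cod C f = Dom C g"
  shows "g \<cdot> (f \<oplus> f') = g \<cdot> f \<oplus> g \<cdot> f'"
  by (rule Cmp_Add) (use assms in auto)

lemma Add_Cmp' [simp]:
  assumes "f \<in> Arr C" "g \<in> Arr C" "g' \<in> Arr C" "Dom C g' = Dom C g" "Cod C g' = Cod C g"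
    "Cod C f = Dom C g"
  shows "(g \<oplus> g') \<cdot> f = g \<cdot> f \<oplus> g' \<cdot> f"
  by (rule Add_Cmp) (use assms in auto)

lemma Cmp_Zero [simp]:
  assumes "g \<in> Arr C" "a \<in> Obj C" "Dom C g = b"
  shows "g \<cdot> Zero C a b = Zero C a (Cod C g)"
proof -
  have b: "b \<in> Obj C" using assms by auto
  have "g \<cdot> Zero C a b \<oplus> g \<cdot> Zero C a b = g \<cdot> Zero C a b \<oplus> Zero C a (Cod C g)"
    using assms b by (simp flip: Cmp_Add')
  then show ?thesis
    by (rule Add_left_cancel) (use assms b in simp_all)
qed

lemma Zero_Cmp [simp]:
  assumes "f \<in> Arr C" "c \<in> Obj C" "Cod C f = b"
  shows "Zero C b c \<cdot> f = Zero C (Dom C f) c"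
proof -
  have b: "b \<in> Obj C" using assms by auto
  have "Zero C b c \<cdot> f \<oplus> Zero C b c \<cdot> f = Zero C b c \<cdot> f \<oplus> Zero C (Dom C f) c"
    using assms b by (simp flip: Add_Cmp')
  then show ?thesis
    by (rule Add_left_cancel) (use assms b in simp_all)
qed

lemma Cmp_Neg [simp]:
  assumes "f \<in> Arr C" "g \<in> Arr C" "Cod C f = Dom C g"
  shows "g \<cdot> \<ominus> f = \<ominus> (g \<cdot> f)"
  by (rule Neg_unique[symmetric]) (use assms in \<open>simp_all flip: Cmp_Add'\<close>)

lemma Neg_Cmp [simp]:
  assumes "f \<in> Arr C" "g \<in> Arr C" "Cod C f = Dom C g"
  shows "\<ominus> g \<cdot> f = \<ominus> (g \<cdot> f)"
  by (rule Neg_unique[symmetric]) (use assms in \<open>simp_all flip: Add_Cmp'\<close>)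

lemma Cmp_reassoc0:
  assumes "g \<cdot> f = Zero C a b" "f \<in> Hom C a c" "g \<in> Hom C c b" "x \<in> Arr C" "Cod C x = a"
  shows "g \<cdot> (f \<cdot> x) = Zero C (Dom C x) b"
proof -
  have "a \<in> Obj C" "b \<in> Obj C" using assms by auto
  then show ?thesis using Cmp_reassoc1[OF assms(1), of x] assms by simp
qed

text \<open>Two arrows with the same composite differ by an arrow that \<open>m\<close> kills, so
  cancellation has to be tested on such arrows only.\<close>

lemma mono_arrI:
  assumes "m \<in> Arr C"
    and "\<And>u. \<lbrakk>u \<in> Arr C; Cod C u = Dom C m; m \<cdot> u = Zero C (Dom C u) (Cod C m)\<rbrakk>
      \<Longrightarrow> u = Zero C (Dom C u) (Dom C m)"
  shows "mono_arr C m"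
  unfolding mono_arr_def
proof (intro conjI allI ballI impI)
  fix a u v
  assume u: "u \<in> Hom C a (Dom C m)" and v: "v \<in> Hom C a (Dom C m)" and eq: "m \<cdot> u = m \<cdot> v"
  have "u \<oplus> \<ominus> v = Zero C a (Dom C m)"
    using assms(2)[of "u \<oplus> \<ominus> v"] assms(1) u v eq by simp
  then show "u = v"
    by (rule Add_Neg_eq_Zero) (use u v in auto)
qed fact

lemma epi_arrI:
  assumes "e \<in> Arr C"
    and "\<And>u. \<lbrakk>u \<in> Arr C; Dom C u = Cod C e; u \<cdot> e = Zero C (Dom C e) (Cod C u)\<rbrakk>
      \<Longrightarrow> u = Zero C (Cod C e) (Cod C u)"
  shows "epi_arr C e"
  unfolding epi_arr_def
proof (intro conjI allI ballI impI)
  fix b u v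
  assume u: "u \<in> Hom C (Cod C e) b" and v: "v \<in> Hom C (Cod C e) b" and eq: "u \<cdot> e = v \<cdot> e"
  have "u \<oplus> \<ominus> v = Zero C (Cod C e) b"
    using assms(2)[of "u \<oplus> \<ominus> v"] assms(1) u v eq by simp
  then show "u = v"
    by (rule Add_Neg_eq_Zero) (use u v in auto)
qed fact

lemma mono_zero:
  assumes "mono_arr C m" "u \<in> Arr C" "Dom C u = a" "Cod C u = Dom C m" "m \<cdot> u = Zero C a (Cod C m)"
  shows "u = Zero C a (Dom C m)"
proof -
  have "m \<in> Arr C" "a \<in> Obj C" using assms by (auto simp: mono_arr_def)
  then show ?thesis
    using mono_cancel[OF assms(1), of u a "Zero C a (Dom C m)"] assms by simp
qed

lemma epi_zero:
  assumes "epi_arr C e" "u \<in> Arr C" "Dom C u = Cod C e" "Cod C u = b" "u \<cdot> e = Zero C (Dom C e) b"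
  shows "u = Zero C (Cod C e) b"
proof -
  have "e \<in> Arr C" "b \<in> Obj C" using assms by (auto simp: epi_arr_def)
  then show ?thesis
    using epi_cancel[OF assms(1), of u b "Zero C (Cod C e) b"] assms by simp
qed

section \<open>Kernels and cokernels\<close>

lemma kernel_mono:
  assumes "is_kernel C f k"
  shows "mono_arr C k"
  unfolding mono_arr_def
proof (intro conjI allI ballI impI)
  have k: "k \<in> Arr C" "f \<in> Arr C" "Cod C k = Dom C f" "f \<cdot> k = Zero C (Dom C k) (Cod C f)"
    using assms by (auto simp: is_kernel_def)
  show "k \<in> Arr C" by fact
  fix a u v
  assume u: "u \<in> Hom C a (Dom C k)" and v: "v \<in> Hom C a (Dom C k)" and eq: "k \<cdot> u = k \<cdot> v"
  have "k \<cdot> u \<in> Arr C" "Cod C (k \<cdot> u) = Dom C f" and d: "Dom C (k \<cdot> u) = a"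
    using k u by simp_all
  moreover have "f \<cdot> (k \<cdot> u) = Zero C (Dom C (k \<cdot> u)) (Cod C f)"
    using Cmp_reassoc1[OF k(4), of u] k u by simp
  ultimately have "\<exists>!w. w \<in> Hom C (Dom C (k \<cdot> u)) (Dom C k) \<and> k \<cdot> w = k \<cdot> u"
    using assms unfolding is_kernel_def by blast
  then show "u = v"
    using u v eq unfolding d by metis
qed

lemma cokernel_epi:
  assumes "is_cokernel C f c"
  shows "epi_arr C c"
  unfolding epi_arr_def
proof (intro conjI allI ballI impI)
  have c: "c \<in> Arr C" "f \<in> Arr C" "Dom C c = Cod C f" "c \<cdot> f = Zero C (Dom C f) (Cod C c)"
    using assms by (auto simp: is_cokernel_def)
  show "c \<in> Arr C" by fact
  fix b u v
  assume u: "u \<in> Hom C (Cod C c) b" and v: "v \<in> Hom C (Cod C c) b" and eq: "u \<cdot> c = v \<cdot> c"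
  have "u \<cdot> c \<in> Arr C" "Dom C (u \<cdot> c) = Cod C f" and d: "Cod C (u \<cdot> c) = b"
    using c u by simp_all
  moreover have "u \<cdot> c \<cdot> f = Zero C (Dom C f) (Cod C (u \<cdot> c))"
    using c u by simp
  ultimately have "\<exists>!w. w \<in> Hom C (Cod C c) (Cod C (u \<cdot> c)) \<and> w \<cdot> c = u \<cdot> c"
    using assms unfolding is_cokernel_def by blast
  then show "u = v"
    using u v eq unfolding d by metis
qed

lemma kernelD:
  assumes "is_kernel C f k"
  shows "k \<in> Arr C" "f \<in> Arr C" "Cod C k = Dom C f" "f \<cdot> k = Zero C (Dom C k) (Cod C f)"
  using assms by (auto simp: is_kernel_def)

lemma cokernelD:
  assumes "is_cokernel C f c"
  shows "c \<in> Arr C" "f \<in> Arr C" "Dom C c = Cod C f" "c \<cdot> f = Zero C (Dom C f) (Cod C c)"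
  using assms by (auto simp: is_cokernel_def)

lemma kernel_factor:
  assumes "is_kernel C f k" "h \<in> Arr C" "Cod C h = Dom C f" "f \<cdot> h = Zero C (Dom C h) (Cod C f)"
  obtains u where "u \<in> Hom C (Dom C h) (Dom C k)" "k \<cdot> u = h"
  using assms unfolding is_kernel_def by blast

lemma cokernel_factor:
  assumes "is_cokernel C f c" "h \<in> Arr C" "Dom C h = Cod C f" "h \<cdot> f = Zero C (Dom C f) (Cod C h)"
  obtains u where "u \<in> Hom C (Cod C c) (Cod C h)" "u \<cdot> c = h"
  using assms unfolding is_cokernel_def by blast

text \<open>Uniqueness of factorisations is the same as monicity of \<open>k\<close>, so the
  universal property reduces to existence.\<close>

lemma is_kernelI:
  assumes "f \<in> Arr C" "mono_arr C k" "Cod C k = Dom C f" "f \<cdot> k = Zero C (Dom C k) (Cod C f)"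
    and "\<And>h. \<lbrakk>h \<in> Arr C; Cod C h = Dom C f; f \<cdot> h = Zero C (Dom C h) (Cod C f)\<rbrakk>
      \<Longrightarrow> \<exists>u \<in> Hom C (Dom C h) (Dom C k). k \<cdot> u = h"
  shows "is_kernel C f k"
  unfolding is_kernel_def
proof (intro conjI ballI impI)
  show "k \<in> Arr C" using assms(2) by (simp add: mono_arr_def)
  fix h assume h: "h \<in> Arr C" "Cod C h = Dom C f \<and> f \<cdot> h = Zero C (Dom C h) (Cod C f)"
  then obtain u where "u \<in> Hom C (Dom C h) (Dom C k)" "k \<cdot> u = h"
    using assms(5) by blast
  then show "\<exists>!u. u \<in> Hom C (Dom C h) (Dom C k) \<and> k \<cdot> u = h"
    using mono_cancel[OF assms(2), of _ "Dom C h" u] by metis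
qed (use assms(1-4) in auto)

lemma is_cokernelI:
  assumes "f \<in> Arr C" "epi_arr C c" "Dom C c = Cod C f" "c \<cdot> f = Zero C (Dom C f) (Cod C c)"
    and "\<And>h. \<lbrakk>h \<in> Arr C; Dom C h = Cod C f; h \<cdot> f = Zero C (Dom C f) (Cod C h)\<rbrakk>
      \<Longrightarrow> \<exists>u \<in> Hom C (Cod C c) (Cod C h). u \<cdot> c = h"
  shows "is_cokernel C f c"
  unfolding is_cokernel_def
proof (intro conjI ballI impI)
  show "c \<in> Arr C" using assms(2) by (simp add: epi_arr_def)
  fix h assume h: "h \<in> Arr C" "Dom C h = Cod C f \<and> h \<cdot> f = Zero C (Dom C f) (Cod C h)"
  then obtain u where "u \<in> Hom C (Cod C c) (Cod C h)" "u \<cdot> c = h"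
    using assms(5) by blast
  then show "\<exists>!u. u \<in> Hom C (Cod C c) (Cod C h) \<and> u \<cdot> c = h"
    using epi_cancel[OF assms(2), of _ "Cod C h" u] by metis
qed (use assms(1-4) in auto)

end

section \<open>Abelian categories\<close>

lemma exact_atD:
  assumes "exact_at C f g"
  shows "f \<in> Arr C" "g \<in> Arr C" "Cod C f = Dom C g"
  using assms by (auto simp: exact_at_def)

context abelian_category
begin

text \<open>Trades the universal properties of a biproduct for equations between arrows, the form in
  which all later computations use it.\<close>

lemma biproduct_binary:
  assumes "a \<in> Obj C" "b \<in> Obj C"
  obtains B i j p q where "B \<in> Obj C" "i \<in> Hom C a B" "j \<in> Hom C b B" "p \<in> Hom C B a" "q \<in> Hom C B
      b"
    "p \<cdot> i = Ide C a" "q \<cdot> j = Ide C b" "p \<cdot> j = Zero C b a" "q \<cdot> i = Zero C a b"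
    "i \<cdot> p \<oplus> j \<cdot> q = Ide C B"
proof -
  obtain B i p where bp: "is_biproduct C (UNIV :: bool set) (\<lambda>s. if s then a else b) B i p"
    using has_biproducts[OF assms] by blast
  then have B: "B \<in> Obj C" and t: "i True \<in> Hom C a B" "i False \<in> Hom C b B" "p True \<in> Hom C B a" "p
      False \<in> Hom C B b"
    by (auto simp: is_biproduct_def)
  have r: "\<And>s t. p t \<cdot> i s = (if s = t then Ide C (if s then a else b) else Zero C (if s then a else
      b) (if t then a else b))"
    using bp unfolding is_biproduct_def by blast
  have rr: "p True \<cdot> i True = Ide C a" "p False \<cdot> i False = Ide C b"
    "p True \<cdot> i False = Zero C b a" "p False \<cdot> i True = Zero C a b"
    using r[of True True] r[of False False] r[of True False] r[of False True] by auto
  let ?w = "i True \<cdot> p True \<oplus> i False \<cdot> p False"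
  have w: "?w \<in> Hom C B B" using t by simp
  \<comment> \<open>Both \<open>?w\<close> and the identity have the projections \<open>p s\<close>
    as their components, so the product property makes them equal.\<close>
  have "\<exists>!u. u \<in> Hom C B B \<and> (\<forall>s \<in> UNIV. p s \<cdot> u = p s)"
  proof -
    have "\<forall>s \<in> UNIV. p s \<in> Hom C B (if s then a else b)"
      using t by simp
    then show ?thesis
      using bp B unfolding is_biproduct_def by blast
  qed
  moreover have "\<forall>s \<in> UNIV. p s \<cdot> Ide C B = p s"
    using t B by (metis (full_types) Cmp_Ide UNIV_I)
  moreover have "p s \<cdot> ?w = p s" for s
    using t B assms Cmp_reassoc1[OF rr(1), of "p True"] Cmp_reassoc1[OF rr(2), of "p False"]
      Cmp_reassoc1[OF rr(3), of "p False"] Cmp_reassoc1[OF rr(4), of "p True"]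
    by (cases s) simp_all
  ultimately have "?w = Ide C B"
    using w Ide_in[OF B] by metis
  then show thesis
    using that[OF B t rr] by simp
qed

text \<open>By normality \<open>m\<close> is the kernel of some \<open>f\<close>. Since
  \<open>f\<close> kills \<open>m\<close>, it factors through the cokernel \<open>c\<close>, and
  whatever \<open>c\<close> kills is then killed by \<open>f\<close> and factors through
  \<open>m\<close>. The next lemma is the dual.\<close>

lemma mono_is_kernel:
  assumes "mono_arr C m" "is_cokernel C m c"
  shows "is_kernel C c m"
proof -
  obtain f where f: "is_kernel C f m" using mono_normal[OF assms(1)] by blast
  note fD = kernelD[OF f] and cD = cokernelD[OF assms(2)]
  obtain v where v: "v \<in> Hom C (Cod C c) (Cod C f)" "v \<cdot> c = f"
    using cokernel_factor[OF assms(2), of f] fD by auto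
  show ?thesis
  proof (rule is_kernelI)
    fix h assume h: "h \<in> Arr C" "Cod C h = Dom C c" "c \<cdot> h = Zero C (Dom C h) (Cod C c)"
    have "f \<cdot> h = v \<cdot> (c \<cdot> h)"
      using v h cD by (intro Cmp_reassoc1[OF v(2), symmetric]) auto
    then have "f \<cdot> h = Zero C (Dom C h) (Cod C f)"
      using v h by simp
    then obtain u where "u \<in> Hom C (Dom C h) (Dom C m)" "m \<cdot> u = h"
      using kernel_factor[OF f, of h] h cD fD by auto
    then show "\<exists>u \<in> Hom C (Dom C h) (Dom C m). m \<cdot> u = h" by blast
  qed (use assms cD in auto)
qed

lemma epi_is_cokernel:
  assumes "epi_arr C e" "is_kernel C e k"
  shows "is_cokernel C k e"
proof -
  obtain f where f: "is_cokernel C f e" using epi_normal[OF assms(1)] by blast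
  note fD = cokernelD[OF f] and kD = kernelD[OF assms(2)]
  obtain v where v: "v \<in> Hom C (Dom C f) (Dom C k)" "k \<cdot> v = f"
    using kernel_factor[OF assms(2), of f] fD by auto
  show ?thesis
  proof (rule is_cokernelI)
    fix h assume h: "h \<in> Arr C" "Dom C h = Cod C k" "h \<cdot> k = Zero C (Dom C k) (Cod C h)"
    have "h \<cdot> (k \<cdot> v) = Zero C (Dom C f) (Cod C h)"
      using Cmp_reassoc1[OF h(3), of v] h v kD by simp
    then have "h \<cdot> f = Zero C (Dom C f) (Cod C h)"
      using v by simp
    then obtain u where "u \<in> Hom C (Cod C e) (Cod C h)" "u \<cdot> e = h"
      using cokernel_factor[OF f, of h] h kD fD by auto
    then show "\<exists>u \<in> Hom C (Cod C e) (Cod C h). u \<cdot> e = h" by blast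
  qed (use assms kD in auto)
qed

text \<open>Suppose \<open>u\<close> kills \<open>e\<close> and let \<open>m\<close> be the kernel
  of \<open>u\<close>. Then \<open>f\<close> factors through the monomorphism
  \<open>k \<cdot> m\<close>, which by normality is the kernel of some \<open>v\<close>. As
  \<open>v\<close> kills \<open>f\<close>, it factors through \<open>c\<close>, so it kills
  \<open>k\<close> as well. Hence \<open>k\<close> factors through \<open>k \<cdot> m\<close>, which
  gives \<open>m\<close> a right inverse and forces \<open>u\<close> to vanish.\<close>

lemma image_epi:
  assumes "is_cokernel C f c" "is_kernel C c k" "e \<in> Hom C (Dom C f) (Dom C k)" "k \<cdot> e = f"
  shows "epi_arr C e"
proof (rule epi_arrI)
  note cD = cokernelD[OF assms(1)] and kD = kernelD[OF assms(2)]
  show "e \<in> Arr C" using assms by simp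
  fix u assume u: "u \<in> Arr C" "Dom C u = Cod C e" "u \<cdot> e = Zero C (Dom C e) (Cod C u)"
  obtain m where m: "is_kernel C u m" using has_kernels[OF u(1)] by blast
  note mD = kernelD[OF m]
  obtain e' where e': "e' \<in> Hom C (Dom C e) (Dom C m)" "m \<cdot> e' = e"
    using kernel_factor[OF m, of e] assms u by auto
  have "mono_arr C (k \<cdot> m)"
  proof (rule mono_arrI)
    fix v assume v: "v \<in> Arr C" "Cod C v = Dom C (k \<cdot> m)" "k \<cdot> m \<cdot> v = Zero C (Dom C v) (Cod C (k \<cdot>
        m))"
    have v2: "Cod C v = Dom C m" using v mD kD assms u by simp
    have "m \<cdot> v = Zero C (Dom C v) (Dom C k)"
      by (rule mono_zero[OF kernel_mono[OF assms(2)]]) (use v v2 mD(1-3) kD(1-3) u(1,2) assms(3) in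
          simp_all)
    then have mv: "m \<cdot> v = Zero C (Dom C v) (Cod C m)"
      using mD(3) u(2) assms(3) by simp
    have d: "Dom C (k \<cdot> m) = Dom C m"
      using mD(1-3) kD(1-3) u(1,2) assms(3) by simp
    show "v = Zero C (Dom C v) (Dom C (k \<cdot> m))"
      unfolding d by (rule mono_zero[OF kernel_mono[OF m] v(1) refl v2 mv])
  qed (use mD kD u assms in simp)
  then obtain v where v: "is_kernel C v (k \<cdot> m)" using mono_normal by blast
  note vD = kernelD[OF v]
  have kmdom: "Dom C (k \<cdot> m) = Dom C m" "Cod C (k \<cdot> m) = Cod C k" "Dom C v = Cod C k"
    using vD mD kD u assms by simp_all
  have fe: "k \<cdot> m \<cdot> e' = f"
    using e' mD kD u assms by simp
  have "v \<cdot> f = Zero C (Dom C f) (Cod C v)"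
  proof -
    have "v \<cdot> (k \<cdot> m \<cdot> e') = Zero C (Dom C e') (Cod C v)"
      using Cmp_reassoc1[OF vD(4), of e'] vD(1-3) e' kmdom mD kD u assms(3) by simp
    then show ?thesis using fe e' assms(3) by simp
  qed
  then obtain w where w: "w \<in> Hom C (Cod C c) (Cod C v)" "w \<cdot> c = v"
    using cokernel_factor[OF assms(1), of v] vD cD kD kmdom by auto
  have "v \<cdot> k = w \<cdot> (c \<cdot> k)"
    using w cD kD by (intro Cmp_reassoc1[OF w(2), symmetric]) auto
  then have "v \<cdot> k = Zero C (Dom C k) (Cod C v)"
    using kD w by simp
  then obtain t where t: "t \<in> Hom C (Dom C k) (Dom C m)" "k \<cdot> m \<cdot> t = k"
    using kernel_factor[OF v, of k] kD kmdom by auto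
  have "m \<cdot> t = Ide C (Dom C k)"
    using mono_cancel[OF kernel_mono[OF assms(2)], of "m \<cdot> t" "Dom C k" "Ide C (Dom C k)"]
      t kD mD u assms(3) by simp
  then have "u = u \<cdot> (m \<cdot> t)"
    using u assms(3) by simp
  also have "\<dots> = Zero C (Cod C e) (Cod C u)"
    using Cmp_reassoc1[OF mD(4), of t] t mD(1-3) u assms(3) by simp
  finally show "u = Zero C (Cod C e) (Cod C u)" .
qed

text \<open>An epimorphism is the cokernel of its kernel. The condition is phrased for all
  generalised elements that \<open>e\<close> kills, and the kernel itself is one of them.\<close>

lemma epi_factor:
  assumes "epi_arr C e" "t \<in> Arr C" "Dom C t = Dom C e"
    and "\<And>u. \<lbrakk>u \<in> Arr C; Cod C u = Dom C e; e \<cdot> u = Zero C (Dom C u) (Cod C e)\<rbrakk>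
      \<Longrightarrow> t \<cdot> u = Zero C (Dom C u) (Cod C t)"
  obtains h where "h \<in> Hom C (Cod C e) (Cod C t)" "h \<cdot> e = t"
proof -
  have "e \<in> Arr C" using assms(1) by (simp add: epi_arr_def)
  then obtain k where k: "is_kernel C e k" using has_kernels by blast
  note kD = kernelD[OF k]
  show thesis
    using cokernel_factor[OF epi_is_cokernel[OF assms(1) k], of t] assms(2,3) assms(4)[of k] kD that
    by auto
qed

text \<open>A generalised element of an object is an arrow into it; statements that in a module category
  read ``there is an element such that'' hold after precomposition with an epimorphism.\<close>

lemma epi_lift:
  assumes "epi_arr C g" "y \<in> Arr C" "Cod C y = Cod C g"
  obtains V e x where "e \<in> Hom C V (Dom C y)" "epi_arr C e" "x \<in> Hom C V (Dom C g)" "g \<cdot> x = y \<cdot> e"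
proof -
  have g: "g \<in> Arr C" using assms(1) by (simp add: epi_arr_def)
  obtain B i j p q where B: "B \<in> Obj C" "i \<in> Hom C (Dom C g) B" "j \<in> Hom C (Dom C y) B"
    "p \<in> Hom C B (Dom C g)" "q \<in> Hom C B (Dom C y)"
    and r: "p \<cdot> i = Ide C (Dom C g)" "q \<cdot> j = Ide C (Dom C y)" "p \<cdot> j = Zero C (Dom C y) (Dom C g)"
    "q \<cdot> i = Zero C (Dom C g) (Dom C y)" and s: "i \<cdot> p \<oplus> j \<cdot> q = Ide C B"
    using biproduct_binary[OF Dom_in[OF g] Dom_in[OF assms(2)]] by blast
  \<comment> \<open>The kernel of this difference on the biproduct is the pullback of
    \<open>g\<close> along \<open>y\<close>. The claim amounts to epimorphisms being stable under
    pullback.\<close>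
  let ?h = "g \<cdot> p \<oplus> \<ominus> (y \<cdot> q)"
  have h: "?h \<in> Hom C B (Cod C g)" using g B assms by simp
  have hi: "?h \<cdot> i = g" using g B assms r by simp
  then have "epi_arr C (?h \<cdot> i)" using assms(1) by simp
  then have eh: "epi_arr C ?h"
    using h B g by (intro epi_arr_right_factor[of ?h i]) simp_all
  obtain k where k: "is_kernel C ?h k" using has_kernels h by auto
  note kD = kernelD[OF k]
  have kd: "k \<in> Arr C" "Cod C k = B" using kD h by simp_all
  \<comment> \<open>If \<open>u\<close> kills \<open>q \<cdot> k\<close>, then
    \<open>u \<cdot> q\<close> factors through \<open>?h\<close>, the cokernel of \<open>k\<close>,
    by some \<open>v\<close>. Restricting to the first summand gives
    \<open>v \<cdot> g = u \<cdot> q \<cdot> i\<close>, which is zero, so \<open>v\<close> vanishes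
    because \<open>g\<close> is epi. Then \<open>u \<cdot> q\<close> vanishes, and with it
    \<open>u\<close>.\<close>
  have "epi_arr C (q \<cdot> k)"
  proof (rule epi_arrI)
    fix u assume u: "u \<in> Arr C" "Dom C u = Cod C (q \<cdot> k)" "u \<cdot> (q \<cdot> k) = Zero C (Dom C (q \<cdot> k)) (Cod
        C u)"
    have u2: "Dom C u = Dom C y" using u kd B by simp
    have "u \<cdot> q \<in> Arr C" "Dom C (u \<cdot> q) = Cod C k" and cuq: "Cod C (u \<cdot> q) = Cod C u"
      and "u \<cdot> q \<cdot> k = Zero C (Dom C k) (Cod C (u \<cdot> q))"
      using u(1,3) u2 kd B(5) by simp_all
    then obtain v where v0: "v \<in> Hom C (Cod C ?h) (Cod C (u \<cdot> q))" "v \<cdot> ?h = u \<cdot> q"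
      using cokernel_factor[OF epi_is_cokernel[OF eh k]] by metis
    have "Cod C ?h = Cod C g" using h by simp
    note v = v0[unfolded this cuq]
    have "v \<cdot> g = v \<cdot> (?h \<cdot> i)" unfolding hi ..
    also have "\<dots> = v \<cdot> ?h \<cdot> i" by (rule Cmp_assoc'[symmetric]) (use v h B in simp_all)
    also have "\<dots> = u \<cdot> q \<cdot> i" using v by simp
    also have "\<dots> = Zero C (Dom C g) (Cod C u)" using u u2 B r g by simp
    finally have "v = Zero C (Cod C g) (Cod C u)"
      using epi_zero[OF assms(1), of v] v by simp
    then have uq: "u \<cdot> q = Zero C B (Cod C u)" using v h u g by simp
    have "u = u \<cdot> (q \<cdot> j)" using u u2 r by simp
    also have "\<dots> = Zero C (Dom C y) (Cod C u)"
      using Cmp_reassoc1[OF uq, of j] B u u2 by simp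
    finally show "u = Zero C (Cod C (q \<cdot> k)) (Cod C u)" using u2 u by simp
  qed (use kd B in simp)
  moreover have "g \<cdot> (p \<cdot> k) = y \<cdot> (q \<cdot> k)"
  proof (rule Add_Neg_eq_Zero[where a = "Dom C k" and b = "Cod C g"])
    show "g \<cdot> (p \<cdot> k) \<oplus> \<ominus> (y \<cdot> (q \<cdot> k)) = Zero C (Dom C k) (Cod C g)"
      using kD(4) kd B g assms by simp
  qed (use kd B g assms in simp_all)
  ultimately show thesis
    using that[of "q \<cdot> k" "Dom C k" "p \<cdot> k"] kd B by simp
qed

lemma exact_comp:
  assumes "exact_at C f g"
  shows "g \<cdot> f = Zero C (Dom C f) (Cod C g)"
proof -
  obtain c k where c: "is_cokernel C f c" and k: "is_kernel C c k" "is_kernel C g k"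
    using assms by (auto simp: exact_at_def)
  note cD = cokernelD[OF c] and kD = kernelD[OF k(1)] and gD = kernelD[OF k(2)]
  obtain e where e: "e \<in> Hom C (Dom C f) (Dom C k)" "k \<cdot> e = f"
    using kernel_factor[OF k(1), of f] cD by auto
  have "g \<cdot> (k \<cdot> e) = Zero C (Dom C f) (Cod C g)"
    using Cmp_reassoc1[OF gD(4), of e] e gD by simp
  then show ?thesis using e by simp
qed

text \<open>The map from the source of \<open>f\<close> to the kernel of \<open>g\<close> is the
  epimorphic part of the image factorisation, so an element killed by \<open>g\<close> lifts along
  it over a cover.\<close>

lemma exact_lift:
  assumes "exact_at C f g" "y \<in> Arr C" "Cod C y = Dom C g" "g \<cdot> y = Zero C (Dom C y) (Cod C g)"
  obtains V e x where "e \<in> Hom C V (Dom C y)" "epi_arr C e" "x \<in> Hom C V (Dom C f)" "f \<cdot> x = y \<cdot> e"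
proof -
  obtain c k where c: "is_cokernel C f c" and k: "is_kernel C c k" "is_kernel C g k"
    using assms by (auto simp: exact_at_def)
  note cD = cokernelD[OF c] and kD = kernelD[OF k(1)]
  obtain e where e: "e \<in> Hom C (Dom C f) (Dom C k)" "k \<cdot> e = f"
    using kernel_factor[OF k(1), of f] cD by auto
  obtain y' where y': "y' \<in> Hom C (Dom C y) (Dom C k)" "k \<cdot> y' = y"
    using kernel_factor[OF k(2), of y] assms by auto
  obtain V e' x where x: "e' \<in> Hom C V (Dom C y)" "epi_arr C e'" "x \<in> Hom C V (Dom C f)" "e \<cdot> x = y'
      \<cdot> e'"
    using epi_lift[OF image_epi[OF c k(1) e], of y'] y' e by auto
  have "f \<cdot> x = k \<cdot> (e \<cdot> x)"
    using e x kD by (intro Cmp_reassoc1[OF e(2), symmetric]) simp_all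
  also have "\<dots> = k \<cdot> (y' \<cdot> e')" using x by simp
  also have "\<dots> = y \<cdot> e'"
    using y' x kD by (intro Cmp_reassoc1[OF y'(2)]) simp_all
  finally show thesis using that x by blast
qed

text \<open>As in \<open>exact_lift\<close>, but a projective source lifts directly through the
  epimorphism onto the image, so no cover appears.\<close>

lemma projective_exact_lift:
  assumes "exact_at C f g" "projective C (Dom C y)" "y \<in> Arr C" "Cod C y = Dom C g"
    "g \<cdot> y = Zero C (Dom C y) (Cod C g)"
  obtains x where "x \<in> Hom C (Dom C y) (Dom C f)" "f \<cdot> x = y"
proof -
  obtain c k where c: "is_cokernel C f c" and k: "is_kernel C c k" "is_kernel C g k"
    using assms by (auto simp: exact_at_def)
  note cD = cokernelD[OF c] and kD = kernelD[OF k(1)]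
  obtain e where e: "e \<in> Hom C (Dom C f) (Dom C k)" "k \<cdot> e = f"
    using kernel_factor[OF k(1), of f] cD by auto
  obtain y' where y': "y' \<in> Hom C (Dom C y) (Dom C k)" "k \<cdot> y' = y"
    using kernel_factor[OF k(2), of y] assms by auto
  have "epi_arr C e" by (rule image_epi[OF c k(1) e])
  then obtain x where x: "x \<in> Hom C (Dom C y) (Dom C f)" "e \<cdot> x = y'"
    using assms(2) y' e unfolding projective_def by force
  have "f \<cdot> x = k \<cdot> (e \<cdot> x)"
    using e x kD by (intro Cmp_reassoc1[OF e(2), symmetric]) simp_all
  then show thesis using that x y' by simp
qed

text \<open>Converse of \<open>exact_lift\<close>, and the form in which exactness is proved from
  here on. If \<open>h\<close> is killed by \<open>g\<close>, then \<open>h\<close> comes from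
  \<open>f\<close> over a cover, so the cokernel of \<open>f\<close> kills \<open>h\<close> over
  that cover and hence outright. Thus \<open>h\<close> factors through the image.\<close>

lemma exact_atI:
  assumes "f \<in> Arr C" "g \<in> Arr C" "Cod C f = Dom C g" "g \<cdot> f = Zero C (Dom C f) (Cod C g)"
    and "\<And>y. \<lbrakk>y \<in> Arr C; Cod C y = Dom C g; g \<cdot> y = Zero C (Dom C y) (Cod C g)\<rbrakk>
      \<Longrightarrow> \<exists>V e x. e \<in> Hom C V (Dom C y) \<and> epi_arr C e \<and> x \<in> Hom C V (Dom C f) \<and> f \<cdot> x = y \<cdot> e"
  shows "exact_at C f g"
proof -
  obtain c where c: "is_cokernel C f c" using has_cokernels assms by blast
  note cD = cokernelD[OF c]
  obtain k where k: "is_kernel C c k" using has_kernels cD by blast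
  note kD = kernelD[OF k]
  obtain e where e: "e \<in> Hom C (Dom C f) (Dom C k)" "k \<cdot> e = f"
    using kernel_factor[OF k, of f] cD by auto
  have "is_kernel C g k"
  proof (rule is_kernelI)
    have "g \<cdot> k \<cdot> e = Zero C (Dom C f) (Cod C g)"
      using assms(1-4) e kD cD by simp
    then show "g \<cdot> k = Zero C (Dom C k) (Cod C g)"
      using epi_zero[OF image_epi[OF c k e], of "g \<cdot> k"] assms(1-3) e kD(1-3) cD(1-3) by simp
    fix h assume h: "h \<in> Arr C" "Cod C h = Dom C g" "g \<cdot> h = Zero C (Dom C h) (Cod C g)"
    obtain V e' x where x: "e' \<in> Hom C V (Dom C h)" "epi_arr C e'" "x \<in> Hom C V (Dom C f)" "f \<cdot> x =
        h \<cdot> e'"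
      using assms(5)[OF h] by blast
    have "c \<cdot> (f \<cdot> x) = Zero C V (Cod C c)"
      using Cmp_reassoc0[OF cD(4), of "Cod C f" x] cD(1-3) x by simp
    then have "c \<cdot> h \<cdot> e' = Zero C V (Cod C c)"
      using x h cD(1-3) assms(3) by simp
    then have "c \<cdot> h = Zero C (Dom C h) (Cod C c)"
      using epi_zero[OF x(2), of "c \<cdot> h"] x h cD(1-3) assms(3) by simp
    then obtain u where "u \<in> Hom C (Dom C h) (Dom C k)" "k \<cdot> u = h"
      using kernel_factor[OF k, of h] h cD assms(3) by auto
    then show "\<exists>u \<in> Hom C (Dom C h) (Dom C k). k \<cdot> u = h" by blast
  qed (use assms(1-3) cD kD kernel_mono[OF k] in simp_all)
  then show ?thesis
    using assms(1-3) c k unfolding exact_at_def by blast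
qed

text \<open>Exactness as two vanishing composites, for any choice of cokernel and kernel. Such
  equations can be evaluated at an object, which is what the passage between a functor category and
  its components needs.\<close>

lemma exact_at_iff:
  assumes "is_cokernel C f c" "is_kernel C g k" "Cod C f = Dom C g"
  shows "exact_at C f g \<longleftrightarrow>
    g \<cdot> f = Zero C (Dom C f) (Cod C g) \<and> c \<cdot> k = Zero C (Dom C k) (Cod C c)"
proof
  note cD = cokernelD[OF assms(1)] and kD = kernelD[OF assms(2)]
  assume ex: "exact_at C f g"
  obtain V e x where x: "e \<in> Hom C V (Dom C k)" "epi_arr C e" "x \<in> Hom C V (Dom C f)" "f \<cdot> x = k \<cdot>
      e"
    using exact_lift[OF ex, of k] kD by auto
  have "c \<cdot> (f \<cdot> x) = Zero C V (Cod C c)"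
    using Cmp_reassoc0[OF cD(4), of "Cod C f" x] cD(1-3) x by simp
  then have "c \<cdot> k \<cdot> e = Zero C V (Cod C c)"
    using x kD(1-3) cD(1-3) assms(3) by simp
  then have "c \<cdot> k = Zero C (Dom C k) (Cod C c)"
    using epi_zero[OF x(2), of "c \<cdot> k"] x cD(1-3) kD(1-3) assms(3) by simp
  then show "g \<cdot> f = Zero C (Dom C f) (Cod C g) \<and> c \<cdot> k = Zero C (Dom C k) (Cod C c)"
    using exact_comp[OF ex] by simp
next
  note cD = cokernelD[OF assms(1)] and kD = kernelD[OF assms(2)]
  assume z: "g \<cdot> f = Zero C (Dom C f) (Cod C g) \<and> c \<cdot> k = Zero C (Dom C k) (Cod C c)"
  obtain m where m: "is_kernel C c m" using has_kernels cD by blast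
  note mD = kernelD[OF m]
  obtain e where e: "e \<in> Hom C (Dom C f) (Dom C m)" "m \<cdot> e = f"
    using kernel_factor[OF m, of f] cD by auto
  show "exact_at C f g"
  proof (rule exact_atI)
    fix y assume y: "y \<in> Arr C" "Cod C y = Dom C g" "g \<cdot> y = Zero C (Dom C y) (Cod C g)"
    obtain y' where y': "y' \<in> Hom C (Dom C y) (Dom C k)" "k \<cdot> y' = y"
      using kernel_factor[OF assms(2) y] by blast
    have "c \<cdot> (k \<cdot> y') = Zero C (Dom C y) (Cod C c)"
      using Cmp_reassoc1[OF conjunct2[OF z], of y'] y' cD kD assms(3) by simp
    then obtain y'' where y'': "y'' \<in> Hom C (Dom C y) (Dom C m)" "m \<cdot> y'' = y"
      using kernel_factor[OF m, of y] y y' cD assms(3) by auto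
    obtain V e' x where x: "e' \<in> Hom C V (Dom C y)" "epi_arr C e'" "x \<in> Hom C V (Dom C f)" "e \<cdot> x =
        y'' \<cdot> e'"
      using epi_lift[OF image_epi[OF assms(1) m e], of y''] y'' e by auto
    have "f \<cdot> x = m \<cdot> (e \<cdot> x)"
      using e x mD by (intro Cmp_reassoc1[OF e(2), symmetric]) simp_all
    also have "\<dots> = m \<cdot> (y'' \<cdot> e')" using x by simp
    also have "\<dots> = y \<cdot> e'"
      using y'' x mD by (intro Cmp_reassoc1[OF y''(2)]) simp_all
    finally show "\<exists>V e x. e \<in> Hom C V (Dom C y) \<and> epi_arr C e \<and> x \<in> Hom C V (Dom C f) \<and> f \<cdot> x = y \<cdot>
        e"
      using x by blast
  qed (use z cD kD assms(3) in simp_all)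
qed

lemma zero_obj:
  obtains z where "z \<in> Obj C" "\<And>f a. f \<in> Hom C a z \<Longrightarrow> f = Zero C a z" "\<And>f a. f \<in> Hom C z a \<Longrightarrow> f = Zero
      C z a"
proof -
  obtain z where z: "zero_object C z" using has_zero by blast
  then have "z \<in> Obj C" by (simp add: zero_object_def)
  moreover have "f = Zero C a z" if f: "f \<in> Hom C a z" for f a
  proof -
    have "a \<in> Obj C" using Hom_Obj[OF f] by simp
    then show ?thesis
      using z f Zero_arr[of a z] unfolding zero_object_def by (metis Hom_iff)
  qed
  moreover have "f = Zero C z a" if f: "f \<in> Hom C z a" for f a
  proof -
    have "a \<in> Obj C" using Hom_Obj[OF f] by simp
    then show ?thesis
      using z f Zero_arr[of z a] unfolding zero_object_def by (metis Hom_iff)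
  qed
  ultimately show thesis using that by blast
qed

text \<open>A splitting given by equations alone, so that every additive functor preserves it. A
  bare short exact sequence would not survive \<open>F\<close>.\<close>

definition split_exact :: "'a \<Rightarrow> 'a \<Rightarrow> 'a \<Rightarrow> 'a \<Rightarrow> bool" where
  "split_exact i p r s \<longleftrightarrow>
     i \<in> Arr C \<and> p \<in> Hom C (Cod C i) (Cod C p) \<and> r \<in> Hom C (Cod C i) (Dom C i) \<and> s \<in> Hom C (Cod C p)
         (Cod C i) \<and>
     r \<cdot> i = Ide C (Dom C i) \<and> p \<cdot> s = Ide C (Cod C p) \<and>
     p \<cdot> i = Zero C (Dom C i) (Cod C p) \<and> i \<cdot> r \<oplus> s \<cdot> p = Ide C (Cod C i)"

text \<open>The section lifts the identity of the projective quotient. The complementary idempotent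
  \<open>1 - s \<cdot> p\<close> is killed by \<open>p\<close> and therefore factors through
  \<open>i\<close>, the kernel of its own cokernel; the factor is the retraction.\<close>

lemma short_exact_split:
  assumes "short_exact C i p" "projective C (Cod C p)"
  obtains r s where "split_exact i p r s"
proof -
  have m: "mono_arr C i" and e: "epi_arr C p" and ex: "exact_at C i p"
    using assms(1) by (auto simp: short_exact_def)
  note D = exact_atD[OF ex]
  obtain s where s: "s \<in> Hom C (Cod C p) (Cod C i)" "p \<cdot> s = Ide C (Cod C p)"
    using assms(2) e D Ide_in[of "Cod C p"] unfolding projective_def by (metis Cod_in)
  obtain c k where c: "is_cokernel C i c" and k: "is_kernel C c k" "is_kernel C p k"
    using ex by (auto simp: exact_at_def)
  have ik: "is_kernel C c i" by (rule mono_is_kernel[OF m c])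
  note cD = cokernelD[OF c] and kD = kernelD[OF k(2)]
  let ?h = "Ide C (Cod C i) \<oplus> \<ominus> (s \<cdot> p)"
  have h: "?h \<in> Hom C (Cod C i) (Cod C i)" using s D by simp
  have "p \<cdot> ?h = Zero C (Cod C i) (Cod C p)"
    using s D Cmp_reassoc1[OF s(2), of p] by simp
  then obtain u where u: "u \<in> Hom C (Cod C i) (Dom C k)" "k \<cdot> u = ?h"
    using kernel_factor[OF k(2), of ?h] h D by auto
  have "c \<cdot> ?h = c \<cdot> k \<cdot> u"
    using u cD kD D kernelD[OF k(1)] by (metis Cmp_assoc Hom_iff)
  then have "c \<cdot> ?h = Zero C (Cod C i) (Cod C c)"
    using kernelD(4)[OF k(1)] u cD by simp
  then obtain r where r: "r \<in> Hom C (Cod C i) (Dom C i)" "i \<cdot> r = ?h"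
    using kernel_factor[OF ik, of ?h] h cD by auto
  have pi: "p \<cdot> i = Zero C (Dom C i) (Cod C p)" by (rule exact_comp[OF ex])
  have "i \<cdot> (r \<cdot> i) = ?h \<cdot> i"
    by (rule Cmp_reassoc1[OF r(2)]) (use r D in simp_all)
  also have "\<dots> = i"
    using D pi s by simp
  finally have "r \<cdot> i = Ide C (Dom C i)"
    using mono_cancel[OF m, of "r \<cdot> i" "Dom C i" "Ide C (Dom C i)"] r D by simp
  moreover have "i \<cdot> r \<oplus> s \<cdot> p = Ide C (Cod C i)"
    using r s D by simp
  ultimately show thesis
    using that[of r s] r s D pi by (auto simp: split_exact_def)
qed

lemma split_exactD:
  assumes "split_exact i p r s"
  shows "i \<in> Arr C" "p \<in> Arr C" "r \<in> Arr C" "s \<in> Arr C"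
    "Dom C p = Cod C i" "Dom C r = Cod C i" "Cod C r = Dom C i" "Dom C s = Cod C p" "Cod C s = Cod C
        i"
    "r \<cdot> i = Ide C (Dom C i)" "p \<cdot> s = Ide C (Cod C p)"
     "p \<cdot> i = Zero C (Dom C i) (Cod C p)" "i \<cdot> r \<oplus> s \<cdot> p = Ide C (Cod C i)"
  using assms by (auto simp: split_exact_def)

lemma split_exact_decomp:
  assumes "split_exact i p r s" "x \<in> Arr C" "Cod C x = Cod C i"
  shows "i \<cdot> (r \<cdot> x) \<oplus> s \<cdot> (p \<cdot> x) = x"
proof -
  note D = split_exactD[OF assms(1)]
  have "(i \<cdot> r \<oplus> s \<cdot> p) \<cdot> x = x" unfolding D(13) using assms by simp
  then show ?thesis using D(1-9) assms(2,3) by simp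
qed

lemma split_exact_mono:
  assumes "split_exact i p r s"
  shows "mono_arr C i"
proof (rule mono_arrI)
  note D = split_exactD[OF assms]
  fix u assume u: "u \<in> Arr C" "Cod C u = Dom C i" "i \<cdot> u = Zero C (Dom C u) (Cod C i)"
  have "r \<cdot> (i \<cdot> u) = Ide C (Dom C i) \<cdot> u"
    by (rule Cmp_reassoc1[OF D(10)]) (use D u in simp_all)
  then show "u = Zero C (Dom C u) (Dom C i)" using u D(1-9) by simp
qed (use split_exactD[OF assms] in simp)

lemma split_exact_epi:
  assumes "split_exact i p r s"
  shows "epi_arr C p"
proof (rule epi_arrI)
  note D = split_exactD[OF assms]
  fix u assume u: "u \<in> Arr C" "Dom C u = Cod C p" "u \<cdot> p = Zero C (Dom C p) (Cod C u)"
  have "u = u \<cdot> (p \<cdot> s)" using D(11) u by simp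
  also have "\<dots> = Zero C (Cod C p) (Cod C u)"
    using Cmp_reassoc1[OF u(3), of s] D(1-9) u by simp
  finally show "u = Zero C (Cod C p) (Cod C u)" .
qed (use split_exactD[OF assms] in simp)

lemma split_exact_short_exact:
  assumes "split_exact i p r s"
  shows "short_exact C i p"
  unfolding short_exact_def
proof (intro conjI split_exact_mono[OF assms] split_exact_epi[OF assms] exact_atI)
  note D = split_exactD[OF assms]
  show "i \<in> Arr C" "p \<in> Arr C" "Cod C i = Dom C p" "p \<cdot> i = Zero C (Dom C i) (Cod C p)"
    using D by simp_all
  fix y assume y: "y \<in> Arr C" "Cod C y = Dom C p" "p \<cdot> y = Zero C (Dom C y) (Cod C p)"
  have "i \<cdot> (r \<cdot> y) = y"
    using split_exact_decomp[OF assms, of y] y D(1-9) by simp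
  then have "Ide C (Dom C y) \<in> Hom C (Dom C y) (Dom C y) \<and> epi_arr C (Ide C (Dom C y))
    \<and> r \<cdot> y \<in> Hom C (Dom C y) (Dom C i) \<and> i \<cdot> (r \<cdot> y) = y \<cdot> Ide C (Dom C y)"
    using y D(1-9) by (simp add: epi_arr_Ide)
  then show "\<exists>V e x. e \<in> Hom C V (Dom C y) \<and> epi_arr C e \<and> x \<in> Hom C V (Dom C i) \<and> i \<cdot> x = y \<cdot> e"
    by blast
qed

end

section \<open>Homology\<close>

context abelian_category
begin

section \<open>Generalised cycles and their homology classes\<close>

definition complex :: "('o, 'a) cpx \<Rightarrow> bool" where
  "complex K \<longleftrightarrow> (\<forall>n. CDif K n \<in> Hom C (CObj K n) (CObj K (n - 1)) \<and>
     CDif K n \<cdot> CDif K (n + 1) = Zero C (CObj K (n + 1)) (CObj K (n - 1)))"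

definition cycle :: "('o, 'a) cpx \<Rightarrow> int \<Rightarrow> 'a \<Rightarrow> bool" where
  "cycle K n x \<longleftrightarrow> x \<in> Arr C \<and> Cod C x = CObj K n \<and> CDif K n \<cdot> x = Zero C (Dom C x) (CObj K (n - 1))"

text \<open>The class of a generalised cycle \<open>x\<close>: factor \<open>x\<close> through the
  chosen kernel \<open>cyc\<close>, then project to homology. The factorisation is unique because
  \<open>cyc\<close> is mono, so the choice operator is harmless on cycles; elsewhere the value is
  arbitrary.\<close>

definition cls :: "('o, 'a) cpx \<Rightarrow> int \<Rightarrow> 'a \<Rightarrow> 'a" where
  "cls K n x = hquot C K n \<cdot> (SOME w. w \<in> Hom C (Dom C x) (Dom C (cyc C K n)) \<and> cyc C K n \<cdot> w = x)"

definition chain_map :: "('o, 'a) cpx \<Rightarrow> ('o, 'a) cpx \<Rightarrow> (int \<Rightarrow> 'a) \<Rightarrow> bool" where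
  "chain_map K K' \<phi> \<longleftrightarrow> (\<forall>n. \<phi> n \<in> Hom C (CObj K n) (CObj K' n) \<and>
     CDif K' n \<cdot> \<phi> n = \<phi> (n - 1) \<cdot> CDif K n)"

lemma complexD:
  assumes "complex K"
  shows "CDif K n \<in> Arr C" "Dom C (CDif K n) = CObj K n" "Cod C (CDif K n) = CObj K (n - 1)" "CObj K
      n \<in> Obj C"
  using assms Dom_in[of "CDif K n"] by (auto simp: complex_def)

lemma complex_dd:
  assumes "complex K" "y \<in> Arr C" "Cod C y = CObj K (n + 1)"
  shows "CDif K n \<cdot> (CDif K (n + 1) \<cdot> y) = Zero C (Dom C y) (CObj K (n - 1))"
  by (rule Cmp_reassoc0[where a = "CObj K (n + 1)" and c = "CObj K n"]) (use assms in \<open>auto simp: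
      complex_def\<close>)

lemma cycleD:
  assumes "cycle K n x"
  shows "x \<in> Arr C" "Cod C x = CObj K n" "CDif K n \<cdot> x = Zero C (Dom C x) (CObj K (n - 1))"
  using assms by (auto simp: cycle_def)

lemma chain_mapD:
  assumes "chain_map K K' \<phi>"
  shows "\<phi> n \<in> Arr C" "Dom C (\<phi> n) = CObj K n" "Cod C (\<phi> n) = CObj K' n" "CDif K' n \<cdot> \<phi> n = \<phi> (n -
      1) \<cdot> CDif K n"
  using assms by (auto simp: chain_map_def)

lemma chain_map_diff:
  assumes "chain_map K K' \<phi>" "complex K" "complex K'" "x \<in> Arr C" "Cod C x = CObj K n"
  shows "CDif K' n \<cdot> (\<phi> n \<cdot> x) = \<phi> (n - 1) \<cdot> (CDif K n \<cdot> x)"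
  by (rule Cmp_reassoc[OF chain_mapD(4)[OF assms(1)]])
    (use chain_mapD(1-3)[OF assms(1)] complexD[OF assms(2)] complexD[OF assms(3)] assms(4,5) in
        simp_all)

lemma is_homology_exists:
  assumes "complex K"
  shows "is_homology C K n (cyc C K n) (hquot C K n)"
proof -
  note KD = complexD[OF assms]
  obtain z where z: "is_kernel C (CDif K n) z" using has_kernels KD by blast
  note zD = kernelD[OF z]
  have "CDif K n \<cdot> CDif K (n + 1) = Zero C (CObj K (n + 1)) (CObj K (n - 1))"
    using assms by (simp add: complex_def)
  then obtain b where b: "b \<in> Hom C (CObj K (n + 1)) (Dom C z)" "z \<cdot> b = CDif K (n + 1)"
    using kernel_factor[OF z, of "CDif K (n + 1)"] KD by auto
  obtain q where "is_cokernel C b q" using has_cokernels b by auto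
  then have "is_homology C K n z q"
    using z b unfolding is_homology_def by blast
  then have "\<exists>zq. case zq of (z, q) \<Rightarrow> is_homology C K n z q"
    by (auto intro: exI[of _ "(z, q)"])
  then have "case homology_data C K n of (z, q) \<Rightarrow> is_homology C K n z q"
    unfolding homology_data_def by (rule someI_ex)
  then show ?thesis
    by (simp add: cyc_def hquot_def case_prod_beta)
qed

lemma homologyD:
  assumes "complex K"
  shows "cyc C K n \<in> Arr C" "Cod C (cyc C K n) = CObj K n" "hquot C K n \<in> Arr C"
    "Dom C (hquot C K n) = Dom C (cyc C K n)" "Cod C (hquot C K n) = homology C K n"
    "CDif K n \<cdot> cyc C K n = Zero C (Dom C (cyc C K n)) (CObj K (n - 1))"
    "is_kernel C (CDif K n) (cyc C K n)" "epi_arr C (hquot C K n)" "homology C K n \<in> Obj C"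
proof -
  note KD = complexD[OF assms]
  obtain b where b: "is_kernel C (CDif K n) (cyc C K n)" "b \<in> Hom C (CObj K (n + 1)) (Dom C (cyc C K
      n))"
    "cyc C K n \<cdot> b = CDif K (n + 1)" "is_cokernel C b (hquot C K n)"
    using is_homology_exists[OF assms, of n] unfolding is_homology_def by blast
  note kD = kernelD[OF b(1)] and cD = cokernelD[OF b(4)]
  show "cyc C K n \<in> Arr C" "Cod C (cyc C K n) = CObj K n" "hquot C K n \<in> Arr C"
    "Dom C (hquot C K n) = Dom C (cyc C K n)" "Cod C (hquot C K n) = homology C K n"
    "CDif K n \<cdot> cyc C K n = Zero C (Dom C (cyc C K n)) (CObj K (n - 1))"
    "is_kernel C (CDif K n) (cyc C K n)" "epi_arr C (hquot C K n)"
    using kD cD KD b cokernel_epi[OF b(4)] by (simp_all add: homology_def)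
  show "homology C K n \<in> Obj C"
    unfolding homology_def by (rule Cod_in) (rule cD(1))
qed

lemma cyc_cancel:
  assumes "complex K" "w \<in> Hom C W (Dom C (cyc C K n))" "w' \<in> Hom C W (Dom C (cyc C K n))"
    "cyc C K n \<cdot> w = cyc C K n \<cdot> w'"
  shows "w = w'"
  by (rule mono_cancel[OF kernel_mono[OF homologyD(7)[OF assms(1)]] assms(2-4)])

lemma cls_cyc:
  assumes "complex K" "w \<in> Hom C W (Dom C (cyc C K n))"
  shows "cls K n (cyc C K n \<cdot> w) = hquot C K n \<cdot> w"
proof -
  note H = homologyD[OF assms(1)]
  let ?P = "\<lambda>v. v \<in> Hom C (Dom C (cyc C K n \<cdot> w)) (Dom C (cyc C K n)) \<and> cyc C K n \<cdot> v = cyc C K n \<cdot>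
      w"
  have d: "Dom C (cyc C K n \<cdot> w) = W"
    using assms H by simp
  have "?P w" using assms d by simp
  then have "?P (SOME v. ?P v)" by (rule someI)
  then have "(SOME v. ?P v) = w"
    unfolding d by (intro cyc_cancel[OF assms(1) _ assms(2)]) blast+
  then show ?thesis by (simp add: cls_def)
qed

lemma cycle_factor:
  assumes "complex K" "cycle K n x"
  obtains w where "w \<in> Hom C (Dom C x) (Dom C (cyc C K n))" "cyc C K n \<cdot> w = x" "cls K n x = hquot C
      K n \<cdot> w"
proof -
  note H = homologyD[OF assms(1)] and X = cycleD[OF assms(2)] and KD = complexD[OF assms(1)]
  obtain w where w: "w \<in> Hom C (Dom C x) (Dom C (cyc C K n))" "cyc C K n \<cdot> w = x"
    using kernel_factor[OF H(7), of x n] X KD by auto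
  then show thesis using that[OF w] cls_cyc[OF assms(1) w(1)] by simp
qed

lemma cycle_cyc:
  assumes "complex K"
  shows "cycle K n (cyc C K n)"
  using homologyD[OF assms] by (simp add: cycle_def)

lemma cycle_Cmp:
  assumes "complex K" "cycle K n x" "u \<in> Arr C" "Cod C u = Dom C x"
  shows "cycle K n (x \<cdot> u)"
  using cycleD[OF assms(2)] complexD[OF assms(1)] assms(3,4)
    Cmp_reassoc0[OF cycleD(3)[OF assms(2)], of "CObj K n" u]
  by (simp add: cycle_def)

lemma cycle_Add:
  assumes "complex K" "cycle K n x" "cycle K n y" "Dom C y = Dom C x"
  shows "cycle K n (x \<oplus> y)"
  using cycleD[OF assms(2)] cycleD[OF assms(3)] complexD[OF assms(1)] assms(4)
  by (simp add: cycle_def)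

lemma cycle_Neg:
  assumes "complex K" "cycle K n x"
  shows "cycle K n (\<ominus> x)"
  using cycleD[OF assms(2)] complexD[OF assms(1)] by (simp add: cycle_def)

lemma cycle_boundary:
  assumes "complex K" "y \<in> Arr C" "Cod C y = CObj K (n + 1)"
  shows "cycle K n (CDif K (n + 1) \<cdot> y)"
  using complex_dd[OF assms] complexD[OF assms(1)] assms by (simp add: cycle_def)

lemma cycle_chain_map:
  assumes "complex K" "complex K'" "chain_map K K' \<phi>" "cycle K n x"
  shows "cycle K' n (\<phi> n \<cdot> x)"
  using chain_map_diff[OF assms(3,1,2), of x n] cycleD[OF assms(4)] chain_mapD[OF assms(3)]
      complexD[OF assms(1)]
    complexD[OF assms(2)]
  by (simp add: cycle_def)

lemma cls_arr:
  assumes "complex K" "cycle K n x"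
  shows "cls K n x \<in> Arr C" "Dom C (cls K n x) = Dom C x" "Cod C (cls K n x) = homology C K n"
proof -
  obtain w where w: "w \<in> Hom C (Dom C x) (Dom C (cyc C K n))" "cls K n x = hquot C K n \<cdot> w"
    using cycle_factor[OF assms] by blast
  show "cls K n x \<in> Arr C" "Dom C (cls K n x) = Dom C x" "Cod C (cls K n x) = homology C K n"
    using w homologyD[OF assms(1)] by simp_all
qed

lemma cls_Cmp:
  assumes "complex K" "cycle K n x" "u \<in> Arr C" "Cod C u = Dom C x"
  shows "cls K n (x \<cdot> u) = cls K n x \<cdot> u"
proof -
  note H = homologyD[OF assms(1), of n]
  obtain w where w: "w \<in> Hom C (Dom C x) (Dom C (cyc C K n))" "cyc C K n \<cdot> w = x" "cls K n x = hquot
      C K n \<cdot> w"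
    using cycle_factor[OF assms(1,2)] by blast
  have "x \<cdot> u = cyc C K n \<cdot> (w \<cdot> u)"
    using Cmp_reassoc1[OF w(2), of u] w(1) H(1-5) assms(3,4) by simp
  then show ?thesis
    using cls_cyc[OF assms(1), of "w \<cdot> u" "Dom C u" n] w(1,3) H(1-5) assms(3,4) by simp
qed

lemma cls_Add:
  assumes "complex K" "cycle K n x" "cycle K n y" "Dom C y = Dom C x"
  shows "cls K n (x \<oplus> y) = cls K n x \<oplus> cls K n y"
proof -
  note H = homologyD[OF assms(1), of n]
  obtain w where w: "w \<in> Hom C (Dom C x) (Dom C (cyc C K n))" "cyc C K n \<cdot> w = x" "cls K n x = hquot
      C K n \<cdot> w"
    using cycle_factor[OF assms(1,2)] by blast
  obtain v where v: "v \<in> Hom C (Dom C y) (Dom C (cyc C K n))" "cyc C K n \<cdot> v = y" "cls K n y = hquot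
      C K n \<cdot> v"
    using cycle_factor[OF assms(1,3)] by blast
  have "x \<oplus> y = cyc C K n \<cdot> (w \<oplus> v)"
    using w(1) v(1) H(1-5) assms(4) by (simp add: w(2) v(2))
  then show ?thesis
    using cls_cyc[OF assms(1), of "w \<oplus> v" "Dom C x" n] w(1,3) v(1,3) H(1-5) assms(4) by simp
qed

lemma cls_boundary:
  assumes "complex K" "y \<in> Arr C" "Cod C y = CObj K (n + 1)"
  shows "cls K n (CDif K (n + 1) \<cdot> y) = Zero C (Dom C y) (homology C K n)"
proof -
  note H = homologyD[OF assms(1), of n] and KD = complexD[OF assms(1)]
  obtain b where b: "b \<in> Hom C (CObj K (n + 1)) (Dom C (cyc C K n))"
    "cyc C K n \<cdot> b = CDif K (n + 1)" "is_cokernel C b (hquot C K n)"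
    using is_homology_exists[OF assms(1), of n] unfolding is_homology_def by blast
  have "CDif K (n + 1) \<cdot> y = cyc C K n \<cdot> (b \<cdot> y)"
    using Cmp_reassoc1[OF b(2), of y] b(1) H assms(2,3) by simp
  then have "cls K n (CDif K (n + 1) \<cdot> y) = hquot C K n \<cdot> (b \<cdot> y)"
    using cls_cyc[OF assms(1), of "b \<cdot> y" "Dom C y" n] b(1) H(1-5) assms(2,3) by simp
  also have "\<dots> = Zero C (Dom C y) (homology C K n)"
    by (rule Cmp_reassoc0[where a = "CObj K (n + 1)" and c = "Dom C (cyc C K n)"])
      (use cokernelD[OF b(3)] b(1) H(3-5) assms(2,3) in simp_all)
  finally show ?thesis .
qed

text \<open>The map \<open>b\<close> from the chains of degree \<open>n + 1\<close> to the cycles is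
  exact with its cokernel \<open>hquot\<close>. A cycle with vanishing class is therefore a
  boundary, but only over a cover.\<close>

lemma cls_zeroD:
  assumes "complex K" "cycle K n x" "cls K n x = Zero C (Dom C x) (homology C K n)"
  obtains V e y where "e \<in> Hom C V (Dom C x)" "epi_arr C e" "y \<in> Hom C V (CObj K (n + 1))"
    "CDif K (n + 1) \<cdot> y = x \<cdot> e"
proof -
  note H = homologyD[OF assms(1), of n] and KD = complexD[OF assms(1)]
  obtain b where b: "b \<in> Hom C (CObj K (n + 1)) (Dom C (cyc C K n))"
    "cyc C K n \<cdot> b = CDif K (n + 1)" "is_cokernel C b (hquot C K n)"
    using is_homology_exists[OF assms(1), of n] unfolding is_homology_def by blast
  note cD = cokernelD[OF b(3)]
  obtain w where w: "w \<in> Hom C (Dom C x) (Dom C (cyc C K n))" "cyc C K n \<cdot> w = x" "cls K n x = hquot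
      C K n \<cdot> w"
    using cycle_factor[OF assms(1,2)] by blast
  obtain k where k: "is_kernel C (hquot C K n) k" using has_kernels[OF H(3)] by blast
  have ex: "exact_at C b (hquot C K n)"
    using exact_at_iff[OF b(3) k] cD kernelD[OF k] by simp
  have q0: "hquot C K n \<cdot> w = Zero C (Dom C w) (Cod C (hquot C K n))"
    using w(1,3) H(5) assms(3) by simp
  obtain V e y where y: "e \<in> Hom C V (Dom C w)" "epi_arr C e" "y \<in> Hom C V (Dom C b)" "b \<cdot> y = w \<cdot>
      e"
    using exact_lift[OF ex _ _ q0] w(1) H(4) by auto
  have "CDif K (n + 1) \<cdot> y = cyc C K n \<cdot> (b \<cdot> y)"
    using Cmp_reassoc1[OF b(2), of y] b(1) y(3) H(1) by simp
  also have "\<dots> = x \<cdot> e"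
    using Cmp_reassoc1[OF w(2), of e] w(1) y(1,4) H(1) by simp
  finally show thesis
    using that[of e V y] y b(1) w(1) by simp
qed

text \<open>\<open>hquot\<close> is epi, so every generalised element of homology is represented by
  a cycle over a cover. Chases on homology objects start here.\<close>

lemma cls_surj:
  assumes "complex K" "h \<in> Arr C" "Cod C h = homology C K n"
  obtains V e x where "e \<in> Hom C V (Dom C h)" "epi_arr C e" "cycle K n x" "Dom C x = V" "cls K n x =
      h \<cdot> e"
proof -
  note H = homologyD[OF assms(1), of n]
  obtain V e w where e: "e \<in> Hom C V (Dom C h)" "epi_arr C e" "w \<in> Hom C V (Dom C (hquot C K n))"
      "hquot C K n \<cdot> w = h \<cdot> e"
    using epi_lift[OF H(8), of h] assms H(5) by auto
  have w: "w \<in> Hom C V (Dom C (cyc C K n))" using e(3) H(4) by simp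
  show thesis
    using that[OF e(1,2), of "cyc C K n \<cdot> w"] cls_cyc[OF assms(1) w] e(4) w H(1)
      cycle_Cmp[OF assms(1) cycle_cyc[OF assms(1), of n], of w] by simp
qed

text \<open>The kernel \<open>cyc\<close> is itself a cycle, the universal one, and its class is the
  epimorphism \<open>hquot\<close>. Agreement on this one class suffices.\<close>

lemma hom_ext_cls:
  assumes "complex K" "h \<in> Hom C (homology C K n) Y" "h' \<in> Hom C (homology C K n) Y"
    and "\<And>x. cycle K n x \<Longrightarrow> h \<cdot> cls K n x = h' \<cdot> cls K n x"
  shows "h = h'"
proof -
  note H = homologyD[OF assms(1), of n]
  have c: "cls K n (cyc C K n) = hquot C K n"
    using cls_cyc[OF assms(1), of "Ide C (Dom C (cyc C K n))" _ n] H(1,3,4) by simp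
  have "h \<cdot> hquot C K n = h' \<cdot> hquot C K n"
    using assms(4)[OF cycle_cyc[OF assms(1)]] c by simp
  then show ?thesis
    using epi_cancel[OF H(8), of h Y h'] assms(2,3) H(5) by simp
qed

text \<open>How an arrow defined on cycles descends to homology. Taking \<open>w\<close> to be the
  factored differential \<open>b\<close> and \<open>y\<close> the identity turns the condition on
  boundaries into \<open>t \<cdot> b = 0\<close>, which the cokernel property requires.\<close>

lemma hom_on_cls:
  assumes "complex K" "t \<in> Hom C (Dom C (cyc C K n)) Y"
    and "\<And>w y. \<lbrakk>w \<in> Hom C (Dom C y) (Dom C (cyc C K n)); y \<in> Arr C; Cod C y = CObj K (n + 1);
      cyc C K n \<cdot> w = CDif K (n + 1) \<cdot> y\<rbrakk> \<Longrightarrow> t \<cdot> w = Zero C (Dom C y) Y"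
  obtains h where "h \<in> Hom C (homology C K n) Y" "h \<cdot> hquot C K n = t"
proof -
  note H = homologyD[OF assms(1), of n] and KD = complexD[OF assms(1)]
  obtain b where b: "b \<in> Hom C (CObj K (n + 1)) (Dom C (cyc C K n))"
    "cyc C K n \<cdot> b = CDif K (n + 1)" "is_cokernel C b (hquot C K n)"
    using is_homology_exists[OF assms(1), of n] unfolding is_homology_def by blast
  have "t \<cdot> b = Zero C (CObj K (n + 1)) Y"
    using assms(3)[of b "Ide C (CObj K (n + 1))"] b(1,2) KD by simp
  then show thesis
    using cokernel_factor[OF b(3), of t] assms(2) b(1) H(5) that by auto
qed

text \<open>Justifies the definite description in \<open>homology_map\<close>: monicity of
  \<open>cyc\<close> forces \<open>\<zeta>\<close>, and then \<open>hquot\<close> being epi forces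
  \<open>h\<close>.\<close>

lemma homology_map_ex1:
  assumes "complex K" "complex K'" "chain_map K K' \<phi>"
  shows "\<exists>!h. h \<in> Hom C (homology C K n) (homology C K' n) \<and>
        (\<exists>\<zeta> \<in> Hom C (Dom C (cyc C K n)) (Dom C (cyc C K' n)).
           cyc C K' n \<cdot> \<zeta> = \<phi> n \<cdot> cyc C K n \<and> h \<cdot> hquot C K n = hquot C K' n \<cdot> \<zeta>)"
proof -
  note H = homologyD[OF assms(1), of n] and H' = homologyD[OF assms(2), of n] and KD = complexD[OF
      assms(1)]
    and KD' = complexD[OF assms(2)] and P = chain_mapD[OF assms(3)]
  have cy: "cycle K' n (\<phi> n \<cdot> cyc C K n)"
    by (rule cycle_chain_map[OF assms cycle_cyc[OF assms(1)]])
  obtain \<zeta> where z: "\<zeta> \<in> Hom C (Dom C (cyc C K n)) (Dom C (cyc C K' n))" "cyc C K' n \<cdot> \<zeta> = \<phi> n \<cdot> cyc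
      C K n"
    "cls K' n (\<phi> n \<cdot> cyc C K n) = hquot C K' n \<cdot> \<zeta>"
    using cycle_factor[OF assms(2) cy] P H(1,2) by auto
  let ?t = "hquot C K' n \<cdot> \<zeta>"
  have t: "?t \<in> Hom C (Dom C (cyc C K n)) (homology C K' n)"
    using z(1) H' by simp
  have t0: "?t \<cdot> w = Zero C (Dom C y) (homology C K' n)"
    if w: "w \<in> Hom C (Dom C y) (Dom C (cyc C K n))" and y: "y \<in> Arr C" "Cod C y = CObj K (n + 1)"
      and eq: "cyc C K n \<cdot> w = CDif K (n + 1) \<cdot> y" for w y
  proof -
    have "\<phi> n \<cdot> cyc C K n \<cdot> w = \<phi> n \<cdot> (CDif K (n + 1) \<cdot> y)"
      using w eq P H(1,2) by simp
    also have "\<dots> = CDif K' (n + 1) \<cdot> (\<phi> (n + 1) \<cdot> y)"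
      using chain_map_diff[OF assms(3,1,2), of y "n + 1"] y by simp
    finally have "cls K' n (\<phi> n \<cdot> cyc C K n \<cdot> w) = Zero C (Dom C y) (homology C K' n)"
      using cls_boundary[OF assms(2), of "\<phi> (n + 1) \<cdot> y" n] P y by simp
    then show ?thesis
      using cls_Cmp[OF assms(2) cy, of w] w z(3) P H(1,2) by simp
  qed
  obtain h where h: "h \<in> Hom C (homology C K n) (homology C K' n)" "h \<cdot> hquot C K n = ?t"
    using hom_on_cls[OF assms(1) t t0] by blast
  show ?thesis
  proof (rule ex1I[of _ h])
    show "h \<in> Hom C (homology C K n) (homology C K' n) \<and>
        (\<exists>\<zeta> \<in> Hom C (Dom C (cyc C K n)) (Dom C (cyc C K' n)).
           cyc C K' n \<cdot> \<zeta> = \<phi> n \<cdot> cyc C K n \<and> h \<cdot> hquot C K n = hquot C K' n \<cdot> \<zeta>)"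
      using h z by blast
    fix g assume g: "g \<in> Hom C (homology C K n) (homology C K' n) \<and>
        (\<exists>\<zeta> \<in> Hom C (Dom C (cyc C K n)) (Dom C (cyc C K' n)).
           cyc C K' n \<cdot> \<zeta> = \<phi> n \<cdot> cyc C K n \<and> g \<cdot> hquot C K n = hquot C K' n \<cdot> \<zeta>)"
    then obtain \<xi> where x: "\<xi> \<in> Hom C (Dom C (cyc C K n)) (Dom C (cyc C K' n))"
       "cyc C K' n \<cdot> \<xi> = \<phi> n \<cdot> cyc C K n" "g \<cdot> hquot C K n = hquot C K' n \<cdot> \<xi>"
      by blast
    have "\<xi> = \<zeta>"
      by (rule cyc_cancel[OF assms(2) x(1) z(1)]) (use x(2) z(2) in simp)
    then show "g = h"
      using epi_cancel[OF H(8), of g "homology C K' n" h] g x(3) h H(5) by simp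
  qed
qed

text \<open>The action on classes determines the induced map by \<open>hom_ext_cls\<close>, so later
  proofs no longer look at the chosen kernels and quotients.\<close>

lemma homology_map:
  assumes "complex K" "complex K'" "chain_map K K' \<phi>"
  shows "homology_map C K K' \<phi> n \<in> Hom C (homology C K n) (homology C K' n)"
    and "cycle K n x \<Longrightarrow> homology_map C K K' \<phi> n \<cdot> cls K n x = cls K' n (\<phi> n \<cdot> x)"
proof -
  note H = homologyD[OF assms(1), of n] and H' = homologyD[OF assms(2), of n] and P = chain_mapD[OF
      assms(3)]
  let ?h = "homology_map C K K' \<phi> n"
  have spec: "?h \<in> Hom C (homology C K n) (homology C K' n) \<and>
        (\<exists>\<zeta> \<in> Hom C (Dom C (cyc C K n)) (Dom C (cyc C K' n)).
           cyc C K' n \<cdot> \<zeta> = \<phi> n \<cdot> cyc C K n \<and> ?h \<cdot> hquot C K n = hquot C K' n \<cdot> \<zeta>)"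
    unfolding homology_map_def by (rule theI') (rule homology_map_ex1[OF assms])
  then show h: "?h \<in> Hom C (homology C K n) (homology C K' n)" by blast
  obtain \<zeta> where z: "\<zeta> \<in> Hom C (Dom C (cyc C K n)) (Dom C (cyc C K' n))"
    "cyc C K' n \<cdot> \<zeta> = \<phi> n \<cdot> cyc C K n" "?h \<cdot> hquot C K n = hquot C K' n \<cdot> \<zeta>"
    using spec by blast
  assume x: "cycle K n x"
  obtain w where w: "w \<in> Hom C (Dom C x) (Dom C (cyc C K n))" "cyc C K n \<cdot> w = x" "cls K n x = hquot
      C K n \<cdot> w"
    using cycle_factor[OF assms(1) x] by blast
  have "?h \<cdot> cls K n x = hquot C K' n \<cdot> (\<zeta> \<cdot> w)"
    unfolding w(3) by (rule Cmp_reassoc[OF z(3)]) (use w(1) h z(1) H(3-5) H'(3-5) in simp_all)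
  also have "\<dots> = cls K' n (cyc C K' n \<cdot> (\<zeta> \<cdot> w))"
    by (rule cls_cyc[OF assms(2), symmetric, where W = "Dom C x"]) (use w(1) z(1) in simp)
  also have "cyc C K' n \<cdot> (\<zeta> \<cdot> w) = \<phi> n \<cdot> (cyc C K n \<cdot> w)"
    by (rule Cmp_reassoc[OF z(2)]) (use w(1) z(1) P H(1,2) H'(1,2) in simp_all)
  finally show "?h \<cdot> cls K n x = cls K' n (\<phi> n \<cdot> x)" by (simp add: w(2))
qed

section \<open>Functoriality and homotopy invariance of homology\<close>

lemma homology_map_eqI:
  assumes "complex K" "complex K'" "chain_map K K' \<phi>" "h \<in> Hom C (homology C K n) (homology C K' n)"
    and "\<And>x. cycle K n x \<Longrightarrow> h \<cdot> cls K n x = cls K' n (\<phi> n \<cdot> x)"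
  shows "homology_map C K K' \<phi> n = h"
  by (rule hom_ext_cls[OF assms(1) homology_map(1)[OF assms(1-3)] assms(4)])
    (simp add: assms(5) homology_map(2)[OF assms(1-3)])

lemma chain_map_Ide:
  assumes "complex K"
  shows "chain_map K K (\<lambda>n. Ide C (CObj K n))"
  using complexD[OF assms] by (simp add: chain_map_def)

lemma homology_map_Ide:
  assumes "complex K"
  shows "homology_map C K K (\<lambda>n. Ide C (CObj K n)) n = Ide C (homology C K n)"
  by (rule homology_map_eqI[OF assms assms chain_map_Ide[OF assms]])
    (use homologyD[OF assms] cls_arr[OF assms] cycleD in simp_all)

lemma chain_map_Cmp:
  assumes "complex K" "complex K'" "complex K''" "chain_map K K' \<phi>" "chain_map K' K'' \<psi>"
  shows "chain_map K K'' (\<lambda>n. \<psi> n \<cdot> \<phi> n)"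
  unfolding chain_map_def
proof (intro allI conjI)
  fix n
  note P = chain_mapD[OF assms(4)] and Q = chain_mapD[OF assms(5)] and D = complexD[OF assms(1)]
      complexD[OF assms(2)]
    complexD[OF assms(3)]
  show "\<psi> n \<cdot> \<phi> n \<in> Hom C (CObj K n) (CObj K'' n)" using P Q by simp
  have "CDif K'' n \<cdot> (\<psi> n \<cdot> \<phi> n) = \<psi> (n - 1) \<cdot> (CDif K' n \<cdot> \<phi> n)"
    by (rule chain_map_diff[OF assms(5,2,3)]) (use P in simp_all)
  also have "\<dots> = \<psi> (n - 1) \<cdot> \<phi> (n - 1) \<cdot> CDif K n"
    unfolding P(4) by (rule Cmp_assoc'[symmetric]) (use P(1-3) Q(1-3) D in simp_all)
  finally show "CDif K'' n \<cdot> (\<psi> n \<cdot> \<phi> n) = \<psi> (n - 1) \<cdot> \<phi> (n - 1) \<cdot> CDif K n" .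
qed

lemma homology_map_Cmp:
  assumes "complex K" "complex K'" "complex K''" "chain_map K K' \<phi>" "chain_map K' K'' \<psi>"
  shows "homology_map C K K'' (\<lambda>n. \<psi> n \<cdot> \<phi> n) n = homology_map C K' K'' \<psi> n \<cdot> homology_map C K K' \<phi>
      n"
proof (rule homology_map_eqI[OF assms(1,3) chain_map_Cmp[OF assms]])
  note P = chain_mapD[OF assms(4)] and Q = chain_mapD[OF assms(5)]
    and M = homology_map(1)[OF assms(1,2,4), of n] homology_map(1)[OF assms(2,3,5), of n]
  show "homology_map C K' K'' \<psi> n \<cdot> homology_map C K K' \<phi> n \<in> Hom C (homology C K n) (homology C K''
      n)"
    using M by simp
  fix x assume x: "cycle K n x"
  show "homology_map C K' K'' \<psi> n \<cdot> homology_map C K K' \<phi> n \<cdot> cls K n x = cls K'' n (\<psi> n \<cdot> \<phi> n \<cdot> x)"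
    using M cls_arr[OF assms(1) x] homology_map(2)[OF assms(1,2,4) x] cycleD[OF x] P Q
      homology_map(2)[OF assms(2,3,5) cycle_chain_map[OF assms(1,2,4) x]]
    by simp
qed

text \<open>On a cycle the term ending in \<open>CDif K n\<close> vanishes and the other one is a
  boundary. Only the components of the homotopy in degrees \<open>n\<close> and \<open>n - 1\<close>
  enter.\<close>

lemma homology_map_homotopic:
  assumes "complex K" "complex K'" "chain_map K K' \<phi>" "chain_map K K' \<psi>"
    and "S n \<in> Hom C (CObj K n) (CObj K' (n + 1))" "S (n - 1) \<in> Hom C (CObj K (n - 1)) (CObj K' n)"
    and "\<phi> n = \<psi> n \<oplus> (CDif K' (n + 1) \<cdot> S n \<oplus> S (n - 1) \<cdot> CDif K n)"
  shows "homology_map C K K' \<phi> n = homology_map C K K' \<psi> n"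
proof (rule homology_map_eqI[OF assms(1-3) homology_map(1)[OF assms(1,2,4)]])
  fix x assume x: "cycle K n x"
  note P = chain_mapD[OF assms(4)] and D = complexD[OF assms(1)] complexD[OF assms(2)] and X =
      cycleD[OF x]
  have "\<phi> n \<cdot> x = \<psi> n \<cdot> x \<oplus> CDif K' (n + 1) \<cdot> (S n \<cdot> x)"
    unfolding assms(7) using P D X assms(5,6) by simp
  moreover have "cls K' n (\<psi> n \<cdot> x \<oplus> CDif K' (n + 1) \<cdot> (S n \<cdot> x)) = cls K' n (\<psi> n \<cdot> x)"
    using cls_Add[OF assms(2) cycle_chain_map[OF assms(1,2,4) x] cycle_boundary[OF assms(2)], of "S
        n \<cdot> x"]
      cls_boundary[OF assms(2), of "S n \<cdot> x" n] cls_arr[OF assms(2) cycle_chain_map[OF assms(1,2,4)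
          x]]
      X D P assms(5) by simp
  ultimately show "homology_map C K K' \<psi> n \<cdot> cls K n x = cls K' n (\<phi> n \<cdot> x)"
    using homology_map(2)[OF assms(1,2,4) x] by simp
qed

end

section \<open>The long exact homology sequence\<close>

context abelian_category
begin

text \<open>Replacing the object \<open>B\<close> of a long exact sequence by an isomorphic
  \<open>B'\<close> touches three spots: exactness at \<open>B\<close> itself, and at the objects
  just after and just before it. The three parts treat these in that order.\<close>

lemma exact_at_iso:
  assumes "k \<in> Hom C B B'" "k' \<in> Hom C B' B" "k' \<cdot> k = Ide C B" "k \<cdot> k' = Ide C B'"
  shows "exact_at C f g \<Longrightarrow> Cod C f = B \<Longrightarrow> exact_at C (k \<cdot> f) (g \<cdot> k')"
    and "exact_at C g d \<Longrightarrow> Dom C g = B \<Longrightarrow> exact_at C (g \<cdot> k') d"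
    and "exact_at C d f \<Longrightarrow> Cod C f = B \<Longrightarrow> exact_at C d (k \<cdot> f)"
proof -
  have kk: "k' \<cdot> (k \<cdot> x) = x" if "x \<in> Arr C" "Cod C x = B" for x
    using Cmp_reassoc1[OF assms(3), of x] assms(1,2) that by simp
  have kk': "k \<cdot> (k' \<cdot> x) = x" if "x \<in> Arr C" "Cod C x = B'" for x
    using Cmp_reassoc1[OF assms(4), of x] assms(1,2) that by simp
  show "exact_at C (k \<cdot> f) (g \<cdot> k')" if ex: "exact_at C f g" and B: "Cod C f = B"
  proof (rule exact_atI)
    note D = exact_atD[OF ex]
    show "g \<cdot> k' \<cdot> (k \<cdot> f) = Zero C (Dom C (k \<cdot> f)) (Cod C (g \<cdot> k'))"
      using D B assms(1,2) kk[of f] exact_comp[OF ex] by simp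
    fix y assume y: "y \<in> Arr C" "Cod C y = Dom C (g \<cdot> k')"
      "g \<cdot> k' \<cdot> y = Zero C (Dom C y) (Cod C (g \<cdot> k'))"
    have y': "k' \<cdot> y \<in> Arr C" "Cod C (k' \<cdot> y) = Dom C g" "g \<cdot> (k' \<cdot> y) = Zero C (Dom C (k' \<cdot> y))
        (Cod C g)"
      using y D B assms(1,2) by simp_all
    obtain V e x where x: "e \<in> Hom C V (Dom C (k' \<cdot> y))" "epi_arr C e" "x \<in> Hom C V (Dom C f)" "f \<cdot>
        x = k' \<cdot> y \<cdot> e"
      using exact_lift[OF ex y'] by blast
    have "k \<cdot> f \<cdot> x = y \<cdot> e"
      using x(1,3) x(4) D B y assms(1,2) kk'[of "y \<cdot> e"] by simp
    then show "\<exists>V e x. e \<in> Hom C V (Dom C y) \<and> epi_arr C e \<and> x \<in> Hom C V (Dom C (k \<cdot> f)) \<and> k \<cdot> f \<cdot> x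
        = y \<cdot> e"
      using x D B y assms(1,2) by (intro exI[of _ V] exI[of _ e] exI[of _ x]) simp
  qed (use exact_atD[OF ex] B assms in simp_all)
  show "exact_at C (g \<cdot> k') d" if ex: "exact_at C g d" and B: "Dom C g = B"
  proof (rule exact_atI)
    note D = exact_atD[OF ex]
    show "d \<cdot> (g \<cdot> k') = Zero C (Dom C (g \<cdot> k')) (Cod C d)"
      using D B assms(1,2) Cmp_reassoc1[OF exact_comp[OF ex], of k'] by simp
    fix y assume y: "y \<in> Arr C" "Cod C y = Dom C d" "d \<cdot> y = Zero C (Dom C y) (Cod C d)"
    obtain V e x where x: "e \<in> Hom C V (Dom C y)" "epi_arr C e" "x \<in> Hom C V (Dom C g)" "g \<cdot> x = y \<cdot>
        e"
      using exact_lift[OF ex y] by blast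
    have "g \<cdot> k' \<cdot> (k \<cdot> x) = y \<cdot> e"
      using x(3,4) D B assms(1,2) kk[of x] by simp
    then show "\<exists>V e x. e \<in> Hom C V (Dom C y) \<and> epi_arr C e \<and> x \<in> Hom C V (Dom C (g \<cdot> k')) \<and> g \<cdot> k' \<cdot>
        x = y \<cdot> e"
      using x D B y assms(1,2) by (intro exI[of _ V] exI[of _ e] exI[of _ "k \<cdot> x"]) simp
  qed (use exact_atD[OF ex] B assms in simp_all)
  show "exact_at C d (k \<cdot> f)" if ex: "exact_at C d f" and B: "Cod C f = B"
  proof (rule exact_atI)
    note D = exact_atD[OF ex]
    show "k \<cdot> f \<cdot> d = Zero C (Dom C d) (Cod C (k \<cdot> f))"
      using D B assms(1,2) exact_comp[OF ex] by simp
    fix y assume y: "y \<in> Arr C" "Cod C y = Dom C (k \<cdot> f)" "k \<cdot> f \<cdot> y = Zero C (Dom C y) (Cod C (k \<cdot>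
        f))"
    have "k' \<cdot> (k \<cdot> (f \<cdot> y)) = Zero C (Dom C y) B"
      using y D B assms(1,2) by simp
    then have y': "y \<in> Arr C" "Cod C y = Dom C f" "f \<cdot> y = Zero C (Dom C y) (Cod C f)"
      using kk[of "f \<cdot> y"] y(1,2) D B assms(1) by simp_all
    show "\<exists>V e x. e \<in> Hom C V (Dom C y) \<and> epi_arr C e \<and> x \<in> Hom C V (Dom C d) \<and> d \<cdot> x = y \<cdot> e"
      using exact_lift[OF ex y'] by metis
  qed (use exact_atD[OF ex] B assms in simp_all)
qed

text \<open>Only \<open>i\<close> and \<open>p\<close> are chain maps. The retractions
  \<open>r\<close> and sections \<open>s\<close> split each degree separately and need not respect
  differentials; if they did, every connecting morphism would be zero.\<close>

definition split_complexes ::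
  "('o, 'a) cpx \<Rightarrow> ('o, 'a) cpx \<Rightarrow> ('o, 'a) cpx \<Rightarrow> (int \<Rightarrow> 'a) \<Rightarrow> (int \<Rightarrow> 'a) \<Rightarrow> (int \<Rightarrow> 'a) \<Rightarrow> (int \<Rightarrow> 'a) \<Rightarrow>
      bool" where
  "split_complexes K L M i p r s \<longleftrightarrow> complex K \<and> complex L \<and> complex M \<and> chain_map K L i \<and> chain_map L
      M p \<and>
     (\<forall>n. split_exact (i n) (p n) (r n) (s n))"

text \<open>The relation behind \<open>connecting\<close>, with cycles in place of their
  factorisations through the chosen kernels: \<open>x\<close> lifts the cycle \<open>w\<close>, and
  \<open>a\<close> is what the boundary of \<open>x\<close> comes from. All three arrows share one
  source.\<close>

definition zigzag ::
  "('o, 'a) cpx \<Rightarrow> ('o, 'a) cpx \<Rightarrow> ('o, 'a) cpx \<Rightarrow> (int \<Rightarrow> 'a) \<Rightarrow> (int \<Rightarrow> 'a) \<Rightarrow> int \<Rightarrow> 'a \<Rightarrow> 'a \<Rightarrow> 'a \<Rightarrow> bool"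
      where
  "zigzag K L M i p n w x a \<longleftrightarrow> cycle M n w \<and> x \<in> Hom C (Dom C w) (CObj L n) \<and> cycle K (n - 1) a \<and> Dom
      C a = Dom C w \<and>
     p n \<cdot> x = w \<and> CDif L n \<cdot> x = i (n - 1) \<cdot> a"

lemma zigzagD:
  assumes "zigzag K L M i p n w x a"
  shows "cycle M n w" "w \<in> Arr C" "Cod C w = CObj M n"
    "x \<in> Arr C" "Dom C x = Dom C w" "Cod C x = CObj L n"
    "cycle K (n - 1) a" "a \<in> Arr C" "Dom C a = Dom C w" "Cod C a = CObj K (n - 1)"
    "p n \<cdot> x = w" "CDif L n \<cdot> x = i (n - 1) \<cdot> a"
  using assms by (auto simp: zigzag_def dest: cycleD)

section \<open>The long exact sequence of a degreewise split sequence of complexes\<close>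

context
  fixes K L M i p r s
  assumes ses: "split_complexes K L M i p r s"
begin

lemma split_complexesD:
  shows "complex K" "complex L" "complex M" "chain_map K L i" "chain_map L M p"
    and "split_exact (i n) (p n) (r n) (s n)"
    and "r n \<in> Arr C" "Dom C (r n) = CObj L n" "Cod C (r n) = CObj K n"
      "s n \<in> Arr C" "Dom C (s n) = CObj M n" "Cod C (s n) = CObj L n"
  using ses split_exactD(1-9)[of "i n" "p n" "r n" "s n"] chain_mapD[of K L i n] chain_mapD[of L M p
      n]
  unfolding split_complexes_def by simp_all

lemmas cpxs = split_complexesD(1-3) and maps = split_complexesD(4,5) and split = split_complexesD(6)
lemmas typing = split_complexesD(7-12) chain_mapD(1-3)[OF split_complexesD(4)] chain_mapD(1-3)[OF
    split_complexesD(5)]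
  complexD[OF split_complexesD(1)] complexD[OF split_complexesD(2)] complexD[OF split_complexesD(3)]

lemma split_mono:
  assumes "x \<in> Hom C W (CObj K n)" "y \<in> Hom C W (CObj K n)" "i n \<cdot> x = i n \<cdot> y"
  shows "x = y"
  by (rule mono_cancel[OF split_exact_mono[OF split[of n]]]) (use assms typing in auto)

lemma split_lift:
  assumes "x \<in> Arr C" "Cod C x = CObj L n" "p n \<cdot> x = Zero C (Dom C x) (CObj M n)"
  shows "i n \<cdot> (r n \<cdot> x) = x"
  using split_exact_decomp[OF split[of n], of x] assms typing by simp

lemma split_section:
  assumes "x \<in> Arr C" "Cod C x = CObj M n"
  shows "p n \<cdot> (s n \<cdot> x) = x"
  using Cmp_reassoc1[OF split_exactD(11)[OF split[of n]], of x] assms typing by simp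

lemma split_pi:
  assumes "x \<in> Arr C" "Cod C x = CObj K n"
  shows "p n \<cdot> (i n \<cdot> x) = Zero C (Dom C x) (CObj M n)"
  using Cmp_reassoc1[OF split_exactD(12)[OF split[of n]], of x] assms typing by simp

lemma cycle_lift:
  assumes "a \<in> Arr C" "Cod C a = CObj K n" "cycle L n (i n \<cdot> a)"
  shows "cycle K n a"
proof -
  have "i (n - 1) \<cdot> (CDif K n \<cdot> a) = CDif L n \<cdot> (i n \<cdot> a)"
    by (rule chain_map_diff[OF maps(1) cpxs(1,2) assms(1,2), symmetric])
  also have "\<dots> = Zero C (Dom C a) (CObj L (n - 1))"
    using cycleD(3)[OF assms(3)] assms(1,2) typing by simp
  also have "\<dots> = i (n - 1) \<cdot> Zero C (Dom C a) (CObj K (n - 1))"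
    using assms(1) typing by simp
  finally have eq: "i (n - 1) \<cdot> (CDif K n \<cdot> a) = i (n - 1) \<cdot> Zero C (Dom C a) (CObj K (n - 1))" .
  have "CDif K n \<cdot> a = Zero C (Dom C a) (CObj K (n - 1))"
    by (rule split_mono[OF _ _ eq, of "Dom C a"]) (use assms(1,2) typing in simp_all)
  then show ?thesis using assms by (simp add: cycle_def)
qed

text \<open>The boundary of \<open>x\<close> lies over the boundary of \<open>w\<close>, which is
  zero, so it comes from the subcomplex and the retraction recovers it. The result is a cycle
  because \<open>i\<close> is mono.\<close>

lemma zigzag_exists:
  assumes "cycle M n w" "x \<in> Hom C (Dom C w) (CObj L n)" "p n \<cdot> x = w"
  obtains a where "zigzag K L M i p n w x a"
proof -
  note W = cycleD[OF assms(1)]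
  let ?a = "r (n - 1) \<cdot> (CDif L n \<cdot> x)"
  have "p (n - 1) \<cdot> (CDif L n \<cdot> x) = Zero C (Dom C w) (CObj M (n - 1))"
    using chain_map_diff[OF maps(2) cpxs(2,3), of x n] assms(2,3) W by simp
  then have ia: "i (n - 1) \<cdot> ?a = CDif L n \<cdot> x"
    by (intro split_lift) (use assms(2) typing in simp_all)
  have "cycle L (n - 1) (CDif L n \<cdot> x)"
    using cycle_boundary[OF cpxs(2), of x "n - 1"] assms(2) by simp
  then have "cycle K (n - 1) ?a"
    by (intro cycle_lift) (use ia assms(2) typing in simp_all)
  then show thesis
    using that[of ?a] ia assms typing by (simp add: zigzag_def)
qed

text \<open>Lifting by the section \<open>s n\<close> avoids any cover, so every cycle of the
  quotient has a zigzag over its own source.\<close>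

lemma zigzag_exists_section:
  assumes "cycle M n w"
  obtains x a where "zigzag K L M i p n w x a"
proof -
  have "s n \<cdot> w \<in> Hom C (Dom C w) (CObj L n)" "p n \<cdot> (s n \<cdot> w) = w"
    using split_section[of w n] cycleD[OF assms] typing by simp_all
  then show thesis
    using zigzag_exists[OF assms] that by metis
qed

lemma zigzag_Cmp:
  assumes "zigzag K L M i p n w x a" "u \<in> Arr C" "Cod C u = Dom C w"
  shows "zigzag K L M i p n (w \<cdot> u) (x \<cdot> u) (a \<cdot> u)"
proof -
  note Z = zigzagD[OF assms(1)]
  have "p n \<cdot> (x \<cdot> u) = w \<cdot> u"
    by (rule Cmp_reassoc1[OF Z(11)]) (use Z typing assms in simp_all)
  moreover have "CDif L n \<cdot> (x \<cdot> u) = i (n - 1) \<cdot> (a \<cdot> u)"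
    by (rule Cmp_reassoc[OF Z(12)]) (use Z typing assms in simp_all)
  ultimately show ?thesis
    using cycle_Cmp[OF cpxs(3) Z(1), of u] cycle_Cmp[OF cpxs(1) Z(7), of u] Z(1-10) assms(2,3)
    by (simp add: zigzag_def)
qed

text \<open>Two lifts \<open>x\<close> and \<open>y\<close> of the same \<open>w\<close> differ by
  \<open>i n \<cdot> ?k\<close>. Comparing boundaries in the subcomplex shows that \<open>a\<close>
  and \<open>b\<close> differ by the boundary of \<open>?k\<close>.\<close>

lemma zigzag_unique:
  assumes "zigzag K L M i p n w x a" "zigzag K L M i p n w y b"
  shows "cls K (n - 1) a = cls K (n - 1) b"
proof -
  note Z = zigzagD[OF assms(1)] and Y = zigzagD[OF assms(2)]
  let ?k = "r n \<cdot> (x \<oplus> \<ominus> y)"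
  have "p n \<cdot> (x \<oplus> \<ominus> y) = Zero C (Dom C w) (CObj M n)"
    using Z Y typing by simp
  then have ik: "i n \<cdot> ?k = x \<oplus> \<ominus> y"
    by (intro split_lift) (use Z Y typing in simp_all)
  have "a = b \<oplus> CDif K n \<cdot> ?k"
  proof (rule split_mono[of _ "Dom C w" "n - 1"])
    have "i (n - 1) \<cdot> (CDif K n \<cdot> ?k) = CDif L n \<cdot> (i n \<cdot> ?k)"
      by (rule chain_map_diff[OF maps(1) cpxs(1,2), symmetric]) (use Z Y typing in simp_all)
    also have "\<dots> = i (n - 1) \<cdot> a \<oplus> \<ominus> (i (n - 1) \<cdot> b)"
      unfolding ik using Z Y typing by simp
    finally have dk: "i (n - 1) \<cdot> (CDif K n \<cdot> ?k) = i (n - 1) \<cdot> a \<oplus> \<ominus> (i (n - 1) \<cdot> b)" .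
    have "i (n - 1) \<cdot> (b \<oplus> CDif K n \<cdot> ?k) = i (n - 1) \<cdot> b \<oplus> i (n - 1) \<cdot> (CDif K n \<cdot> ?k)"
      by (rule Cmp_Add') (use Z Y typing in simp_all)
    also have "\<dots> = i (n - 1) \<cdot> a \<oplus> (i (n - 1) \<cdot> b \<oplus> \<ominus> (i (n - 1) \<cdot> b))"
      unfolding dk by (rule Add_left_commute) (use Z Y typing in simp_all)
    also have "\<dots> = i (n - 1) \<cdot> a"
      using Z(8-10) Y(8-10) typing by simp
    finally show "i (n - 1) \<cdot> a = i (n - 1) \<cdot> (b \<oplus> CDif K n \<cdot> ?k)" by (rule sym)
  qed (use Z Y typing in simp_all)
  moreover have "cls K (n - 1) (b \<oplus> CDif K n \<cdot> ?k) = cls K (n - 1) b"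
    using cls_Add[OF cpxs(1) Y(7) cycle_boundary[OF cpxs(1), of ?k "n - 1"]]
      cls_boundary[OF cpxs(1), of ?k "n - 1"] cls_arr[OF cpxs(1) Y(7)] Z(4-6) Y(4-6,8-10) typing
    by simp
  ultimately show ?thesis by simp
qed

text \<open>A boundary \<open>w\<close> has a second zigzag: lift \<open>y\<close> by the section
  and take its boundary as the middle element. That element has zero boundary, so the zigzag ends in
  zero, and \<open>zigzag_unique\<close> compares.\<close>

lemma zigzag_boundary:
  assumes "zigzag K L M i p n w x a" "y \<in> Hom C (Dom C w) (CObj M (n + 1))" "w = CDif M (n + 1) \<cdot> y"
  shows "cls K (n - 1) a = Zero C (Dom C w) (homology C K (n - 1))"
proof -
  note Z = zigzagD[OF assms(1)]
  let ?a = "Zero C (Dom C w) (CObj K (n - 1))"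
  have o: "Dom C w \<in> Obj C" using Z by simp
  have "p n \<cdot> (CDif L (n + 1) \<cdot> (s (n + 1) \<cdot> y)) = CDif M (n + 1) \<cdot> (p (n + 1) \<cdot> (s (n + 1) \<cdot> y))"
    using chain_map_diff[OF maps(2) cpxs(2,3), of "s (n + 1) \<cdot> y" "n + 1"] assms(2) typing by simp
  then have "p n \<cdot> (CDif L (n + 1) \<cdot> (s (n + 1) \<cdot> y)) = w"
    using split_section[of y "n + 1"] assms(2,3) by simp
  moreover have "CDif L n \<cdot> (CDif L (n + 1) \<cdot> (s (n + 1) \<cdot> y)) = i (n - 1) \<cdot> ?a"
    using complex_dd[OF cpxs(2), of "s (n + 1) \<cdot> y" n] assms(2) typing o by simp
  moreover have "cycle K (n - 1) ?a" using typing o by (simp add: cycle_def)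
  ultimately have "zigzag K L M i p n w (CDif L (n + 1) \<cdot> (s (n + 1) \<cdot> y)) ?a"
    using Z(1) assms(2) typing o by (simp add: zigzag_def)
  then have "cls K (n - 1) a = cls K (n - 1) ?a" by (rule zigzag_unique[OF assms(1)])
  also have "\<dots> = Zero C (Dom C w) (homology C K (n - 1))"
    using cls_boundary[OF cpxs(1), of "Zero C (Dom C w) (CObj K n)" "n - 1"] typing o by simp
  finally show ?thesis .
qed

text \<open>Justifies the definite description in \<open>connecting\<close>. A zigzag over the
  universal cycle \<open>cyc\<close> yields a class that vanishes on boundaries and hence descends
  to homology; precomposing that zigzag reaches every other one.\<close>

lemma connecting_ex1:
  "\<exists>!h. h \<in> Hom C (homology C M n) (homology C K (n - 1)) \<and>
        (\<forall>W. \<forall>w \<in> Hom C W (Dom C (cyc C M n)). \<forall>x \<in> Hom C W (CObj L n).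
         \<forall>a \<in> Hom C W (Dom C (cyc C K (n - 1))).
           p n \<cdot> x = cyc C M n \<cdot> w \<and> CDif L n \<cdot> x = i (n - 1) \<cdot> (cyc C K (n - 1) \<cdot> a) \<longrightarrow>
           h \<cdot> (hquot C M n \<cdot> w) = hquot C K (n - 1) \<cdot> a)" (is "\<exists>!h. ?P h")
proof -
  note HM = homologyD[OF cpxs(3), of n] and HK = homologyD[OF cpxs(1), of "n - 1"]
  have cM: "cycle M n (cyc C M n)" by (rule cycle_cyc[OF cpxs(3)])
  have zz: "zigzag K L M i p n (cyc C M n \<cdot> w) x (cyc C K (n - 1) \<cdot> a)"
    if "w \<in> Hom C W (Dom C (cyc C M n))" "x \<in> Hom C W (CObj L n)" "a \<in> Hom C W (Dom C (cyc C K (n -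
        1)))"
      "p n \<cdot> x = cyc C M n \<cdot> w" "CDif L n \<cdot> x = i (n - 1) \<cdot> (cyc C K (n - 1) \<cdot> a)" for W w x a
    using cycle_Cmp[OF cpxs(3) cM, of w] cycle_Cmp[OF cpxs(1) cycle_cyc[OF cpxs(1), of "n - 1"], of
        a] that HM(1,2) HK(1,2)
    by (simp add: zigzag_def)
  obtain x0 a0 where z0: "zigzag K L M i p n (cyc C M n) x0 a0"
    using zigzag_exists_section[OF cM] by blast
  note Z = zigzagD[OF z0]
  let ?t = "cls K (n - 1) a0"
  have t: "?t \<in> Hom C (Dom C (cyc C M n)) (homology C K (n - 1))"
    using cls_arr[OF cpxs(1) Z(7)] Z(9) by simp
  have t0: "?t \<cdot> w = Zero C (Dom C y) (homology C K (n - 1))"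
    if w: "w \<in> Hom C (Dom C y) (Dom C (cyc C M n))" and y: "y \<in> Arr C" "Cod C y = CObj M (n + 1)"
      and eq: "cyc C M n \<cdot> w = CDif M (n + 1) \<cdot> y" for w y
  proof -
    have d: "Dom C (cyc C M n \<cdot> w) = Dom C y" using w HM by simp
    have "cls K (n - 1) (a0 \<cdot> w) = Zero C (Dom C (cyc C M n \<cdot> w)) (homology C K (n - 1))"
      by (rule zigzag_boundary[OF zigzag_Cmp[OF z0] _ eq]) (use w y d in simp_all)
    then show ?thesis
      using cls_Cmp[OF cpxs(1) Z(7), of w] w Z(9) d by simp
  qed
  obtain h where h: "h \<in> Hom C (homology C M n) (homology C K (n - 1))" "h \<cdot> hquot C M n = ?t"
    using hom_on_cls[OF cpxs(3) t t0] by blast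
  show ?thesis
  proof (rule ex1I[of _ h])
    show "?P h"
    proof (intro conjI allI ballI impI h(1))
      fix W w x a
      assume w: "w \<in> Hom C W (Dom C (cyc C M n))" and x: "x \<in> Hom C W (CObj L n)"
        and a: "a \<in> Hom C W (Dom C (cyc C K (n - 1)))"
        and eq: "p n \<cdot> x = cyc C M n \<cdot> w \<and> CDif L n \<cdot> x = i (n - 1) \<cdot> (cyc C K (n - 1) \<cdot> a)"
      have "h \<cdot> (hquot C M n \<cdot> w) = ?t \<cdot> w"
        by (rule Cmp_reassoc1[OF h(2)]) (use w h(1) HM in simp_all)
      also have "\<dots> = cls K (n - 1) (a0 \<cdot> w)"
        by (rule cls_Cmp[OF cpxs(1) Z(7), symmetric]) (use w Z(9) in simp_all)
      also have "\<dots> = cls K (n - 1) (cyc C K (n - 1) \<cdot> a)"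
        by (rule zigzag_unique[OF zigzag_Cmp[OF z0] zz]) (use w x a eq in auto)
      also have "\<dots> = hquot C K (n - 1) \<cdot> a"
        by (rule cls_cyc[OF cpxs(1) a])
      finally show "h \<cdot> (hquot C M n \<cdot> w) = hquot C K (n - 1) \<cdot> a" .
    qed
    fix g assume g: "?P g"
    obtain a1 where a1: "a1 \<in> Hom C (Dom C (cyc C M n)) (Dom C (cyc C K (n - 1)))" "cyc C K (n - 1)
        \<cdot> a1 = a0"
      "cls K (n - 1) a0 = hquot C K (n - 1) \<cdot> a1"
      using cycle_factor[OF cpxs(1) Z(7)] Z(9) by metis
    \<comment> \<open>The universal case: \<open>w\<close> is the identity of the object of cycles,
      so the condition pins down \<open>g\<close> on the epimorphism \<open>hquot\<close>.\<close>
    have "g \<cdot> (hquot C M n \<cdot> Ide C (Dom C (cyc C M n))) = hquot C K (n - 1) \<cdot> a1"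
      by (rule g[THEN conjunct2, rule_format, of _ "Dom C (cyc C M n)" x0]) (use Z HM a1 in
          simp_all)
    then have "g \<cdot> hquot C M n = h \<cdot> hquot C M n"
      using h(2) a1(3) HM by simp
    then show "g = h"
      using epi_cancel[OF HM(8), of g "homology C K (n - 1)" h] g h HM(5) by simp
  qed
qed

lemma connecting_arr: "connecting C K L M i p n \<in> Hom C (homology C M n) (homology C K (n - 1))"
  unfolding connecting_def by (rule theI'[OF connecting_ex1, THEN conjunct1])

lemma connecting_cls:
  assumes "zigzag K L M i p n w x a"
  shows "connecting C K L M i p n \<cdot> cls M n w = cls K (n - 1) a"
proof -
  note Z = zigzagD[OF assms]
  obtain v where v: "v \<in> Hom C (Dom C w) (Dom C (cyc C M n))" "cyc C M n \<cdot> v = w" "cls M n w = hquot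
      C M n \<cdot> v"
    using cycle_factor[OF cpxs(3) Z(1)] by blast
  obtain b where b: "b \<in> Hom C (Dom C w) (Dom C (cyc C K (n - 1)))" "cyc C K (n - 1) \<cdot> b = a"
      "cls K (n - 1) a = hquot C K (n - 1) \<cdot> b"
    using cycle_factor[OF cpxs(1) Z(7)] Z(9) by metis
  have "\<forall>W. \<forall>w \<in> Hom C W (Dom C (cyc C M n)). \<forall>x \<in> Hom C W (CObj L n).
         \<forall>a \<in> Hom C W (Dom C (cyc C K (n - 1))).
           p n \<cdot> x = cyc C M n \<cdot> w \<and> CDif L n \<cdot> x = i (n - 1) \<cdot> (cyc C K (n - 1) \<cdot> a) \<longrightarrow>
           connecting C K L M i p n \<cdot> (hquot C M n \<cdot> w) = hquot C K (n - 1) \<cdot> a"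
    unfolding connecting_def by (rule theI'[OF connecting_ex1, THEN conjunct2])
  from this[rule_format, of v "Dom C w" x b] show ?thesis
    unfolding v(3) b(3) using Z v b by simp
qed

text \<open>If the image of a cycle \<open>x\<close> becomes a boundary
  \<open>CDif M (n + 1) \<cdot> m\<close> over a cover, then subtracting the boundary of the lifted
  \<open>m\<close> leaves the class of \<open>x\<close> unchanged and moves \<open>x\<close> into
  the image of \<open>i\<close>.\<close>

lemma exact_middle: "exact_at C (homology_map C K L i n) (homology_map C L M p n)"
proof (rule exact_atI)
  note Hi = homology_map[OF cpxs(1,2) maps(1), of n] and Hp = homology_map[OF cpxs(2,3) maps(2), of
      n]
  show "homology_map C L M p n \<cdot> homology_map C K L i n =
    Zero C (Dom C (homology_map C K L i n)) (Cod C (homology_map C L M p n))"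
  proof (rule hom_ext_cls[OF cpxs(1)])
    fix x assume x: "cycle K n x"
    note X = cycleD[OF x]
    have o: "Dom C x \<in> Obj C" using X by simp
    have "homology_map C L M p n \<cdot> (homology_map C K L i n \<cdot> cls K n x) = cls M n (p n \<cdot> (i n \<cdot> x))"
      using Hi(2)[OF x] Hp(2)[OF cycle_chain_map[OF cpxs(1,2) maps(1) x]] by simp
    also have "p n \<cdot> (i n \<cdot> x) = CDif M (n + 1) \<cdot> Zero C (Dom C x) (CObj M (n + 1))"
      using split_pi[of x n] X typing o by simp
    also have "cls M n \<dots> = Zero C (Dom C x) (homology C M n)"
      using cls_boundary[OF cpxs(3), of "Zero C (Dom C x) (CObj M (n + 1))" n] typing o by simp
    finally show "homology_map C L M p n \<cdot> homology_map C K L i n \<cdot> cls K n x =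
       Zero C (Dom C (homology_map C K L i n)) (Cod C (homology_map C L M p n)) \<cdot> cls K n x"
      using Hi(1) Hp(1) cls_arr[OF cpxs(1) x] homologyD(9)[OF cpxs(3)] by simp
  qed (use Hi(1) Hp(1) homologyD(9)[OF cpxs(1)] homologyD(9)[OF cpxs(3)] in simp_all)
  fix y assume y: "y \<in> Arr C" "Cod C y = Dom C (homology_map C L M p n)"
    "homology_map C L M p n \<cdot> y = Zero C (Dom C y) (Cod C (homology_map C L M p n))"
  have yc: "Cod C y = homology C L n" using y(2) Hp(1) by simp
  obtain V e x where x: "e \<in> Hom C V (Dom C y)" "epi_arr C e" "cycle L n x" "Dom C x = V" "cls L n x
      = y \<cdot> e"
    using cls_surj[OF cpxs(2) y(1) yc] by metis
  note X = cycleD[OF x(3)] and px = cycle_chain_map[OF cpxs(2,3) maps(2) x(3)]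
  have dpx: "Dom C (p n \<cdot> x) = V" using X x(4) typing by simp
  have "cls M n (p n \<cdot> x) = homology_map C L M p n \<cdot> (y \<cdot> e)"
    using Hp(2)[OF x(3)] x(5) by simp
  also have "\<dots> = Zero C V (homology C M n)"
    using Cmp_reassoc1[OF y(3), of e] y(1,2) x(1) Hp(1) homologyD(9)[OF cpxs(3)] by simp
  finally obtain V' e' m where m: "e' \<in> Hom C V' V" "epi_arr C e'" "m \<in> Hom C V' (CObj M (n + 1))"
    "CDif M (n + 1) \<cdot> m = p n \<cdot> x \<cdot> e'"
    using cls_zeroD[OF cpxs(3) px] dpx by metis
  let ?l = "CDif L (n + 1) \<cdot> (s (n + 1) \<cdot> m)"
  let ?x = "x \<cdot> e' \<oplus> \<ominus> ?l"
  have xe: "cycle L n (x \<cdot> e')" by (rule cycle_Cmp[OF cpxs(2) x(3)]) (use m x in auto)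
  have cl: "cycle L n ?l" by (rule cycle_boundary[OF cpxs(2)]) (use m typing in auto)
  have xm: "cycle L n ?x"
    by (rule cycle_Add[OF cpxs(2) xe cycle_Neg[OF cpxs(2) cl]]) (use m x X typing in simp)
  have "p n \<cdot> ?l = CDif M (n + 1) \<cdot> (p (n + 1) \<cdot> (s (n + 1) \<cdot> m))"
    using chain_map_diff[OF maps(2) cpxs(2,3), of "s (n + 1) \<cdot> m" "n + 1"] m typing by simp
  also have "\<dots> = p n \<cdot> (x \<cdot> e')"
    using split_section[of m "n + 1"] m(3,4) m(1) x(4) X typing by simp
  finally have "p n \<cdot> ?x = Zero C (Dom C ?x) (CObj M n)"
    using m(1,3) x(4) X typing by simp
  then have ir: "i n \<cdot> (r n \<cdot> ?x) = ?x"
    by (intro split_lift) (use m(1,3) x(4) X typing in simp_all)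
  have k: "cycle K n (r n \<cdot> ?x)"
    by (rule cycle_lift) (use ir xm m(1,3) x(4) X typing in simp_all)
  have "cls L n (x \<cdot> e') = cls L n (?x \<oplus> ?l)"
    using m(1,3) x(4) X typing by simp
  also have "\<dots> = cls L n ?x"
    using cls_Add[OF cpxs(2) xm cl] cls_boundary[OF cpxs(2), of "s (n + 1) \<cdot> m" n] cls_arr[OF
        cpxs(2) xm]
      m(1,3) x(4) X typing by simp
  also have "\<dots> = homology_map C K L i n \<cdot> cls K n (r n \<cdot> ?x)"
    using Hi(2)[OF k] ir by simp
  finally have "homology_map C K L i n \<cdot> cls K n (r n \<cdot> ?x) = y \<cdot> (e \<cdot> e')"
    using cls_Cmp[OF cpxs(2) x(3), of e'] x(1,4,5) m(1) y(1) by simp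
  moreover have "epi_arr C (e \<cdot> e')" by (rule epi_arr_Cmp[OF m(2) x(2)]) (use m x in simp)
  moreover have "cls K n (r n \<cdot> ?x) \<in> Hom C V' (Dom C (homology_map C K L i n))"
    using cls_arr[OF cpxs(1) k] Hi(1) m(1,3) x(4) X typing by simp
  moreover have "e \<cdot> e' \<in> Hom C V' (Dom C y)" using x m by simp
  ultimately show "\<exists>V e x. e \<in> Hom C V (Dom C y) \<and> epi_arr C e \<and> x \<in> Hom C V (Dom C (homology_map C
      K L i n)) \<and>
      homology_map C K L i n \<cdot> x = y \<cdot> e"
    by blast
qed (use homology_map(1)[OF cpxs(1,2) maps(1), of n] homology_map(1)[OF cpxs(2,3) maps(2), of n] in
    simp_all)

text \<open>If the end \<open>a\<close> of a zigzag over \<open>w\<close> becomes a boundary of some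
  \<open>k\<close> over a cover, then \<open>x\<close> corrected by \<open>i n \<cdot> k\<close> is
  a cycle that still lies over \<open>w\<close>.\<close>

lemma exact_right: "exact_at C (homology_map C L M p n) (connecting C K L M i p n)"
proof (rule exact_atI)
  note Hp = homology_map[OF cpxs(2,3) maps(2), of n] and c = connecting_arr[of n]
  show "connecting C K L M i p n \<cdot> homology_map C L M p n =
    Zero C (Dom C (homology_map C L M p n)) (Cod C (connecting C K L M i p n))"
  proof (rule hom_ext_cls[OF cpxs(2)])
    fix x assume x: "cycle L n x"
    note X = cycleD[OF x] and px = cycle_chain_map[OF cpxs(2,3) maps(2) x]
    have o: "Dom C x \<in> Obj C" using X by simp
    let ?a = "Zero C (Dom C x) (CObj K (n - 1))"
    have "zigzag K L M i p n (p n \<cdot> x) x ?a"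
      using px X typing o by (simp add: zigzag_def) (simp add: cycle_def)
    then have "connecting C K L M i p n \<cdot> (homology_map C L M p n \<cdot> cls L n x) = cls K (n - 1) ?a"
      using connecting_cls Hp(2)[OF x] by simp
    also have "\<dots> = Zero C (Dom C x) (homology C K (n - 1))"
      using cls_boundary[OF cpxs(1), of "Zero C (Dom C x) (CObj K n)" "n - 1"] typing o by simp
    finally show "connecting C K L M i p n \<cdot> homology_map C L M p n \<cdot> cls L n x =
       Zero C (Dom C (homology_map C L M p n)) (Cod C (connecting C K L M i p n)) \<cdot> cls L n x"
      using c Hp(1) cls_arr[OF cpxs(2) x] homologyD(9)[OF cpxs(1)] by simp
  qed (use c Hp(1) homologyD(9)[OF cpxs(1)] homologyD(9)[OF cpxs(2)] in simp_all)
  fix y assume y: "y \<in> Arr C" "Cod C y = Dom C (connecting C K L M i p n)"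
    "connecting C K L M i p n \<cdot> y = Zero C (Dom C y) (Cod C (connecting C K L M i p n))"
  have yc: "Cod C y = homology C M n" using y(2) c by simp
  obtain V e w where w: "e \<in> Hom C V (Dom C y)" "epi_arr C e" "cycle M n w" "Dom C w = V" "cls M n w
      = y \<cdot> e"
    using cls_surj[OF cpxs(3) y(1) yc] by metis
  obtain x a where z: "zigzag K L M i p n w x a"
    using zigzag_exists_section[OF w(3)] by blast
  note Z = zigzagD[OF z]
  have "cls K (n - 1) a = connecting C K L M i p n \<cdot> (y \<cdot> e)"
    using connecting_cls[OF z] w(5) by simp
  also have "\<dots> = Zero C (Dom C a) (homology C K (n - 1))"
    using Cmp_reassoc1[OF y(3), of e] y(1,2) w(1,4) Z(9) c homologyD(9)[OF cpxs(1)] by simp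
  finally have a0: "cls K (n - 1) a = Zero C (Dom C a) (homology C K (n - 1))" .
  obtain V' e' k where k0: "e' \<in> Hom C V' (Dom C a)" "epi_arr C e'" "k \<in> Hom C V' (CObj K (n - 1 +
      1))"
    "CDif K (n - 1 + 1) \<cdot> k = a \<cdot> e'"
    by (rule cls_zeroD[OF cpxs(1) Z(7) a0])
  \<comment> \<open>\<open>cls_zeroD\<close> in degree \<open>n - 1\<close> speaks of degree
    \<open>n - 1 + 1\<close>; here this is normalised to \<open>n\<close>.\<close>
  have k: "e' \<in> Hom C V' V" "epi_arr C e'" "k \<in> Hom C V' (CObj K n)" "CDif K n \<cdot> k = a \<cdot> e'"
    using k0 Z(9) w(4) by simp_all
  let ?x = "x \<cdot> e' \<oplus> \<ominus> (i n \<cdot> k)"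
  have tx: "?x \<in> Hom C V' (CObj L n)"
    using k(1,3) Z w(4) typing by simp
  have "CDif L n \<cdot> (x \<cdot> e') = i (n - 1) \<cdot> (a \<cdot> e')"
    by (rule Cmp_reassoc[OF Z(12)]) (use k(1) Z(1-10) w(4) typing in simp_all)
  moreover have "CDif L n \<cdot> (i n \<cdot> k) = i (n - 1) \<cdot> (a \<cdot> e')"
    using chain_map_diff[OF maps(1) cpxs(1,2), of k n] k(3,4) by simp
  ultimately have xc: "cycle L n ?x"
    using tx k(1,3) Z(1-10) w(4) typing by (simp add: cycle_def)
  have "p n \<cdot> (x \<cdot> e') = w \<cdot> e'"
    by (rule Cmp_reassoc1[OF Z(11)]) (use k(1) Z(1-10) w(4) typing in simp_all)
  moreover have "V' \<in> Obj C" using k(1) by auto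
  ultimately have "p n \<cdot> ?x = w \<cdot> e'"
    using split_pi[of k n] k(1,3) Z(1-10) w(4) typing by simp
  then have "homology_map C L M p n \<cdot> cls L n ?x = y \<cdot> (e \<cdot> e')"
    using Hp(2)[OF xc] cls_Cmp[OF cpxs(3) w(3), of e'] w(1,4,5) k(1) y(1) by simp
  moreover have "epi_arr C (e \<cdot> e')" by (rule epi_arr_Cmp[OF k(2) w(2)]) (use k w in simp)
  moreover have "cls L n ?x \<in> Hom C V' (Dom C (homology_map C L M p n))"
    using cls_arr[OF cpxs(2) xc] Hp(1) tx by simp
  moreover have "e \<cdot> e' \<in> Hom C V' (Dom C y)" using w k by simp
  ultimately show "\<exists>V e x. e \<in> Hom C V (Dom C y) \<and> epi_arr C e \<and> x \<in> Hom C V (Dom C (homology_map C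
      L M p n)) \<and>
      homology_map C L M p n \<cdot> x = y \<cdot> e"
    by blast
qed (use connecting_arr[of n] homology_map(1)[OF cpxs(2,3) maps(2), of n] in simp_all)

text \<open>If \<open>i\<close> sends a cycle \<open>a\<close> to a boundary of some
  \<open>x\<close> over a cover, then \<open>p n \<cdot> x\<close> is a cycle and \<open>x\<close>
  exhibits a zigzag from it to \<open>a\<close>.\<close>

lemma exact_left: "exact_at C (connecting C K L M i p n) (homology_map C K L i (n - 1))"
proof (rule exact_atI)
  note Hi = homology_map[OF cpxs(1,2) maps(1), of "n - 1"] and c = connecting_arr[of n]
  show "homology_map C K L i (n - 1) \<cdot> connecting C K L M i p n =
    Zero C (Dom C (connecting C K L M i p n)) (Cod C (homology_map C K L i (n - 1)))"
  proof (rule hom_ext_cls[OF cpxs(3)])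
    fix w assume w: "cycle M n w"
    obtain x a where z: "zigzag K L M i p n w x a"
      using zigzag_exists_section[OF w] by blast
    note Z = zigzagD[OF z]
    have "homology_map C K L i (n - 1) \<cdot> (connecting C K L M i p n \<cdot> cls M n w) = cls L (n - 1)
        (CDif L n \<cdot> x)"
      using connecting_cls[OF z] Hi(2)[OF Z(7)] Z(12) by simp
    also have "\<dots> = Zero C (Dom C w) (homology C L (n - 1))"
      using cls_boundary[OF cpxs(2), of x "n - 1"] Z(4-6) by simp
    finally show "homology_map C K L i (n - 1) \<cdot> connecting C K L M i p n \<cdot> cls M n w =
       Zero C (Dom C (connecting C K L M i p n)) (Cod C (homology_map C K L i (n - 1))) \<cdot> cls M n w"
      using c Hi(1) cls_arr[OF cpxs(3) w] homologyD(9)[OF cpxs(2)] by simp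
  qed (use c Hi(1) homologyD(9)[OF cpxs(2)] homologyD(9)[OF cpxs(3)] in simp_all)
  fix y assume y: "y \<in> Arr C" "Cod C y = Dom C (homology_map C K L i (n - 1))"
    "homology_map C K L i (n - 1) \<cdot> y = Zero C (Dom C y) (Cod C (homology_map C K L i (n - 1)))"
  have yc: "Cod C y = homology C K (n - 1)" using y(2) Hi(1) by simp
  obtain V e a where a: "e \<in> Hom C V (Dom C y)" "epi_arr C e" "cycle K (n - 1) a" "Dom C a = V" "cls
      K (n - 1) a = y \<cdot> e"
    using cls_surj[OF cpxs(1) y(1) yc] by metis
  note A = cycleD[OF a(3)] and ia = cycle_chain_map[OF cpxs(1,2) maps(1) a(3)]
  have dia: "Dom C (i (n - 1) \<cdot> a) = V" using A a(4) typing by simp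
  have "cls L (n - 1) (i (n - 1) \<cdot> a) = homology_map C K L i (n - 1) \<cdot> (y \<cdot> e)"
    using Hi(2)[OF a(3)] a(5) by simp
  also have "\<dots> = Zero C (Dom C (i (n - 1) \<cdot> a)) (homology C L (n - 1))"
    using Cmp_reassoc1[OF y(3), of e] y(1,2) a(1) Hi(1) homologyD(9)[OF cpxs(2)] dia by simp
  finally have ia0: "cls L (n - 1) (i (n - 1) \<cdot> a) = Zero C (Dom C (i (n - 1) \<cdot> a)) (homology C L (n
      - 1))" .
  obtain V' e' x where x0: "e' \<in> Hom C V' (Dom C (i (n - 1) \<cdot> a))" "epi_arr C e'" "x \<in> Hom C V'
      (CObj L (n - 1 + 1))"
    "CDif L (n - 1 + 1) \<cdot> x = i (n - 1) \<cdot> a \<cdot> e'"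
    by (rule cls_zeroD[OF cpxs(2) ia ia0])
  have x: "e' \<in> Hom C V' V" "x \<in> Hom C V' (CObj L n)" "CDif L n \<cdot> x = i (n - 1) \<cdot> (a \<cdot> e')"
    using x0 dia A a(4) typing by simp_all
  have ae: "cycle K (n - 1) (a \<cdot> e')" by (rule cycle_Cmp[OF cpxs(1) a(3)]) (use x a in auto)
  have "CDif M n \<cdot> (p n \<cdot> x) = p (n - 1) \<cdot> (CDif L n \<cdot> x)"
    by (rule chain_map_diff[OF maps(2) cpxs(2,3)]) (use x in simp_all)
  also have "\<dots> = Zero C V' (CObj M (n - 1))"
    using split_pi[of "a \<cdot> e'" "n - 1"] x A a(4) by simp
  finally have w: "cycle M n (p n \<cdot> x)"
    using x typing by (simp add: cycle_def)
  have z: "zigzag K L M i p n (p n \<cdot> x) x (a \<cdot> e')"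
    using w ae x A a(4) typing by (simp add: zigzag_def)
  have "connecting C K L M i p n \<cdot> cls M n (p n \<cdot> x) = y \<cdot> (e \<cdot> e')"
    using connecting_cls[OF z] cls_Cmp[OF cpxs(1) a(3), of e'] a(1,4,5) x(1) y(1) by simp
  moreover have "epi_arr C (e \<cdot> e')" by (rule epi_arr_Cmp[OF x0(2) a(2)]) (use x a in simp)
  moreover have "cls M n (p n \<cdot> x) \<in> Hom C V' (Dom C (connecting C K L M i p n))"
    using cls_arr[OF cpxs(3) w] c x typing by simp
  moreover have "e \<cdot> e' \<in> Hom C V' (Dom C y)" using x a by simp
  ultimately show "\<exists>V e x. e \<in> Hom C V (Dom C y) \<and> epi_arr C e \<and> x \<in> Hom C V (Dom C (connecting C K
      L M i p n)) \<and>
      connecting C K L M i p n \<cdot> x = y \<cdot> e"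
    by blast
qed (use connecting_arr[of n] homology_map(1)[OF cpxs(1,2) maps(1), of "n - 1"] in simp_all)

end

text \<open>The three chain maps carry a zigzag to a zigzag, and this requires both squares to
  commute on the nose in each degree; a homotopy would not do. The demand is met later by
  \<open>horseshoe_map\<close>.\<close>

lemma connecting_natural:
  assumes "split_complexes K L M i p r s" "split_complexes K' L' M' i' p' r' s'"
    and "chain_map K K' \<kappa>" "chain_map L L' \<theta>" "chain_map M M' \<mu>"
    and "\<And>n. \<theta> n \<cdot> i n = i' n \<cdot> \<kappa> n" "\<And>n. \<mu> n \<cdot> p n = p' n \<cdot> \<theta> n"
  shows "connecting C K' L' M' i' p' n \<cdot> homology_map C M M' \<mu> n =
    homology_map C K K' \<kappa> (n - 1) \<cdot> connecting C K L M i p n"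
proof (rule hom_ext_cls)
  note D = split_complexesD[OF assms(1)] and D' = split_complexesD[OF assms(2)]
  note T = typing[OF assms(1)] and T' = typing[OF assms(2)]
    and P = chain_mapD(1-3)[OF assms(3)] chain_mapD(1-3)[OF assms(4)] chain_mapD(1-3)[OF assms(5)]
  note Hk = homology_map[OF D(1) D'(1) assms(3), of "n - 1"] and Hm = homology_map[OF D(3) D'(3)
      assms(5), of n]
    and c = connecting_arr[OF assms(1), of n] and c' = connecting_arr[OF assms(2), of n]
  show "complex M" by fact
  show "connecting C K' L' M' i' p' n \<cdot> homology_map C M M' \<mu> n \<in> Hom C (homology C M n) (homology C
      K' (n - 1))"
    "homology_map C K K' \<kappa> (n - 1) \<cdot> connecting C K L M i p n \<in> Hom C (homology C M n) (homology C
        K' (n - 1))"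
    using Hk(1) Hm(1) c c' by simp_all
  fix w assume w: "cycle M n w"
  obtain x a where z: "zigzag K L M i p n w x a"
    using zigzag_exists_section[OF assms(1) w] by blast
  note Z = zigzagD[OF z]
  have "p' n \<cdot> (\<theta> n \<cdot> x) = \<mu> n \<cdot> (p n \<cdot> x)"
    by (rule Cmp_reassoc[OF assms(7)[symmetric]]) (use T T' P Z in simp_all)
  moreover have "CDif L' n \<cdot> (\<theta> n \<cdot> x) = i' (n - 1) \<cdot> (\<kappa> (n - 1) \<cdot> a)"
  proof -
    have "CDif L' n \<cdot> (\<theta> n \<cdot> x) = \<theta> (n - 1) \<cdot> (i (n - 1) \<cdot> a)"
      using chain_map_diff[OF assms(4) D(2) D'(2), of x n] Z by simp
    also have "\<dots> = i' (n - 1) \<cdot> (\<kappa> (n - 1) \<cdot> a)"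
      by (rule Cmp_reassoc[OF assms(6)]) (use T T' P Z in simp_all)
    finally show ?thesis .
  qed
  ultimately have z': "zigzag K' L' M' i' p' n (\<mu> n \<cdot> w) (\<theta> n \<cdot> x) (\<kappa> (n - 1) \<cdot> a)"
    using cycle_chain_map[OF D(3) D'(3) assms(5) w] cycle_chain_map[OF D(1) D'(1) assms(3) Z(7)] Z P
    by (simp add: zigzag_def)
  show "connecting C K' L' M' i' p' n \<cdot> homology_map C M M' \<mu> n \<cdot> cls M n w =
    homology_map C K K' \<kappa> (n - 1) \<cdot> connecting C K L M i p n \<cdot> cls M n w"
    using Hk(1) Hm(1) c c' cls_arr[OF D(3) w] Hm(2)[OF w] connecting_cls[OF assms(1) z]
      connecting_cls[OF assms(2) z'] Hk(2)[OF Z(7)] by simp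
qed

text \<open>The objects \<open>H n\<close> stand in for the homology of the middle complex. In the
  application they are the homology of the total complex on the chosen resolution, while
  \<open>L\<close> is built from a horseshoe.\<close>

lemma long_exact_homology:
  assumes "split_complexes K L M i p r s"
    and "\<And>n. k n \<in> Hom C (homology C L n) (H n)" "\<And>n. k' n \<in> Hom C (H n) (homology C L n)"
    and "\<And>n. k' n \<cdot> k n = Ide C (homology C L n)" "\<And>n. k n \<cdot> k' n = Ide C (H n)"
  shows "long_exact C (\<lambda>n. k n \<cdot> homology_map C K L i n) (\<lambda>n. homology_map C L M p n \<cdot> k' n)
    (connecting C K L M i p)"
proof -
  note D = split_complexesD[OF assms(1)]
  note Hi = homology_map(1)[OF D(1,2,4)] and Hp = homology_map(1)[OF D(2,3,5)]
  show ?thesis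
    unfolding long_exact_def
    using exact_at_iso(1)[OF assms(2-5) exact_middle[OF assms(1)]]
      exact_at_iso(2)[OF assms(2-5) exact_right[OF assms(1)]]
      exact_at_iso(3)[OF assms(2-5) exact_left[OF assms(1)]] Hi Hp
    by simp
qed

end

section \<open>Projective resolutions\<close>

text \<open>The differentials of a resolution together with the augmentation, which counts as
  the differential leaving degree 0.\<close>

definition bd :: "('o, 'a) resol \<Rightarrow> nat \<Rightarrow> 'a" where
  "bd P n = (case n of 0 \<Rightarrow> RAug P | Suc m \<Rightarrow> RDif P m)"

lemma bd_simps [simp]: "bd P 0 = RAug P" "bd P (Suc n) = RDif P n"
  by (simp_all add: bd_def)

context abelian_category
begin

lemma resolutionD:
  assumes "is_proj_resolution C X P"
  shows "projective C (RObj P n)" "RObj P n \<in> Obj C"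
    "RDif P n \<in> Arr C" "Dom C (RDif P n) = RObj P (Suc n)" "Cod C (RDif P n) = RObj P n"
    "RAug P \<in> Arr C" "Dom C (RAug P) = RObj P 0" "Cod C (RAug P) = X" "epi_arr C (RAug P)" "X \<in> Obj
        C"
  using assms Cod_in[of "RAug P"] by (auto simp: is_proj_resolution_def projective_def)

lemma resolution_exact:
  assumes "is_proj_resolution C X P"
  shows "exact_at C (RDif P n) (bd P n)"
  using assms by (cases n) (auto simp: is_proj_resolution_def)

lemma resolution_bd:
  assumes "is_proj_resolution C X P"
  shows "bd P n \<in> Arr C" "Dom C (bd P n) = RObj P n" "bd P n \<cdot> RDif P n = Zero C (RObj P (Suc n))
      (Cod C (bd P n))"
proof -
  note R = resolutionD[OF assms] and ex = resolution_exact[OF assms, of n]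
  show "bd P n \<in> Arr C" "Dom C (bd P n) = RObj P n"
    using R by (cases n; simp)+
  show "bd P n \<cdot> RDif P n = Zero C (RObj P (Suc n)) (Cod C (bd P n))"
    using exact_comp[OF ex] R by simp
qed

lemma resolution_bd_cancel:
  assumes "is_proj_resolution C X P" "x \<in> Arr C" "Cod C x = RObj P (Suc n)"
  shows "bd P n \<cdot> (RDif P n \<cdot> x) = Zero C (Dom C x) (Cod C (bd P n))"
  by (rule Cmp_reassoc0[OF resolution_bd(3)[OF assms(1)]])
    (use resolution_bd[OF assms(1)] resolutionD[OF assms(1)] assms in auto)

lemma resolution_dd:
  assumes "is_proj_resolution C X P"
  shows "RDif P n \<cdot> RDif P (Suc n) = Zero C (RObj P (Suc (Suc n))) (RObj P n)"
  using resolution_bd(3)[OF assms, of "Suc n"] resolutionD[OF assms] by simp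

lemma resolution_lift:
  assumes "is_proj_resolution C X P" "y \<in> Arr C" "projective C (Dom C y)" "Cod C y = RObj P n"
    "bd P n \<cdot> y = Zero C (Dom C y) (Cod C (bd P n))"
  obtains x where "x \<in> Hom C (Dom C y) (RObj P (Suc n))" "RDif P n \<cdot> x = y"
  using projective_exact_lift[OF resolution_exact[OF assms(1)] assms(3,2) _ assms(5)]
    resolutionD[OF assms(1)] resolution_bd[OF assms(1)] assms(4) by metis

lemma projective_epi_lift:
  assumes "projective C (Dom C y)" "epi_arr C e" "y \<in> Arr C" "Cod C y = Cod C e"
  obtains x where "x \<in> Hom C (Dom C y) (Dom C e)" "e \<cdot> x = y"
proof -
  have "y \<in> Hom C (Dom C y) (Cod C e)" using assms by simp
  then have "\<exists>h \<in> Hom C (Dom C y) (Dom C e). e \<cdot> h = y"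
    using assms(1,2) unfolding projective_def by blast
  then show thesis using that by blast
qed

text \<open>Cover the kernel of \<open>f\<close> by a projective and compose; this is one step in
  building a resolution.\<close>

lemma projective_cover:
  assumes "enough_projectives C" "f \<in> Arr C"
  obtains d where "projective C (Dom C d)" "exact_at C d f"
proof -
  obtain k where k: "is_kernel C f k" using has_kernels[OF assms(2)] by blast
  note kD = kernelD[OF k]
  obtain e where e: "projective C (Dom C e)" "e \<in> Arr C" "Cod C e = Dom C k" "epi_arr C e"
    using assms(1) Dom_in[OF kD(1)] unfolding enough_projectives_def by auto
  have "exact_at C (k \<cdot> e) f"
  proof (rule exact_atI)
    show "f \<cdot> (k \<cdot> e) = Zero C (Dom C (k \<cdot> e)) (Cod C f)"
      using Cmp_reassoc1[OF kD(4), of e] e kD(1-3) by simp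
    fix y assume y: "y \<in> Arr C" "Cod C y = Dom C f" "f \<cdot> y = Zero C (Dom C y) (Cod C f)"
    obtain y' where y': "y' \<in> Hom C (Dom C y) (Dom C k)" "k \<cdot> y' = y"
      using kernel_factor[OF k y] by blast
    obtain V e' x where x: "e' \<in> Hom C V (Dom C y)" "epi_arr C e'" "x \<in> Hom C V (Dom C e)" "e \<cdot> x =
        y' \<cdot> e'"
      using epi_lift[OF e(4), of y'] y'(1) e(3) by auto
    have "k \<cdot> (y' \<cdot> e') = y \<cdot> e'"
      by (rule Cmp_reassoc1[OF y'(2)]) (use y'(1) x(1) kD in simp_all)
    then have "k \<cdot> e \<cdot> x = y \<cdot> e'"
      using x(3,4) e kD(1-3) by simp
    then show "\<exists>V e' x. e' \<in> Hom C V (Dom C y) \<and> epi_arr C e' \<and> x \<in> Hom C V (Dom C (k \<cdot> e)) \<and> k \<cdot> e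
        \<cdot> x = y \<cdot> e'"
      using x e kD(1-3) by (intro exI[of _ V] exI[of _ e'] exI[of _ x]) simp
  qed (use e kD assms in simp_all)
  moreover have "Dom C (k \<cdot> e) = Dom C e" using e kD by simp
  ultimately show thesis using that[of "k \<cdot> e"] e by simp
qed

lemma resolution_exists:
  assumes "enough_projectives C" "X \<in> Obj C"
  shows "is_proj_resolution C X (res C X)"
proof -
  \<comment> \<open>A single sequence holds the whole resolution: \<open>f 0\<close> is the
    augmentation and \<open>f (Suc n)\<close> the differential into degree \<open>n\<close>, so the
    same choice step serves in all degrees.\<close>
  have "\<exists>f. \<forall>n::nat. (f n \<in> Arr C \<and> projective C (Dom C (f n)) \<and> (n = 0 \<longrightarrow> Cod C (f n) = X \<and> epi_arr
      C (f n))) \<and>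
    exact_at C (f (Suc n)) (f n)"
  proof (rule dependent_nat_choice)
    show "\<exists>x. x \<in> Arr C \<and> projective C (Dom C x) \<and> ((0::nat) = 0 \<longrightarrow> Cod C x = X \<and> epi_arr C x)"
      using assms unfolding enough_projectives_def by auto
    fix x and n :: nat assume "x \<in> Arr C \<and> projective C (Dom C x) \<and> (n = 0 \<longrightarrow> Cod C x = X \<and> epi_arr C
        x)"
    then obtain d where "projective C (Dom C d)" "exact_at C d x"
      using projective_cover[OF assms(1), of x] by blast
    then show "\<exists>y. (y \<in> Arr C \<and> projective C (Dom C y) \<and> (Suc n = 0 \<longrightarrow> Cod C y = X \<and> epi_arr C y)) \<and>
        exact_at C y x"
      using exact_atD[of C d x] by auto
  qed
  then obtain f where f: "\<And>n. f n \<in> Arr C" "\<And>n. projective C (Dom C (f n))" "Cod C (f 0) = X"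
      "epi_arr C (f 0)"
    "\<And>n. exact_at C (f (Suc n)) (f n)"
    by blast
  have "is_proj_resolution C X \<lparr>RObj = (\<lambda>n. Dom C (f n)), RDif = (\<lambda>n. f (Suc n)), RAug = f 0\<rparr>"
    using f exact_atD(3)[OF f(5)] by (simp add: is_proj_resolution_def)
  then show ?thesis unfolding res_def by (rule someI)
qed

section \<open>Comparison of projective resolutions\<close>

lemma resolution_mapD:
  assumes "is_resolution_map C P P' f \<phi>"
  shows "\<phi> n \<in> Arr C" "Dom C (\<phi> n) = RObj P n" "Cod C (\<phi> n) = RObj P' n"
    "RAug P' \<cdot> \<phi> 0 = f \<cdot> RAug P" "RDif P' n \<cdot> \<phi> (Suc n) = \<phi> n \<cdot> RDif P n"
  using assms by (auto simp: is_resolution_map_def)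

lemma resolution_map_exists:
  assumes "is_proj_resolution C X P" "is_proj_resolution C X' P'" "f \<in> Hom C X X'"
  shows "\<exists>\<phi>. is_resolution_map C P P' f \<phi>"
proof -
  note R = resolutionD[OF assms(1)] and R' = resolutionD[OF assms(2)]
    and B = resolution_bd[OF assms(1)] and B' = resolution_bd[OF assms(2)]
  \<comment> \<open>The invariant says that \<open>bd P' n\<close> kills
    \<open>\<phi> n \<cdot> RDif P n\<close>. This is exactly the condition for lifting that
    composite to the next degree, and \<open>bd\<close> makes degree 0 no exception.\<close>
  have "\<exists>\<phi>. \<forall>n. (\<phi> n \<in> Hom C (RObj P n) (RObj P' n) \<and> (n = 0 \<longrightarrow> RAug P' \<cdot> \<phi> n = f \<cdot> RAug P) \<and>
      bd P' n \<cdot> (\<phi> n \<cdot> RDif P n) = Zero C (RObj P (Suc n)) (Cod C (bd P' n))) \<and>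
    RDif P' n \<cdot> \<phi> (Suc n) = \<phi> n \<cdot> RDif P n"
  proof (rule dependent_nat_choice)
    have fe: "f \<cdot> RAug P \<in> Arr C" "Dom C (f \<cdot> RAug P) = RObj P 0" "Cod C (f \<cdot> RAug P) = Cod C (RAug
        P')"
      using assms(3) R R' by simp_all
    obtain x where x: "x \<in> Hom C (RObj P 0) (RObj P' 0)" "RAug P' \<cdot> x = f \<cdot> RAug P"
      using projective_epi_lift[OF _ R'(9) fe(1,3)] fe(2) R(1) R'(7) by metis
    have "RAug P' \<cdot> (x \<cdot> RDif P 0) = f \<cdot> (RAug P \<cdot> RDif P 0)"
      by (rule Cmp_reassoc[OF x(2)]) (use x(1) assms(3) R R' in simp_all)
    also have "\<dots> = Zero C (RObj P (Suc 0)) X'"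
      using B(3)[of 0] assms(3) R by simp
    finally show "\<exists>x. x \<in> Hom C (RObj P 0) (RObj P' 0) \<and> ((0::nat) = 0 \<longrightarrow> RAug P' \<cdot> x = f \<cdot> RAug P) \<and>
        bd P' 0 \<cdot> (x \<cdot> RDif P 0) = Zero C (RObj P (Suc 0)) (Cod C (bd P' 0))"
      using x R' by auto
    fix x n assume "x \<in> Hom C (RObj P n) (RObj P' n) \<and> (n = 0 \<longrightarrow> RAug P' \<cdot> x = f \<cdot> RAug P) \<and>
        bd P' n \<cdot> (x \<cdot> RDif P n) = Zero C (RObj P (Suc n)) (Cod C (bd P' n))"
    then have x: "x \<in> Hom C (RObj P n) (RObj P' n)"
      "bd P' n \<cdot> (x \<cdot> RDif P n) = Zero C (RObj P (Suc n)) (Cod C (bd P' n))" by auto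
    have xd: "x \<cdot> RDif P n \<in> Arr C" "Dom C (x \<cdot> RDif P n) = RObj P (Suc n)" "Cod C (x \<cdot> RDif P n) =
        RObj P' n"
      using x(1) R by simp_all
    obtain y where y: "y \<in> Hom C (RObj P (Suc n)) (RObj P' (Suc n))" "RDif P' n \<cdot> y = x \<cdot> RDif P n"
      using resolution_lift[OF assms(2) xd(1) _ xd(3)] x(2) xd(2) R(1) by metis
    have "RDif P' n \<cdot> (y \<cdot> RDif P (Suc n)) = x \<cdot> (RDif P n \<cdot> RDif P (Suc n))"
      by (rule Cmp_reassoc[OF y(2)]) (use x(1) y(1) R R' in simp_all)
    also have "\<dots> = Zero C (RObj P (Suc (Suc n))) (RObj P' n)"
      using resolution_dd[OF assms(1)] x(1) R by simp
    finally show "\<exists>y. (y \<in> Hom C (RObj P (Suc n)) (RObj P' (Suc n)) \<and> (Suc n = 0 \<longrightarrow> RAug P' \<cdot> y = f \<cdot>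
        RAug P) \<and>
        bd P' (Suc n) \<cdot> (y \<cdot> RDif P (Suc n)) = Zero C (RObj P (Suc (Suc n))) (Cod C (bd P' (Suc
            n)))) \<and>
        RDif P' n \<cdot> y = x \<cdot> RDif P n"
      using y R' by auto
  qed
  then show ?thesis unfolding is_resolution_map_def by blast
qed

text \<open>The difference \<open>d\<close> of two lifts of the same arrow covers zero, so it can be
  contracted degree by degree. Degree 0 has a formula of its own because no homotopy component
  arrives from below.\<close>

lemma resolution_map_homotopy:
  assumes "is_proj_resolution C X P" "is_proj_resolution C X' P'"
    and "is_resolution_map C P P' f \<phi>" "is_resolution_map C P P' f \<psi>"
  obtains s where "\<And>n. s n \<in> Hom C (RObj P n) (RObj P' (Suc n))" "\<phi> 0 = \<psi> 0 \<oplus> RDif P' 0 \<cdot> s 0"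
    "\<And>n. \<phi> (Suc n) = \<psi> (Suc n) \<oplus> (RDif P' (Suc n) \<cdot> s (Suc n) \<oplus> s n \<cdot> RDif P n)"
proof -
  note R = resolutionD[OF assms(1)] and R' = resolutionD[OF assms(2)]
    and B = resolution_bd[OF assms(1)] and B' = resolution_bd[OF assms(2)]
    and F = resolution_mapD[OF assms(3)] and G = resolution_mapD[OF assms(4)]
  define d where "d n = \<phi> n \<oplus> \<ominus> \<psi> n" for n
  have dT: "d n \<in> Arr C" "Dom C (d n) = RObj P n" "Cod C (d n) = RObj P' n" for n
    unfolding d_def using F(1-3) G(1-3) by simp_all
  have d0: "RAug P' \<cdot> d 0 = Zero C (RObj P 0) X'"
    unfolding d_def using F(1-4) G(1-4) R R' by simp (metis Add_Neg Cmp_arr F(1-4) R'(6-8) Cod_Obj)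
  have dS: "RDif P' n \<cdot> d (Suc n) = d n \<cdot> RDif P n" for n
    unfolding d_def using F G R R' by simp
  have dSS: "RDif P' n \<cdot> (d (Suc n) \<cdot> x) = d n \<cdot> (RDif P n \<cdot> x)" if "x \<in> Arr C" "Cod C x = RObj P
      (Suc n)" for x n
    by (rule Cmp_reassoc[OF dS]) (use that dT R R' in simp_all)
  \<comment> \<open>What remains in degree \<open>Suc n\<close> is \<open>d (Suc n)\<close> minus
    the part already accounted for by \<open>s n\<close>. The invariant records that this remainder
    is a cycle, hence liftable.\<close>
  have "\<exists>s. \<forall>n. (s n \<in> Hom C (RObj P n) (RObj P' (Suc n)) \<and> (n = 0 \<longrightarrow> RDif P' n \<cdot> s n = d n) \<and>
      RDif P' n \<cdot> (d (Suc n) \<oplus> \<ominus> (s n \<cdot> RDif P n)) = Zero C (RObj P (Suc n)) (RObj P' n)) \<and>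
    RDif P' (Suc n) \<cdot> s (Suc n) = d (Suc n) \<oplus> \<ominus> (s n \<cdot> RDif P n)"
  proof (rule dependent_nat_choice)
    obtain x where x: "x \<in> Hom C (RObj P 0) (RObj P' (Suc 0))" "RDif P' 0 \<cdot> x = d 0"
      using resolution_lift[OF assms(2) dT(1)[of 0], of 0] dT d0 R(1) R'(8) by (metis bd_simps(1))
    have "RDif P' 0 \<cdot> (x \<cdot> RDif P 0) = d 0 \<cdot> RDif P 0"
      by (rule Cmp_reassoc1[OF x(2)]) (use x(1) R R' in simp_all)
    then have "RDif P' 0 \<cdot> (d (Suc 0) \<oplus> \<ominus> (x \<cdot> RDif P 0)) = Zero C (RObj P (Suc 0)) (RObj P' 0)"
      using dS[of 0] dT x(1) R R' by simp
    then show "\<exists>x. x \<in> Hom C (RObj P 0) (RObj P' (Suc 0)) \<and> ((0::nat) = 0 \<longrightarrow> RDif P' 0 \<cdot> x = d 0) \<and>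
        RDif P' 0 \<cdot> (d (Suc 0) \<oplus> \<ominus> (x \<cdot> RDif P 0)) = Zero C (RObj P (Suc 0)) (RObj P' 0)"
      using x by blast
    fix x n assume "x \<in> Hom C (RObj P n) (RObj P' (Suc n)) \<and> (n = 0 \<longrightarrow> RDif P' n \<cdot> x = d n) \<and>
      RDif P' n \<cdot> (d (Suc n) \<oplus> \<ominus> (x \<cdot> RDif P n)) = Zero C (RObj P (Suc n)) (RObj P' n)"
    then have x: "x \<in> Hom C (RObj P n) (RObj P' (Suc n))"
      "RDif P' n \<cdot> (d (Suc n) \<oplus> \<ominus> (x \<cdot> RDif P n)) = Zero C (RObj P (Suc n)) (RObj P' n)" by auto
    let ?e = "d (Suc n) \<oplus> \<ominus> (x \<cdot> RDif P n)"
    have e: "?e \<in> Arr C" "Dom C ?e = RObj P (Suc n)" "Cod C ?e = RObj P' (Suc n)"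
      using x(1) R R' dT by simp_all
    obtain y where y: "y \<in> Hom C (RObj P (Suc n)) (RObj P' (Suc (Suc n)))" "RDif P' (Suc n) \<cdot> y =
        ?e"
      using resolution_lift[OF assms(2) e(1) _ e(3)] e(2,3) R(1) x(2) R'(5) by (metis bd_simps(2))
    have "RDif P' (Suc n) \<cdot> (y \<cdot> RDif P (Suc n)) = ?e \<cdot> RDif P (Suc n)"
      by (rule Cmp_reassoc1[OF y(2)]) (use y(1) R R' in simp_all)
    also have "\<dots> = d (Suc n) \<cdot> RDif P (Suc n)"
      using x(1) R R' dT resolution_dd[OF assms(1), of n] by simp
    finally have "RDif P' (Suc n) \<cdot> (y \<cdot> RDif P (Suc n)) = d (Suc n) \<cdot> RDif P (Suc n)" .
    then have "RDif P' (Suc n) \<cdot> (d (Suc (Suc n)) \<oplus> \<ominus> (y \<cdot> RDif P (Suc n))) = Zero C (RObj P (Suc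
        (Suc n))) (RObj P' (Suc n))"
      using dS[of "Suc n"] dT y(1) R R' by simp
    then show "\<exists>y. (y \<in> Hom C (RObj P (Suc n)) (RObj P' (Suc (Suc n))) \<and> (Suc n = 0 \<longrightarrow> RDif P' (Suc
        n) \<cdot> y = d (Suc n)) \<and>
      RDif P' (Suc n) \<cdot> (d (Suc (Suc n)) \<oplus> \<ominus> (y \<cdot> RDif P (Suc n))) = Zero C (RObj P (Suc (Suc n)))
          (RObj P' (Suc n))) \<and>
      RDif P' (Suc n) \<cdot> y = ?e"
      using y by blast
  qed
  then obtain s where s: "\<And>n. s n \<in> Hom C (RObj P n) (RObj P' (Suc n))" "RDif P' 0 \<cdot> s 0 = d 0"
    "\<And>n. RDif P' (Suc n) \<cdot> s (Suc n) = d (Suc n) \<oplus> \<ominus> (s n \<cdot> RDif P n)"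
    by auto
  have fd: "\<phi> n = \<psi> n \<oplus> d n" for n
    unfolding d_def using F(1-3) G(1-3) by (simp add: Add_left_commute)
  show thesis
  proof (rule that[OF s(1)])
    show "\<phi> 0 = \<psi> 0 \<oplus> RDif P' 0 \<cdot> s 0" using fd s(2) by simp
    fix n
    have "RDif P' (Suc n) \<cdot> s (Suc n) \<oplus> s n \<cdot> RDif P n = d (Suc n)"
      unfolding s(3) using s(1) dT R R' by simp
    then show "\<phi> (Suc n) = \<psi> (Suc n) \<oplus> (RDif P' (Suc n) \<cdot> s (Suc n) \<oplus> s n \<cdot> RDif P n)"
      using fd by simp
  qed
qed

lemma resolution_map_Ide:
  assumes "is_proj_resolution C X P"
  shows "is_resolution_map C P P (Ide C X) (res_id C P)"
  using resolutionD[OF assms] by (simp add: is_resolution_map_def res_id_def)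

lemma resolution_map_Cmp:
  assumes "is_proj_resolution C X P" "is_proj_resolution C X' P'" "is_proj_resolution C X'' P''"
    and "is_resolution_map C P P' f \<phi>" "is_resolution_map C P' P'' g \<psi>" "f \<in> Hom C X X'" "g \<in> Hom C
        X' X''"
  shows "is_resolution_map C P P'' (g \<cdot> f) (\<lambda>n. \<psi> n \<cdot> \<phi> n)"
  unfolding is_resolution_map_def
proof (intro conjI allI)
  note R = resolutionD[OF assms(1)] and R' = resolutionD[OF assms(2)] and R'' = resolutionD[OF
      assms(3)]
    and F = resolution_mapD[OF assms(4)] and G = resolution_mapD[OF assms(5)]
  show "\<psi> n \<cdot> \<phi> n \<in> Hom C (RObj P n) (RObj P'' n)" for n using F G by simp
  have "RAug P'' \<cdot> (\<psi> 0 \<cdot> \<phi> 0) = g \<cdot> (RAug P' \<cdot> \<phi> 0)"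
    by (rule Cmp_reassoc[OF G(4)]) (use F(1-3) G(1-3) R R' R'' assms(6,7) in simp_all)
  also have "\<dots> = g \<cdot> f \<cdot> RAug P"
    using F(4) R assms(6,7) by simp
  finally show "RAug P'' \<cdot> (\<psi> 0 \<cdot> \<phi> 0) = g \<cdot> f \<cdot> RAug P" .
  fix n
  have "RDif P'' n \<cdot> (\<psi> (Suc n) \<cdot> \<phi> (Suc n)) = \<psi> n \<cdot> (RDif P' n \<cdot> \<phi> (Suc n))"
    by (rule Cmp_reassoc[OF G(5)]) (use F(1-3) G(1-3) R R' R'' in simp_all)
  also have "\<dots> = \<psi> n \<cdot> \<phi> n \<cdot> RDif P n"
    using F G(1-3) R by simp
  finally show "RDif P'' n \<cdot> (\<psi> (Suc n) \<cdot> \<phi> (Suc n)) = \<psi> n \<cdot> \<phi> n \<cdot> RDif P n" .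
qed

text \<open>A map on the subobject of a degreewise split sequence extends to the middle term as soon as
  the remaining obstruction, which lives on the quotient, can be lifted.\<close>

lemma split_extend:
  assumes "split_exact i p r s" "\<kappa> \<in> Hom C (Dom C i) Z" "\<delta> \<in> Hom C Z Y" "t \<in> Hom C (Cod C i) Y"
    and "t \<cdot> i = \<delta> \<cdot> \<kappa>"
    and "\<beta> \<in> Hom C (Cod C p) Z" "\<delta> \<cdot> \<beta> = (t \<oplus> \<ominus> (\<delta> \<cdot> (\<kappa> \<cdot> r))) \<cdot> s"
  shows "\<kappa> \<cdot> r \<oplus> \<beta> \<cdot> p \<in> Hom C (Cod C i) Z" "(\<kappa> \<cdot> r \<oplus> \<beta> \<cdot> p) \<cdot> i = \<kappa>" "\<delta> \<cdot> (\<kappa> \<cdot> r \<oplus> \<beta> \<cdot> p) = t"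
proof -
  note S = split_exactD[OF assms(1)]
  show "\<kappa> \<cdot> r \<oplus> \<beta> \<cdot> p \<in> Hom C (Cod C i) Z" using S(1-9) assms(2,6) by simp
  have "Z \<in> Obj C" using assms(2) by auto
  then show "(\<kappa> \<cdot> r \<oplus> \<beta> \<cdot> p) \<cdot> i = \<kappa>" using S assms(2,6) by simp
  \<comment> \<open>The error of the naive extension \<open>\<kappa> \<cdot> r\<close>. It vanishes
    on \<open>i\<close>, so it equals \<open>?e \<cdot> s \<cdot> p\<close>, and the summand
    \<open>\<beta> \<cdot> p\<close> with \<open>\<beta>\<close> lifting \<open>?e \<cdot> s\<close>
    corrects it.\<close>
  let ?e = "t \<oplus> \<ominus> (\<delta> \<cdot> (\<kappa> \<cdot> r))"
  have e: "?e \<in> Hom C (Cod C i) Y" using S(1-9) assms(2-4) by simp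
  have "\<delta> \<cdot> (\<kappa> \<cdot> (r \<cdot> i)) = \<delta> \<cdot> \<kappa>" using S assms(2,3) by simp
  then have ei: "?e \<cdot> i = Zero C (Dom C i) Y"
    using S(1-9) assms(2-5) by simp
  have "?e = ?e \<cdot> (i \<cdot> r \<oplus> s \<cdot> p)" unfolding S(13) using e by simp
  also have "\<dots> = ?e \<cdot> (i \<cdot> r) \<oplus> ?e \<cdot> (s \<cdot> p)"
    by (rule Cmp_Add') (use e S(1-9) in simp_all)
  also have "?e \<cdot> (i \<cdot> r) = Zero C (Cod C i) Y"
    by (subst Cmp_reassoc0[OF ei]) (use e S(1-9) in simp_all)
  also have "?e \<cdot> (s \<cdot> p) = \<delta> \<cdot> (\<beta> \<cdot> p)"
    by (rule Cmp_reassoc[OF assms(7)[symmetric]]) (use e S(1-9) assms(3,6) in simp_all)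
  finally have "?e = \<delta> \<cdot> (\<beta> \<cdot> p)" using assms(3,6) S(1-9) by simp
  moreover have "\<delta> \<cdot> (\<kappa> \<cdot> r \<oplus> \<beta> \<cdot> p) = \<delta> \<cdot> (\<kappa> \<cdot> r) \<oplus> \<delta> \<cdot> (\<beta> \<cdot> p)"
    using S(1-9) assms(2,3,6) by simp
  ultimately have "\<delta> \<cdot> (\<kappa> \<cdot> r \<oplus> \<beta> \<cdot> p) = \<delta> \<cdot> (\<kappa> \<cdot> r) \<oplus> ?e" by simp
  also have "\<dots> = t"
    using S(1-9) assms(2-4) by (simp add: Add_left_commute)
  finally show "\<delta> \<cdot> (\<kappa> \<cdot> r \<oplus> \<beta> \<cdot> p) = t" .
qed

text \<open>A comparison theorem relative to a subcomplex: the lift of \<open>m\<close> must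
  restrict strictly to the given \<open>\<kappa>\<close>. The freedom left in each degree is an
  arrow out of the quotient term \<open>RObj T n\<close>, and since this is projective the
  obstruction can be lifted away.\<close>

lemma resolution_map_extend:
  assumes "is_proj_resolution C M Q" "is_proj_resolution C M' Q'" "is_proj_resolution C L P"
      "is_proj_resolution C N T"
    and "is_resolution_map C P Q f i" "f \<in> Hom C L M" "\<And>n. split_exact (i n) (p n) (r n) (s n)" "\<And>n.
        Cod C (p n) = RObj T n"
    and "is_resolution_map C P Q' (m \<cdot> f) \<kappa>" "m \<in> Hom C M M'"
  obtains \<mu> where "is_resolution_map C Q Q' m \<mu>" "\<And>n. \<mu> n \<cdot> i n = \<kappa> n"
proof -
  note R = resolutionD[OF assms(1)] and R' = resolutionD[OF assms(2)] and RP = resolutionD[OF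
      assms(3)]
    and RT = resolutionD[OF assms(4)]
  note B' = resolution_bd[OF assms(2)] and S = split_exactD(1-9)[OF assms(7)]
    and F = resolution_mapD[OF assms(5)] and K = resolution_mapD[OF assms(9)]
  \<comment> \<open>The invariant of the ordinary comparison theorem together with the prescribed
    restriction along \<open>i n\<close>.\<close>
  have "\<exists>\<mu>. \<forall>n. (\<mu> n \<in> Hom C (RObj Q n) (RObj Q' n) \<and> \<mu> n \<cdot> i n = \<kappa> n \<and> (n = 0 \<longrightarrow> RAug Q' \<cdot> \<mu> n = m \<cdot>
      RAug Q) \<and>
      bd Q' n \<cdot> (\<mu> n \<cdot> RDif Q n) = Zero C (RObj Q (Suc n)) (Cod C (bd Q' n))) \<and>
    RDif Q' n \<cdot> \<mu> (Suc n) = \<mu> n \<cdot> RDif Q n"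
  proof (rule dependent_nat_choice)
    let ?t = "m \<cdot> RAug Q"
    let ?e = "(?t \<oplus> \<ominus> (RAug Q' \<cdot> (\<kappa> 0 \<cdot> r 0))) \<cdot> s 0"
    have e: "?e \<in> Arr C" "Dom C ?e = RObj T 0" "Cod C ?e = Cod C (RAug Q')"
      using S[of 0] K(1-3)[of 0] F(1-3)[of 0] R R' assms(8,10) by simp_all
    obtain \<beta> where b: "\<beta> \<in> Hom C (RObj T 0) (RObj Q' 0)" "RAug Q' \<cdot> \<beta> = ?e"
      using projective_epi_lift[OF _ R'(9) e(1,3)] e(2) RT(1) R'(7) by metis
    let ?x = "\<kappa> 0 \<cdot> r 0 \<oplus> \<beta> \<cdot> p 0"
    have ti: "?t \<cdot> i 0 = RAug Q' \<cdot> \<kappa> 0"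
      unfolding K(4) using F(4) F(1-3)[of 0] RP R assms(6,10) by simp
    have x: "?x \<in> Hom C (RObj Q 0) (RObj Q' 0)" "?x \<cdot> i 0 = \<kappa> 0" "RAug Q' \<cdot> ?x = ?t"
      using split_extend[OF assms(7)[of 0] _ _ _ ti _ b(2), where Z = "RObj Q' 0" and Y = M'] b(1)
          S[of 0] K(1-3)[of 0] F(1-3)[of 0] R R' assms(8,10)
      by simp_all
    have "RAug Q' \<cdot> (?x \<cdot> RDif Q 0) = m \<cdot> (RAug Q \<cdot> RDif Q 0)"
      by (rule Cmp_reassoc[OF x(3)]) (use x(1) assms(10) R R' in simp_all)
    also have "\<dots> = Zero C (RObj Q (Suc 0)) M'"
      using resolution_bd(3)[OF assms(1), of 0] assms(10) R by simp
    finally show "\<exists>x. x \<in> Hom C (RObj Q 0) (RObj Q' 0) \<and> x \<cdot> i 0 = \<kappa> 0 \<and> ((0::nat) = 0 \<longrightarrow> RAug Q' \<cdot> x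
        = ?t) \<and>
      bd Q' 0 \<cdot> (x \<cdot> RDif Q 0) = Zero C (RObj Q (Suc 0)) (Cod C (bd Q' 0))"
      using x R' by (intro exI[of _ ?x]) simp
    fix x n assume "x \<in> Hom C (RObj Q n) (RObj Q' n) \<and> x \<cdot> i n = \<kappa> n \<and> (n = 0 \<longrightarrow> RAug Q' \<cdot> x = ?t) \<and>
      bd Q' n \<cdot> (x \<cdot> RDif Q n) = Zero C (RObj Q (Suc n)) (Cod C (bd Q' n))"
    then have x: "x \<in> Hom C (RObj Q n) (RObj Q' n)" "x \<cdot> i n = \<kappa> n"
      "bd Q' n \<cdot> (x \<cdot> RDif Q n) = Zero C (RObj Q (Suc n)) (Cod C (bd Q' n))"
      by auto
    let ?k = "\<kappa> (Suc n) \<cdot> r (Suc n)"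
    let ?t = "x \<cdot> RDif Q n"
    let ?d = "?t \<oplus> \<ominus> (RDif Q' n \<cdot> ?k)"
    have tT: "?t \<in> Hom C (RObj Q (Suc n)) (RObj Q' n)" and kT: "?k \<in> Hom C (RObj Q (Suc n)) (RObj Q'
        (Suc n))"
      using x(1) S[of "Suc n"] K(1-3)[of "Suc n"] F(1-3)[of "Suc n"] R by simp_all
    have dT: "?d \<in> Hom C (RObj Q (Suc n)) (RObj Q' n)"
      using tT kT R' by simp
    \<comment> \<open>The obstruction \<open>?d\<close> is a cycle: \<open>?t\<close> is killed by
      the invariant, and the other term is already a boundary. Exactness of \<open>Q'\<close> then
      lifts its restriction to the quotient summand.\<close>
    have "bd Q' n \<cdot> ?d = Zero C (RObj Q (Suc n)) (Cod C (bd Q' n))"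
    proof -
      have "bd Q' n \<cdot> ?d = bd Q' n \<cdot> ?t \<oplus> bd Q' n \<cdot> \<ominus> (RDif Q' n \<cdot> ?k)"
        by (rule Cmp_Add') (use tT kT B' R' in simp_all)
      also have "bd Q' n \<cdot> \<ominus> (RDif Q' n \<cdot> ?k) = \<ominus> (bd Q' n \<cdot> (RDif Q' n \<cdot> ?k))"
        by (rule Cmp_Neg) (use kT B' R' in simp_all)
      also have "bd Q' n \<cdot> (RDif Q' n \<cdot> ?k) = Zero C (RObj Q (Suc n)) (Cod C (bd Q' n))"
        using resolution_bd_cancel[OF assms(2), of ?k n] kT by (simp del: Cmp_assoc' Cmp_arr)
      finally show ?thesis using x(3) B' R by simp
    qed
    then have e0: "bd Q' n \<cdot> (?d \<cdot> s (Suc n)) = Zero C (Dom C (?d \<cdot> s (Suc n))) (Cod C (bd Q' n))"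
      by (subst Cmp_reassoc0) (use dT S[of "Suc n"] F(1-3)[of "Suc n"] B' in simp_all)
    have e: "?d \<cdot> s (Suc n) \<in> Arr C" "Dom C (?d \<cdot> s (Suc n)) = RObj T (Suc n)" "Cod C (?d \<cdot> s (Suc
        n)) = RObj Q' n"
      using dT S[of "Suc n"] F(1-3)[of "Suc n"] assms(8) by simp_all
    obtain \<beta> where b: "\<beta> \<in> Hom C (RObj T (Suc n)) (RObj Q' (Suc n))" "RDif Q' n \<cdot> \<beta> = ?d \<cdot> s (Suc
        n)"
      using resolution_lift[OF assms(2) e(1) _ e(3) e0] e(2) RT(1) by metis
    let ?y = "?k \<oplus> \<beta> \<cdot> p (Suc n)"
    have "?t \<cdot> i (Suc n) = x \<cdot> (i n \<cdot> RDif P n)"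
      using F(5)[of n] F(1-3)[of "Suc n"] x(1) R by simp
    also have "\<dots> = \<kappa> n \<cdot> RDif P n"
      by (rule Cmp_reassoc1[OF x(2)]) (use x(1) F(1-3) RP in simp_all)
    finally have ti: "?t \<cdot> i (Suc n) = RDif Q' n \<cdot> \<kappa> (Suc n)"
      unfolding K(5) .
    have y: "?y \<in> Hom C (RObj Q (Suc n)) (RObj Q' (Suc n))" "?y \<cdot> i (Suc n) = \<kappa> (Suc n)" "RDif Q' n
        \<cdot> ?y = ?t"
      using split_extend[OF assms(7)[of "Suc n"] _ _ _ ti _ b(2), where Z = "RObj Q' (Suc n)" and Y
          = "RObj Q' n"]
        b(1) S[of "Suc n"] K(1-3)[of "Suc n"] F(1-3)[of "Suc n"] R' assms(8) tT
      by simp_all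
    have "RDif Q' n \<cdot> (?y \<cdot> RDif Q (Suc n)) = x \<cdot> (RDif Q n \<cdot> RDif Q (Suc n))"
      by (rule Cmp_reassoc[OF y(3)]) (use x(1) y(1) R R' in simp_all)
    also have "\<dots> = Zero C (RObj Q (Suc (Suc n))) (RObj Q' n)"
      using resolution_dd[OF assms(1)] x(1) R by simp
    finally show "\<exists>y. (y \<in> Hom C (RObj Q (Suc n)) (RObj Q' (Suc n)) \<and> y \<cdot> i (Suc n) = \<kappa> (Suc n) \<and>
        (Suc n = 0 \<longrightarrow> RAug Q' \<cdot> y = m \<cdot> RAug Q) \<and>
        bd Q' (Suc n) \<cdot> (y \<cdot> RDif Q (Suc n)) = Zero C (RObj Q (Suc (Suc n))) (Cod C (bd Q' (Suc
            n)))) \<and>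
        RDif Q' n \<cdot> y = ?t"
      using y R' by (intro exI[of _ ?y]) simp
  qed
  then obtain \<mu> where "\<And>n. \<mu> n \<in> Hom C (RObj Q n) (RObj Q' n)" "\<And>n. \<mu> n \<cdot> i n = \<kappa> n"
    "RAug Q' \<cdot> \<mu> 0 = m \<cdot> RAug Q" "\<And>n. RDif Q' n \<cdot> \<mu> (Suc n) = \<mu> n \<cdot> RDif Q n"
    by auto
  then show thesis using that[of \<mu>] unfolding is_resolution_map_def by blast
qed

end

section \<open>The horseshoe lemma\<close>

context abelian_category
begin

text \<open>An arrow out of \<open>B\<close> is lifted separately on \<open>P\<close> and on
  \<open>Q\<close>; the decomposition of the identity of \<open>B\<close> glues the two
  lifts.\<close>

lemma projective_biproduct:
  assumes "projective C P" "projective C Q"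
    and "a \<in> Hom C P B" "b \<in> Hom C Q B" "u \<in> Hom C B P" "v \<in> Hom C B Q" "a \<cdot> u \<oplus> b \<cdot> v = Ide C B"
  shows "projective C B"
  unfolding projective_def
proof (intro conjI allI impI)
  show "B \<in> Obj C" using assms(3) by auto
  fix e f assume "epi_arr C e \<and> f \<in> Hom C B (Cod C e)"
  then have e: "epi_arr C e" "e \<in> Arr C" "f \<in> Hom C B (Cod C e)" by (auto simp: epi_arr_def)
  obtain x where x: "x \<in> Hom C P (Dom C e)" "e \<cdot> x = f \<cdot> a"
    using projective_epi_lift[of "f \<cdot> a" e] assms(1,3) e by auto
  obtain y where y: "y \<in> Hom C Q (Dom C e)" "e \<cdot> y = f \<cdot> b"
    using projective_epi_lift[of "f \<cdot> b" e] assms(2,4) e by auto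
  have "e \<cdot> (x \<cdot> u) = f \<cdot> (a \<cdot> u)"
    by (rule Cmp_reassoc[OF x(2)]) (use x(1) e assms in simp_all)
  moreover have "e \<cdot> (y \<cdot> v) = f \<cdot> (b \<cdot> v)"
    by (rule Cmp_reassoc[OF y(2)]) (use y(1) e assms in simp_all)
  ultimately have "e \<cdot> (x \<cdot> u \<oplus> y \<cdot> v) = f \<cdot> (a \<cdot> u) \<oplus> f \<cdot> (b \<cdot> v)"
    using x(1) y(1) e assms(3-6) by simp
  also have "\<dots> = f \<cdot> (a \<cdot> u \<oplus> b \<cdot> v)"
    using e(3) assms(3-6) by simp
  also have "\<dots> = f" unfolding assms(7) using e(3) by simp
  finally have "x \<cdot> u \<oplus> y \<cdot> v \<in> Hom C B (Dom C e) \<and> e \<cdot> (x \<cdot> u \<oplus> y \<cdot> v) = f"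
    using x(1) y(1) assms(5,6) by simp
  then show "\<exists>h \<in> Hom C B (Dom C e). e \<cdot> h = f" by blast
qed

text \<open>Exactness of the middle row of the horseshoe at one spot; \<open>f\<close> and \<open>g\<close> are the
  maps of the short exact sequence one step to the right.\<close>

lemma horseshoe_exact:
  assumes "mono_arr C f" "f \<in> Hom C A X" "g \<in> Hom C X B" "g \<cdot> f = Zero C A B"
    and "x1 \<in> Hom C P1 A" "y1 \<in> Hom C Q1 B" "x2 \<in> Hom C P2 P1" "y2 \<in> Hom C Q2 Q1"
    and "exact_at C x2 x1" "exact_at C y2 y1"
    and "a1 \<in> Hom C P1 R1" "b1 \<in> Hom C Q1 R1" "u1 \<in> Hom C R1 P1" "v1 \<in> Hom C R1 Q1"
    and "u1 \<cdot> a1 = Ide C P1" "v1 \<cdot> a1 = Zero C P1 Q1" "a1 \<cdot> u1 \<oplus> b1 \<cdot> v1 = Ide C R1"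
    and "a2 \<in> Hom C P2 R2" "b2 \<in> Hom C Q2 R2" "u2 \<in> Hom C R2 P2" "v2 \<in> Hom C R2 Q2"
    and "u2 \<cdot> a2 = Ide C P2" "v2 \<cdot> b2 = Ide C Q2" "u2 \<cdot> b2 = Zero C Q2 P2" "v2 \<cdot> a2 = Zero C P2 Q2"
    and "\<sigma> \<in> Hom C Q1 X" "g \<cdot> \<sigma> = y1" "\<tau> \<in> Hom C Q2 R1" "v1 \<cdot> \<tau> = y2"
    and "(f \<cdot> (x1 \<cdot> u1) \<oplus> \<sigma> \<cdot> v1) \<cdot> \<tau> = Zero C Q2 X"
  shows "exact_at C (a1 \<cdot> (x2 \<cdot> u2) \<oplus> \<tau> \<cdot> v2) (f \<cdot> (x1 \<cdot> u1) \<oplus> \<sigma> \<cdot> v1)"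
    (is "exact_at C ?d ?e")
proof (rule exact_atI)
  note T = assms(2,3,5-8,11-14,18-21,26,28)
  have o: "P1 \<in> Obj C" "Q1 \<in> Obj C" "P2 \<in> Obj C" "Q2 \<in> Obj C" "X \<in> Obj C" "B \<in> Obj C" "A \<in> Obj C"
      "R1 \<in> Obj C" "R2 \<in> Obj C"
    using T by auto
  have d: "?d \<in> Hom C R2 R1" and e: "?e \<in> Hom C R1 X" using T by simp_all
  show "?d \<in> Arr C" "?e \<in> Arr C" "Cod C ?d = Dom C ?e" using d e by simp_all
  have xx: "x1 \<cdot> x2 = Zero C P2 A" using exact_comp[OF assms(9)] T by simp
  have ea: "?e \<cdot> a1 = f \<cdot> x1" using T assms(15,16) o by simp
  have "?e \<cdot> ?d = ?e \<cdot> (a1 \<cdot> (x2 \<cdot> u2)) \<oplus> ?e \<cdot> (\<tau> \<cdot> v2)"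
    by (rule Cmp_Add') (use T in simp_all)
  also have "?e \<cdot> (a1 \<cdot> (x2 \<cdot> u2)) = f \<cdot> x1 \<cdot> (x2 \<cdot> u2)"
    by (rule Cmp_reassoc1[OF ea]) (use T in simp_all)
  also have "\<dots> = f \<cdot> (x1 \<cdot> x2 \<cdot> u2)"
    using T by simp
  also have "\<dots> = Zero C R2 X" unfolding xx using T o by simp
  also have "?e \<cdot> (\<tau> \<cdot> v2) = Zero C R2 X"
    by (subst Cmp_reassoc0[OF assms(30)]) (use T in simp_all)
  finally show "?e \<cdot> ?d = Zero C (Dom C ?d) (Cod C ?e)" using d e o by simp
  fix y assume y: "y \<in> Arr C" "Cod C y = Dom C ?e" "?e \<cdot> y = Zero C (Dom C y) (Cod C ?e)"
  then have y: "y \<in> Arr C" "Cod C y = R1" "?e \<cdot> y = Zero C (Dom C y) X" using e by simp_all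
  have yo: "Dom C y \<in> Obj C" using y by simp
  \<comment> \<open>Apply \<open>g\<close> to the condition that \<open>y\<close> is killed: the
    \<open>f\<close> part disappears and the \<open>\<sigma>\<close> part becomes \<open>y1\<close>.
    So the quotient component of \<open>y\<close> is a cycle of the quotient row and lifts to some
    \<open>w\<close> over a cover.\<close>
  have "y1 \<cdot> (v1 \<cdot> y) = Zero C (Dom C y) B"
  proof -
    have "g \<cdot> (?e \<cdot> y) = Zero C (Dom C y) B" unfolding y(3) using T yo by simp
    moreover have "g \<cdot> (f \<cdot> z) = Zero C (Dom C z) B" if "z \<in> Arr C" "Cod C z = A" for z
      by (rule Cmp_reassoc0[OF assms(4)]) (use that T in simp_all)
    moreover have "g \<cdot> (\<sigma> \<cdot> z) = y1 \<cdot> z" if "z \<in> Arr C" "Cod C z = Q1" for z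
      by (rule Cmp_reassoc1[OF assms(27)]) (use that T in simp_all)
    ultimately show ?thesis using T y(1,2) by simp
  qed
  then obtain V e1 w where w: "e1 \<in> Hom C V (Dom C y)" "epi_arr C e1" "w \<in> Hom C V Q2" "y2 \<cdot> w = v1
      \<cdot> y \<cdot> e1"
    using exact_lift[OF assms(10), of "v1 \<cdot> y"] T y(1,2) by auto
  have V: "V \<in> Obj C" using w by auto
  \<comment> \<open>Subtracting \<open>\<tau> \<cdot> w\<close> removes the quotient component. What
    is left lives in the sub row, where monicity of \<open>f\<close> turns it into a cycle of that
    row.\<close>
  let ?y = "y \<cdot> e1 \<oplus> \<ominus> (\<tau> \<cdot> w)"
  have yT: "?y \<in> Hom C V R1" using w y(1,2) T by simp
  have "v1 \<cdot> (\<tau> \<cdot> w) = y2 \<cdot> w"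
    by (rule Cmp_reassoc1[OF assms(29)]) (use T w in simp_all)
  then have v1y: "v1 \<cdot> ?y = Zero C V Q1"
    using w y(1,2) T V by simp
  have "?e \<cdot> (\<tau> \<cdot> w) = Zero C V X"
    by (subst Cmp_reassoc0[OF assms(30)]) (use T w in simp_all)
  moreover have "?e \<cdot> (y \<cdot> e1) = Zero C V X"
    by (subst Cmp_reassoc0[OF y(3)]) (use T w y(1,2) in simp_all)
  moreover have "?e \<cdot> ?y = ?e \<cdot> (y \<cdot> e1) \<oplus> \<ominus> (?e \<cdot> (\<tau> \<cdot> w))"
    using Cmp_Add'[of "y \<cdot> e1" "\<ominus> (\<tau> \<cdot> w)" ?e] Cmp_Neg[of "\<tau> \<cdot> w" ?e] w(1,3) y(1,2) T by simp
  ultimately have "?e \<cdot> ?y = Zero C V X" using V o by simp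
  moreover have "?e \<cdot> ?y = f \<cdot> (x1 \<cdot> u1) \<cdot> ?y \<oplus> \<sigma> \<cdot> v1 \<cdot> ?y"
    by (rule Add_Cmp') (use T yT in simp_all)
  moreover have "\<sigma> \<cdot> v1 \<cdot> ?y = \<sigma> \<cdot> (v1 \<cdot> ?y)" by (rule Cmp_assoc') (use T yT in simp_all)
  moreover have "f \<cdot> (x1 \<cdot> u1) \<cdot> ?y = f \<cdot> (x1 \<cdot> (u1 \<cdot> ?y))"
    using Cmp_assoc'[of ?y "x1 \<cdot> u1" f] Cmp_assoc'[of ?y u1 x1] T yT by simp
  ultimately have "f \<cdot> (x1 \<cdot> (u1 \<cdot> ?y)) \<oplus> \<sigma> \<cdot> (v1 \<cdot> ?y) = Zero C V X" by simp
  then have "f \<cdot> (x1 \<cdot> (u1 \<cdot> ?y)) = Zero C V (Cod C f)"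
    unfolding v1y using T V yT o Cmp_arr[of ?y u1] by simp
  then have "x1 \<cdot> (u1 \<cdot> ?y) = Zero C V (Dom C f)"
    by (intro mono_zero[OF assms(1), of "x1 \<cdot> (u1 \<cdot> ?y)"]) (use T yT Cmp_arr[of ?y u1] in simp_all)
  then have x0: "x1 \<cdot> (u1 \<cdot> ?y) = Zero C (Dom C (u1 \<cdot> ?y)) (Cod C x1)"
    using T yT Cmp_arr[of ?y u1] by simp
  have uy: "u1 \<cdot> ?y \<in> Arr C" "Dom C (u1 \<cdot> ?y) = V" "Cod C (u1 \<cdot> ?y) = P1"
    using T yT Cmp_arr[of ?y u1] by simp_all
  obtain V' e2 t where t: "e2 \<in> Hom C V' V" "epi_arr C e2" "t \<in> Hom C V' P2" "x2 \<cdot> t = u1 \<cdot> ?y \<cdot> e2"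
    using exact_lift[OF assms(9) uy(1) _ x0] uy T by auto
  \<comment> \<open>The preimage is assembled from the lifts in the two rows, both pulled back to
    the common cover.\<close>
  let ?x = "a2 \<cdot> t \<oplus> b2 \<cdot> (w \<cdot> e2)"
  have xT: "?x \<in> Hom C V' R2" using t w T by simp
  have V': "V' \<in> Obj C" using t by auto
  have u2x: "u2 \<cdot> ?x = t"
    using Cmp_reassoc1[OF assms(22), of t] Cmp_reassoc1[OF assms(24), of "w \<cdot> e2"] t w T o V' by
        simp
  have v2x: "v2 \<cdot> ?x = w \<cdot> e2"
    using Cmp_reassoc1[OF assms(25), of t] Cmp_reassoc1[OF assms(23), of "w \<cdot> e2"] t w T o V' by
        simp
  have dx: "?d \<cdot> ?x = a1 \<cdot> (x2 \<cdot> (u2 \<cdot> ?x)) \<oplus> \<tau> \<cdot> (v2 \<cdot> ?x)"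
    using Add_Cmp'[of ?x "a1 \<cdot> (x2 \<cdot> u2)" "\<tau> \<cdot> v2"] Cmp_assoc'[of ?x "x2 \<cdot> u2" a1] Cmp_assoc'[of ?x
        u2 x2]
      Cmp_assoc'[of ?x v2 \<tau>] T xT by simp
  have "a1 \<cdot> (u1 \<cdot> ?y) = (a1 \<cdot> u1 \<oplus> b1 \<cdot> v1) \<cdot> ?y"
  proof -
    have "(a1 \<cdot> u1 \<oplus> b1 \<cdot> v1) \<cdot> ?y = a1 \<cdot> (u1 \<cdot> ?y) \<oplus> b1 \<cdot> (v1 \<cdot> ?y)"
      using Add_Cmp'[of ?y "a1 \<cdot> u1" "b1 \<cdot> v1"] Cmp_assoc'[of ?y u1 a1] Cmp_assoc'[of ?y v1 b1] T yT
          by simp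
    then show ?thesis unfolding v1y using T V uy by simp
  qed
  then have auy: "a1 \<cdot> (u1 \<cdot> ?y) = ?y" unfolding assms(17) using yT by simp
  have "a1 \<cdot> (u1 \<cdot> ?y \<cdot> e2) = ?y \<cdot> e2"
    using Cmp_reassoc1[OF auy, of e2] uy yT t(1) T by simp
  then have "?d \<cdot> ?x = ?y \<cdot> e2 \<oplus> \<tau> \<cdot> (w \<cdot> e2)"
    unfolding dx u2x v2x t(4) by simp
  also have "?y \<cdot> e2 = y \<cdot> (e1 \<cdot> e2) \<oplus> \<ominus> (\<tau> \<cdot> (w \<cdot> e2))"
    using w(1,3) y(1,2) T t(1) by simp
  also have "\<dots> \<oplus> \<tau> \<cdot> (w \<cdot> e2) = y \<cdot> (e1 \<cdot> e2)"
    using w(1,3) y(1,2) T t(1) by simp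
  finally have "?d \<cdot> ?x = y \<cdot> (e1 \<cdot> e2)" .
  moreover have "epi_arr C (e1 \<cdot> e2)" by (rule epi_arr_Cmp[OF t(2) w(2)]) (use t w in simp)
  moreover have "?x \<in> Hom C V' (Dom C ?d)" using xT d by simp
  moreover have "e1 \<cdot> e2 \<in> Hom C V' (Dom C y)" using w t by simp
  ultimately show "\<exists>V e x. e \<in> Hom C V (Dom C y) \<and> epi_arr C e \<and> x \<in> Hom C V (Dom C ?d) \<and> ?d \<cdot> x = y
      \<cdot> e"
    by blast
qed

text \<open>An arrow \<open>h\<close> that kills the augmentation kills \<open>f \<cdot> x\<close>,
  hence \<open>f\<close>, and also \<open>\<sigma>\<close>. It therefore factors through
  \<open>g\<close> by some \<open>t\<close> with
  \<open>t \<cdot> y = h \<cdot> \<sigma> = 0\<close>, and \<open>y\<close> is epi.\<close>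

lemma horseshoe_epi:
  assumes "short_exact C f g" "f \<in> Hom C L M" "g \<in> Hom C M N"
    and "epi_arr C x" "x \<in> Hom C P L" "epi_arr C y" "y \<in> Hom C Q N" "\<sigma> \<in> Hom C Q M" "g \<cdot> \<sigma> = y"
    and "a \<in> Hom C P R" "b \<in> Hom C Q R" "u \<in> Hom C R P" "v \<in> Hom C R Q"
    and "u \<cdot> a = Ide C P" "v \<cdot> b = Ide C Q" "u \<cdot> b = Zero C Q P" "v \<cdot> a = Zero C P Q"
  shows "epi_arr C (f \<cdot> (x \<cdot> u) \<oplus> \<sigma> \<cdot> v)" (is "epi_arr C ?e")
proof (rule epi_arrI)
  note T = assms(2,3,5,7,8,10-13)
  have ex: "exact_at C f g" and g: "epi_arr C g" using assms(1) by (auto simp: short_exact_def)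
  have o: "P \<in> Obj C" "Q \<in> Obj C" "M \<in> Obj C" "L \<in> Obj C" "N \<in> Obj C" using T by auto
  have e: "?e \<in> Hom C R M" using T by simp
  then show "?e \<in> Arr C" by simp
  have ea: "?e \<cdot> a = f \<cdot> x" and eb: "?e \<cdot> b = \<sigma>" using T assms(14-17) o by simp_all
  fix h assume h0: "h \<in> Arr C" "Dom C h = Cod C ?e" "h \<cdot> ?e = Zero C (Dom C ?e) (Cod C h)"
  have h: "h \<in> Arr C" "Dom C h = M" "h \<cdot> ?e = Zero C R (Cod C h)" using h0 e by simp_all
  have "h \<cdot> (f \<cdot> x) = Zero C P (Cod C h)"
    using Cmp_reassoc1[OF h(3), of a] h(1,2) T unfolding ea by simp
  then have hf: "h \<cdot> f = Zero C L (Cod C h)"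
    using epi_zero[OF assms(4), of "h \<cdot> f"] h(1,2) T by simp
  have hs: "h \<cdot> \<sigma> = Zero C Q (Cod C h)"
    using Cmp_reassoc1[OF h(3), of b] h(1,2) T unfolding eb by simp
  obtain t where t: "t \<in> Hom C N (Cod C h)" "t \<cdot> g = h"
  proof (rule epi_factor[OF g h(1)])
    fix z assume z: "z \<in> Arr C" "Cod C z = Dom C g" "g \<cdot> z = Zero C (Dom C z) (Cod C g)"
    obtain V e x where x: "e \<in> Hom C V (Dom C z)" "epi_arr C e" "x \<in> Hom C V (Dom C f)" "f \<cdot> x = z \<cdot>
        e"
      using exact_lift[OF ex z] by blast
    have "h \<cdot> (f \<cdot> x) = Zero C V (Cod C h)"
      using Cmp_reassoc1[OF hf, of x] x(3) h(1,2) T by simp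
    then have "h \<cdot> z \<cdot> e = Zero C V (Cod C h)"
      using x(1,4) z(1,2) h(1,2) T by simp
    then show "h \<cdot> z = Zero C (Dom C z) (Cod C h)"
      using epi_zero[OF x(2), of "h \<cdot> z"] x(1) z(1,2) h(1,2) T by simp
  qed (use T h(2) in auto)
  have "t \<cdot> y = h \<cdot> \<sigma>"
    using Cmp_reassoc1[OF t(2), of \<sigma>] t(1) T assms(9) by simp
  then have "t = Zero C N (Cod C h)"
    using epi_zero[OF assms(6), of t] t(1) hs T by simp
  then have "h = Zero C M (Cod C h)"
    using t o T h(1) by (metis Cod_Obj Zero_Cmp Hom_iff)
  then show "h = Zero C (Cod C ?e) (Cod C h)" using e by simp
qed

text \<open>The middle terms are biproducts and the differential is a triangular matrix with the
  given differentials on the diagonal. All the work lies in the off-diagonal entries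
  \<open>\<theta> n\<close>, which must make the square of the differential vanish.\<close>

lemma horseshoe_exists:
  assumes "short_exact C f g" "f \<in> Hom C L M" "g \<in> Hom C M N"
    and "is_proj_resolution C L P" "is_proj_resolution C N Q"
  shows "\<exists>R i p. is_proj_resolution C M R \<and> is_resolution_map C P R f i \<and> is_resolution_map C R Q g
      p \<and>
     (\<forall>n. short_exact C (i n) (p n))"
proof -
  note RP = resolutionD[OF assms(4)] and RQ = resolutionD[OF assms(5)]
  have ex: "exact_at C f g" and g: "epi_arr C g" and f: "mono_arr C f" using assms(1) by (auto simp:
      short_exact_def)
  have gf: "g \<cdot> f = Zero C L N" using exact_comp[OF ex] assms(2,3) by simp
  have o: "L \<in> Obj C" "M \<in> Obj C" "N \<in> Obj C" using assms(2,3) by auto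
  \<comment> \<open>The component of the middle augmentation on the quotient summand.\<close>
  obtain \<sigma> where s: "\<sigma> \<in> Hom C (RObj Q 0) M" "g \<cdot> \<sigma> = RAug Q"
    using projective_epi_lift[of "RAug Q" g] g RQ assms(3) by auto
  have sd: "\<sigma> \<cdot> RDif Q 0 \<in> Arr C" "Dom C (\<sigma> \<cdot> RDif Q 0) = RObj Q (Suc 0)" "Cod C (\<sigma> \<cdot> RDif Q 0) =
      Dom C g"
    using s RQ assms(3) by simp_all
  have "g \<cdot> (\<sigma> \<cdot> RDif Q 0) = RAug Q \<cdot> RDif Q 0"
    by (rule Cmp_reassoc1[OF s(2)]) (use s(1) RQ assms(3) in simp_all)
  then have gsd: "g \<cdot> (\<sigma> \<cdot> RDif Q 0) = Zero C (Dom C (\<sigma> \<cdot> RDif Q 0)) (Cod C g)"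
    using resolution_bd(3)[OF assms(5), of 0] RQ assms(3) sd by simp
  \<comment> \<open>\<open>\<sigma> \<cdot> RDif Q 0\<close> is killed by \<open>g\<close>, so it
    comes from \<open>L\<close>. The resulting \<open>\<tau>\<close> is the failure of the
    augmentation to vanish on boundaries from the quotient row.\<close>
  obtain \<tau> where t: "\<tau> \<in> Hom C (RObj Q (Suc 0)) L" "f \<cdot> \<tau> = \<sigma> \<cdot> RDif Q 0"
    using projective_exact_lift[OF ex _ sd(1,3) gsd] sd(2) RQ(1) assms(2) by auto
  \<comment> \<open>The sign makes the entry \<open>\<theta>0\<close> cancel that failure: the
    augmentation sends it to \<open>- f \<cdot> \<tau>\<close>, the opposite of
    \<open>\<sigma> \<cdot> RDif Q 0\<close>.\<close>
  obtain \<theta>0 where th0: "\<theta>0 \<in> Hom C (RObj Q (Suc 0)) (RObj P 0)" "RAug P \<cdot> \<theta>0 = \<ominus> \<tau>"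
    using projective_epi_lift[of "\<ominus> \<tau>" "RAug P"] t RP RQ(1) by auto
  \<comment> \<open>The off-diagonal entry of the squared differential is
    \<open>RDif P n \<cdot> \<theta> (Suc n)\<close> plus
    \<open>\<theta> n \<cdot> RDif Q (Suc n)\<close>. Its vanishing is the recursion, and the
    condition on \<open>bd P n\<close> is what allows the next lift.\<close>
  have "\<exists>\<theta>. \<forall>n. (\<theta> n \<in> Hom C (RObj Q (Suc n)) (RObj P n) \<and> (n = 0 \<longrightarrow> RAug P \<cdot> \<theta> n = \<ominus> \<tau>) \<and>
      bd P n \<cdot> (\<theta> n \<cdot> RDif Q (Suc n)) = Zero C (RObj Q (Suc (Suc n))) (Cod C (bd P n))) \<and>
    RDif P n \<cdot> \<theta> (Suc n) \<oplus> \<theta> n \<cdot> RDif Q (Suc n) = Zero C (RObj Q (Suc (Suc n))) (RObj P n)"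
  proof (rule dependent_nat_choice)
    have "f \<cdot> (\<tau> \<cdot> RDif Q (Suc 0)) = \<sigma> \<cdot> (RDif Q 0 \<cdot> RDif Q (Suc 0))"
      by (rule Cmp_reassoc[OF t(2)]) (use s(1) t(1) RQ assms(2) in simp_all)
    also have "\<dots> = Zero C (RObj Q (Suc (Suc 0))) (Cod C f)"
      using resolution_dd[OF assms(5)] s(1) RQ assms(2) by simp
    finally have td: "\<tau> \<cdot> RDif Q (Suc 0) = Zero C (RObj Q (Suc (Suc 0))) (Dom C f)"
      by (rule mono_zero[OF f, rotated -1]) (use t(1) RQ assms(2) in simp_all)
    have "RAug P \<cdot> (\<theta>0 \<cdot> RDif Q (Suc 0)) = \<ominus> \<tau> \<cdot> RDif Q (Suc 0)"
      by (rule Cmp_reassoc1[OF th0(2)]) (use th0(1) RP RQ in simp_all)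
    also have "\<dots> = Zero C (RObj Q (Suc (Suc 0))) L"
      using td t(1) RQ assms(2) o by simp
    finally show "\<exists>x. x \<in> Hom C (RObj Q (Suc 0)) (RObj P 0) \<and> ((0::nat) = 0 \<longrightarrow> RAug P \<cdot> x = \<ominus> \<tau>) \<and>
      bd P 0 \<cdot> (x \<cdot> RDif Q (Suc 0)) = Zero C (RObj Q (Suc (Suc 0))) (Cod C (bd P 0))"
      using th0 RP by (intro exI[of _ \<theta>0]) simp
    fix x n assume "x \<in> Hom C (RObj Q (Suc n)) (RObj P n) \<and> (n = 0 \<longrightarrow> RAug P \<cdot> x = \<ominus> \<tau>) \<and>
      bd P n \<cdot> (x \<cdot> RDif Q (Suc n)) = Zero C (RObj Q (Suc (Suc n))) (Cod C (bd P n))"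
    then have x: "x \<in> Hom C (RObj Q (Suc n)) (RObj P n)"
      "bd P n \<cdot> (x \<cdot> RDif Q (Suc n)) = Zero C (RObj Q (Suc (Suc n))) (Cod C (bd P n))" by auto
    let ?e = "\<ominus> (x \<cdot> RDif Q (Suc n))"
    have e: "?e \<in> Arr C" "Dom C ?e = RObj Q (Suc (Suc n))" "Cod C ?e = RObj P n"
      using x(1) RQ by simp_all
    have e0: "bd P n \<cdot> ?e = Zero C (Dom C ?e) (Cod C (bd P n))"
      using x RQ resolution_bd[OF assms(4)] by simp
    obtain y where y: "y \<in> Hom C (RObj Q (Suc (Suc n))) (RObj P (Suc n))" "RDif P n \<cdot> y = ?e"
      using resolution_lift[OF assms(4) e(1) _ e(3) e0] e(2) RQ(1) by metis
    have "RDif P n \<cdot> (y \<cdot> RDif Q (Suc (Suc n))) = ?e \<cdot> RDif Q (Suc (Suc n))"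
      by (rule Cmp_reassoc1[OF y(2)]) (use y(1) RP RQ in simp_all)
    also have "\<dots> = Zero C (RObj Q (Suc (Suc (Suc n)))) (RObj P n)"
      using x(1) RQ RP resolution_dd[OF assms(5), of "Suc n"] by simp
    finally show "\<exists>y. (y \<in> Hom C (RObj Q (Suc (Suc n))) (RObj P (Suc n)) \<and> (Suc n = 0 \<longrightarrow> RAug P \<cdot> y =
        \<ominus> \<tau>) \<and>
        bd P (Suc n) \<cdot> (y \<cdot> RDif Q (Suc (Suc n))) = Zero C (RObj Q (Suc (Suc (Suc n)))) (Cod C (bd P
            (Suc n)))) \<and>
        RDif P n \<cdot> y \<oplus> x \<cdot> RDif Q (Suc n) = Zero C (RObj Q (Suc (Suc n))) (RObj P n)"
      using y x(1) RP RQ by (intro exI[of _ y]) simp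
  qed
  then obtain \<theta> where th: "\<And>n. \<theta> n \<in> Hom C (RObj Q (Suc n)) (RObj P n)" "RAug P \<cdot> \<theta> 0 = \<ominus> \<tau>"
    "\<And>n. RDif P n \<cdot> \<theta> (Suc n) \<oplus> \<theta> n \<cdot> RDif Q (Suc n) = Zero C (RObj Q (Suc (Suc n))) (RObj P n)"
    by blast
  have "\<forall>n. \<exists>B i j p q. B \<in> Obj C \<and> i \<in> Hom C (RObj P n) B \<and> j \<in> Hom C (RObj Q n) B \<and>
    p \<in> Hom C B (RObj P n) \<and> q \<in> Hom C B (RObj Q n) \<and> p \<cdot> i = Ide C (RObj P n) \<and> q \<cdot> j = Ide C (RObj
        Q n) \<and>
    p \<cdot> j = Zero C (RObj Q n) (RObj P n) \<and> q \<cdot> i = Zero C (RObj P n) (RObj Q n) \<and> i \<cdot> p \<oplus> j \<cdot> q =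
        Ide C B"
    using biproduct_binary[OF RP(2) RQ(2)] by metis
  then obtain B a b u v where B: "\<And>n. B n \<in> Obj C" and aT: "\<And>n. a n \<in> Hom C (RObj P n) (B n)"
    and bT: "\<And>n. b n \<in> Hom C (RObj Q n) (B n)" and uT: "\<And>n. u n \<in> Hom C (B n) (RObj P n)"
    and vT: "\<And>n. v n \<in> Hom C (B n) (RObj Q n)" and ua: "\<And>n. u n \<cdot> a n = Ide C (RObj P n)"
    and vb: "\<And>n. v n \<cdot> b n = Ide C (RObj Q n)" and ub: "\<And>n. u n \<cdot> b n = Zero C (RObj Q n) (RObj P
        n)"
    and va: "\<And>n. v n \<cdot> a n = Zero C (RObj P n) (RObj Q n)" and sum: "\<And>n. a n \<cdot> u n \<oplus> b n \<cdot> v n = Ide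
        C (B n)"
    by metis
  \<comment> \<open>The column of the differential that belongs to the quotient summand; the other
    column is \<open>a n \<cdot> RDif P n\<close>.\<close>
  define \<rho> where "\<rho> n = a n \<cdot> \<theta> n \<oplus> b n \<cdot> RDif Q n" for n
  note T = aT bT uT vT th(1) B
  have rT: "\<rho> n \<in> Hom C (RObj Q (Suc n)) (B n)" for n
    unfolding \<rho>_def using T RQ by simp
  have vr: "v n \<cdot> \<rho> n = RDif Q n" and ur: "u n \<cdot> \<rho> n = \<theta> n" for n
  proof -
    have "v n \<cdot> (a n \<cdot> \<theta> n) = Zero C (RObj Q (Suc n)) (RObj Q n)" "u n \<cdot> (a n \<cdot> \<theta> n) = \<theta> n"
      "v n \<cdot> (b n \<cdot> RDif Q n) = RDif Q n" "u n \<cdot> (b n \<cdot> RDif Q n) = Zero C (RObj Q (Suc n)) (RObj P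
          n)"
      using Cmp_reassoc1[OF va[of n], of "\<theta> n"] Cmp_reassoc1[OF ua[of n], of "\<theta> n"]
        Cmp_reassoc1[OF vb[of n], of "RDif Q n"] Cmp_reassoc1[OF ub[of n], of "RDif Q n"] T RP RQ by
            simp_all
    then show "v n \<cdot> \<rho> n = RDif Q n" "u n \<cdot> \<rho> n = \<theta> n"
      unfolding \<rho>_def using T RP RQ by simp_all
  qed
  let ?R = "\<lparr>RObj = B, RDif = (\<lambda>n. a n \<cdot> (RDif P n \<cdot> u (Suc n)) \<oplus> \<rho> n \<cdot> v (Suc n)),
     RAug = f \<cdot> (RAug P \<cdot> u 0) \<oplus> \<sigma> \<cdot> v 0\<rparr>"
  have split: "split_exact (a n) (v n) (u n) (b n)" for n
    unfolding split_exact_def using T ua vb va sum by simp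
  have monoa: "mono_arr C (a n)" for n by (rule split_exact_mono[OF split])
  have epiQ: "epi_arr C (RAug Q)" and epiP: "epi_arr C (RAug P)" by (fact RQ(9) RP(9))+
  have e0: "exact_at C (RDif ?R 0) (RAug ?R)"
  proof -
    have "(f \<cdot> (RAug P \<cdot> u 0) \<oplus> \<sigma> \<cdot> v 0) \<cdot> \<rho> 0 = f \<cdot> (RAug P \<cdot> (u 0 \<cdot> \<rho> 0)) \<oplus> \<sigma> \<cdot> (v 0 \<cdot> \<rho> 0)"
      using s(1) T rT RP assms(2) by simp
    also have "\<dots> = \<ominus> (f \<cdot> \<tau>) \<oplus> \<sigma> \<cdot> RDif Q 0"
      unfolding vr ur th(2) using t(1) assms(2) by simp
    also have "\<dots> = Zero C (RObj Q (Suc 0)) M"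
      unfolding t(2) using s(1) RQ by simp
    finally have z: "(f \<cdot> (RAug P \<cdot> u 0) \<oplus> \<sigma> \<cdot> v 0) \<cdot> \<rho> 0 = Zero C (RObj Q (Suc 0)) M" .
    have ex1: "exact_at C (RDif P 0) (RAug P)" "exact_at C (RDif Q 0) (RAug Q)"
      using assms(4,5) by (auto simp: is_proj_resolution_def)
    show ?thesis
      by simp (rule horseshoe_exact[OF f assms(2,3) gf _ _ _ _ ex1 aT bT uT vT ua va sum aT bT uT vT
          ua vb ub va s rT vr z];
        use RP RQ in simp)
  qed
  have eS: "exact_at C (RDif ?R (Suc n)) (RDif ?R n)" for n
  proof -
    have "(a n \<cdot> (RDif P n \<cdot> u (Suc n)) \<oplus> \<rho> n \<cdot> v (Suc n)) \<cdot> \<rho> (Suc n) =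
        a n \<cdot> (RDif P n \<cdot> (u (Suc n) \<cdot> \<rho> (Suc n))) \<oplus> \<rho> n \<cdot> (v (Suc n) \<cdot> \<rho> (Suc n))"
      using T rT RP by simp
    also have "\<dots> = a n \<cdot> (RDif P n \<cdot> \<theta> (Suc n)) \<oplus> (a n \<cdot> (\<theta> n \<cdot> RDif Q (Suc n)) \<oplus> b n \<cdot> (RDif Q n \<cdot>
        RDif Q (Suc n)))"
      unfolding vr ur unfolding \<rho>_def using T RP RQ by simp
    also have "\<dots> = a n \<cdot> (RDif P n \<cdot> \<theta> (Suc n) \<oplus> \<theta> n \<cdot> RDif Q (Suc n))"
      using T RP RQ resolution_dd[OF assms(5), of n] by simp
    also have "\<dots> = Zero C (RObj Q (Suc (Suc n))) (B n)"
      unfolding th(3) using T RQ by simp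
    finally have z: "(a n \<cdot> (RDif P n \<cdot> u (Suc n)) \<oplus> \<rho> n \<cdot> v (Suc n)) \<cdot> \<rho> (Suc n) = Zero C (RObj Q
        (Suc (Suc n))) (B n)" .
    have ex1: "exact_at C (RDif P (Suc n)) (RDif P n)" "exact_at C (RDif Q (Suc n)) (RDif Q n)"
      using assms(4,5) by (auto simp: is_proj_resolution_def)
    show ?thesis
      by simp (rule horseshoe_exact[OF monoa aT vT va _ _ _ _ ex1 aT bT uT vT ua va sum aT bT uT vT
          ua vb ub va rT vr rT vr z];
        use RP RQ in simp)
  qed
  have "is_proj_resolution C M ?R"
    unfolding is_proj_resolution_def
  proof (intro conjI allI e0 eS)
    show "projective C (RObj ?R n)" for n
      using projective_biproduct[OF RP(1) RQ(1) aT bT uT vT sum] by simp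
    show "RDif ?R n \<in> Hom C (RObj ?R (Suc n)) (RObj ?R n)" for n
      using T rT RP by simp
    show "RAug ?R \<in> Hom C (RObj ?R 0) M"
      using T s RP assms(2) by simp
    show "epi_arr C (RAug ?R)"
      by simp (rule horseshoe_epi[OF assms(1-3) epiP _ epiQ _ s aT bT uT vT ua vb ub va]; use RP RQ
          in simp)
  qed
  moreover have "is_resolution_map C P ?R f a"
    unfolding is_resolution_map_def
  proof (intro conjI allI)
    show "RAug ?R \<cdot> a 0 = f \<cdot> RAug P"
      using T s(1) RP RQ ua va assms(2) o by simp
    show "RDif ?R n \<cdot> a (Suc n) = a n \<cdot> RDif P n" for n
      using T rT RP RQ ua va by simp
  qed (use T in simp)
  moreover have "is_resolution_map C ?R Q g v"
    unfolding is_resolution_map_def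
  proof (intro conjI allI)
    have "g \<cdot> (f \<cdot> z) = Zero C (Dom C z) N" if "z \<in> Arr C" "Cod C z = L" for z
      by (rule Cmp_reassoc0[OF gf]) (use that assms(2,3) in simp_all)
    moreover have "g \<cdot> (\<sigma> \<cdot> z) = RAug Q \<cdot> z" if "z \<in> Arr C" "Cod C z = RObj Q 0" for z
      by (rule Cmp_reassoc1[OF s(2)]) (use that s(1) assms(3) in simp_all)
    ultimately show "RAug Q \<cdot> v 0 = g \<cdot> RAug ?R"
      using T s(1) RP RQ assms(2,3) by simp
    fix n
    have "v n \<cdot> (a n \<cdot> z) = Zero C (Dom C z) (RObj Q n)" if "z \<in> Arr C" "Cod C z = RObj P n" for z
      by (rule Cmp_reassoc0[OF va]) (use that T in simp_all)
    moreover have "v n \<cdot> (\<rho> n \<cdot> z) = RDif Q n \<cdot> z" if "z \<in> Arr C" "Cod C z = RObj Q (Suc n)" for z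
      by (rule Cmp_reassoc1[OF vr]) (use that T rT in simp_all)
    ultimately show "RDif Q n \<cdot> v (Suc n) = v n \<cdot> RDif ?R n"
      using T rT RP RQ by simp
  qed (use T in simp)
  moreover have "\<forall>n. short_exact C (a n) (v n)"
    using split_exact_short_exact[OF split] by blast
  ultimately show ?thesis by blast
qed

lemma horseshoe:
  assumes "short_exact C f g" "enough_projectives C" "horseshoe C f g = (R, i, p)"
  shows "is_proj_resolution C (Cod C f) R" "is_resolution_map C (res C (Dom C f)) R f i"
    "is_resolution_map C R (res C (Cod C g)) g p" "short_exact C (i n) (p n)"
proof -
  have T: "f \<in> Hom C (Dom C f) (Cod C f)" "g \<in> Hom C (Cod C f) (Cod C g)"
    using assms(1) exact_atD[of C f g] by (auto simp: short_exact_def)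
  let ?P = "\<lambda>(P, i, p). is_proj_resolution C (Cod C f) P \<and> is_resolution_map C (res C (Dom C f)) P f
      i \<and>
     is_resolution_map C P (res C (Cod C g)) g p \<and> (\<forall>n. short_exact C (i n) (p n))"
  have "\<exists>x. ?P x"
    using horseshoe_exists[OF assms(1) T resolution_exists[OF assms(2)] resolution_exists[OF
        assms(2)]] T
    by (auto simp: split_paired_Ex)
  then have "?P (horseshoe C f g)"
    unfolding horseshoe_def by (rule someI_ex)
  then show "is_proj_resolution C (Cod C f) R" "is_resolution_map C (res C (Dom C f)) R f i"
    "is_resolution_map C R (res C (Cod C g)) g p" "short_exact C (i n) (p n)"
    using assms(3) by simp_all
qed

lemma res_map:
  assumes "enough_projectives C" "f \<in> Arr C"
  shows "is_resolution_map C (res C (Dom C f)) (res C (Cod C f)) f (res_map C f)"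
proof -
  have "\<exists>\<phi>. is_resolution_map C (res C (Dom C f)) (res C (Cod C f)) f \<phi>"
    using resolution_map_exists[OF resolution_exists resolution_exists, of "Dom C f" "Cod C f" f]
        assms by simp
  then show ?thesis unfolding res_map_def by (rule someI_ex)
qed

text \<open>Since \<open>p n\<close> has a section, the induced map can only be
  \<open>p' n \<cdot> \<mu> n \<cdot> s n\<close>. It commutes with the projections because
  \<open>\<mu>\<close> maps the image of \<open>i\<close> into that of \<open>i'\<close>, which
  \<open>p'\<close> kills. The compatibilities with differentials and augmentations are tested after
  the epimorphism \<open>p n\<close>, so \<open>s\<close> need not be a chain map.\<close>

lemma resolution_map_quotient:
  assumes "is_proj_resolution C M R" "is_proj_resolution C M' R'" "is_proj_resolution C L P"
      "is_proj_resolution C N Q"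
    "is_proj_resolution C L' P'" "is_proj_resolution C N' Q'"
    and "is_resolution_map C P R f i" "is_resolution_map C R Q g p" "is_resolution_map C P' R' f'
        i'" "is_resolution_map C R' Q' g' p'"
    and "\<And>n. split_exact (i n) (p n) (r n) (s n)" "\<And>n. p' n \<cdot> i' n = Zero C (RObj P' n) (RObj Q' n)"
    and "is_resolution_map C R R' m \<mu>" "is_resolution_map C P P' l \<kappa>" "\<And>n. \<mu> n \<cdot> i n = i' n \<cdot> \<kappa> n"
    and "g \<in> Hom C M N" "m \<in> Hom C M M'" "g' \<in> Hom C M' N'" "t \<in> Hom C N N'" "t \<cdot> g = g' \<cdot> m"
  obtains \<rho> where "is_resolution_map C Q Q' t \<rho>" "\<And>n. \<rho> n \<cdot> p n = p' n \<cdot> \<mu> n"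
proof -
  note R = resolutionD(1-8)[OF assms(1)] resolutionD(1-8)[OF assms(2)] resolutionD(1-8)[OF assms(3)]
    resolutionD(1-8)[OF assms(4)] resolutionD(1-8)[OF assms(5)] resolutionD(1-8)[OF assms(6)]
  note F = resolution_mapD[OF assms(7)] and G = resolution_mapD[OF assms(8)] and F' =
      resolution_mapD[OF assms(9)]
    and G' = resolution_mapD[OF assms(10)] and Mu = resolution_mapD[OF assms(13)] and K =
        resolution_mapD[OF assms(14)]
  note FT = F(1-3) G(1-3) F'(1-3) G'(1-3) Mu(1-3) K(1-3)
  note S = split_exactD[OF assms(11)]
  define \<rho> where "\<rho> n = p' n \<cdot> (\<mu> n \<cdot> s n)" for n
  have rT: "\<rho> n \<in> Hom C (RObj Q n) (RObj Q' n)" for n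
    unfolding \<rho>_def using FT S(1-9) by simp
  have rp: "\<rho> n \<cdot> p n = p' n \<cdot> \<mu> n" for n
  proof -
    have "p' n \<cdot> (\<mu> n \<cdot> (i n \<cdot> r n)) = p' n \<cdot> (i' n \<cdot> (\<kappa> n \<cdot> r n))"
      using Cmp_reassoc[OF assms(15)[of n], of "r n"] FT S(1-9) by simp
    also have "\<dots> = Zero C (RObj R n) (RObj Q' n)"
      by (subst Cmp_reassoc0[OF assms(12)]) (use FT S(1-9)[of n] in simp_all)
    finally have z: "p' n \<cdot> (\<mu> n \<cdot> (i n \<cdot> r n)) = Zero C (RObj R n) (RObj Q' n)" .
    have "p' n \<cdot> \<mu> n = p' n \<cdot> (\<mu> n \<cdot> (i n \<cdot> r n \<oplus> s n \<cdot> p n))"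
      unfolding S(13) using FT by simp
    also have "\<dots> = p' n \<cdot> (\<mu> n \<cdot> (i n \<cdot> r n)) \<oplus> p' n \<cdot> (\<mu> n \<cdot> (s n \<cdot> p n))"
      using FT S(1-9)[of n] by simp
    also have "\<dots> = p' n \<cdot> (\<mu> n \<cdot> (s n \<cdot> p n))"
      unfolding z using FT S(1-9)[of n] by simp
    finally show ?thesis unfolding \<rho>_def using FT S(1-9)[of n] by simp
  qed
  have ep: "epi_arr C (p n)" for n by (rule split_exact_epi[OF assms(11)])
  have rpc: "\<rho> n \<cdot> (p n \<cdot> x) = p' n \<cdot> (\<mu> n \<cdot> x)" if "x \<in> Arr C" "Cod C x = RObj R n" for n x
    by (rule Cmp_reassoc[OF rp]) (use that rT FT in simp_all)
  have "is_resolution_map C Q Q' t \<rho>"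
    unfolding is_resolution_map_def
  proof (intro conjI allI rT)
    have "RAug Q' \<cdot> (\<rho> 0 \<cdot> p 0) = g' \<cdot> (RAug R' \<cdot> \<mu> 0)"
      unfolding rp using Cmp_reassoc[OF G'(4), of "\<mu> 0"] FT R assms(18) by simp
    also have "\<dots> = g' \<cdot> m \<cdot> RAug R"
      unfolding Mu(4) using R assms(17,18) by simp
    also have "\<dots> = t \<cdot> (g \<cdot> RAug R)"
      unfolding assms(20)[symmetric] using R assms(16,19) by simp
    also have "\<dots> = t \<cdot> RAug Q \<cdot> p 0"
      unfolding G(4)[symmetric] using R FT assms(19) by simp
    finally have eq: "RAug Q' \<cdot> \<rho> 0 \<cdot> p 0 = t \<cdot> RAug Q \<cdot> p 0" using rT FT R by simp
    show "RAug Q' \<cdot> \<rho> 0 = t \<cdot> RAug Q"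
      by (rule epi_cancel[OF ep _ _ eq]) (use rT FT R assms(19) in simp_all)
    fix n
    have "RDif Q' n \<cdot> (\<rho> (Suc n) \<cdot> p (Suc n)) = p' n \<cdot> (RDif R' n \<cdot> \<mu> (Suc n))"
      unfolding rp using Cmp_reassoc[OF G'(5)[of n], of "\<mu> (Suc n)"] FT R by simp
    also have "\<dots> = \<rho> n \<cdot> (p n \<cdot> RDif R n)"
      unfolding Mu(5) using rpc[of "RDif R n" n] R FT by simp
    also have "\<dots> = \<rho> n \<cdot> RDif Q n \<cdot> p (Suc n)"
      unfolding G(5)[symmetric] using R FT rT by simp
    finally have eq: "RDif Q' n \<cdot> \<rho> (Suc n) \<cdot> p (Suc n) = \<rho> n \<cdot> RDif Q n \<cdot> p (Suc n)" using rT FT R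
        by simp
    show "RDif Q' n \<cdot> \<rho> (Suc n) = \<rho> n \<cdot> RDif Q n"
      by (rule epi_cancel[OF ep _ _ eq]) (use rT FT R in simp_all)
  qed
  then show thesis using that rp by blast
qed

end

section \<open>Finite biproducts\<close>

context abelian_category
begin

lemma biproductD:
  assumes "is_biproduct C S X B i p"
  shows "B \<in> Obj C"
    and "s \<in> S \<Longrightarrow> i s \<in> Arr C" "s \<in> S \<Longrightarrow> Dom C (i s) = X s" "s \<in> S \<Longrightarrow> Cod C (i s) = B"
    and "s \<in> S \<Longrightarrow> p s \<in> Arr C" "s \<in> S \<Longrightarrow> Dom C (p s) = B" "s \<in> S \<Longrightarrow> Cod C (p s) = X s"
    and "s \<in> S \<Longrightarrow> t \<in> S \<Longrightarrow> p t \<cdot> i s = (if s = t then Ide C (X s) else Zero C (X s) (X t))"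
    and "a \<in> Obj C \<Longrightarrow> (\<And>s. s \<in> S \<Longrightarrow> h s \<in> Hom C a (X s)) \<Longrightarrow> \<exists>!u. u \<in> Hom C a B \<and> (\<forall>s \<in> S. p s \<cdot> u = h
        s)"
    and "a \<in> Obj C \<Longrightarrow> (\<And>s. s \<in> S \<Longrightarrow> h s \<in> Hom C (X s) a) \<Longrightarrow> \<exists>!u. u \<in> Hom C B a \<and> (\<forall>s \<in> S. u \<cdot> i s = h
        s)"
proof -
  show "B \<in> Obj C" using assms by (simp add: is_biproduct_def)
  have "\<forall>s \<in> S. i s \<in> Hom C (X s) B \<and> p s \<in> Hom C B (X s)"
    using assms unfolding is_biproduct_def by blast
  then show "s \<in> S \<Longrightarrow> i s \<in> Arr C" "s \<in> S \<Longrightarrow> Dom C (i s) = X s" "s \<in> S \<Longrightarrow> Cod C (i s) = B"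
    "s \<in> S \<Longrightarrow> p s \<in> Arr C" "s \<in> S \<Longrightarrow> Dom C (p s) = B" "s \<in> S \<Longrightarrow> Cod C (p s) = X s"
    by auto
  show "s \<in> S \<Longrightarrow> t \<in> S \<Longrightarrow> p t \<cdot> i s = (if s = t then Ide C (X s) else Zero C (X s) (X t))"
    using assms unfolding is_biproduct_def by blast
  show "a \<in> Obj C \<Longrightarrow> (\<And>s. s \<in> S \<Longrightarrow> h s \<in> Hom C a (X s)) \<Longrightarrow> \<exists>!u. u \<in> Hom C a B \<and> (\<forall>s \<in> S. p s \<cdot> u = h
      s)"
    using assms unfolding is_biproduct_def by blast
  show "a \<in> Obj C \<Longrightarrow> (\<And>s. s \<in> S \<Longrightarrow> h s \<in> Hom C (X s) a) \<Longrightarrow> \<exists>!u. u \<in> Hom C B a \<and> (\<forall>s \<in> S. u \<cdot> i s = h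
      s)"
    using assms unfolding is_biproduct_def by blast
qed

lemma biproduct_proj_ext:
  assumes "is_biproduct C S X B i p" "x \<in> Hom C W B" "y \<in> Hom C W B" "\<And>s. s \<in> S \<Longrightarrow> p s \<cdot> x = p s \<cdot> y"
  shows "x = y"
proof -
  note D = biproductD[OF assms(1)]
  have W: "W \<in> Obj C" using assms(2) by auto
  have "\<exists>!u. u \<in> Hom C W B \<and> (\<forall>s \<in> S. p s \<cdot> u = p s \<cdot> x)"
    by (rule D(9)[OF W]) (use D(5-7) assms(2) in simp)
  then show ?thesis using assms by metis
qed

lemma biproduct_inj_ext:
  assumes "is_biproduct C S X B i p" "x \<in> Hom C B W" "y \<in> Hom C B W" "\<And>s. s \<in> S \<Longrightarrow> x \<cdot> i s = y \<cdot> i s"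
  shows "x = y"
proof -
  note D = biproductD[OF assms(1)]
  have W: "W \<in> Obj C" using assms(2) by auto
  have "\<exists>!u. u \<in> Hom C B W \<and> (\<forall>s \<in> S. u \<cdot> i s = x \<cdot> i s)"
    by (rule D(10)[OF W]) (use D(2-4) assms(2) in simp)
  then show ?thesis using assms by metis
qed

text \<open>The induction step for finite biproducts: \<open>R\<close> is a binary biproduct of the
  new summand and the biproduct of the old ones.\<close>

lemma biproduct_insert:
  assumes "is_biproduct C S X B i p" "t \<notin> S" "X t \<in> Obj C" "\<And>s. s \<in> S \<Longrightarrow> X s \<in> Obj C"
    and R: "R \<in> Obj C" "a \<in> Hom C (X t) R" "b \<in> Hom C B R" "u \<in> Hom C R (X t)" "v \<in> Hom C R B"
    and ua: "u \<cdot> a = Ide C (X t)" and vb: "v \<cdot> b = Ide C B"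
    and ub: "u \<cdot> b = Zero C B (X t)" and va: "v \<cdot> a = Zero C (X t) B" and sum: "a \<cdot> u \<oplus> b \<cdot> v = Ide
        C R"
  shows "is_biproduct C (insert t S) X R (\<lambda>s. if s = t then a else b \<cdot> i s) (\<lambda>s. if s = t then u
      else p s \<cdot> v)"
  unfolding is_biproduct_def
proof (intro conjI ballI allI impI)
  note D = biproductD[OF assms(1)]
  have st: "s \<noteq> t" if "s \<in> S" for s using that assms(2) by blast
  show "R \<in> Obj C" by fact
  show "(if s = t then a else b \<cdot> i s) \<in> Hom C (X s) R" "(if s = t then u else p s \<cdot> v) \<in> Hom C R (X
      s)"
    if "s \<in> insert t S" for s
    using that D(1-7) R by (cases "s = t"; simp)+
  show "(if t' = t then u else p t' \<cdot> v) \<cdot> (if s = t then a else b \<cdot> i s) =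
      (if s = t' then Ide C (X s) else Zero C (X s) (X t'))"
    if "s \<in> insert t S" "t' \<in> insert t S" for s t'
  proof -
    have vbc: "v \<cdot> (b \<cdot> x) = x" if "x \<in> Arr C" "Cod C x = B" for x
      using Cmp_reassoc1[OF vb, of x] that R by simp
    have ubc: "u \<cdot> (b \<cdot> x) = Zero C (Dom C x) (X t)" if "x \<in> Arr C" "Cod C x = B" for x
      by (rule Cmp_reassoc0[OF ub]) (use that R in simp_all)
    show ?thesis
      using that D(1-8) R ua va vbc ubc assms(3,4) by (cases "s = t"; cases "t' = t"; simp)
  qed
  show "\<exists>!w. w \<in> Hom C A R \<and> (\<forall>s \<in> insert t S. (if s = t then u else p s \<cdot> v) \<cdot> w = h s)"
    if A: "A \<in> Obj C" and h: "\<forall>s \<in> insert t S. h s \<in> Hom C A (X s)" for A h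
  proof -
    obtain w where w: "w \<in> Hom C A B" "\<And>s. s \<in> S \<Longrightarrow> p s \<cdot> w = h s"
      using D(9)[OF A, of h] h by blast
    have ht: "h t \<in> Hom C A (X t)" and hs: "\<And>s. s \<in> S \<Longrightarrow> h s \<in> Hom C A (X s)" using h by blast+
    have uab: "u \<cdot> (a \<cdot> h t) = h t" "u \<cdot> (b \<cdot> w) = Zero C A (X t)" "v \<cdot> (a \<cdot> h t) = Zero C A B" "v \<cdot>
        (b \<cdot> w) = w"
      using Cmp_reassoc1[OF ua, of "h t"] Cmp_reassoc1[OF ub, of w] Cmp_reassoc1[OF va, of "h t"]
          Cmp_reassoc1[OF vb, of w]
        R ht w(1) D(1) assms(3) by simp_all
    show ?thesis
    proof (rule ex1I[of _ "a \<cdot> h t \<oplus> b \<cdot> w"])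
      show "a \<cdot> h t \<oplus> b \<cdot> w \<in> Hom C A R \<and> (\<forall>s \<in> insert t S. (if s = t then u else p s \<cdot> v) \<cdot> (a \<cdot> h
          t \<oplus> b \<cdot> w) = h s)"
        using R ht hs w D(1-7) uab st A assms(3,4) by auto
      fix z assume z: "z \<in> Hom C A R \<and> (\<forall>s \<in> insert t S. (if s = t then u else p s \<cdot> v) \<cdot> z = h s)"
      have uz: "u \<cdot> z = h t" using z by simp
      have "v \<cdot> z = w"
      proof (rule biproduct_proj_ext[OF assms(1) _ w(1)])
        show "v \<cdot> z \<in> Hom C A B" using z R by simp
        show "p s \<cdot> (v \<cdot> z) = p s \<cdot> w" if "s \<in> S" for s
        proof -
          have "p s \<cdot> v \<cdot> z = h s" using z that st[OF that] by auto
          then show ?thesis using w(2)[OF that] D(5-7)[OF that] z R by simp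
        qed
      qed
      then have "a \<cdot> h t \<oplus> b \<cdot> w = (a \<cdot> u \<oplus> b \<cdot> v) \<cdot> z"
        using uz z R by simp
      then show "z = a \<cdot> h t \<oplus> b \<cdot> w" unfolding sum using z by simp
    qed
  qed
  show "\<exists>!w. w \<in> Hom C R A \<and> (\<forall>s \<in> insert t S. w \<cdot> (if s = t then a else b \<cdot> i s) = h s)"
    if A: "A \<in> Obj C" and h: "\<forall>s \<in> insert t S. h s \<in> Hom C (X s) A" for A h
  proof -
    obtain w where w: "w \<in> Hom C B A" "\<And>s. s \<in> S \<Longrightarrow> w \<cdot> i s = h s"
      using D(10)[OF A, of h] h by blast
    have ht: "h t \<in> Hom C (X t) A" using h by blast
    show ?thesis
    proof (rule ex1I[of _ "h t \<cdot> u \<oplus> w \<cdot> v"])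
      have "(h t \<cdot> u \<oplus> w \<cdot> v) \<cdot> a = h t"
        using R ht w(1) ua va A assms(3) D(1) by simp
      moreover have "(h t \<cdot> u \<oplus> w \<cdot> v) \<cdot> b = w"
        using R ht w(1) ub vb A assms(3) D(1) by simp
      then have "(h t \<cdot> u \<oplus> w \<cdot> v) \<cdot> (b \<cdot> i s) = w \<cdot> i s" if "s \<in> S" for s
        by (rule Cmp_reassoc1) (use R ht w(1) D(2-4)[OF that] in simp_all)
      then have "(h t \<cdot> u \<oplus> w \<cdot> v) \<cdot> (b \<cdot> i s) = h s" if "s \<in> S" for s
        using that w(2) by simp
      ultimately show "h t \<cdot> u \<oplus> w \<cdot> v \<in> Hom C R A \<and> (\<forall>s \<in> insert t S. (h t \<cdot> u \<oplus> w \<cdot> v) \<cdot> (if s = t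
          then a else b \<cdot> i s) = h s)"
        using R ht w(1) st by auto
      fix z assume z: "z \<in> Hom C R A \<and> (\<forall>s \<in> insert t S. z \<cdot> (if s = t then a else b \<cdot> i s) = h s)"
      have za: "z \<cdot> a = h t" using z by simp
      have zb: "z \<cdot> b = w"
      proof (rule biproduct_inj_ext[OF assms(1) _ w(1)])
        show "z \<cdot> b \<in> Hom C B A" using z R by simp
        show "z \<cdot> b \<cdot> i s = w \<cdot> i s" if "s \<in> S" for s
        proof -
          have "z \<cdot> (b \<cdot> i s) = h s" using z that st[OF that] by auto
          then show ?thesis using w(2)[OF that] D(2-4)[OF that] z R by simp
        qed
      qed
      have "h t \<cdot> u \<oplus> w \<cdot> v = z \<cdot> (a \<cdot> u \<oplus> b \<cdot> v)"
        using Cmp_reassoc1[OF za, of u] Cmp_reassoc1[OF zb, of v] z R by simp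
      then show "z = h t \<cdot> u \<oplus> w \<cdot> v" unfolding sum using z by simp
    qed
  qed
qed

lemma biproduct_exists:
  assumes "finite S" "\<And>s. s \<in> S \<Longrightarrow> X s \<in> Obj C"
  shows "\<exists>B i p. is_biproduct C S X B i p"
  using assms
proof (induction S rule: finite_induct)
  case empty
  obtain z where z: "z \<in> Obj C" "\<And>f a. f \<in> Hom C a z \<Longrightarrow> f = Zero C a z" "\<And>f a. f \<in> Hom C z a \<Longrightarrow> f =
      Zero C z a"
    using zero_obj by blast
  \<comment> \<open>Over the empty index set the families of injections and projections are never
    evaluated, so any value serves; the zero object supplies both universal properties.\<close>
  have "is_biproduct C {} X z (\<lambda>_. undefined) (\<lambda>_. undefined)"
    unfolding is_biproduct_def
  proof (intro conjI ballI allI impI)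
    show "\<exists>!u. u \<in> Hom C a z \<and> (\<forall>s \<in> {}. undefined \<cdot> u = h s)" if "a \<in> Obj C" for a h
      by (rule ex1I[of _ "Zero C a z"]) (use that z(1) z(2) in auto)
    show "\<exists>!u. u \<in> Hom C z a \<and> (\<forall>s \<in> {}. u \<cdot> undefined = h s)" if "a \<in> Obj C" for a h
      by (rule ex1I[of _ "Zero C z a"]) (use that z(1) z(3) in auto)
  qed (use z in auto)
  then show ?case by blast
next
  case (insert t S)
  have "\<exists>B i p. is_biproduct C S X B i p" by (rule insert.IH) (use insert.prems in simp)
  then obtain B i p where bp: "is_biproduct C S X B i p" by blast
  have t: "X t \<in> Obj C" using insert.prems by blast
  obtain R a b u v where R: "R \<in> Obj C" "a \<in> Hom C (X t) R" "b \<in> Hom C B R" "u \<in> Hom C R (X t)" "v \<in>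
      Hom C R B"
    "u \<cdot> a = Ide C (X t)" "v \<cdot> b = Ide C B" "u \<cdot> b = Zero C B (X t)" "v \<cdot> a = Zero C (X t) B" "a \<cdot> u
        \<oplus> b \<cdot> v = Ide C R"
    using biproduct_binary[OF t biproductD(1)[OF bp]] by blast
  show ?case
    using biproduct_insert[OF bp insert.hyps(2) t _ R] insert.prems by blast
qed

lemma biprod:
  assumes "finite S" "\<And>s. s \<in> S \<Longrightarrow> X s \<in> Obj C"
  shows "is_biproduct C S X (biprod C S X) (inj_arr C S X) (proj_arr C S X)"
proof -
  obtain B i p where "is_biproduct C S X B i p" using biproduct_exists[of S X] assms by blast
  then have "\<exists>x. case x of (B, i, p) \<Rightarrow> is_biproduct C S X B i p"
    by (intro exI[of _ "(B, i, p)"]) simp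
  then have "case biprod_data C S X of (B, i, p) \<Rightarrow> is_biproduct C S X B i p"
    unfolding biprod_data_def by (rule someI_ex)
  then show ?thesis
    by (simp add: biprod_def inj_arr_def proj_arr_def case_prod_beta)
qed

lemma matrix_arr:
  assumes "finite S" "\<And>s. s \<in> S \<Longrightarrow> X s \<in> Obj C" "finite T" "\<And>t. t \<in> T \<Longrightarrow> Y t \<in> Obj C"
    and "\<And>s t. s \<in> S \<Longrightarrow> t \<in> T \<Longrightarrow> m s t \<in> Hom C (X s) (Y t)"
  shows "matrix_arr C S X T Y m \<in> Hom C (biprod C S X) (biprod C T Y)"
    and "s \<in> S \<Longrightarrow> t \<in> T \<Longrightarrow> proj_arr C T Y t \<cdot> (matrix_arr C S X T Y m \<cdot> inj_arr C S X s) = m s t"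
proof -
  have bS: "is_biproduct C S X (biprod C S X) (inj_arr C S X) (proj_arr C S X)"
    and bT: "is_biproduct C T Y (biprod C T Y) (inj_arr C T Y) (proj_arr C T Y)"
    using biprod assms(1-4) by blast+
  note DS = biproductD[OF bS] and DT = biproductD[OF bT]
  let ?P = "\<lambda>h. h \<in> Hom C (biprod C S X) (biprod C T Y) \<and>
        (\<forall>s \<in> S. \<forall>t \<in> T. proj_arr C T Y t \<cdot> (h \<cdot> inj_arr C S X s) = m s t)"
  have "\<exists>c. c \<in> Hom C (X s) (biprod C T Y) \<and> (\<forall>t \<in> T. proj_arr C T Y t \<cdot> c = m s t)" if "s \<in> S" for
      s
    using DT(9)[of "X s" "m s"] assms(2,5)[OF that] by blast
  then obtain c where c: "\<And>s. s \<in> S \<Longrightarrow> c s \<in> Hom C (X s) (biprod C T Y)"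
    "\<And>s t. s \<in> S \<Longrightarrow> t \<in> T \<Longrightarrow> proj_arr C T Y t \<cdot> c s = m s t"
    by metis
  obtain h where h: "h \<in> Hom C (biprod C S X) (biprod C T Y)" "\<And>s. s \<in> S \<Longrightarrow> h \<cdot> inj_arr C S X s = c
      s"
    using DS(10)[OF DT(1), of c] c(1) by blast
  have "\<exists>!h. ?P h"
  proof (rule ex1I[of _ h])
    show "?P h" using h c(2) by simp
    fix g assume g: "?P g"
    show "g = h"
    proof (rule biproduct_inj_ext[OF bS _ h(1)])
      show "g \<in> Hom C (biprod C S X) (biprod C T Y)" using g by blast
      fix s assume s: "s \<in> S"
      show "g \<cdot> inj_arr C S X s = h \<cdot> inj_arr C S X s"
        by (rule biproduct_proj_ext[OF bT, where W = "X s"]) (use g h c(1)[OF s] c(2) s DS(2-4)[OF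
            s] in simp_all)
    qed
  qed
  then have P: "?P (matrix_arr C S X T Y m)"
    unfolding matrix_arr_def by (rule theI')
  then show "matrix_arr C S X T Y m \<in> Hom C (biprod C S X) (biprod C T Y)" by blast
  show "s \<in> S \<Longrightarrow> t \<in> T \<Longrightarrow> proj_arr C T Y t \<cdot> (matrix_arr C S X T Y m \<cdot> inj_arr C S X s) = m s t"
    using P by blast
qed

text \<open>Identifies a whole row of a matrix by testing it on the injections. Afterwards total
  complexes can be computed with through projections alone.\<close>

lemma proj_matrix_arr:
  assumes "finite S" "\<And>s. s \<in> S \<Longrightarrow> X s \<in> Obj C" "finite T" "\<And>t. t \<in> T \<Longrightarrow> Y t \<in> Obj C"
    and "\<And>s t. s \<in> S \<Longrightarrow> t \<in> T \<Longrightarrow> m s t \<in> Hom C (X s) (Y t)"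
    and "t \<in> T" "h \<in> Hom C (biprod C S X) (Y t)" "\<And>s. s \<in> S \<Longrightarrow> h \<cdot> inj_arr C S X s = m s t"
  shows "proj_arr C T Y t \<cdot> matrix_arr C S X T Y m = h"
proof -
  have bS: "is_biproduct C S X (biprod C S X) (inj_arr C S X) (proj_arr C S X)"
    and bT: "is_biproduct C T Y (biprod C T Y) (inj_arr C T Y) (proj_arr C T Y)"
    using biprod assms(1-4) by blast+
  note DS = biproductD[OF bS] and DT = biproductD[OF bT]
  have M: "matrix_arr C S X T Y m \<in> Hom C (biprod C S X) (biprod C T Y)"
    "\<And>s t. s \<in> S \<Longrightarrow> t \<in> T \<Longrightarrow> proj_arr C T Y t \<cdot> (matrix_arr C S X T Y m \<cdot> inj_arr C S X s) = m s t"
    using matrix_arr[of S X T Y m] assms(1-5) by blast+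
  show ?thesis
    by (rule biproduct_inj_ext[OF bS _ assms(7)]) (use M assms(6,8) DS(1-7) DT(1-7) in simp_all)
qed

section \<open>Calculus of signs\<close>

lemma sign_arr_eq: "sign_arr C p h = (if even p then h else \<ominus> h)"
  by (simp add: sign_arr_def neg_arr_def)

lemma sign_arr_simps [simp]:
  assumes "h \<in> Arr C"
  shows "sign_arr C p h \<in> Arr C" "Dom C (sign_arr C p h) = Dom C h" "Cod C (sign_arr C p h) = Cod C
      h"
    "sign_arr C (Suc p) h = \<ominus> sign_arr C p h" "sign_arr C p (sign_arr C p h) = h"
    "sign_arr C p (\<ominus> h) = \<ominus> sign_arr C p h" "sign_arr C 0 h = h"
  using assms by (simp_all add: sign_arr_eq)

lemma sign_arr_Cmp [simp]:
  assumes "h \<in> Arr C" "g \<in> Arr C" "Cod C h = Dom C g"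
  shows "g \<cdot> sign_arr C p h = sign_arr C p (g \<cdot> h)" "sign_arr C p g \<cdot> h = sign_arr C p (g \<cdot> h)"
  using assms by (simp_all add: sign_arr_eq)

lemma sign_arr_Add [simp]:
  assumes "h \<in> Arr C" "g \<in> Arr C" "Dom C g = Dom C h" "Cod C g = Cod C h"
  shows "sign_arr C p (h \<oplus> g) = sign_arr C p h \<oplus> sign_arr C p g"
  using assms by (simp add: sign_arr_eq)

lemma sign_arr_Zero [simp]:
  assumes "a \<in> Obj C" "b \<in> Obj C"
  shows "sign_arr C p (Zero C a b) = Zero C a b"
  using assms by (simp add: sign_arr_eq)

end

section \<open>Total complexes\<close>

locale bifunctor = C: abelian_category C + D: abelian_category D + E: abelian_category E
  for C :: "('oc, 'ac, 'xc) addcat_scheme" and D :: "('od, 'ad, 'xd) addcat_scheme"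
    and E :: "('oe, 'ae, 'xe) addcat_scheme" (structure) +
  fixes F :: "('oc \<times> 'od, 'ac \<times> 'ad, 'oe, 'ae) ftr"
  assumes additive: "additive_bifunctor C D E F"
    and enough_C: "enough_projectives C" and enough_D: "enough_projectives D"
begin

section \<open>Functoriality and additivity of \<open>F\<close> as rewrite rules\<close>

lemma F_functor: "is_functor (prod_cat C D) E F"
  using additive by (simp add: additive_bifunctor_def)

lemma F_Obj [simp]: "\<lbrakk>X \<in> Obj C; Y \<in> Obj D\<rbrakk> \<Longrightarrow> OMap F (X, Y) \<in> Obj E"
  using F_functor by (simp add: is_functor_def prod_cat_def)

lemma F_Ide [simp]: "\<lbrakk>X \<in> Obj C; Y \<in> Obj D\<rbrakk> \<Longrightarrow> AMap F (Ide C X, Ide D Y) = Ide E (OMap F (X, Y))"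
  using F_functor by (auto simp: is_functor_def prod_cat_def)

lemma F_arr [simp]:
  assumes "f \<in> Arr C" "g \<in> Arr D"
  shows "AMap F (f, g) \<in> Arr E" "Dom E (AMap F (f, g)) = OMap F (Dom C f, Dom D g)"
    "Cod E (AMap F (f, g)) = OMap F (Cod C f, Cod D g)"
  using F_functor assms by (auto simp: is_functor_def prod_cat_def)

lemma F_Cmp [simp]:
  assumes "f \<in> Arr C" "f' \<in> Arr C" "Cod C f = Dom C f'" "g \<in> Arr D" "g' \<in> Arr D" "Cod D g = Dom D
      g'"
  shows "AMap F (f', g') \<cdot> AMap F (f, g) = AMap F (f' \<cdot>\<^bsub>C\<^esub> f, g' \<cdot>\<^bsub>D\<^esub> g)"
proof -
  have "\<forall>h \<in> Arr C \<times> Arr D. \<forall>h' \<in> Arr C \<times> Arr D. Cod (prod_cat C D) h = Dom (prod_cat C D) h' \<longrightarrow>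
      AMap F (Cmp (prod_cat C D) h' h) = AMap F h' \<cdot> AMap F h"
    using F_functor unfolding is_functor_def by (simp add: prod_cat_def)
  from this[rule_format, of "(f, g)" "(f', g')"] show ?thesis
    using assms by (simp add: prod_cat_def)
qed

lemma F_Cmp_Cmp [simp]:
  assumes "f \<in> Arr C" "f' \<in> Arr C" "Cod C f = Dom C f'" "g \<in> Arr D" "g' \<in> Arr D" "Cod D g = Dom D
      g'"
    and "x \<in> Arr E" "Cod E x = OMap F (Dom C f, Dom D g)"
  shows "AMap F (f', g') \<cdot> (AMap F (f, g) \<cdot> x) = AMap F (f' \<cdot>\<^bsub>C\<^esub> f, g' \<cdot>\<^bsub>D\<^esub> g) \<cdot> x"
  by (rule E.Cmp_reassoc1[OF F_Cmp]) (use assms in simp_all)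

text \<open>Additivity is given only with an identity in the other variable. Factoring
  \<open>F(h, g)\<close> as \<open>F(1, g)\<close> after \<open>F(h, 1)\<close> extends it to every
  \<open>g\<close>.\<close>

lemma F_Add_left [simp]:
  assumes "f \<in> Arr C" "f' \<in> Arr C" "Dom C f' = Dom C f" "Cod C f' = Cod C f" "g \<in> Arr D"
  shows "AMap F (f \<oplus>\<^bsub>C\<^esub> f', g) = AMap F (f, g) \<oplus> AMap F (f', g)"
proof -
  have "additive_functor C E (fix_right D F (Dom D g))"
    using additive assms by (simp add: additive_bifunctor_def)
  then have a: "AMap F (f \<oplus>\<^bsub>C\<^esub> f', Ide D (Dom D g)) = AMap F (f, Ide D (Dom D g)) \<oplus> AMap F (f', Ide
      D (Dom D g))"
    using assms unfolding additive_functor_def fix_right_def by simp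
  have s: "AMap F (h, g) = AMap F (Ide C (Cod C h), g) \<cdot> AMap F (h, Ide D (Dom D g))" if "h \<in> Arr C"
      for h
    using that assms by simp
  show ?thesis
    using s[of "f \<oplus>\<^bsub>C\<^esub> f'"] assms
    by (simp add: a del: F_Cmp) (simp add: assms)
qed

lemma F_Add_right [simp]:
  assumes "f \<in> Arr C" "g \<in> Arr D" "g' \<in> Arr D" "Dom D g' = Dom D g" "Cod D g' = Cod D g"
  shows "AMap F (f, g \<oplus>\<^bsub>D\<^esub> g') = AMap F (f, g) \<oplus> AMap F (f, g')"
proof -
  have "additive_functor D E (fix_left C F (Dom C f))"
    using additive assms by (simp add: additive_bifunctor_def)
  then have a: "AMap F (Ide C (Dom C f), g \<oplus>\<^bsub>D\<^esub> g') = AMap F (Ide C (Dom C f), g) \<oplus> AMap F (Ide C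
      (Dom C f), g')"
    using assms unfolding additive_functor_def fix_left_def by simp
  have s: "AMap F (f, h) = AMap F (f, Ide D (Cod D h)) \<cdot> AMap F (Ide C (Dom C f), h)" if "h \<in> Arr D"
      for h
    using that assms by simp
  show ?thesis
    using s[of "g \<oplus>\<^bsub>D\<^esub> g'"] assms
    by (simp add: a del: F_Cmp) (simp add: assms)
qed

lemma F_Zero_left [simp]:
  assumes "a \<in> Obj C" "b \<in> Obj C" "g \<in> Arr D"
  shows "AMap F (Zero C a b, g) = Zero E (OMap F (a, Dom D g)) (OMap F (b, Cod D g))"
proof -
  let ?z = "AMap F (Zero C a b, g)"
  have "?z \<oplus> ?z = ?z" using assms by (simp flip: F_Add_left)
  then have "?z \<oplus> ?z = ?z \<oplus> Zero E (OMap F (a, Dom D g)) (OMap F (b, Cod D g))" using assms by simp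
  then show ?thesis by (rule E.Add_left_cancel) (use assms in simp_all)
qed

lemma F_Zero_right [simp]:
  assumes "a \<in> Obj D" "b \<in> Obj D" "f \<in> Arr C"
  shows "AMap F (f, Zero D a b) = Zero E (OMap F (Dom C f, a)) (OMap F (Cod C f, b))"
proof -
  let ?z = "AMap F (f, Zero D a b)"
  have "?z \<oplus> ?z = ?z" using assms by (simp flip: F_Add_right)
  then have "?z \<oplus> ?z = ?z \<oplus> Zero E (OMap F (Dom C f, a)) (OMap F (Cod C f, b))" using assms by simp
  then show ?thesis by (rule E.Add_left_cancel) (use assms in simp_all)
qed

section \<open>The total complex through its projections\<close>

abbreviation Tot :: "('oc, 'ac) resol \<Rightarrow> ('od, 'ad) resol \<Rightarrow> ('oe, 'ae) cpx" where
  "Tot P Q \<equiv> tot C D E F P Q"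

text \<open>Total complexes depend on the resolutions and not on the objects resolved, so the latter
  are quantified away.\<close>

definition res_pair :: "('oc, 'ac) resol \<Rightarrow> ('od, 'ad) resol \<Rightarrow> bool" where
  "res_pair P Q \<longleftrightarrow> (\<exists>X. is_proj_resolution C X P) \<and> (\<exists>Y. is_proj_resolution D Y Q)"

lemma res_pairI: "is_proj_resolution C X P \<Longrightarrow> is_proj_resolution D Y Q \<Longrightarrow> res_pair P Q"
  by (auto simp: res_pair_def)

lemma res_pairD:
  assumes "res_pair P Q"
  shows "RObj P p \<in> Obj C" "RDif P p \<in> Arr C" "Dom C (RDif P p) = RObj P (Suc p)" "Cod C (RDif P p)
      = RObj P p"
    "RObj Q q \<in> Obj D" "RDif Q q \<in> Arr D" "Dom D (RDif Q q) = RObj Q (Suc q)" "Cod D (RDif Q q) =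
        RObj Q q"
    "RDif P p \<cdot>\<^bsub>C\<^esub> RDif P (Suc p) = Zero C (RObj P (Suc (Suc p))) (RObj P p)"
    "RDif Q q \<cdot>\<^bsub>D\<^esub> RDif Q (Suc q) = Zero D (RObj Q (Suc (Suc q))) (RObj Q q)"
  using assms C.resolutionD C.resolution_dd D.resolutionD D.resolution_dd by (auto simp:
      res_pair_def)

text \<open>Arrows into a total complex are compared and constructed by these components, by
  \<open>tot_ext\<close> and \<open>tot_exists\<close> below, which turns identities of total
  complexes into identities in the double complex.\<close>

definition pr :: "('oc, 'ac) resol \<Rightarrow> ('od, 'ad) resol \<Rightarrow> int \<Rightarrow> nat \<Rightarrow> nat \<Rightarrow> 'ae" where
  "pr P Q n p q = proj_arr E (tot_index n) (dbl F P Q) (p, q)"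

lemma finite_tot_index: "finite (tot_index n)"
proof (rule finite_subset)
  show "tot_index n \<subseteq> {..nat n} \<times> {..nat n}" by (auto simp: tot_index_def)
qed simp

lemma tot_index_iff: "(p, q) \<in> tot_index n \<longleftrightarrow> int p + int q = n"
  by (simp add: tot_index_def)

context
  fixes P Q
  assumes PQ: "res_pair P Q"
begin

lemma dbl_Obj: "s \<in> tot_index n \<Longrightarrow> dbl F P Q s \<in> Obj E"
  using res_pairD[OF PQ] by (cases s) (simp add: dbl_def)

lemma tot_biprod:
  "is_biproduct E (tot_index n) (dbl F P Q) (biprod E (tot_index n) (dbl F P Q))
    (inj_arr E (tot_index n) (dbl F P Q)) (proj_arr E (tot_index n) (dbl F P Q))"
  using E.biprod[OF finite_tot_index, of n "dbl F P Q"] dbl_Obj by blast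

lemma tot_Obj: "CObj (Tot P Q) n \<in> Obj E"
  using E.biproductD(1)[OF tot_biprod] by (simp add: tot_def)

lemma pr_arr:
  assumes "int p + int q = n"
  shows "pr P Q n p q \<in> Arr E" "Dom E (pr P Q n p q) = CObj (Tot P Q) n"
    "Cod E (pr P Q n p q) = OMap F (RObj P p, RObj Q q)"
  using E.biproductD(5-7)[OF tot_biprod[of n], of "(p, q)"] assms
  by (simp_all add: pr_def tot_def dbl_def tot_index_iff)

lemma tot_ext:
  assumes "x \<in> Hom E W (CObj (Tot P Q) n)" "y \<in> Hom E W (CObj (Tot P Q) n)"
    and "\<And>p q. int p + int q = n \<Longrightarrow> pr P Q n p q \<cdot> x = pr P Q n p q \<cdot> y"
  shows "x = y"
  by (rule E.biproduct_proj_ext[OF tot_biprod[of n], where W = W])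
    (use assms in \<open>auto simp: tot_def pr_def tot_index_iff\<close>)

lemma tot_exists:
  assumes "\<And>p q. int p + int q = n \<Longrightarrow> h p q \<in> Hom E W (OMap F (RObj P p, RObj Q q))" "W \<in> Obj E"
  shows "\<exists>x. x \<in> Hom E W (CObj (Tot P Q) n) \<and> (\<forall>p q. int p + int q = n \<longrightarrow> pr P Q n p q \<cdot> x = h p q)"
proof -
  have "\<exists>!u. u \<in> Hom E W (biprod E (tot_index n) (dbl F P Q)) \<and>
      (\<forall>s \<in> tot_index n. proj_arr E (tot_index n) (dbl F P Q) s \<cdot> u = h (fst s) (snd s))"
    by (rule E.biproductD(9)[OF tot_biprod assms(2)]) (use assms(1) in \<open>auto simp: tot_index_iff
        dbl_def\<close>)
  then obtain u where "u \<in> Hom E W (biprod E (tot_index n) (dbl F P Q))"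
      "\<forall>s \<in> tot_index n. proj_arr E (tot_index n) (dbl F P Q) s \<cdot> u = h (fst s) (snd s)"
    by blast
  then show ?thesis
    by (intro exI[of _ u]) (auto simp: tot_def pr_def tot_index_iff)
qed

lemma tot_inj:
  assumes "int p + int q = n" "int p' + int q' = n"
  shows "inj_arr E (tot_index n) (dbl F P Q) (p, q) \<in> Hom E (OMap F (RObj P p, RObj Q q)) (CObj (Tot
      P Q) n)"
    and "pr P Q n p' q' \<cdot> inj_arr E (tot_index n) (dbl F P Q) (p, q) =
      (if p = p' \<and> q = q' then Ide E (OMap F (RObj P p, RObj Q q))
       else Zero E (OMap F (RObj P p, RObj Q q)) (OMap F (RObj P p', RObj Q q')))"
  using E.biproductD(2-4)[OF tot_biprod[of n], of "(p, q)"] E.biproductD(8)[OF tot_biprod[of n], of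
      "(p, q)" "(p', q')"] assms
  by (auto simp: pr_def tot_def dbl_def tot_index_iff)

text \<open>The summand \<open>(p, q)\<close> receives from \<open>(Suc p, q)\<close> and
  \<open>(p, Suc q)\<close> only. The sign in the definition refers to the source index, but the
  second arrow leaves \<open>p\<close> fixed, so here it can be read off the target.\<close>

lemma tot_diff:
  shows "CDif (Tot P Q) n \<in> Arr E" "Dom E (CDif (Tot P Q) n) = CObj (Tot P Q) n" "Cod E (CDif (Tot P
      Q) n) = CObj (Tot P Q) (n - 1)"
    and "int p + int q = n - 1 \<Longrightarrow> pr P Q (n - 1) p q \<cdot> CDif (Tot P Q) n =
      AMap F (RDif P p, Ide D (RObj Q q)) \<cdot> pr P Q n (Suc p) q \<oplus>
      sign_arr E p (AMap F (Ide C (RObj P p), RDif Q q) \<cdot> pr P Q n p (Suc q))"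
proof -
  note R = res_pairD[OF PQ]
  let ?m = "\<lambda>(p, q) (p', q'). if p = Suc p' \<and> q = q' then AMap F (RDif P p', Ide D (RObj Q q))
           else if p = p' \<and> q = Suc q' then sign_arr E p (AMap F (Ide C (RObj P p), RDif Q q'))
           else Zero E (dbl F P Q (p, q)) (dbl F P Q (p', q'))"
  have m: "?m s t \<in> Hom E (dbl F P Q s) (dbl F P Q t)" if "s \<in> tot_index n" "t \<in> tot_index (n - 1)"
      for s t
    using R by (cases s; cases t) (auto simp: dbl_def)
  have M: "matrix_arr E (tot_index n) (dbl F P Q) (tot_index (n - 1)) (dbl F P Q) ?m
      \<in> Hom E (biprod E (tot_index n) (dbl F P Q)) (biprod E (tot_index (n - 1)) (dbl F P Q))"
    by (rule E.matrix_arr(1)) (fact finite_tot_index dbl_Obj m)+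
  show "CDif (Tot P Q) n \<in> Arr E" "Dom E (CDif (Tot P Q) n) = CObj (Tot P Q) n" "Cod E (CDif (Tot P
      Q) n) = CObj (Tot P Q) (n - 1)"
    using M by (simp_all add: tot_def)
  show "pr P Q (n - 1) p q \<cdot> CDif (Tot P Q) n =
      AMap F (RDif P p, Ide D (RObj Q q)) \<cdot> pr P Q n (Suc p) q \<oplus>
      sign_arr E p (AMap F (Ide C (RObj P p), RDif Q q) \<cdot> pr P Q n p (Suc q))" (is "_ = ?h")
    if pq: "int p + int q = n - 1"
  proof -
    have i1: "int (Suc p) + int q = n" "int p + int (Suc q) = n" using pq by simp_all
    note T = pr_arr[OF i1(1)] pr_arr[OF i1(2)]
    have h: "?h \<in> Hom E (CObj (Tot P Q) n) (OMap F (RObj P p, RObj Q q))"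
      using T R by simp
    have "?h \<cdot> inj_arr E (tot_index n) (dbl F P Q) s = ?m s (p, q)" if s: "s \<in> tot_index n" for s
    proof -
      obtain p' q' where s': "s = (p', q')" by (cases s)
      have i2: "int p' + int q' = n" using s s' by (simp add: tot_index_iff)
      note J = tot_inj(1)[OF i2 i2] tot_inj(2)[OF i2 i1(1)] tot_inj(2)[OF i2 i1(2)]
      show ?thesis
        unfolding s' using J T R by (auto simp: dbl_def)
    qed
    then have "proj_arr E (tot_index (n - 1)) (dbl F P Q) (p, q) \<cdot>
        matrix_arr E (tot_index n) (dbl F P Q) (tot_index (n - 1)) (dbl F P Q) ?m = ?h"
      by (intro E.proj_matrix_arr[where X = "dbl F P Q" and Y = "dbl F P Q"] finite_tot_index
          dbl_Obj m)
        (use h pq in \<open>auto simp: tot_index_iff tot_def dbl_def\<close>)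
    then show ?thesis by (simp add: pr_def tot_def)
  qed
qed

text \<open>The target degree is a separate variable \<open>m\<close>, so the rule also matches
  where the two degrees are written \<open>n\<close> and \<open>n + 1\<close>, as happens for
  homotopies.\<close>

lemma tot_diff_Cmp:
  assumes "int p + int q = m" "m = n - 1" "x \<in> Arr E" "Cod E x = CObj (Tot P Q) n"
  shows "pr P Q m p q \<cdot> (CDif (Tot P Q) n \<cdot> x) =
      AMap F (RDif P p, Ide D (RObj Q q)) \<cdot> (pr P Q n (Suc p) q \<cdot> x) \<oplus>
      sign_arr E p (AMap F (Ide C (RObj P p), RDif Q q) \<cdot> (pr P Q n p (Suc q) \<cdot> x))"
proof -
  note R = res_pairD[OF PQ]
  have i: "int p + int q = n - 1" using assms by simp
  have i1: "int (Suc p) + int q = n" "int p + int (Suc q) = n" using i by simp_all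
  show ?thesis
    using E.Cmp_reassoc1[OF tot_diff(4)[OF i], of x] tot_diff(1-3) pr_arr[OF i] pr_arr[OF i1(1)]
        pr_arr[OF i1(2)] R assms(2-4)
    by simp
qed

lemma complex_tot: "E.complex (Tot P Q)"
  unfolding E.complex_def
proof (intro allI conjI)
  note R = res_pairD[OF PQ]
  fix n
  show "CDif (Tot P Q) n \<in> Hom E (CObj (Tot P Q) n) (CObj (Tot P Q) (n - 1))" using tot_diff by simp
  note Dn = tot_diff(1-3)
  show "CDif (Tot P Q) n \<cdot> CDif (Tot P Q) (n + 1) = Zero E (CObj (Tot P Q) (n + 1)) (CObj (Tot P Q)
      (n - 1))"
  proof (rule tot_ext)
    fix p q assume pq: "int p + int q = n - 1"
    have i: "int (Suc p) + int q = n + 1 - 1" "int p + int (Suc q) = n + 1 - 1" "int (Suc (Suc p)) +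
        int q = n + 1"
      "int (Suc p) + int (Suc q) = n + 1" "int p + int (Suc (Suc q)) = n + 1" using pq by simp_all
    have "pr P Q (n - 1) p q \<cdot> (CDif (Tot P Q) n \<cdot> CDif (Tot P Q) (n + 1)) =
      AMap F (RDif P p, Ide D (RObj Q q)) \<cdot> (pr P Q n (Suc p) q \<cdot> CDif (Tot P Q) (n + 1)) \<oplus>
      sign_arr E p (AMap F (Ide C (RObj P p), RDif Q q) \<cdot> (pr P Q n p (Suc q) \<cdot> CDif (Tot P Q) (n +
          1)))"
      by (rule tot_diff_Cmp[OF pq]) (use Dn in simp_all)
    also have "pr P Q n (Suc p) q \<cdot> CDif (Tot P Q) (n + 1) = AMap F (RDif P (Suc p), Ide D (RObj Q
        q)) \<cdot> pr P Q (n + 1) (Suc (Suc p)) q \<oplus>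
      sign_arr E (Suc p) (AMap F (Ide C (RObj P (Suc p)), RDif Q q) \<cdot> pr P Q (n + 1) (Suc p) (Suc
          q))"
      using tot_diff(4)[OF i(1)] by simp
    also have "pr P Q n p (Suc q) \<cdot> CDif (Tot P Q) (n + 1) = AMap F (RDif P p, Ide D (RObj Q (Suc
        q))) \<cdot> pr P Q (n + 1) (Suc p) (Suc q) \<oplus>
      sign_arr E p (AMap F (Ide C (RObj P p), RDif Q (Suc q)) \<cdot> pr P Q (n + 1) p (Suc (Suc q)))"
      using tot_diff(4)[OF i(2)] by simp
    \<comment> \<open>The two pure terms vanish because the resolutions are complexes. The two mixed
      terms are the same \<open>F(d, d)\<close> with the signs of \<open>Suc p\<close> and
      \<open>p\<close>, hence cancel.\<close>
    also have "AMap F (RDif P p, Ide D (RObj Q q)) \<cdot> (AMap F (RDif P (Suc p), Ide D (RObj Q q)) \<cdot> pr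
        P Q (n + 1) (Suc (Suc p)) q \<oplus>
        sign_arr E (Suc p) (AMap F (Ide C (RObj P (Suc p)), RDif Q q) \<cdot> pr P Q (n + 1) (Suc p) (Suc
            q))) \<oplus>
      sign_arr E p (AMap F (Ide C (RObj P p), RDif Q q) \<cdot> (AMap F (RDif P p, Ide D (RObj Q (Suc q)))
          \<cdot> pr P Q (n + 1) (Suc p) (Suc q) \<oplus>
        sign_arr E p (AMap F (Ide C (RObj P p), RDif Q (Suc q)) \<cdot> pr P Q (n + 1) p (Suc (Suc q)))))
            =
      Zero E (CObj (Tot P Q) (n + 1)) (OMap F (RObj P p, RObj Q q))"
      using pr_arr[OF i(3)] pr_arr[OF i(4)] pr_arr[OF i(5)] R tot_Obj by simp
    finally show "pr P Q (n - 1) p q \<cdot> (CDif (Tot P Q) n \<cdot> CDif (Tot P Q) (n + 1)) =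
      pr P Q (n - 1) p q \<cdot> Zero E (CObj (Tot P Q) (n + 1)) (CObj (Tot P Q) (n - 1))"
      using pr_arr[OF pq] tot_Obj by simp
  qed (use Dn tot_Obj in simp_all)
qed

end

end

section \<open>Lifts of arrows and of short exact sequences to resolutions\<close>

definition lifts :: "('o, 'a, 'x) addcat_scheme \<Rightarrow> ('o, 'a) resol \<Rightarrow> ('o, 'a) resol \<Rightarrow> 'a \<Rightarrow> (nat \<Rightarrow> 'a)
    \<Rightarrow> bool" where
  "lifts C P P' f \<phi> \<longleftrightarrow> f \<in> Arr C \<and> is_proj_resolution C (Dom C f) P \<and> is_proj_resolution C (Cod C f)
      P' \<and>
     is_resolution_map C P P' f \<phi>"

text \<open>Compatibility with differentials is left out on purpose: retractions and sections of a
  degreewise splitting are of this kind without being chain maps in general.\<close>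

definition degreewise :: "('o, 'a, 'x) addcat_scheme \<Rightarrow> ('o, 'a) resol \<Rightarrow> ('o, 'a) resol \<Rightarrow> (nat \<Rightarrow> 'a)
    \<Rightarrow> bool" where
  "degreewise C P P' \<phi> \<longleftrightarrow> (\<forall>n. \<phi> n \<in> Hom C (RObj P n) (RObj P' n))"

lemma degreewiseD:
  assumes "degreewise C P P' \<phi>"
  shows "\<phi> n \<in> Arr C" "Dom C (\<phi> n) = RObj P n" "Cod C (\<phi> n) = RObj P' n"
  using assms by (auto simp: degreewise_def)

context abelian_category
begin

lemma lifts_degreewise: "lifts C P P' f \<phi> \<Longrightarrow> degreewise C P P' \<phi>"
  by (auto simp: lifts_def degreewise_def is_resolution_map_def)

lemma lifts_Cmp:
  assumes "lifts C P P' f \<phi>" "lifts C P' P'' g \<psi>" "Cod C f = Dom C g"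
  shows "lifts C P P'' (g \<cdot> f) (\<lambda>n. \<psi> n \<cdot> \<phi> n)"
  using assms resolution_map_Cmp[of "Dom C f" P "Cod C f" P' "Cod C g" P'' f \<phi> g \<psi>] by (simp add:
      lifts_def)

lemma lifts_Ide: "is_proj_resolution C X P \<Longrightarrow> lifts C P P (Ide C X) (res_id C P)"
  using resolution_map_Ide[of X P] resolutionD(10)[of X P] by (simp add: lifts_def)

lemma lifts_res_map: "\<lbrakk>enough_projectives C; f \<in> Arr C\<rbrakk> \<Longrightarrow> lifts C (res C (Dom C f)) (res C (Cod C
    f)) f (res_map C f)"
  using res_map resolution_exists by (simp add: lifts_def)

lemma lifts_exists:
  assumes "is_proj_resolution C (Dom C f) P" "is_proj_resolution C (Cod C f) P'" "f \<in> Arr C"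
  obtains \<phi> where "lifts C P P' f \<phi>"
  using resolution_map_exists[OF assms(1,2), of f] assms by (auto simp: lifts_def)

lemma degreewise_Cmp:
  "\<lbrakk>degreewise C P P' \<phi>; degreewise C P' P'' \<psi>\<rbrakk> \<Longrightarrow> degreewise C P P'' (\<lambda>n. \<psi> n \<cdot> \<phi> n)"
  by (simp add: degreewise_def)

lemma degreewise_res_id: "(\<And>n. RObj P n \<in> Obj C) \<Longrightarrow> degreewise C P P (res_id C P)"
  by (simp add: degreewise_def res_id_def)

lemma horseshoe_lifts:
  assumes "short_exact C f g" "enough_projectives C" "horseshoe C f g = (R, i, p)"
  shows "lifts C (res C (Dom C f)) R f i" "lifts C R (res C (Cod C g)) g p" "Cod C f = Dom C g"
    "f \<in> Arr C" "g \<in> Arr C" "\<exists>r s. \<forall>n. split_exact (i n) (p n) (r n) (s n)"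
proof -
  note H = horseshoe[OF assms]
  have "exact_at C f g" using assms(1) by (simp add: short_exact_def)
  from exact_atD[OF this] show fg: "f \<in> Arr C" "g \<in> Arr C" "Cod C f = Dom C g" by simp_all
  show "lifts C (res C (Dom C f)) R f i" "lifts C R (res C (Cod C g)) g p"
    using H fg resolution_exists[OF assms(2)] by (simp_all add: lifts_def)
  have "\<exists>r s. split_exact (i n) (p n) r s" for n
    using short_exact_split[OF H(4)] resolutionD(1)[OF resolution_exists[OF assms(2)], of "Cod C g"]
      resolution_mapD(3)[OF H(3)] fg by (metis Cod_Obj)
  then show "\<exists>r s. \<forall>n. split_exact (i n) (p n) (r n) (s n)" by metis
qed

text \<open>Supplies the strict squares that \<open>connecting_natural\<close> asks for. The lift
  \<open>\<kappa>\<close> of the left-hand arrow is prescribed and will be the chosen one. The lift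
  \<open>\<rho>\<close> on the right is whatever the middle map induces, which is enough because
  homology sees only the arrow it lifts.\<close>

lemma horseshoe_map:
  assumes "short_exact_map C f g f' g' l m t" "enough_projectives C"
    and "horseshoe C f g = (R, i, p)" "horseshoe C f' g' = (R', i', p')"
    and "lifts C (res C (Dom C l)) (res C (Cod C l)) l \<kappa>"
  obtains \<mu> \<rho> where "lifts C R R' m \<mu>" "lifts C (res C (Dom C t)) (res C (Cod C t)) t \<rho>"
    "\<And>n. \<mu> n \<cdot> i n = i' n \<cdot> \<kappa> n" "\<And>n. \<rho> n \<cdot> p n = p' n \<cdot> \<mu> n"
proof -
  have se: "short_exact C f g" "short_exact C f' g'" and sq: "comm_square C f l m f'" "comm_square C
      g m t g'"
    using assms(1) by (auto simp: short_exact_map_def)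
  note H = horseshoe_lifts[OF se(1) assms(2,3)] and H' = horseshoe_lifts[OF se(2) assms(2,4)]
  have T: "f \<in> Hom C (Dom C l) (Dom C m)" "f' \<in> Hom C (Cod C l) (Cod C m)" "g \<in> Hom C (Dom C m) (Dom
      C t)"
    "g' \<in> Hom C (Cod C m) (Cod C t)" "l \<in> Arr C" "m \<in> Arr C" "t \<in> Arr C" "m \<cdot> f = f' \<cdot> l" "t \<cdot> g =
        g' \<cdot> m"
    using sq by (auto simp: comm_square_def)
  obtain r s where S: "\<And>n. split_exact (i n) (p n) (r n) (s n)" using H(6) by blast
  obtain r' s' where S': "\<And>n. split_exact (i' n) (p' n) (r' n) (s' n)" using H'(6) by blast
  have L: "lifts C (res C (Dom C l)) R f i" "lifts C R (res C (Dom C t)) g p"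
    "lifts C (res C (Cod C l)) R' f' i'" "lifts C R' (res C (Cod C t)) g' p'"
    using H(1,2) H'(1,2) T by simp_all
  \<comment> \<open>Following \<open>\<kappa>\<close> by the inclusion \<open>i'\<close> gives a
    lift of \<open>f' \<cdot> l = m \<cdot> f\<close>, which is the restriction to be extended over
    the middle resolution.\<close>
  have k: "lifts C (res C (Dom C l)) R' (m \<cdot> f) (\<lambda>n. i' n \<cdot> \<kappa> n)"
    unfolding T(8) by (rule lifts_Cmp[OF assms(5) L(3)]) (use T in simp)
  note LD = L[unfolded lifts_def] and kD = k[unfolded lifts_def] and aD = assms(5)[unfolded
      lifts_def]
  have pR: "is_proj_resolution C (Dom C m) R" "is_proj_resolution C (Cod C m) R'"
      "is_proj_resolution C (Dom C l) (res C (Dom C l))"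
    "is_proj_resolution C (Dom C t) (res C (Dom C t))" "is_proj_resolution C (Cod C l) (res C (Cod C
        l))"
    "is_proj_resolution C (Cod C t) (res C (Cod C t))"
    using LD T by simp_all
  have pT: "Cod C (p n) = RObj (res C (Dom C t)) n" for n
    using resolution_mapD(3)[of R "res C (Dom C t)" g p n] LD(2) by blast
  have fT: "f \<in> Hom C (Dom C l) (Dom C m)" and mT: "m \<in> Hom C (Dom C m) (Cod C m)" using T by
      simp_all
  obtain \<mu> where mu: "is_resolution_map C R R' m \<mu>" "\<And>n. \<mu> n \<cdot> i n = i' n \<cdot> \<kappa> n"
    using resolution_map_extend[OF pR(1,2,3,4) _ fT S pT _ mT] LD(1) kD by blast
  have z: "p' n \<cdot> i' n = Zero C (RObj (res C (Cod C l)) n) (RObj (res C (Cod C t)) n)" for n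
    using split_exactD(12)[OF S'[of n]] resolution_mapD(2)[of "res C (Cod C l)" R' f' i' n]
      resolution_mapD(3)[of R' "res C (Cod C t)" g' p' n] LD(3,4) by simp
  obtain \<rho> where "is_resolution_map C (res C (Dom C t)) (res C (Cod C t)) t \<rho>" "\<And>n. \<rho> n \<cdot> p n = p' n
      \<cdot> \<mu> n"
    by (rule resolution_map_quotient[OF pR(1,2,3,4,5,6) _ _ _ _ S z mu(1) _ mu(2), of f g f' g' l
        t])
      (use LD aD T in auto)
  then show thesis
    using that[of \<mu> \<rho>] mu pR T by (simp add: lifts_def)
qed

end

section \<open>Maps and homotopies between total complexes\<close>

context bifunctor
begin

lemma lifts_res_pair:
  assumes "lifts C P P' f \<phi>" "lifts D Q Q' g \<psi>"
  shows "res_pair P Q" "res_pair P' Q'" "res_pair P' Q" "res_pair P Q'"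
  using assms by (auto simp: lifts_def intro: res_pairI)

context
  fixes P Q P' Q' \<phi> \<psi>
  assumes PQ: "res_pair P Q" and PQ': "res_pair P' Q'"
    and \<phi>: "degreewise C P P' \<phi>" and \<psi>: "degreewise D Q Q' \<psi>"
begin

lemma tot_map_arr:
  shows "tot_map E F P Q P' Q' \<phi> \<psi> n \<in> Arr E" "Dom E (tot_map E F P Q P' Q' \<phi> \<psi> n) = CObj (Tot P Q)
      n"
    "Cod E (tot_map E F P Q P' Q' \<phi> \<psi> n) = CObj (Tot P' Q') n"
  and pr_tot_map: "int p + int q = n \<Longrightarrow>
    pr P' Q' n p q \<cdot> tot_map E F P Q P' Q' \<phi> \<psi> n = AMap F (\<phi> p, \<psi> q) \<cdot> pr P Q n p q"
proof -
  note R = res_pairD[OF PQ] and R' = res_pairD[OF PQ'] and f = degreewiseD[OF \<phi>] and g =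
      degreewiseD[OF \<psi>]
  let ?m = "\<lambda>(p, q) (p', q'). if p = p' \<and> q = q' then AMap F (\<phi> p, \<psi> q)
          else Zero E (dbl F P Q (p, q)) (dbl F P' Q' (p', q'))"
  have m: "?m s t \<in> Hom E (dbl F P Q s) (dbl F P' Q' t)" if "s \<in> tot_index n" "t \<in> tot_index n" for
      s t
    using R R' f g by (cases s; cases t) (auto simp: dbl_def)
  have M: "matrix_arr E (tot_index n) (dbl F P Q) (tot_index n) (dbl F P' Q') ?m
      \<in> Hom E (biprod E (tot_index n) (dbl F P Q)) (biprod E (tot_index n) (dbl F P' Q'))"
    by (rule E.matrix_arr(1)) (fact finite_tot_index dbl_Obj[OF PQ] dbl_Obj[OF PQ'] m)+
  then show "tot_map E F P Q P' Q' \<phi> \<psi> n \<in> Arr E" "Dom E (tot_map E F P Q P' Q' \<phi> \<psi> n) = CObj (Tot P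
      Q) n"
    "Cod E (tot_map E F P Q P' Q' \<phi> \<psi> n) = CObj (Tot P' Q') n"
    by (simp_all add: tot_map_def tot_def)
  show "pr P' Q' n p q \<cdot> tot_map E F P Q P' Q' \<phi> \<psi> n = AMap F (\<phi> p, \<psi> q) \<cdot> pr P Q n p q" (is "_ =
      ?h")
    if pq: "int p + int q = n"
  proof -
    note T = pr_arr[OF PQ pq]
    have h: "?h \<in> Hom E (CObj (Tot P Q) n) (OMap F (RObj P' p, RObj Q' q))"
      using T R R' f g by simp
    have "?h \<cdot> inj_arr E (tot_index n) (dbl F P Q) s = ?m s (p, q)" if s: "s \<in> tot_index n" for s
    proof -
      obtain p' q' where s': "s = (p', q')" by (cases s)
      have i2: "int p' + int q' = n" using s s' by (simp add: tot_index_iff)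
      note J = tot_inj(1)[OF PQ i2 i2] tot_inj(2)[OF PQ i2 pq]
      show ?thesis
        unfolding s' using J T R R' f g by (auto simp: dbl_def)
    qed
    then have "proj_arr E (tot_index n) (dbl F P' Q') (p, q) \<cdot>
        matrix_arr E (tot_index n) (dbl F P Q) (tot_index n) (dbl F P' Q') ?m = ?h"
      by (intro E.proj_matrix_arr[where X = "dbl F P Q" and Y = "dbl F P' Q'"] finite_tot_index
          dbl_Obj[OF PQ] dbl_Obj[OF PQ'] m)
        (use h pq in \<open>auto simp: tot_index_iff tot_def dbl_def\<close>)
    then show ?thesis by (simp add: pr_def tot_map_def)
  qed
qed

lemma pr_tot_map_Cmp:
  assumes "int p + int q = n" "x \<in> Arr E" "Cod E x = CObj (Tot P Q) n"
  shows "pr P' Q' n p q \<cdot> (tot_map E F P Q P' Q' \<phi> \<psi> n \<cdot> x) = AMap F (\<phi> p, \<psi> q) \<cdot> (pr P Q n p q \<cdot>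
      x)"
  by (rule E.Cmp_reassoc[OF pr_tot_map[OF assms(1)]])
    (use assms tot_map_arr pr_arr[OF PQ assms(1)] pr_arr[OF PQ' assms(1)] degreewiseD[OF \<phi>]
        degreewiseD[OF \<psi>] in simp_all)

end

lemma tot_map_Cmp:
  assumes "res_pair P Q" "res_pair P' Q'" "res_pair P'' Q''" "degreewise C P P' \<phi>" "degreewise D Q
      Q' \<psi>"
    "degreewise C P' P'' \<phi>'" "degreewise D Q' Q'' \<psi>'"
  shows "tot_map E F P' Q' P'' Q'' \<phi>' \<psi>' n \<cdot> tot_map E F P Q P' Q' \<phi> \<psi> n =
    tot_map E F P Q P'' Q'' (\<lambda>p. \<phi>' p \<cdot>\<^bsub>C\<^esub> \<phi> p) (\<lambda>q. \<psi>' q \<cdot>\<^bsub>D\<^esub> \<psi> q) n"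
proof (rule tot_ext[OF assms(3), where W = "CObj (Tot P Q) n"])
  note d = C.degreewise_Cmp[OF assms(4,6)] D.degreewise_Cmp[OF assms(5,7)]
  note T = tot_map_arr[OF assms(1,2,4,5), where n = n] tot_map_arr[OF assms(2,3,6,7), where n = n]
    tot_map_arr[OF assms(1,3) d, where n = n]
  show "tot_map E F P' Q' P'' Q'' \<phi>' \<psi>' n \<cdot> tot_map E F P Q P' Q' \<phi> \<psi> n \<in> Hom E (CObj (Tot P Q) n)
      (CObj (Tot P'' Q'') n)"
    "tot_map E F P Q P'' Q'' (\<lambda>p. \<phi>' p \<cdot>\<^bsub>C\<^esub> \<phi> p) (\<lambda>q. \<psi>' q \<cdot>\<^bsub>D\<^esub> \<psi> q) n \<in> Hom E (CObj (Tot P Q) n)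
        (CObj (Tot P'' Q'') n)"
    using T by simp_all
  show "pr P'' Q'' n p q \<cdot> (tot_map E F P' Q' P'' Q'' \<phi>' \<psi>' n \<cdot> tot_map E F P Q P' Q' \<phi> \<psi> n) =
    pr P'' Q'' n p q \<cdot> tot_map E F P Q P'' Q'' (\<lambda>p. \<phi>' p \<cdot>\<^bsub>C\<^esub> \<phi> p) (\<lambda>q. \<psi>' q \<cdot>\<^bsub>D\<^esub> \<psi> q) n"
    if pq: "int p + int q = n" for p q
    using pr_tot_map_Cmp[OF assms(2,3,6,7) pq, of "tot_map E F P Q P' Q' \<phi> \<psi> n"] pr_tot_map[OF
        assms(1,2,4,5) pq]
      pr_tot_map[OF assms(1,3) d pq] T pr_arr[OF assms(1) pq] degreewiseD[OF assms(4)]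
          degreewiseD[OF assms(5)]
      degreewiseD[OF assms(6)] degreewiseD[OF assms(7)] by simp
qed

lemma tot_map_Ide:
  assumes "res_pair P Q"
  shows "tot_map E F P Q P Q (res_id C P) (res_id D Q) n = Ide E (CObj (Tot P Q) n)"
proof (rule tot_ext[OF assms, where W = "CObj (Tot P Q) n"])
  note R = res_pairD[OF assms]
  note d = C.degreewise_res_id[of P, OF R(1)] D.degreewise_res_id[of Q, OF R(5)]
  show "tot_map E F P Q P Q (res_id C P) (res_id D Q) n \<in> Hom E (CObj (Tot P Q) n) (CObj (Tot P Q)
      n)"
    "Ide E (CObj (Tot P Q) n) \<in> Hom E (CObj (Tot P Q) n) (CObj (Tot P Q) n)"
    using tot_map_arr[OF assms assms d] tot_Obj[OF assms] by simp_all
  show "pr P Q n p q \<cdot> tot_map E F P Q P Q (res_id C P) (res_id D Q) n = pr P Q n p q \<cdot> Ide E (CObj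
      (Tot P Q) n)"
    if pq: "int p + int q = n" for p q
    using pr_tot_map[OF assms assms d pq] pr_arr[OF assms pq] R by (simp add: res_id_def)
qed

lemma chain_map_tot_map:
  assumes "lifts C P P' f \<phi>" "lifts D Q Q' g \<psi>"
  shows "E.chain_map (Tot P Q) (Tot P' Q') (tot_map E F P Q P' Q' \<phi> \<psi>)"
  unfolding E.chain_map_def
proof (intro allI conjI)
  fix n
  note PQ = lifts_res_pair(1)[OF assms] and PQ' = lifts_res_pair(2)[OF assms]
  note R = res_pairD[OF PQ] and R' = res_pairD[OF PQ']
  note d = C.lifts_degreewise[OF assms(1)] D.lifts_degreewise[OF assms(2)]
  note f = degreewiseD[OF d(1)] and g = degreewiseD[OF d(2)]
  have fd: "RDif P' p \<cdot>\<^bsub>C\<^esub> \<phi> (Suc p) = \<phi> p \<cdot>\<^bsub>C\<^esub> RDif P p" for p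
    using assms(1) C.resolution_mapD(5) by (auto simp: lifts_def)
  have gd: "RDif Q' q \<cdot>\<^bsub>D\<^esub> \<psi> (Suc q) = \<psi> q \<cdot>\<^bsub>D\<^esub> RDif Q q" for q
    using assms(2) D.resolution_mapD(5) by (auto simp: lifts_def)
  note T = tot_map_arr[OF PQ PQ' d]
  show "tot_map E F P Q P' Q' \<phi> \<psi> n \<in> Hom E (CObj (Tot P Q) n) (CObj (Tot P' Q') n)" using T by simp
  note Dn = tot_diff(1-3)[OF PQ] tot_diff(1-3)[OF PQ']
  show "CDif (Tot P' Q') n \<cdot> tot_map E F P Q P' Q' \<phi> \<psi> n = tot_map E F P Q P' Q' \<phi> \<psi> (n - 1) \<cdot> CDif
      (Tot P Q) n"
  proof (rule tot_ext[OF PQ', where W = "CObj (Tot P Q) n"])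
    fix p q assume pq: "int p + int q = n - 1"
    have i: "int (Suc p) + int q = n" "int p + int (Suc q) = n" using pq by simp_all
    note X = pr_arr[OF PQ i(1)] pr_arr[OF PQ i(2)]
    show "pr P' Q' (n - 1) p q \<cdot> (CDif (Tot P' Q') n \<cdot> tot_map E F P Q P' Q' \<phi> \<psi> n) =
      pr P' Q' (n - 1) p q \<cdot> (tot_map E F P Q P' Q' \<phi> \<psi> (n - 1) \<cdot> CDif (Tot P Q) n)"
      using tot_diff_Cmp[OF PQ' pq refl, of "tot_map E F P Q P' Q' \<phi> \<psi> n"] pr_tot_map[OF PQ PQ' d
          i(1)] pr_tot_map[OF PQ PQ' d i(2)]
        pr_tot_map_Cmp[OF PQ PQ' d pq, of "CDif (Tot P Q) n"] tot_diff(4)[OF PQ pq] T Dn X R R' f g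
            fd gd
      by simp
  qed (use Dn T in simp_all)
qed

text \<open>A homotopy \<open>s\<close> between two lifts in the first variable induces one on total
  complexes by \<open>F(s, \<psi>)\<close>, with no sign. The first differential reproduces the
  homotopy formula, and the second contributes two terms that cancel.\<close>

lemma tot_map_homotopic_left:
  assumes "lifts C P P' f \<phi>" "lifts C P P' f \<phi>'" "lifts D Q Q' g \<psi>"
  obtains S where "\<And>n. S n \<in> Hom E (CObj (Tot P Q) n) (CObj (Tot P' Q') (n + 1))"
    "\<And>n. tot_map E F P Q P' Q' \<phi> \<psi> n = tot_map E F P Q P' Q' \<phi>' \<psi> n \<oplus>
      (CDif (Tot P' Q') (n + 1) \<cdot> S n \<oplus> S (n - 1) \<cdot> CDif (Tot P Q) n)"
proof -
  note PQ = lifts_res_pair(1)[OF assms(1,3)] and PQ' = lifts_res_pair(2)[OF assms(1,3)]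
  note R = res_pairD[OF PQ] and R' = res_pairD[OF PQ']
  note d = C.lifts_degreewise[OF assms(1)] C.lifts_degreewise[OF assms(2)] D.lifts_degreewise[OF
      assms(3)]
  note fg = degreewiseD[OF d(1)] degreewiseD[OF d(2)] degreewiseD[OF d(3)]
  note l = assms(1,2)[unfolded lifts_def]
  have gd: "RDif Q' q \<cdot>\<^bsub>D\<^esub> \<psi> (Suc q) = \<psi> q \<cdot>\<^bsub>D\<^esub> RDif Q q" for q
    using assms(3) D.resolution_mapD(5) by (auto simp: lifts_def)
  obtain s where s: "\<And>n. s n \<in> Hom C (RObj P n) (RObj P' (Suc n))" "\<phi> 0 = \<phi>' 0 \<oplus>\<^bsub>C\<^esub> RDif P' 0 \<cdot>\<^bsub>C\<^esub> s
      0"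
    "\<And>n. \<phi> (Suc n) = \<phi>' (Suc n) \<oplus>\<^bsub>C\<^esub> (RDif P' (Suc n) \<cdot>\<^bsub>C\<^esub> s (Suc n) \<oplus>\<^bsub>C\<^esub> s n \<cdot>\<^bsub>C\<^esub> RDif P n)"
    using C.resolution_map_homotopy[of "Dom C f" P "Cod C f" P' f \<phi> \<phi>'] l by blast
  \<comment> \<open>The homotopy raises the first index by one, so the summand with first index 0
    receives nothing; summand \<open>(Suc p, q)\<close> receives from \<open>(p, q)\<close>.\<close>
  let ?h = "\<lambda>n p q. case p of 0 \<Rightarrow> Zero E (CObj (Tot P Q) n) (OMap F (RObj P' 0, RObj Q' q))
    | Suc p \<Rightarrow> AMap F (s p, \<psi> q) \<cdot> pr P Q n p q"
  have "\<exists>x. x \<in> Hom E (CObj (Tot P Q) n) (CObj (Tot P' Q') (n + 1)) \<and>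
      (\<forall>p q. int p + int q = n + 1 \<longrightarrow> pr P' Q' (n + 1) p q \<cdot> x = ?h n p q)" for n
  proof (rule tot_exists[OF PQ' _ tot_Obj[OF PQ]])
    fix p q assume pq: "int p + int q = n + 1"
    show "?h n p q \<in> Hom E (CObj (Tot P Q) n) (OMap F (RObj P' p, RObj Q' q))"
    proof (cases p)
      case (Suc p')
      then have "int p' + int q = n" using pq by simp
      from pr_arr[OF PQ this] show ?thesis using Suc s(1) fg R R' by simp
    qed (use R' tot_Obj[OF PQ] in simp)
  qed
  then have "\<exists>S. \<forall>n. S n \<in> Hom E (CObj (Tot P Q) n) (CObj (Tot P' Q') (n + 1)) \<and>
      (\<forall>p q. int p + int q = n + 1 \<longrightarrow> pr P' Q' (n + 1) p q \<cdot> S n = ?h n p q)"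
    by (intro choice allI)
  then obtain S where S: "\<And>n. S n \<in> Hom E (CObj (Tot P Q) n) (CObj (Tot P' Q') (n + 1))"
    "\<And>n p q. int p + int q = n + 1 \<Longrightarrow> pr P' Q' (n + 1) p q \<cdot> S n = ?h n p q"
    by blast
  note T = tot_map_arr[OF PQ PQ' d(1,3)] tot_map_arr[OF PQ PQ' d(2,3)] tot_diff(1-3)[OF PQ]
      tot_diff(1-3)[OF PQ']
  have S': "S (n - 1) \<in> Arr E" "Dom E (S (n - 1)) = CObj (Tot P Q) (n - 1)" "Cod E (S (n - 1)) =
      CObj (Tot P' Q') n"
    "\<And>p q. int p + int q = n \<Longrightarrow> pr P' Q' n p q \<cdot> S (n - 1) = ?h (n - 1) p q" for n
    using S(1)[of "n - 1"] S(2)[where n = "n - 1"] by simp_all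
  have "tot_map E F P Q P' Q' \<phi> \<psi> n = tot_map E F P Q P' Q' \<phi>' \<psi> n \<oplus>
      (CDif (Tot P' Q') (n + 1) \<cdot> S n \<oplus> S (n - 1) \<cdot> CDif (Tot P Q) n)" for n
  proof (rule tot_ext[OF PQ', where W = "CObj (Tot P Q) n"])
    fix p q assume pq: "int p + int q = n"
    have i: "int (Suc p) + int q = n + 1" "int p + int (Suc q) = n + 1" using pq by simp_all
    note X = pr_arr[OF PQ pq] and X' = pr_arr[OF PQ' pq]
    note eqs = pr_tot_map[OF PQ PQ' d(1,3) pq] pr_tot_map[OF PQ PQ' d(2,3) pq]
    have a: "pr P' Q' n p q \<cdot> (CDif (Tot P' Q') (n + 1) \<cdot> S n) = AMap F (RDif P' p \<cdot>\<^bsub>C\<^esub> s p, \<psi> q) \<cdot>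
        pr P Q n p q \<oplus>
      sign_arr E p (AMap F (Ide C (RObj P' p), RDif Q' q) \<cdot> ?h n p (Suc q))"
      using tot_diff_Cmp[OF PQ' pq, of "n + 1" "S n"] S(1)[of n] S(2)[OF i(1)] S(2)[OF i(2)] X R R'
          fg s(1) by simp
    have b: "pr P' Q' n p q \<cdot> (S (n - 1) \<cdot> CDif (Tot P Q) n) = ?h (n - 1) p q \<cdot> CDif (Tot P Q) n"
      by (rule E.Cmp_reassoc1[OF S'(4)[OF pq]]) (use S'(1-3) X' T in simp_all)
    have e: "pr P' Q' n p q \<cdot> (tot_map E F P Q P' Q' \<phi>' \<psi> n \<oplus> (CDif (Tot P' Q') (n + 1) \<cdot> S n \<oplus> S (n
        - 1) \<cdot> CDif (Tot P Q) n)) =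
      AMap F (\<phi>' p, \<psi> q) \<cdot> pr P Q n p q \<oplus> (pr P' Q' n p q \<cdot> (CDif (Tot P' Q') (n + 1) \<cdot> S n) \<oplus> pr P'
          Q' n p q \<cdot> (S (n - 1) \<cdot> CDif (Tot P Q) n))"
      using eqs(2) S(1)[of n] S'(1-3)[of n] T X' by simp
    show "pr P' Q' n p q \<cdot> tot_map E F P Q P' Q' \<phi> \<psi> n =
      pr P' Q' n p q \<cdot> (tot_map E F P Q P' Q' \<phi>' \<psi> n \<oplus> (CDif (Tot P' Q') (n + 1) \<cdot> S n \<oplus> S (n - 1) \<cdot>
          CDif (Tot P Q) n))"
    proof (cases p)
      case 0
      show ?thesis
        unfolding e a b unfolding eqs using 0 X R R' fg s(1) T tot_Obj[OF PQ] by (simp add: s(2))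
    next
      case (Suc p')
      have j: "int p' + int q = n - 1" and j2: "int p' + int (Suc q) = n" using pq Suc by simp_all
      note Y = pr_arr[OF PQ j] pr_arr[OF PQ j2]
      \<comment> \<open>The second term here carries the sign of \<open>p'\<close>, while its
        counterpart from the other order of composition carries that of \<open>Suc p'\<close>. Since
        \<open>\<psi>\<close> commutes with the differentials, the two cancel.\<close>
      have "AMap F (s p', \<psi> q) \<cdot> pr P Q (n - 1) p' q \<cdot> CDif (Tot P Q) n =
        AMap F (s p' \<cdot>\<^bsub>C\<^esub> RDif P p', \<psi> q) \<cdot> pr P Q n p q \<oplus> sign_arr E p' (AMap F (s p', \<psi> q \<cdot>\<^bsub>D\<^esub>
            RDif Q q) \<cdot> pr P Q n p' (Suc q))"
        using tot_diff(4)[OF PQ j] Y X[unfolded Suc] R R' fg s(1) T by (simp add: Suc)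
      then show ?thesis
        unfolding e a b unfolding eqs using X[unfolded Suc] Y R R' fg s(1) gd T by (simp add: Suc
            s(3) E.Add_ac)
    qed
  qed (use T S(1)[of n] S'(1-3)[of n] in simp_all)
  then show thesis using that S(1) by blast
qed

text \<open>The same in the second variable, except that the homotopy must carry a sign to
  compensate for the one in the second differential.\<close>

lemma tot_map_homotopic_right:
  assumes "lifts C P P' f \<phi>" "lifts D Q Q' g \<psi>" "lifts D Q Q' g \<psi>'"
  obtains S where "\<And>n. S n \<in> Hom E (CObj (Tot P Q) n) (CObj (Tot P' Q') (n + 1))"
    "\<And>n. tot_map E F P Q P' Q' \<phi> \<psi> n = tot_map E F P Q P' Q' \<phi> \<psi>' n \<oplus>
      (CDif (Tot P' Q') (n + 1) \<cdot> S n \<oplus> S (n - 1) \<cdot> CDif (Tot P Q) n)"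
proof -
  note PQ = lifts_res_pair(1)[OF assms(1,2)] and PQ' = lifts_res_pair(2)[OF assms(1,2)]
  note R = res_pairD[OF PQ] and R' = res_pairD[OF PQ']
  note d = C.lifts_degreewise[OF assms(1)] D.lifts_degreewise[OF assms(2)] D.lifts_degreewise[OF
      assms(3)]
  note fg = degreewiseD[OF d(1)] degreewiseD[OF d(2)] degreewiseD[OF d(3)]
  note l = assms(2,3)[unfolded lifts_def]
  have fd: "RDif P' p \<cdot>\<^bsub>C\<^esub> \<phi> (Suc p) = \<phi> p \<cdot>\<^bsub>C\<^esub> RDif P p" for p
    using assms(1) C.resolution_mapD(5) by (auto simp: lifts_def)
  obtain s where s: "\<And>n. s n \<in> Hom D (RObj Q n) (RObj Q' (Suc n))" "\<psi> 0 = \<psi>' 0 \<oplus>\<^bsub>D\<^esub> RDif Q' 0 \<cdot>\<^bsub>D\<^esub> s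
      0"
    "\<And>n. \<psi> (Suc n) = \<psi>' (Suc n) \<oplus>\<^bsub>D\<^esub> (RDif Q' (Suc n) \<cdot>\<^bsub>D\<^esub> s (Suc n) \<oplus>\<^bsub>D\<^esub> s n \<cdot>\<^bsub>D\<^esub> RDif Q n)"
    using D.resolution_map_homotopy[of "Dom D g" Q "Cod D g" Q' g \<psi> \<psi>'] l by blast
  \<comment> \<open>With the factor \<open>(-1)^p\<close> the sign of the second differential
    squares away on the homotopy terms. The terms with the first differential then have opposite
    signs, because that differential shifts \<open>p\<close> by one.\<close>
  let ?h = "\<lambda>n p q. case q of 0 \<Rightarrow> Zero E (CObj (Tot P Q) n) (OMap F (RObj P' p, RObj Q' 0))
    | Suc q \<Rightarrow> sign_arr E p (AMap F (\<phi> p, s q) \<cdot> pr P Q n p q)"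
  have "\<exists>x. x \<in> Hom E (CObj (Tot P Q) n) (CObj (Tot P' Q') (n + 1)) \<and>
      (\<forall>p q. int p + int q = n + 1 \<longrightarrow> pr P' Q' (n + 1) p q \<cdot> x = ?h n p q)" for n
  proof (rule tot_exists[OF PQ' _ tot_Obj[OF PQ]])
    fix p q assume pq: "int p + int q = n + 1"
    show "?h n p q \<in> Hom E (CObj (Tot P Q) n) (OMap F (RObj P' p, RObj Q' q))"
    proof (cases q)
      case (Suc q')
      then have "int p + int q' = n" using pq by simp
      from pr_arr[OF PQ this] show ?thesis using Suc s(1) fg R R' by simp
    qed (use R' tot_Obj[OF PQ] in simp)
  qed
  then have "\<exists>S. \<forall>n. S n \<in> Hom E (CObj (Tot P Q) n) (CObj (Tot P' Q') (n + 1)) \<and>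
      (\<forall>p q. int p + int q = n + 1 \<longrightarrow> pr P' Q' (n + 1) p q \<cdot> S n = ?h n p q)"
    by (intro choice allI)
  then obtain S where S: "\<And>n. S n \<in> Hom E (CObj (Tot P Q) n) (CObj (Tot P' Q') (n + 1))"
    "\<And>n p q. int p + int q = n + 1 \<Longrightarrow> pr P' Q' (n + 1) p q \<cdot> S n = ?h n p q"
    by blast
  note T = tot_map_arr[OF PQ PQ' d(1,2)] tot_map_arr[OF PQ PQ' d(1,3)] tot_diff(1-3)[OF PQ]
      tot_diff(1-3)[OF PQ']
  have S': "S (n - 1) \<in> Arr E" "Dom E (S (n - 1)) = CObj (Tot P Q) (n - 1)" "Cod E (S (n - 1)) =
      CObj (Tot P' Q') n"
    "\<And>p q. int p + int q = n \<Longrightarrow> pr P' Q' n p q \<cdot> S (n - 1) = ?h (n - 1) p q" for n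
    using S(1)[of "n - 1"] S(2)[where n = "n - 1"] by simp_all
  have "tot_map E F P Q P' Q' \<phi> \<psi> n = tot_map E F P Q P' Q' \<phi> \<psi>' n \<oplus>
      (CDif (Tot P' Q') (n + 1) \<cdot> S n \<oplus> S (n - 1) \<cdot> CDif (Tot P Q) n)" for n
  proof (rule tot_ext[OF PQ', where W = "CObj (Tot P Q) n"])
    fix p q assume pq: "int p + int q = n"
    have i: "int (Suc p) + int q = n + 1" "int p + int (Suc q) = n + 1" using pq by simp_all
    note X = pr_arr[OF PQ pq] and X' = pr_arr[OF PQ' pq]
    note eqs = pr_tot_map[OF PQ PQ' d(1,2) pq] pr_tot_map[OF PQ PQ' d(1,3) pq]
    have a: "pr P' Q' n p q \<cdot> (CDif (Tot P' Q') (n + 1) \<cdot> S n) =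
      AMap F (RDif P' p, Ide D (RObj Q' q)) \<cdot> ?h n (Suc p) q \<oplus> AMap F (\<phi> p, RDif Q' q \<cdot>\<^bsub>D\<^esub> s q) \<cdot> pr
          P Q n p q"
      using tot_diff_Cmp[OF PQ' pq, of "n + 1" "S n"] S(1)[of n] S(2)[OF i(1)] S(2)[OF i(2)] X R R'
          fg s(1) by simp
    have b: "pr P' Q' n p q \<cdot> (S (n - 1) \<cdot> CDif (Tot P Q) n) = ?h (n - 1) p q \<cdot> CDif (Tot P Q) n"
      by (rule E.Cmp_reassoc1[OF S'(4)[OF pq]]) (use S'(1-3) X' T in simp_all)
    have e: "pr P' Q' n p q \<cdot> (tot_map E F P Q P' Q' \<phi> \<psi>' n \<oplus> (CDif (Tot P' Q') (n + 1) \<cdot> S n \<oplus> S (n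
        - 1) \<cdot> CDif (Tot P Q) n)) =
      AMap F (\<phi> p, \<psi>' q) \<cdot> pr P Q n p q \<oplus> (pr P' Q' n p q \<cdot> (CDif (Tot P' Q') (n + 1) \<cdot> S n) \<oplus> pr P'
          Q' n p q \<cdot> (S (n - 1) \<cdot> CDif (Tot P Q) n))"
      using eqs(2) S(1)[of n] S'(1-3)[of n] T X' by simp
    show "pr P' Q' n p q \<cdot> tot_map E F P Q P' Q' \<phi> \<psi> n =
      pr P' Q' n p q \<cdot> (tot_map E F P Q P' Q' \<phi> \<psi>' n \<oplus> (CDif (Tot P' Q') (n + 1) \<cdot> S n \<oplus> S (n - 1) \<cdot>
          CDif (Tot P Q) n))"
    proof (cases q)
      case 0
      show ?thesis
        unfolding e a b unfolding eqs using 0 X R R' fg s(1) T tot_Obj[OF PQ] by (simp add: s(2))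
    next
      case (Suc q')
      have j: "int p + int q' = n - 1" and j2: "int (Suc p) + int q' = n" using pq Suc by simp_all
      note Y = pr_arr[OF PQ j] pr_arr[OF PQ j2]
      have "sign_arr E p (AMap F (\<phi> p, s q') \<cdot> pr P Q (n - 1) p q') \<cdot> CDif (Tot P Q) n =
        sign_arr E p (AMap F (\<phi> p \<cdot>\<^bsub>C\<^esub> RDif P p, s q') \<cdot> pr P Q n (Suc p) q') \<oplus> AMap F (\<phi> p, s q'
            \<cdot>\<^bsub>D\<^esub> RDif Q q') \<cdot> pr P Q n p q"
        using tot_diff(4)[OF PQ j] Y X[unfolded Suc] R R' fg s(1) T by (simp add: Suc)
      then show ?thesis
        unfolding e a b unfolding eqs using X[unfolded Suc] Y R R' fg s(1) fd T by (simp add: Suc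
            s(3) E.Add_ac)
    qed
  qed (use T S(1)[of n] S'(1-3)[of n] in simp_all)
  then show thesis using that S(1) by blast
qed

section \<open>Induced maps on the homology of total complexes\<close>

abbreviation Hmap where
  "Hmap P Q P' Q' \<phi> \<psi> n \<equiv> homology_map E (Tot P Q) (Tot P' Q') (tot_map E F P Q P' Q' \<phi> \<psi>) n"

lemma Hmap_arr:
  assumes "lifts C P P' f \<phi>" "lifts D Q Q' g \<psi>"
  shows "Hmap P Q P' Q' \<phi> \<psi> n \<in> Hom E (homology E (Tot P Q) n) (homology E (Tot P' Q') n)"
  using E.homology_map(1)[OF complex_tot complex_tot chain_map_tot_map[OF assms]] lifts_res_pair[OF
      assms] by blast

text \<open>Homology forgets which lifts were used, so any convenient lift may replace the chosen
  one. The two variables are changed one after the other, since each homotopy is built for a single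
  variable.\<close>

lemma Hmap_unique:
  assumes "lifts C P P' f \<phi>" "lifts C P P' f \<phi>'" "lifts D Q Q' g \<psi>" "lifts D Q Q' g \<psi>'"
  shows "Hmap P Q P' Q' \<phi> \<psi> n = Hmap P Q P' Q' \<phi>' \<psi>' n"
proof -
  note PQ = lifts_res_pair(1)[OF assms(1,3)] and PQ' = lifts_res_pair(2)[OF assms(1,3)]
  obtain S where S: "\<And>n. S n \<in> Hom E (CObj (Tot P Q) n) (CObj (Tot P' Q') (n + 1))"
    "\<And>n. tot_map E F P Q P' Q' \<phi> \<psi> n = tot_map E F P Q P' Q' \<phi>' \<psi> n \<oplus>
      (CDif (Tot P' Q') (n + 1) \<cdot> S n \<oplus> S (n - 1) \<cdot> CDif (Tot P Q) n)"
    using tot_map_homotopic_left[OF assms(1-3)] by blast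
  have "Hmap P Q P' Q' \<phi> \<psi> n = Hmap P Q P' Q' \<phi>' \<psi> n"
    by (rule E.homology_map_homotopic[OF complex_tot[OF PQ] complex_tot[OF PQ'] chain_map_tot_map[OF
        assms(1,3)]
      chain_map_tot_map[OF assms(2,3)] S(1) _ S(2)]) (use S(1)[of "n - 1"] in simp)
  also obtain S where S: "\<And>n. S n \<in> Hom E (CObj (Tot P Q) n) (CObj (Tot P' Q') (n + 1))"
    "\<And>n. tot_map E F P Q P' Q' \<phi>' \<psi> n = tot_map E F P Q P' Q' \<phi>' \<psi>' n \<oplus>
      (CDif (Tot P' Q') (n + 1) \<cdot> S n \<oplus> S (n - 1) \<cdot> CDif (Tot P Q) n)"
    using tot_map_homotopic_right[OF assms(2-4)] by blast
  have "Hmap P Q P' Q' \<phi>' \<psi> n = Hmap P Q P' Q' \<phi>' \<psi>' n"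
    by (rule E.homology_map_homotopic[OF complex_tot[OF PQ] complex_tot[OF PQ'] chain_map_tot_map[OF
        assms(2,3)]
      chain_map_tot_map[OF assms(2,4)] S(1) _ S(2)]) (use S(1)[of "n - 1"] in simp)
  finally show ?thesis .
qed

lemma Hmap_Cmp:
  assumes "lifts C P P' f \<phi>" "lifts C P' P'' f' \<phi>'" "lifts D Q Q' g \<psi>" "lifts D Q' Q'' g' \<psi>'"
    and "Cod C f = Dom C f'" "Cod D g = Dom D g'"
  shows "Hmap P' Q' P'' Q'' \<phi>' \<psi>' n \<cdot> Hmap P Q P' Q' \<phi> \<psi> n = Hmap P Q P'' Q'' (\<lambda>p. \<phi>' p \<cdot>\<^bsub>C\<^esub> \<phi> p)
      (\<lambda>q. \<psi>' q \<cdot>\<^bsub>D\<^esub> \<psi> q) n"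
proof -
  note r = lifts_res_pair(1,2)[OF assms(1,3)] lifts_res_pair(2)[OF assms(2,4)]
  note d = C.lifts_degreewise[OF assms(1)] D.lifts_degreewise[OF assms(3)] C.lifts_degreewise[OF
      assms(2)] D.lifts_degreewise[OF assms(4)]
  have "tot_map E F P Q P'' Q'' (\<lambda>p. \<phi>' p \<cdot>\<^bsub>C\<^esub> \<phi> p) (\<lambda>q. \<psi>' q \<cdot>\<^bsub>D\<^esub> \<psi> q) =
    (\<lambda>n. tot_map E F P' Q' P'' Q'' \<phi>' \<psi>' n \<cdot> tot_map E F P Q P' Q' \<phi> \<psi> n)"
    using tot_map_Cmp[OF r d] by (intro ext) simp
  then show ?thesis
    using E.homology_map_Cmp[OF complex_tot[OF r(1)] complex_tot[OF r(2)] complex_tot[OF r(3)]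
      chain_map_tot_map[OF assms(1,3)] chain_map_tot_map[OF assms(2,4)], of n] by simp
qed

lemma Hmap_Ide:
  assumes "is_proj_resolution C X P" "is_proj_resolution D Y Q"
  shows "Hmap P Q P Q (res_id C P) (res_id D Q) n = Ide E (homology E (Tot P Q) n)"
proof -
  note r = res_pairI[OF assms]
  have "tot_map E F P Q P Q (res_id C P) (res_id D Q) = (\<lambda>n. Ide E (CObj (Tot P Q) n))"
    using tot_map_Ide[OF r] by (intro ext) simp
  then show ?thesis using E.homology_map_Ide[OF complex_tot[OF r]] by simp
qed

end

section \<open>Long exact sequences of the derived bifunctors\<close>

context bifunctor
begin

text \<open>\<open>split_exact\<close> consists of equations between composites, sums, identities
  and zeros, all of which an additive functor respects.\<close>

lemma F_split_left:
  assumes "C.split_exact i p r s" "Y \<in> Obj D"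
  shows "E.split_exact (AMap F (i, Ide D Y)) (AMap F (p, Ide D Y)) (AMap F (r, Ide D Y)) (AMap F (s,
      Ide D Y))"
proof -
  note S = C.split_exactD[OF assms(1)]
  have "AMap F (i, Ide D Y) \<cdot> AMap F (r, Ide D Y) \<oplus> AMap F (s, Ide D Y) \<cdot> AMap F (p, Ide D Y) =
      AMap F (i \<cdot>\<^bsub>C\<^esub> r \<oplus>\<^bsub>C\<^esub> s \<cdot>\<^bsub>C\<^esub> p, Ide D Y)"
    using S(1-9) assms(2) by simp
  also have "\<dots> = Ide E (OMap F (Cod C i, Y))"
    unfolding S(13) using S(1) assms(2) by simp
  finally show ?thesis
    unfolding E.split_exact_def using S(1-12) assms(2) by simp
qed

lemma F_split_right:
  assumes "D.split_exact i p r s" "X \<in> Obj C"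
  shows "E.split_exact (AMap F (Ide C X, i)) (AMap F (Ide C X, p)) (AMap F (Ide C X, r)) (AMap F
      (Ide C X, s))"
proof -
  note S = D.split_exactD[OF assms(1)]
  have "AMap F (Ide C X, i) \<cdot> AMap F (Ide C X, r) \<oplus> AMap F (Ide C X, s) \<cdot> AMap F (Ide C X, p) =
      AMap F (Ide C X, i \<cdot>\<^bsub>D\<^esub> r \<oplus>\<^bsub>D\<^esub> s \<cdot>\<^bsub>D\<^esub> p)"
    using S(1-9) assms(2) by simp
  also have "\<dots> = Ide E (OMap F (X, Cod D i))"
    unfolding S(13) using S(1) assms(2) by simp
  finally show ?thesis
    unfolding E.split_exact_def using S(1-12) assms(2) by simp
qed

text \<open>Maps of total complexes of this form are diagonal in the summands, so each splitting
  equation is checked on one summand at a time. No differential enters.\<close>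

lemma tot_map_split:
  assumes r: "res_pair P Q" "res_pair P' Q'" "res_pair P'' Q''"
    and i: "degreewise C P P' i" "degreewise D Q Q' i'" and p: "degreewise C P' P'' p" "degreewise D
        Q' Q'' p'"
    and r': "degreewise C P' P r" "degreewise D Q' Q r'" and s: "degreewise C P'' P' s" "degreewise
        D Q'' Q' s'"
    and split: "\<And>m n. E.split_exact (AMap F (i m, i' n)) (AMap F (p m, p' n)) (AMap F (r m, r' n))
        (AMap F (s m, s' n))"
  shows "E.split_exact (tot_map E F P Q P' Q' i i' n) (tot_map E F P' Q' P'' Q'' p p' n)
    (tot_map E F P' Q' P Q r r' n) (tot_map E F P'' Q'' P' Q' s s' n)"
proof -
  note T = tot_map_arr[OF r(1,2) i, where n = n] tot_map_arr[OF r(2,3) p, where n = n]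
    tot_map_arr[OF r(2,1) r', where n = n] tot_map_arr[OF r(3,2) s, where n = n]
  note O = tot_Obj[OF r(1)] tot_Obj[OF r(2)] tot_Obj[OF r(3)]
  note d = degreewiseD[OF i(1)] degreewiseD[OF i(2)] degreewiseD[OF p(1)] degreewiseD[OF p(2)]
    degreewiseD[OF r'(1)] degreewiseD[OF r'(2)] degreewiseD[OF s(1)] degreewiseD[OF s(2)]
  note R = res_pairD(1,5)[OF r(1)] res_pairD(1,5)[OF r(2)] res_pairD(1,5)[OF r(3)]
  note S = E.split_exactD(10-13)[OF split]
  have "tot_map E F P' Q' P Q r r' n \<cdot> tot_map E F P Q P' Q' i i' n = Ide E (CObj (Tot P Q) n)"
  proof (rule tot_ext[OF r(1), where W = "CObj (Tot P Q) n"])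
    fix a b assume ab: "int a + int b = n"
    have "pr P Q n a b \<cdot> (tot_map E F P' Q' P Q r r' n \<cdot> tot_map E F P Q P' Q' i i' n) =
        AMap F (r a, r' b) \<cdot> (AMap F (i a, i' b) \<cdot> pr P Q n a b)"
      using pr_tot_map_Cmp[OF r(2,1) r' ab, of "tot_map E F P Q P' Q' i i' n"] pr_tot_map[OF r(1,2)
          i ab] T by simp
    also have "\<dots> = pr P Q n a b"
      by (subst E.Cmp_reassoc1[OF S(1)]) (use d R pr_arr[OF r(1) ab] in simp_all)
    finally show "pr P Q n a b \<cdot> (tot_map E F P' Q' P Q r r' n \<cdot> tot_map E F P Q P' Q' i i' n) = pr
        P Q n a b \<cdot> Ide E (CObj (Tot P Q) n)"
      using pr_arr[OF r(1) ab] by simp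
  qed (use T O in simp_all)
  moreover have "tot_map E F P' Q' P'' Q'' p p' n \<cdot> tot_map E F P'' Q'' P' Q' s s' n = Ide E (CObj
      (Tot P'' Q'') n)"
  proof (rule tot_ext[OF r(3), where W = "CObj (Tot P'' Q'') n"])
    fix a b assume ab: "int a + int b = n"
    have "pr P'' Q'' n a b \<cdot> (tot_map E F P' Q' P'' Q'' p p' n \<cdot> tot_map E F P'' Q'' P' Q' s s' n) =
        AMap F (p a, p' b) \<cdot> (AMap F (s a, s' b) \<cdot> pr P'' Q'' n a b)"
      using pr_tot_map_Cmp[OF r(2,3) p ab, of "tot_map E F P'' Q'' P' Q' s s' n"] pr_tot_map[OF
          r(3,2) s ab] T by simp
    also have "\<dots> = pr P'' Q'' n a b"
      by (subst E.Cmp_reassoc1[OF S(2)]) (use d R pr_arr[OF r(3) ab] in simp_all)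
    finally show "pr P'' Q'' n a b \<cdot> (tot_map E F P' Q' P'' Q'' p p' n \<cdot> tot_map E F P'' Q'' P' Q' s
        s' n) =
        pr P'' Q'' n a b \<cdot> Ide E (CObj (Tot P'' Q'') n)"
      using pr_arr[OF r(3) ab] by simp
  qed (use T O in simp_all)
  moreover have "tot_map E F P' Q' P'' Q'' p p' n \<cdot> tot_map E F P Q P' Q' i i' n = Zero E (CObj (Tot
      P Q) n) (CObj (Tot P'' Q'') n)"
  proof (rule tot_ext[OF r(3), where W = "CObj (Tot P Q) n"])
    fix a b assume ab: "int a + int b = n"
    have "pr P'' Q'' n a b \<cdot> (tot_map E F P' Q' P'' Q'' p p' n \<cdot> tot_map E F P Q P' Q' i i' n) =
        AMap F (p a, p' b) \<cdot> (AMap F (i a, i' b) \<cdot> pr P Q n a b)"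
      using pr_tot_map_Cmp[OF r(2,3) p ab, of "tot_map E F P Q P' Q' i i' n"] pr_tot_map[OF r(1,2) i
          ab] T by simp
    also have "\<dots> = Zero E (CObj (Tot P Q) n) (OMap F (RObj P'' a, RObj Q'' b))"
      by (subst E.Cmp_reassoc1[OF S(3)]) (use d R pr_arr[OF r(1) ab] in simp_all)
    finally show "pr P'' Q'' n a b \<cdot> (tot_map E F P' Q' P'' Q'' p p' n \<cdot> tot_map E F P Q P' Q' i i'
        n) =
        pr P'' Q'' n a b \<cdot> Zero E (CObj (Tot P Q) n) (CObj (Tot P'' Q'') n)"
      using pr_arr[OF r(3) ab] O by simp
  qed (use T O in simp_all)
  moreover have "tot_map E F P Q P' Q' i i' n \<cdot> tot_map E F P' Q' P Q r r' n \<oplus>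
      tot_map E F P'' Q'' P' Q' s s' n \<cdot> tot_map E F P' Q' P'' Q'' p p' n = Ide E (CObj (Tot P' Q')
          n)" (is "?x \<oplus> ?y = _")
  proof (rule tot_ext[OF r(2), where W = "CObj (Tot P' Q') n"])
    fix a b assume ab: "int a + int b = n"
    note X = pr_arr[OF r(2) ab]
    have "pr P' Q' n a b \<cdot> (?x \<oplus> ?y) = pr P' Q' n a b \<cdot> ?x \<oplus> pr P' Q' n a b \<cdot> ?y"
      using X T by simp
    also have "pr P' Q' n a b \<cdot> ?x = AMap F (i a, i' b) \<cdot> AMap F (r a, r' b) \<cdot> pr P' Q' n a b"
      using pr_tot_map_Cmp[OF r(1,2) i ab, of "tot_map E F P' Q' P Q r r' n"] pr_tot_map[OF r(2,1)
          r' ab] T X d R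
      by simp
    also have "pr P' Q' n a b \<cdot> ?y = AMap F (s a, s' b) \<cdot> AMap F (p a, p' b) \<cdot> pr P' Q' n a b"
      using pr_tot_map_Cmp[OF r(3,2) s ab, of "tot_map E F P' Q' P'' Q'' p p' n"] pr_tot_map[OF
          r(2,3) p ab] T X d R
      by simp
    also have "AMap F (i a, i' b) \<cdot> AMap F (r a, r' b) \<cdot> pr P' Q' n a b \<oplus> AMap F (s a, s' b) \<cdot> AMap
        F (p a, p' b) \<cdot> pr P' Q' n a b =
        (AMap F (i a, i' b) \<cdot> AMap F (r a, r' b) \<oplus> AMap F (s a, s' b) \<cdot> AMap F (p a, p' b)) \<cdot> pr P'
            Q' n a b"
      by (rule E.Add_Cmp'[symmetric]) (use X d in simp_all)
    also have "\<dots> = pr P' Q' n a b"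
      unfolding S(4) using X d by simp
    finally show "pr P' Q' n a b \<cdot> (?x \<oplus> ?y) = pr P' Q' n a b \<cdot> Ide E (CObj (Tot P' Q') n)"
      using X by simp
  qed (use T O in simp_all)
  ultimately show ?thesis
    unfolding E.split_exact_def using T by simp
qed

lemma split_complexes_left:
  assumes "lifts C P P' f i" "lifts C P' P'' g p" "\<And>n. C.split_exact (i n) (p n) (r n) (s n)"
      "is_proj_resolution D Y Q"
  shows "E.split_complexes (Tot P Q) (Tot P' Q) (Tot P'' Q) (tot_map E F P Q P' Q i (res_id D Q))
    (tot_map E F P' Q P'' Q p (res_id D Q)) (tot_map E F P' Q P Q r (res_id D Q)) (tot_map E F P'' Q
        P' Q s (res_id D Q))"
proof -
  note Q = D.lifts_Ide[OF assms(4)]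
  note rp = lifts_res_pair(1,2)[OF assms(1) Q] lifts_res_pair(2)[OF assms(2) Q]
  note di = C.lifts_degreewise[OF assms(1)] and dp = C.lifts_degreewise[OF assms(2)] and dq =
      D.lifts_degreewise[OF Q]
  have dr: "degreewise C P' P r" "degreewise C P'' P' s"
    using C.split_exactD(1-9)[OF assms(3)] degreewiseD[OF di] degreewiseD[OF dp] by (simp_all add:
        degreewise_def)
  have "E.split_exact (AMap F (i m, res_id D Q n)) (AMap F (p m, res_id D Q n)) (AMap F (r m, res_id
      D Q n)) (AMap F (s m, res_id D Q n))" for m n
    unfolding res_id_def by (rule F_split_left[OF assms(3) res_pairD(5)[OF rp(1)]])
  then show ?thesis
    unfolding E.split_complexes_def
    using complex_tot[OF rp(1)] complex_tot[OF rp(2)] complex_tot[OF rp(3)] chain_map_tot_map[OF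
        assms(1) Q] chain_map_tot_map[OF assms(2) Q]
      tot_map_split[OF rp di dq dp dq dr(1) dq dr(2) dq] by blast
qed

lemma split_complexes_right:
  assumes "is_proj_resolution C X P" "lifts D Q Q' f i" "lifts D Q' Q'' g p" "\<And>n. D.split_exact (i
      n) (p n) (r n) (s n)"
  shows "E.split_complexes (Tot P Q) (Tot P Q') (Tot P Q'') (tot_map E F P Q P Q' (res_id C P) i)
    (tot_map E F P Q' P Q'' (res_id C P) p) (tot_map E F P Q' P Q (res_id C P) r) (tot_map E F P Q''
        P Q' (res_id C P) s)"
proof -
  note P = C.lifts_Ide[OF assms(1)]
  note rp = lifts_res_pair(1,2)[OF P assms(2)] lifts_res_pair(2)[OF P assms(3)]
  note di = D.lifts_degreewise[OF assms(2)] and dp = D.lifts_degreewise[OF assms(3)] and dq =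
      C.lifts_degreewise[OF P]
  have dr: "degreewise D Q' Q r" "degreewise D Q'' Q' s"
    using D.split_exactD(1-9)[OF assms(4)] degreewiseD[OF di] degreewiseD[OF dp] by (simp_all add:
        degreewise_def)
  have "E.split_exact (AMap F (res_id C P m, i n)) (AMap F (res_id C P m, p n)) (AMap F (res_id C P
      m, r n)) (AMap F (res_id C P m, s n))" for m n
    unfolding res_id_def by (rule F_split_right[OF assms(4) res_pairD(1)[OF rp(1)]])
  then show ?thesis
    unfolding E.split_complexes_def
    using complex_tot[OF rp(1)] complex_tot[OF rp(2)] complex_tot[OF rp(3)] chain_map_tot_map[OF P
        assms(2)] chain_map_tot_map[OF P assms(3)]
      tot_map_split[OF rp dq di dq dp dq dr(1) dq dr(2)] by blast
qed

section \<open>The derived bifunctor on arrows\<close>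

abbreviation Der :: "int \<Rightarrow> ('oc \<times> 'od, 'ac \<times> 'ad, 'oe, 'ae) ftr" where
  "Der n \<equiv> left_derived C D E F n"

abbreviation "rC \<equiv> res C"
abbreviation "rD \<equiv> res D"

lemmas proj_res_C = C.resolution_exists[OF enough_C]
lemmas proj_res_D = D.resolution_exists[OF enough_D]
lemmas lift_C = C.lifts_res_map[OF enough_C]
lemmas lift_D = D.lifts_res_map[OF enough_D]

lemma Der_obj: "OMap (Der n) (X, Y) = homology E (Tot (rC X) (rD Y)) n"
  by (simp add: left_derived_def)

lemma Der_arr:
  "AMap (Der n) (f, g) = Hmap (rC (Dom C f)) (rD (Dom D g)) (rC (Cod C f)) (rD (Cod D g)) (res_map C
      f) (res_map D g) n"
  by (simp add: left_derived_def Let_def)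

text \<open>Frees the derived bifunctor from \<open>res_map\<close>: any pair of lifts between the
  chosen resolutions computes it.\<close>

lemma Der_lift:
  assumes "lifts C (rC X) (rC X') f \<phi>" "lifts D (rD Y) (rD Y') g \<psi>" "f \<in> Hom C X X'" "g \<in> Hom D Y
      Y'"
  shows "Hmap (rC X) (rD Y) (rC X') (rD Y') \<phi> \<psi> n = AMap (Der n) (f, g)"
proof -
  have e: "Dom C f = X" "Cod C f = X'" "Dom D g = Y" "Cod D g = Y'" "f \<in> Arr C" "g \<in> Arr D" using
      assms(3,4) by simp_all
  show ?thesis
    unfolding Der_arr e(1-4)
    by (rule Hmap_unique[OF assms(1) _ assms(2)]) (use lift_C[OF e(5)] lift_D[OF e(6)] e in
        simp_all)
qed

lemma Der_Hom:
  assumes "f \<in> Hom C X X'" "g \<in> Hom D Y Y'"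
  shows "AMap (Der n) (f, g) \<in> Hom E (OMap (Der n) (X, Y)) (OMap (Der n) (X', Y'))"
  using Hmap_arr[OF lift_C lift_D, of f g n] assms unfolding Der_arr Der_obj by simp

lemma Der_Obj:
  assumes "X \<in> Obj C" "Y \<in> Obj D"
  shows "OMap (Der n) (X, Y) \<in> Obj E"
  by (rule E.Hom_Obj(1)[OF Der_Hom[of "Ide C X" X X "Ide D Y" Y Y n]]) (use assms in simp_all)

text \<open>The chosen lift of an identity need not be an identity, but the identity maps form
  another lift. In the same way the composite of chosen lifts serves in
  \<open>Der_Cmp\<close>.\<close>

lemma Der_Ide:
  assumes "X \<in> Obj C" "Y \<in> Obj D"
  shows "AMap (Der n) (Ide C X, Ide D Y) = Ide E (OMap (Der n) (X, Y))"
  using Der_lift[OF C.lifts_Ide[OF proj_res_C[OF assms(1)]] D.lifts_Ide[OF proj_res_D[OF assms(2)]],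
      of n]
    Hmap_Ide[OF proj_res_C[OF assms(1)] proj_res_D[OF assms(2)], of n] assms by (simp add: Der_obj)

lemma Der_Cmp:
  assumes "f \<in> Hom C X X'" "f' \<in> Hom C X' X''" "g \<in> Hom D Y Y'" "g' \<in> Hom D Y' Y''"
  shows "AMap (Der n) (f' \<cdot>\<^bsub>C\<^esub> f, g' \<cdot>\<^bsub>D\<^esub> g) = AMap (Der n) (f', g') \<cdot> AMap (Der n) (f, g)"
proof -
  have l: "lifts C (rC X) (rC X') f (res_map C f)" "lifts C (rC X') (rC X'') f' (res_map C f')"
    "lifts D (rD Y) (rD Y') g (res_map D g)" "lifts D (rD Y') (rD Y'') g' (res_map D g')"
    using lift_C[of f] lift_C[of f'] lift_D[of g] lift_D[of g'] assms by simp_all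
  have c: "Cod C f = Dom C f'" "Cod D g = Dom D g'" using assms by simp_all
  have "AMap (Der n) (f', g') \<cdot> AMap (Der n) (f, g) =
    Hmap (rC X) (rD Y) (rC X'') (rD Y'') (\<lambda>p. res_map C f' p \<cdot>\<^bsub>C\<^esub> res_map C f p) (\<lambda>q. res_map D g' q
        \<cdot>\<^bsub>D\<^esub> res_map D g q) n"
    using Hmap_Cmp[OF l c, of n] assms by (simp add: Der_arr)
  also have "\<dots> = AMap (Der n) (f' \<cdot>\<^bsub>C\<^esub> f, g' \<cdot>\<^bsub>D\<^esub> g)"
    by (rule Der_lift[OF C.lifts_Cmp[OF l(1,2) c(1)] D.lifts_Cmp[OF l(3,4) c(2)]]) (use assms in
        simp_all)
  finally show ?thesis by simp
qed

text \<open>An arbitrary resolution of \<open>X\<close> computes the same homology as the chosen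
  one: both composites of the comparison maps lift the identity of \<open>X\<close>, as do the
  identity maps. The isomorphism is kept as a pair of explicit arrows in the form that
  \<open>long_exact_homology\<close> takes.\<close>

lemma comparison_left:
  assumes "is_proj_resolution C X P" "Y \<in> Obj D"
  obtains \<kappa> \<kappa>' where "lifts C P (rC X) (Ide C X) \<kappa>" "lifts C (rC X) P (Ide C X) \<kappa>'"
    "\<And>n. Hmap (rC X) (rD Y) P (rD Y) \<kappa>' (res_id D (rD Y)) n \<cdot> Hmap P (rD Y) (rC X) (rD Y) \<kappa> (res_id
        D (rD Y)) n = Ide E (homology E (Tot P (rD Y)) n)"
    "\<And>n. Hmap P (rD Y) (rC X) (rD Y) \<kappa> (res_id D (rD Y)) n \<cdot> Hmap (rC X) (rD Y) P (rD Y) \<kappa>' (res_id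
        D (rD Y)) n = Ide E (homology E (Tot (rC X) (rD Y)) n)"
proof -
  have X: "X \<in> Obj C" using C.resolutionD(10)[OF assms(1)] .
  note r = assms(1) proj_res_C[OF X]
  note q = proj_res_D[OF assms(2)]
  note l = C.lifts_Ide[OF r(1)] C.lifts_Ide[OF r(2)] and lq = D.lifts_Ide[OF q]
  obtain \<kappa> where k: "lifts C P (rC X) (Ide C X) \<kappa>"
    by (rule C.lifts_exists[of "Ide C X" P "rC X"]) (use r X in auto)
  obtain \<kappa>' where k': "lifts C (rC X) P (Ide C X) \<kappa>'"
    by (rule C.lifts_exists[of "Ide C X" "rC X" P]) (use r X in auto)
  have c: "Cod C (Ide C X) = Dom C (Ide C X)" "Cod D (Ide D Y) = Dom D (Ide D Y)" "Ide C X \<cdot>\<^bsub>C\<^esub> Ide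
      C X = Ide C X"
      "Ide D Y \<cdot>\<^bsub>D\<^esub> Ide D Y = Ide D Y"
    using X assms(2) by simp_all
  note kk = C.lifts_Cmp[OF k k' c(1), unfolded c(3)] C.lifts_Cmp[OF k' k c(1), unfolded c(3)] and qq
      = D.lifts_Cmp[OF lq lq c(2), unfolded c(4)]
  show thesis
  proof (rule that[OF k k'])
    fix n
    show "Hmap (rC X) (rD Y) P (rD Y) \<kappa>' (res_id D (rD Y)) n \<cdot> Hmap P (rD Y) (rC X) (rD Y) \<kappa> (res_id
        D (rD Y)) n = Ide E (homology E (Tot P (rD Y)) n)"
      unfolding Hmap_Cmp[OF k k' lq lq c(1,2)] Hmap_unique[OF kk(1) l(1) qq lq] by (rule Hmap_Ide[OF
          r(1) q])
    show "Hmap P (rD Y) (rC X) (rD Y) \<kappa> (res_id D (rD Y)) n \<cdot> Hmap (rC X) (rD Y) P (rD Y) \<kappa>' (res_id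
        D (rD Y)) n = Ide E (homology E (Tot (rC X) (rD Y)) n)"
      unfolding Hmap_Cmp[OF k' k lq lq c(1,2)] Hmap_unique[OF kk(2) l(2) qq lq] by (rule Hmap_Ide[OF
          r(2) q])
  qed
qed

lemma comparison_right:
  assumes "X \<in> Obj C" "is_proj_resolution D Y Q"
  obtains \<kappa> \<kappa>' where "lifts D Q (rD Y) (Ide D Y) \<kappa>" "lifts D (rD Y) Q (Ide D Y) \<kappa>'"
    "\<And>n. Hmap (rC X) (rD Y) (rC X) Q (res_id C (rC X)) \<kappa>' n \<cdot> Hmap (rC X) Q (rC X) (rD Y) (res_id C
        (rC X)) \<kappa> n = Ide E (homology E (Tot (rC X) Q) n)"
    "\<And>n. Hmap (rC X) Q (rC X) (rD Y) (res_id C (rC X)) \<kappa> n \<cdot> Hmap (rC X) (rD Y) (rC X) Q (res_id C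
        (rC X)) \<kappa>' n = Ide E (homology E (Tot (rC X) (rD Y)) n)"
proof -
  have Y: "Y \<in> Obj D" using D.resolutionD(10)[OF assms(2)] .
  note r = assms(2) proj_res_D[OF Y]
  note q = proj_res_C[OF assms(1)]
  note l = D.lifts_Ide[OF r(1)] D.lifts_Ide[OF r(2)] and lq = C.lifts_Ide[OF q]
  obtain \<kappa> where k: "lifts D Q (rD Y) (Ide D Y) \<kappa>"
    by (rule D.lifts_exists[of "Ide D Y" Q "rD Y"]) (use r Y in auto)
  obtain \<kappa>' where k': "lifts D (rD Y) Q (Ide D Y) \<kappa>'"
    by (rule D.lifts_exists[of "Ide D Y" "rD Y" Q]) (use r Y in auto)
  have c: "Cod D (Ide D Y) = Dom D (Ide D Y)" "Cod C (Ide C X) = Dom C (Ide C X)" "Ide D Y \<cdot>\<^bsub>D\<^esub> Ide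
      D Y = Ide D Y"
      "Ide C X \<cdot>\<^bsub>C\<^esub> Ide C X = Ide C X"
    using Y assms(1) by simp_all
  note kk = D.lifts_Cmp[OF k k' c(1), unfolded c(3)] D.lifts_Cmp[OF k' k c(1), unfolded c(3)] and qq
      = C.lifts_Cmp[OF lq lq c(2), unfolded c(4)]
  show thesis
  proof (rule that[OF k k'])
    fix n
    show "Hmap (rC X) (rD Y) (rC X) Q (res_id C (rC X)) \<kappa>' n \<cdot> Hmap (rC X) Q (rC X) (rD Y) (res_id C
        (rC X)) \<kappa> n = Ide E (homology E (Tot (rC X) Q) n)"
      unfolding Hmap_Cmp[OF lq lq k k' c(2,1)] Hmap_unique[OF qq lq kk(1) l(1)] by (rule Hmap_Ide[OF
          q r(1)])
    show "Hmap (rC X) Q (rC X) (rD Y) (res_id C (rC X)) \<kappa> n \<cdot> Hmap (rC X) (rD Y) (rC X) Q (res_id C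
        (rC X)) \<kappa>' n = Ide E (homology E (Tot (rC X) (rD Y)) n)"
      unfolding Hmap_Cmp[OF lq lq k' k c(2,1)] Hmap_unique[OF qq lq kk(2) l(2)] by (rule Hmap_Ide[OF
          q r(2)])
  qed
qed

lemma long_exact_left:
  assumes "short_exact C f g" "Y \<in> Obj D"
  shows "long_exact E (\<lambda>n. AMap (Der n) (f, Ide D Y)) (\<lambda>n. AMap (Der n) (g, Ide D Y)) (\<lambda>n. delta1 C
      D E F n f g Y)"
proof -
  obtain R i p where h: "horseshoe C f g = (R, i, p)" by (metis prod_cases3)
  note H = C.horseshoe_lifts[OF assms(1) enough_C h]
  obtain r s where S: "\<And>n. C.split_exact (i n) (p n) (r n) (s n)" using H(6) by blast
  have R: "is_proj_resolution C (Cod C f) R" using H(1) by (simp add: lifts_def)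
  note q = proj_res_D[OF assms(2)] and lq = D.lifts_Ide[OF proj_res_D[OF assms(2)]]
  obtain \<kappa> \<kappa>' where k: "lifts C R (rC (Cod C f)) (Ide C (Cod C f)) \<kappa>" "lifts C (rC (Cod C f)) R (Ide
      C (Cod C f)) \<kappa>'"
    "\<And>n. Hmap (rC (Cod C f)) (rD Y) R (rD Y) \<kappa>' (res_id D (rD Y)) n \<cdot> Hmap R (rD Y) (rC (Cod C f))
        (rD Y) \<kappa> (res_id D (rD Y)) n = Ide E (homology E (Tot R (rD Y)) n)"
    "\<And>n. Hmap R (rD Y) (rC (Cod C f)) (rD Y) \<kappa> (res_id D (rD Y)) n \<cdot> Hmap (rC (Cod C f)) (rD Y) R
        (rD Y) \<kappa>' (res_id D (rD Y)) n = Ide E (homology E (Tot (rC (Cod C f)) (rD Y)) n)"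
    using comparison_left[OF R assms(2)] by blast
  have cq: "Cod D (Ide D Y) = Dom D (Ide D Y)" "Ide D Y \<cdot>\<^bsub>D\<^esub> Ide D Y = Ide D Y" using assms(2) by
      simp_all
  note qq = D.lifts_Cmp[OF lq lq cq(1), unfolded cq(2)]
  have cf: "Cod C f = Dom C (Ide C (Cod C f))" "Ide C (Cod C f) \<cdot>\<^bsub>C\<^esub> f = f" and cg: "Cod C (Ide C
      (Cod C f)) = Dom C g" "g \<cdot>\<^bsub>C\<^esub> Ide C (Cod C f) = g"
    using H(3-5) by simp_all
  \<comment> \<open>Inclusion into the horseshoe followed by comparison with the chosen resolution
    is a lift of \<open>f\<close>, so after the replacement of the middle term the first map is the
    derived functor applied to \<open>f\<close>.\<close>
  have 1: "Hmap R (rD Y) (rC (Cod C f)) (rD Y) \<kappa> (res_id D (rD Y)) n \<cdot> Hmap (rC (Dom C f)) (rD Y) R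
      (rD Y) i (res_id D (rD Y)) n =
      AMap (Der n) (f, Ide D Y)" for n
    unfolding Hmap_Cmp[OF H(1) k(1) lq lq cf(1) cq(1)]
    by (rule Der_lift[OF C.lifts_Cmp[OF H(1) k(1) cf(1), unfolded cf(2)] qq]) (use H(4) assms(2) in
        simp_all)
  \<comment> \<open>Similarly, comparison back into the horseshoe followed by its projection is a
    lift of \<open>g\<close>.\<close>
  have 2: "Hmap R (rD Y) (rC (Cod C g)) (rD Y) p (res_id D (rD Y)) n \<cdot> Hmap (rC (Cod C f)) (rD Y) R
      (rD Y) \<kappa>' (res_id D (rD Y)) n =
      AMap (Der n) (g, Ide D Y)" for n
    unfolding Hmap_Cmp[OF k(2) H(2) lq lq cg(1) cq(1)]
    by (rule Der_lift[OF C.lifts_Cmp[OF k(2) H(2) cg(1), unfolded cg(2)] qq]) (use H(3,5) assms(2)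
        in simp_all)
  show ?thesis
    using E.long_exact_homology[OF split_complexes_left[OF H(1,2) S q] Hmap_arr[OF k(1) lq]
        Hmap_arr[OF k(2) lq] k(3,4)]
    unfolding 1 2 delta1_def h by (simp add: Let_def)
qed

lemma long_exact_right:
  assumes "short_exact D f g" "X \<in> Obj C"
  shows "long_exact E (\<lambda>n. AMap (Der n) (Ide C X, f)) (\<lambda>n. AMap (Der n) (Ide C X, g)) (\<lambda>n. delta2 C
      D E F n X f g)"
proof -
  obtain R i p where h: "horseshoe D f g = (R, i, p)" by (metis prod_cases3)
  note H = D.horseshoe_lifts[OF assms(1) enough_D h]
  obtain r s where S: "\<And>n. D.split_exact (i n) (p n) (r n) (s n)" using H(6) by blast
  have R: "is_proj_resolution D (Cod D f) R" using H(1) by (simp add: lifts_def)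
  note q = proj_res_C[OF assms(2)] and lq = C.lifts_Ide[OF proj_res_C[OF assms(2)]]
  obtain \<kappa> \<kappa>' where k: "lifts D R (rD (Cod D f)) (Ide D (Cod D f)) \<kappa>" "lifts D (rD (Cod D f)) R (Ide
      D (Cod D f)) \<kappa>'"
    "\<And>n. Hmap (rC X) (rD (Cod D f)) (rC X) R (res_id C (rC X)) \<kappa>' n \<cdot> Hmap (rC X) R (rC X) (rD (Cod
        D f)) (res_id C (rC X)) \<kappa> n = Ide E (homology E (Tot (rC X) R) n)"
    "\<And>n. Hmap (rC X) R (rC X) (rD (Cod D f)) (res_id C (rC X)) \<kappa> n \<cdot> Hmap (rC X) (rD (Cod D f)) (rC
        X) R (res_id C (rC X)) \<kappa>' n = Ide E (homology E (Tot (rC X) (rD (Cod D f))) n)"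
    using comparison_right[OF assms(2) R] by blast
  have cq: "Cod C (Ide C X) = Dom C (Ide C X)" "Ide C X \<cdot>\<^bsub>C\<^esub> Ide C X = Ide C X" using assms(2) by
      simp_all
  note qq = C.lifts_Cmp[OF lq lq cq(1), unfolded cq(2)]
  have cf: "Cod D f = Dom D (Ide D (Cod D f))" "Ide D (Cod D f) \<cdot>\<^bsub>D\<^esub> f = f" and cg: "Cod D (Ide D
      (Cod D f)) = Dom D g" "g \<cdot>\<^bsub>D\<^esub> Ide D (Cod D f) = g"
    using H(3-5) by simp_all
  have 1: "Hmap (rC X) R (rC X) (rD (Cod D f)) (res_id C (rC X)) \<kappa> n \<cdot> Hmap (rC X) (rD (Dom D f))
      (rC X) R (res_id C (rC X)) i n =
      AMap (Der n) (Ide C X, f)" for n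
    unfolding Hmap_Cmp[OF lq lq H(1) k(1) cq(1) cf(1)]
    by (rule Der_lift[OF qq D.lifts_Cmp[OF H(1) k(1) cf(1), unfolded cf(2)]]) (use H(4) assms(2) in
        simp_all)
  have 2: "Hmap (rC X) R (rC X) (rD (Cod D g)) (res_id C (rC X)) p n \<cdot> Hmap (rC X) (rD (Cod D f))
      (rC X) R (res_id C (rC X)) \<kappa>' n =
      AMap (Der n) (Ide C X, g)" for n
    unfolding Hmap_Cmp[OF lq lq k(2) H(2) cq(1) cg(1)]
    by (rule Der_lift[OF qq D.lifts_Cmp[OF k(2) H(2) cg(1), unfolded cg(2)]]) (use H(3,5) assms(2)
        in simp_all)
  show ?thesis
    using E.long_exact_homology[OF split_complexes_right[OF q H(1,2) S] Hmap_arr[OF lq k(1)]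
        Hmap_arr[OF lq k(2)] k(3,4)]
    unfolding 1 2 delta2_def h by (simp add: Let_def)
qed

text \<open>Both arguments vary at once: the morphism of short exact sequences in the first variable
  and \<open>a\<close> in the second. The total maps pair each horseshoe lift with the one chosen
  lift of \<open>a\<close>.\<close>

lemma delta1_natural:
  assumes "short_exact_map C f g f' g' l m t" "a \<in> Arr D"
  shows "delta1 C D E F n f' g' (Cod D a) \<cdot> AMap (Der n) (t, a) = AMap (Der (n - 1)) (l, a) \<cdot> delta1
      C D E F n f g (Dom D a)"
proof -
  have se: "short_exact C f g" "short_exact C f' g'" and sq: "comm_square C f l m f'" "comm_square C
      g m t g'"
    using assms(1) by (auto simp: short_exact_map_def)
  have T: "f \<in> Hom C (Dom C l) (Dom C m)" "f' \<in> Hom C (Cod C l) (Cod C m)" "g \<in> Hom C (Dom C m) (Dom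
      C t)"
    "g' \<in> Hom C (Cod C m) (Cod C t)" "l \<in> Arr C" "m \<in> Arr C" "t \<in> Arr C"
    using sq by (auto simp: comm_square_def)
  obtain R i p where h: "horseshoe C f g = (R, i, p)" by (metis prod_cases3)
  obtain R' i' p' where h': "horseshoe C f' g' = (R', i', p')" by (metis prod_cases3)
  note H = C.horseshoe_lifts[OF se(1) enough_C h] and H' = C.horseshoe_lifts[OF se(2) enough_C h']
  obtain r s where S: "\<And>n. C.split_exact (i n) (p n) (r n) (s n)" using H(6) by blast
  obtain r' s' where S': "\<And>n. C.split_exact (i' n) (p' n) (r' n) (s' n)" using H'(6) by blast
  note k = lift_C[OF T(5)] and a = lift_D[OF assms(2)]
  obtain \<mu> \<rho> where M: "lifts C R R' m \<mu>" "lifts C (rC (Dom C t)) (rC (Cod C t)) t \<rho>"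
    "\<And>n. \<mu> n \<cdot>\<^bsub>C\<^esub> i n = i' n \<cdot>\<^bsub>C\<^esub> res_map C l n" "\<And>n. \<rho> n \<cdot>\<^bsub>C\<^esub> p n = p' n \<cdot>\<^bsub>C\<^esub> \<mu> n"
    using C.horseshoe_map[OF assms(1) enough_C h h' k] by blast
  have ad: "Dom D a \<in> Obj D" "Cod D a \<in> Obj D" using assms(2) by simp_all
  note q = proj_res_D[OF ad(1)] and q' = proj_res_D[OF ad(2)]
  note lq = D.lifts_Ide[OF q] and lq' = D.lifts_Ide[OF q']
  have L: "lifts C (rC (Dom C l)) R f i" "lifts C R (rC (Dom C t)) g p" "lifts C (rC (Cod C l)) R'
      f' i'" "lifts C R' (rC (Cod C t)) g' p'"
    using H(1,2) H'(1,2) T by simp_all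
  note rp = lifts_res_pair(1,2)[OF L(1) lq] lifts_res_pair(2)[OF L(2) lq] lifts_res_pair(1,2)[OF
      L(3) lq'] lifts_res_pair(2)[OF L(4) lq']
  note dw = C.lifts_degreewise[OF L(1)] C.lifts_degreewise[OF L(2)] C.lifts_degreewise[OF L(3)]
      C.lifts_degreewise[OF L(4)]
    C.lifts_degreewise[OF k] C.lifts_degreewise[OF M(1)] C.lifts_degreewise[OF M(2)]
    D.lifts_degreewise[OF lq] D.lifts_degreewise[OF lq'] D.lifts_degreewise[OF a]
  have aq: "res_map D a n \<cdot>\<^bsub>D\<^esub> res_id D (rD (Dom D a)) n = res_map D a n" "res_id D (rD (Cod D a)) n
      \<cdot>\<^bsub>D\<^esub> res_map D a n = res_map D a n" for n
    using degreewiseD[OF dw(10), of n] by (simp_all add: res_id_def)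
  \<comment> \<open>Both composites collapse to a single total map whose first components agree by
    strictness of the lifted square. In the second variable the identities are absorbed, leaving the
    chosen lift of \<open>a\<close> on either side.\<close>
  have 1: "tot_map E F R (rD (Dom D a)) R' (rD (Cod D a)) \<mu> (res_map D a) n \<cdot> tot_map E F (rC (Dom C
      l)) (rD (Dom D a)) R (rD (Dom D a)) i (res_id D (rD (Dom D a))) n
    = tot_map E F (rC (Cod C l)) (rD (Cod D a)) R' (rD (Cod D a)) i' (res_id D (rD (Cod D a))) n \<cdot>
      tot_map E F (rC (Dom C l)) (rD (Dom D a)) (rC (Cod C l)) (rD (Cod D a)) (res_map C l) (res_map
          D a) n" for n
    unfolding tot_map_Cmp[OF rp(1,2,5) dw(1,8,6,10)] tot_map_Cmp[OF rp(1,4,5) dw(5,10,3,9)] M(3) aq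
        ..
  have 2: "tot_map E F (rC (Dom C t)) (rD (Dom D a)) (rC (Cod C t)) (rD (Cod D a)) \<rho> (res_map D a) n
      \<cdot> tot_map E F R (rD (Dom D a)) (rC (Dom C t)) (rD (Dom D a)) p (res_id D (rD (Dom D a))) n
    = tot_map E F R' (rD (Cod D a)) (rC (Cod C t)) (rD (Cod D a)) p' (res_id D (rD (Cod D a))) n \<cdot>
      tot_map E F R (rD (Dom D a)) R' (rD (Cod D a)) \<mu> (res_map D a) n" for n
    unfolding tot_map_Cmp[OF rp(2,3,6) dw(2,8,7,10)] tot_map_Cmp[OF rp(2,5,6) dw(6,10,4,9)] M(4) aq
        ..
  \<comment> \<open>\<open>\<rho>\<close> is some lift of \<open>t\<close> and need not be the
    chosen one, hence the detour over \<open>Der_lift\<close>. On the left no such step is needed,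
    since the chosen lift of \<open>l\<close> was prescribed.\<close>
  have 3: "Hmap (rC (Dom C t)) (rD (Dom D a)) (rC (Cod C t)) (rD (Cod D a)) \<rho> (res_map D a) n = AMap
      (Der n) (t, a)"
    by (rule Der_lift[OF M(2) a]) (use T assms(2) in simp_all)
  have e: "Dom C f = Dom C l" "Cod C g = Dom C t" "Dom C f' = Cod C l" "Cod C g' = Cod C t" using T
      by simp_all
  show ?thesis
    using E.connecting_natural[OF split_complexes_left[OF L(1,2) S q] split_complexes_left[OF L(3,4)
        S' q']
      chain_map_tot_map[OF k a] chain_map_tot_map[OF M(1) a] chain_map_tot_map[OF M(2) a] 1 2, of n]
    unfolding 3 delta1_def h h' by (simp add: Let_def Der_arr e)
qed

lemma delta2_natural:
  assumes "short_exact_map D f g f' g' l m t" "a \<in> Arr C"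
  shows "delta2 C D E F n (Cod C a) f' g' \<cdot> AMap (Der n) (a, t) = AMap (Der (n - 1)) (a, l) \<cdot> delta2
      C D E F n (Dom C a) f g"
proof -
  have se: "short_exact D f g" "short_exact D f' g'" and sq: "comm_square D f l m f'" "comm_square D
      g m t g'"
    using assms(1) by (auto simp: short_exact_map_def)
  have T: "f \<in> Hom D (Dom D l) (Dom D m)" "f' \<in> Hom D (Cod D l) (Cod D m)" "g \<in> Hom D (Dom D m) (Dom
      D t)"
    "g' \<in> Hom D (Cod D m) (Cod D t)" "l \<in> Arr D" "m \<in> Arr D" "t \<in> Arr D"
    using sq by (auto simp: comm_square_def)
  obtain R i p where h: "horseshoe D f g = (R, i, p)" by (metis prod_cases3)
  obtain R' i' p' where h': "horseshoe D f' g' = (R', i', p')" by (metis prod_cases3)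
  note H = D.horseshoe_lifts[OF se(1) enough_D h] and H' = D.horseshoe_lifts[OF se(2) enough_D h']
  obtain r s where S: "\<And>n. D.split_exact (i n) (p n) (r n) (s n)" using H(6) by blast
  obtain r' s' where S': "\<And>n. D.split_exact (i' n) (p' n) (r' n) (s' n)" using H'(6) by blast
  note k = lift_D[OF T(5)] and a = lift_C[OF assms(2)]
  obtain \<mu> \<rho> where M: "lifts D R R' m \<mu>" "lifts D (rD (Dom D t)) (rD (Cod D t)) t \<rho>"
    "\<And>n. \<mu> n \<cdot>\<^bsub>D\<^esub> i n = i' n \<cdot>\<^bsub>D\<^esub> res_map D l n" "\<And>n. \<rho> n \<cdot>\<^bsub>D\<^esub> p n = p' n \<cdot>\<^bsub>D\<^esub> \<mu> n"
    using D.horseshoe_map[OF assms(1) enough_D h h' k] by blast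
  have ad: "Dom C a \<in> Obj C" "Cod C a \<in> Obj C" using assms(2) by simp_all
  note q = proj_res_C[OF ad(1)] and q' = proj_res_C[OF ad(2)]
  note lq = C.lifts_Ide[OF q] and lq' = C.lifts_Ide[OF q']
  have L: "lifts D (rD (Dom D l)) R f i" "lifts D R (rD (Dom D t)) g p" "lifts D (rD (Cod D l)) R'
      f' i'" "lifts D R' (rD (Cod D t)) g' p'"
    using H(1,2) H'(1,2) T by simp_all
  note rp = lifts_res_pair(1,2)[OF lq L(1)] lifts_res_pair(2)[OF lq L(2)] lifts_res_pair(1,2)[OF lq'
      L(3)] lifts_res_pair(2)[OF lq' L(4)]
  note dw = D.lifts_degreewise[OF L(1)] D.lifts_degreewise[OF L(2)] D.lifts_degreewise[OF L(3)]
      D.lifts_degreewise[OF L(4)]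
    D.lifts_degreewise[OF k] D.lifts_degreewise[OF M(1)] D.lifts_degreewise[OF M(2)]
    C.lifts_degreewise[OF lq] C.lifts_degreewise[OF lq'] C.lifts_degreewise[OF a]
  have aq: "res_map C a n \<cdot>\<^bsub>C\<^esub> res_id C (rC (Dom C a)) n = res_map C a n" "res_id C (rC (Cod C a)) n
      \<cdot>\<^bsub>C\<^esub> res_map C a n = res_map C a n" for n
    using degreewiseD[OF dw(10), of n] by (simp_all add: res_id_def)
  have 1: "tot_map E F (rC (Dom C a)) R (rC (Cod C a)) R' (res_map C a) \<mu> n \<cdot> tot_map E F (rC (Dom C
      a)) (rD (Dom D l)) (rC (Dom C a)) R (res_id C (rC (Dom C a))) i n
    = tot_map E F (rC (Cod C a)) (rD (Cod D l)) (rC (Cod C a)) R' (res_id C (rC (Cod C a))) i' n \<cdot>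
      tot_map E F (rC (Dom C a)) (rD (Dom D l)) (rC (Cod C a)) (rD (Cod D l)) (res_map C a) (res_map
          D l) n" for n
    unfolding tot_map_Cmp[OF rp(1,2,5) dw(8,1,10,6)] tot_map_Cmp[OF rp(1,4,5) dw(10,5,9,3)] M(3) aq
        ..
  have 2: "tot_map E F (rC (Dom C a)) (rD (Dom D t)) (rC (Cod C a)) (rD (Cod D t)) (res_map C a) \<rho> n
      \<cdot> tot_map E F (rC (Dom C a)) R (rC (Dom C a)) (rD (Dom D t)) (res_id C (rC (Dom C a))) p n
    = tot_map E F (rC (Cod C a)) R' (rC (Cod C a)) (rD (Cod D t)) (res_id C (rC (Cod C a))) p' n \<cdot>
      tot_map E F (rC (Dom C a)) R (rC (Cod C a)) R' (res_map C a) \<mu> n" for n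
    unfolding tot_map_Cmp[OF rp(2,3,6) dw(8,2,10,7)] tot_map_Cmp[OF rp(2,5,6) dw(10,6,9,4)] M(4) aq
        ..
  have 3: "Hmap (rC (Dom C a)) (rD (Dom D t)) (rC (Cod C a)) (rD (Cod D t)) (res_map C a) \<rho> n = AMap
      (Der n) (a, t)"
    by (rule Der_lift[OF a M(2)]) (use T assms(2) in simp_all)
  have e: "Dom D f = Dom D l" "Cod D g = Dom D t" "Dom D f' = Cod D l" "Cod D g' = Cod D t" using T
      by simp_all
  show ?thesis
    using E.connecting_natural[OF split_complexes_right[OF q L(1,2) S] split_complexes_right[OF q'
        L(3,4) S']
      chain_map_tot_map[OF a k] chain_map_tot_map[OF a M(1)] chain_map_tot_map[OF a M(2)] 1 2, of n]
    unfolding 3 delta2_def h h' by (simp add: Let_def Der_arr e)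
qed

end

section \<open>Functor categories\<close>

lemma fun_cat_simps [simp]:
  "Obj (fun_cat I C) = ftr_set I C" "Arr (fun_cat I C) = ntr_set I C" "Dom (fun_cat I C) = Src" "Cod
      (fun_cat I C) = Trg"
  by (simp_all add: fun_cat_def)

lemma Src_Cmp [simp]: "Src (\<tau> \<cdot>\<^bsub>fun_cat I C\<^esub> \<sigma>) = Src \<sigma>"
  and Trg_Cmp [simp]: "Trg (\<tau> \<cdot>\<^bsub>fun_cat I C\<^esub> \<sigma>) = Trg \<tau>"
  and Cmpt_Cmp [simp]: "k \<in> Obj I \<Longrightarrow> Cmpt (\<tau> \<cdot>\<^bsub>fun_cat I C\<^esub> \<sigma>) k = Cmpt \<tau> k \<cdot>\<^bsub>C\<^esub> Cmpt \<sigma> k"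
  and Cmpt_Zero [simp]: "k \<in> Obj I \<Longrightarrow> Cmpt (Zero (fun_cat I C) X Y) k = Zero C (OMap X k) (OMap Y k)"
  and Cmpt_Ide [simp]: "k \<in> Obj I \<Longrightarrow> Cmpt (Ide (fun_cat I C) X) k = Ide C (OMap X k)"
  and Src_Zero [simp]: "Src (Zero (fun_cat I C) X Y) = X" and Trg_Zero [simp]: "Trg (Zero (fun_cat I
      C) X Y) = Y"
  and Src_Ide [simp]: "Src (Ide (fun_cat I C) X) = X" and Trg_Ide [simp]: "Trg (Ide (fun_cat I C) X)
      = X"
  by (simp_all add: fun_cat_def)

lemma ntr_setD:
  assumes "\<sigma> \<in> ntr_set I C"
  shows "Src \<sigma> \<in> ftr_set I C" "Trg \<sigma> \<in> ftr_set I C" "Cmpt \<sigma> \<in> extensional (Obj I)"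
    and "k \<in> Obj I \<Longrightarrow> Cmpt \<sigma> k \<in> Arr C" "k \<in> Obj I \<Longrightarrow> Dom C (Cmpt \<sigma> k) = OMap (Src \<sigma>) k"
      "k \<in> Obj I \<Longrightarrow> Cod C (Cmpt \<sigma> k) = OMap (Trg \<sigma>) k"
    and "u \<in> Arr I \<Longrightarrow> Cmpt \<sigma> (Cod I u) \<cdot>\<^bsub>C\<^esub> AMap (Src \<sigma>) u = AMap (Trg \<sigma>) u \<cdot>\<^bsub>C\<^esub> Cmpt \<sigma> (Dom I u)"
  using assms by (auto simp: ntr_set_def)

lemma ftr_setD:
  assumes "X \<in> ftr_set I C"
  shows "k \<in> Obj I \<Longrightarrow> OMap X k \<in> Obj C" "k \<in> Obj I \<Longrightarrow> AMap X (Ide I k) = Ide C (OMap X k)"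
    and "u \<in> Arr I \<Longrightarrow> AMap X u \<in> Arr C" "u \<in> Arr I \<Longrightarrow> Dom C (AMap X u) = OMap X (Dom I u)"
      "u \<in> Arr I \<Longrightarrow> Cod C (AMap X u) = OMap X (Cod I u)"
    and "u \<in> Arr I \<Longrightarrow> v \<in> Arr I \<Longrightarrow> Cod I u = Dom I v \<Longrightarrow> AMap X (v \<cdot>\<^bsub>I\<^esub> u) = AMap X v \<cdot>\<^bsub>C\<^esub> AMap X u"
  using assms by (auto simp: ftr_set_def is_functor_def)

lemma ntr_eqI:
  fixes \<sigma> \<tau> :: "('o1, 'a1, 'o2, 'a2) ntr"
  assumes "\<sigma> \<in> ntr_set I C" "\<tau> \<in> ntr_set I C" "Src \<sigma> = Src \<tau>" "Trg \<sigma> = Trg \<tau>" "\<And>k. k \<in> Obj I \<Longrightarrow> Cmpt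
      \<sigma> k = Cmpt \<tau> k"
  shows "\<sigma> = \<tau>"
proof -
  have "Cmpt \<sigma> = Cmpt \<tau>"
    by (rule extensionalityI[OF ntr_setD(3)[OF assms(1)] ntr_setD(3)[OF assms(2)] assms(5)])
  then show ?thesis using assms(3,4) by (cases \<sigma>, cases \<tau>) simp
qed

locale functor_category = I: category I + abelian_category C
  for I :: "('oi, 'ai, 'xi) cat_scheme" and C :: "('o, 'a, 'x) addcat_scheme" (structure)
begin

lemma Cmp_ntr:
  assumes "\<sigma> \<in> ntr_set I C" "\<tau> \<in> ntr_set I C" "Trg \<sigma> = Src \<tau>"
  shows "\<tau> \<cdot>\<^bsub>fun_cat I C\<^esub> \<sigma> \<in> ntr_set I C"
proof -
  note S = ntr_setD[OF assms(1)] and T = ntr_setD[OF assms(2)]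
  note X = ftr_setD[OF S(1)] and Y = ftr_setD[OF S(2)] and Z = ftr_setD[OF T(2)]
  have "Cmpt \<tau> (Cod I u) \<cdot> Cmpt \<sigma> (Cod I u) \<cdot> AMap (Src \<sigma>) u = AMap (Trg \<tau>) u \<cdot> (Cmpt \<tau> (Dom I u) \<cdot>
      Cmpt \<sigma> (Dom I u))"
    if u: "u \<in> Arr I" for u
  proof -
    have o: "Dom I u \<in> Obj I" "Cod I u \<in> Obj I" using u by simp_all
    have "Cmpt \<tau> (Cod I u) \<cdot> Cmpt \<sigma> (Cod I u) \<cdot> AMap (Src \<sigma>) u = Cmpt \<tau> (Cod I u) \<cdot> (AMap (Src \<tau>) u
        \<cdot> Cmpt \<sigma> (Dom I u))"
      using S(4-7) T(4-6) X Y u o assms(3) by simp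
    also have "\<dots> = AMap (Trg \<tau>) u \<cdot> (Cmpt \<tau> (Dom I u) \<cdot> Cmpt \<sigma> (Dom I u))"
      by (rule Cmp_reassoc[OF T(7)[OF u]]) (use S(4-6) T(4-6) Y Z u o assms(3) in simp_all)
    finally show ?thesis .
  qed
  then show ?thesis
    using S T assms(3) by (simp add: ntr_set_def fun_cat_def)
qed

lemma Zero_ntr:
  assumes "X \<in> ftr_set I C" "Y \<in> ftr_set I C"
  shows "Zero (fun_cat I C) X Y \<in> ntr_set I C"
  using assms ftr_setD[OF assms(1)] ftr_setD[OF assms(2)] by (simp add: ntr_set_def fun_cat_def)

lemma Ide_ntr:
  assumes "X \<in> ftr_set I C"
  shows "Ide (fun_cat I C) X \<in> ntr_set I C"
  using assms ftr_setD[OF assms(1)] by (simp add: ntr_set_def fun_cat_def)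

text \<open>Kernels are chosen at each object, and the structure maps are the induced
  factorisations. Monicity of the kernels makes these unique, which yields functoriality although
  the choices are unrelated. The cokernel case is dual.\<close>

lemma pointwise_kernel:
  assumes "\<sigma> \<in> ntr_set I C"
  obtains \<kappa> where "\<kappa> \<in> ntr_set I C" "Trg \<kappa> = Src \<sigma>" "\<And>k. k \<in> Obj I \<Longrightarrow> is_kernel C (Cmpt \<sigma> k) (Cmpt \<kappa>
      k)"
proof -
  note S = ntr_setD[OF assms] and X = ftr_setD[OF ntr_setD(1)[OF assms]] and Y = ftr_setD[OF
      ntr_setD(2)[OF assms]]
  have "\<forall>k. \<exists>m. k \<in> Obj I \<longrightarrow> is_kernel C (Cmpt \<sigma> k) m"
    using has_kernels S(4) by metis
  then obtain m where m: "\<And>k. k \<in> Obj I \<Longrightarrow> is_kernel C (Cmpt \<sigma> k) (m k)" by metis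
  have mT: "m k \<in> Arr C" "Cod C (m k) = OMap (Src \<sigma>) k" "Cmpt \<sigma> k \<cdot> m k = Zero C (Dom C (m k)) (OMap
      (Trg \<sigma>) k)"
    "mono_arr C (m k)" "Dom C (m k) \<in> Obj C" if "k \<in> Obj I" for k
    using kernelD[OF m[OF that]] S(4-6)[OF that] kernel_mono[OF m[OF that]] by simp_all
  have "\<exists>v. v \<in> Hom C (Dom C (m (Dom I u))) (Dom C (m (Cod I u))) \<and> m (Cod I u) \<cdot> v = AMap (Src \<sigma>) u
      \<cdot> m (Dom I u)"
    if u: "u \<in> Arr I" for u
  proof -
    have o: "Dom I u \<in> Obj I" "Cod I u \<in> Obj I" using u by simp_all
    have "Cmpt \<sigma> (Cod I u) \<cdot> (AMap (Src \<sigma>) u \<cdot> m (Dom I u)) = AMap (Trg \<sigma>) u \<cdot> (Cmpt \<sigma> (Dom I u) \<cdot> m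
        (Dom I u))"
      by (rule Cmp_reassoc[OF S(7)[OF u]]) (use S(4-6) X Y u o mT[OF o(1)] in simp_all)
    also have "\<dots> = Zero C (Dom C (m (Dom I u))) (OMap (Trg \<sigma>) (Cod I u))"
      unfolding mT(3)[OF o(1)] using Y u o mT[OF o(1)] by simp
    finally have z: "Cmpt \<sigma> (Cod I u) \<cdot> (AMap (Src \<sigma>) u \<cdot> m (Dom I u)) = Zero C (Dom C (m (Dom I
        u))) (OMap (Trg \<sigma>) (Cod I u))" .
    show ?thesis
      using kernel_factor[OF m[OF o(2)], of "AMap (Src \<sigma>) u \<cdot> m (Dom I u)"] z S(4-6)[OF o(2)] X u o
          mT[OF o(1)] by force
  qed
  then obtain v where v: "\<And>u. u \<in> Arr I \<Longrightarrow> v u \<in> Hom C (Dom C (m (Dom I u))) (Dom C (m (Cod I u)))"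
    "\<And>u. u \<in> Arr I \<Longrightarrow> m (Cod I u) \<cdot> v u = AMap (Src \<sigma>) u \<cdot> m (Dom I u)"
    by metis
  let ?K = "\<lparr>OMap = (\<lambda>k \<in> Obj I. Dom C (m k)), AMap = (\<lambda>u \<in> Arr I. v u)\<rparr>"
  have K: "?K \<in> ftr_set I C"
  proof -
    have "v (Ide I k) = Ide C (Dom C (m k))" if k: "k \<in> Obj I" for k
      by (rule mono_cancel[OF mT(4)[OF k], where a = "Dom C (m k)"])
        (use v(1)[of "Ide I k"] v(2)[of "Ide I k"] k mT[OF k] X in simp_all)
    moreover have "v (w \<cdot>\<^bsub>I\<^esub> u) = v w \<cdot> v u" if u: "u \<in> Arr I" "w \<in> Arr I" "Cod I u = Dom I w" for u
        w
    proof (rule mono_cancel[OF mT(4)[of "Cod I w"], where a = "Dom C (m (Dom I u))"])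
      have o: "Dom I u \<in> Obj I" "Dom I w \<in> Obj I" "Cod I w \<in> Obj I" "Cod I u \<in> Obj I" using u by
          simp_all
      note M = mT(1,2)[OF o(1)] mT(1,2)[OF o(2)] mT(1,2)[OF o(3)]
      note V = v(1)[OF u(1)] v(1)[OF u(2)]
      have "m (Cod I w) \<cdot> (v w \<cdot> v u) = AMap (Src \<sigma>) w \<cdot> (m (Dom I w) \<cdot> v u)"
        by (rule Cmp_reassoc[OF v(2)[OF u(2)]]) (use V M X u o in simp_all)
      also have "\<dots> = AMap (Src \<sigma>) w \<cdot> (AMap (Src \<sigma>) u \<cdot> m (Dom I u))"
        using v(2)[OF u(1)] u(3) by simp
      also have "\<dots> = AMap (Src \<sigma>) (w \<cdot>\<^bsub>I\<^esub> u) \<cdot> m (Dom I u)"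
        using X M u o by simp
      also have "\<dots> = m (Cod I w) \<cdot> v (w \<cdot>\<^bsub>I\<^esub> u)"
        using v(2)[of "w \<cdot>\<^bsub>I\<^esub> u"] u by simp
      finally show "m (Cod I w) \<cdot> v (w \<cdot>\<^bsub>I\<^esub> u) = m (Cod I w) \<cdot> (v w \<cdot> v u)" by simp
    qed (use v(1)[of "w \<cdot>\<^bsub>I\<^esub> u"] v(1)[of u] v(1)[of w] u in simp_all)
    ultimately show ?thesis
      using v(1) mT(5) by (simp add: ftr_set_def is_functor_def)
  qed
  let ?k = "\<lparr>Src = ?K, Trg = Src \<sigma>, Cmpt = (\<lambda>k \<in> Obj I. m k)\<rparr>"
  have "?k \<in> ntr_set I C"
    using K S(1) mT v(2) by (simp add: ntr_set_def)
  then show thesis using that[of ?k] m by simp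
qed

lemma pointwise_cokernel:
  assumes "\<sigma> \<in> ntr_set I C"
  obtains \<kappa> where "\<kappa> \<in> ntr_set I C" "Src \<kappa> = Trg \<sigma>" "\<And>k. k \<in> Obj I \<Longrightarrow> is_cokernel C (Cmpt \<sigma> k) (Cmpt
      \<kappa> k)"
proof -
  note S = ntr_setD[OF assms] and X = ftr_setD[OF ntr_setD(1)[OF assms]] and Y = ftr_setD[OF
      ntr_setD(2)[OF assms]]
  have "\<forall>k. \<exists>m. k \<in> Obj I \<longrightarrow> is_cokernel C (Cmpt \<sigma> k) m"
    using has_cokernels S(4) by metis
  then obtain m where m: "\<And>k. k \<in> Obj I \<Longrightarrow> is_cokernel C (Cmpt \<sigma> k) (m k)" by metis
  have mT: "m k \<in> Arr C" "Dom C (m k) = OMap (Trg \<sigma>) k" "m k \<cdot> Cmpt \<sigma> k = Zero C (OMap (Src \<sigma>) k)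
      (Cod C (m k))"
    "epi_arr C (m k)" "Cod C (m k) \<in> Obj C" if "k \<in> Obj I" for k
    using cokernelD[OF m[OF that]] S(4-6)[OF that] cokernel_epi[OF m[OF that]] by simp_all
  have "\<exists>v. v \<in> Hom C (Cod C (m (Dom I u))) (Cod C (m (Cod I u))) \<and> v \<cdot> m (Dom I u) = m (Cod I u) \<cdot>
      AMap (Trg \<sigma>) u"
    if u: "u \<in> Arr I" for u
  proof -
    have o: "Dom I u \<in> Obj I" "Cod I u \<in> Obj I" using u by simp_all
    have "m (Cod I u) \<cdot> AMap (Trg \<sigma>) u \<cdot> Cmpt \<sigma> (Dom I u) = m (Cod I u) \<cdot> (Cmpt \<sigma> (Cod I u) \<cdot> AMap
        (Src \<sigma>) u)"
      unfolding S(7)[OF u] by (rule Cmp_assoc') (use S(4-6) Y u o mT[OF o(2)] in simp_all)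
    also have "\<dots> = Zero C (OMap (Src \<sigma>) (Dom I u)) (Cod C (m (Cod I u)))"
      using Cmp_reassoc1[OF mT(3)[OF o(2)], of "AMap (Src \<sigma>) u"] S(4-6) X u o mT[OF o(2)] by simp
    finally have z: "m (Cod I u) \<cdot> AMap (Trg \<sigma>) u \<cdot> Cmpt \<sigma> (Dom I u) = Zero C (OMap (Src \<sigma>) (Dom I
        u)) (Cod C (m (Cod I u)))" .
    have t: "m (Cod I u) \<cdot> AMap (Trg \<sigma>) u \<in> Arr C" "Dom C (m (Cod I u) \<cdot> AMap (Trg \<sigma>) u) = Cod C
        (Cmpt \<sigma> (Dom I u))"
      "Cod C (m (Cod I u) \<cdot> AMap (Trg \<sigma>) u) = Cod C (m (Cod I u))" "Dom C (Cmpt \<sigma> (Dom I u)) = OMap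
          (Src \<sigma>) (Dom I u)"
      using S(4-6) Y u o mT[OF o(2)] by simp_all
    show ?thesis
      using cokernel_factor[OF m[OF o(1)] t(1,2)] z unfolding t(3,4) by blast
  qed
  then obtain v where v: "\<And>u. u \<in> Arr I \<Longrightarrow> v u \<in> Hom C (Cod C (m (Dom I u))) (Cod C (m (Cod I u)))"
    "\<And>u. u \<in> Arr I \<Longrightarrow> v u \<cdot> m (Dom I u) = m (Cod I u) \<cdot> AMap (Trg \<sigma>) u"
    by metis
  let ?K = "\<lparr>OMap = (\<lambda>k \<in> Obj I. Cod C (m k)), AMap = (\<lambda>u \<in> Arr I. v u)\<rparr>"
  have K: "?K \<in> ftr_set I C"
  proof -
    have "v (Ide I k) = Ide C (Cod C (m k))" if k: "k \<in> Obj I" for k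
      by (rule epi_cancel[OF mT(4)[OF k], where b = "Cod C (m k)"])
        (use v(1)[of "Ide I k"] v(2)[of "Ide I k"] k mT[OF k] Y in simp_all)
    moreover have "v (w \<cdot>\<^bsub>I\<^esub> u) = v w \<cdot> v u" if u: "u \<in> Arr I" "w \<in> Arr I" "Cod I u = Dom I w" for u
        w
    proof (rule epi_cancel[OF mT(4)[of "Dom I u"], where b = "Cod C (m (Cod I w))"])
      have o: "Dom I u \<in> Obj I" "Dom I w \<in> Obj I" "Cod I w \<in> Obj I" "Cod I u \<in> Obj I" using u by
          simp_all
      note M = mT(1,2)[OF o(1)] mT(1,2)[OF o(2)] mT(1,2)[OF o(3)]
      note V = v(1)[OF u(1)] v(1)[OF u(2)]
      have "v w \<cdot> v u \<cdot> m (Dom I u) = v w \<cdot> (m (Dom I w) \<cdot> AMap (Trg \<sigma>) u)"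
        using V M v(2)[OF u(1)] u(3) by simp
      also have "\<dots> = m (Cod I w) \<cdot> (AMap (Trg \<sigma>) w \<cdot> AMap (Trg \<sigma>) u)"
        by (rule Cmp_reassoc[OF v(2)[OF u(2)]]) (use V M Y u o in simp_all)
      also have "\<dots> = m (Cod I w) \<cdot> AMap (Trg \<sigma>) (w \<cdot>\<^bsub>I\<^esub> u)"
        using Y M u o by simp
      also have "\<dots> = v (w \<cdot>\<^bsub>I\<^esub> u) \<cdot> m (Dom I u)"
        using v(2)[of "w \<cdot>\<^bsub>I\<^esub> u"] u by simp
      finally show "v (w \<cdot>\<^bsub>I\<^esub> u) \<cdot> m (Dom I u) = v w \<cdot> v u \<cdot> m (Dom I u)" by simp
    qed (use v(1)[of "w \<cdot>\<^bsub>I\<^esub> u"] v(1)[of u] v(1)[of w] u in simp_all)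
    ultimately show ?thesis
      using v(1) mT(5) by (simp add: ftr_set_def is_functor_def)
  qed
  let ?k = "\<lparr>Src = Trg \<sigma>, Trg = ?K, Cmpt = (\<lambda>k \<in> Obj I. m k)\<rparr>"
  have "?k \<in> ntr_set I C"
    using K S(2) mT v(2) by (simp add: ntr_set_def)
  then show thesis using that[of ?k] m by simp
qed

text \<open>Factorisations exist and are unique at each object; naturality of the resulting family
  is checked after composing with the monic components of \<open>\<kappa>\<close>.\<close>

lemma is_kernel_fun_cat:
  assumes "\<sigma> \<in> ntr_set I C" "\<kappa> \<in> ntr_set I C" "Trg \<kappa> = Src \<sigma>"
    and "\<And>k. k \<in> Obj I \<Longrightarrow> is_kernel C (Cmpt \<sigma> k) (Cmpt \<kappa> k)"
  shows "is_kernel (fun_cat I C) \<sigma> \<kappa>"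
proof -
  note S = ntr_setD[OF assms(1)] and K = ntr_setD[OF assms(2)]
  have "\<sigma> \<cdot>\<^bsub>fun_cat I C\<^esub> \<kappa> = Zero (fun_cat I C) (Src \<kappa>) (Trg \<sigma>)"
    by (rule ntr_eqI[OF Cmp_ntr[OF assms(2,1,3)] Zero_ntr[OF K(1) S(2)]])
      (use kernelD(4)[OF assms(4)] S(4-6) K(4-6) in simp_all)
  moreover have "\<exists>!u. u \<in> Hom (fun_cat I C) (Src h) (Src \<kappa>) \<and> \<kappa> \<cdot>\<^bsub>fun_cat I C\<^esub> u = h"
    if h: "h \<in> ntr_set I C" "Trg h = Src \<sigma>" "\<sigma> \<cdot>\<^bsub>fun_cat I C\<^esub> h = Zero (fun_cat I C) (Src h) (Trg
        \<sigma>)" for h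
  proof -
    note H = ntr_setD[OF h(1)]
    note X = ftr_setD[OF H(1)] and Y = ftr_setD[OF K(1)] and Z = ftr_setD[OF H(2)]
    have "\<exists>w. w \<in> Hom C (OMap (Src h) k) (OMap (Src \<kappa>) k) \<and> Cmpt \<kappa> k \<cdot> w = Cmpt h k" if k: "k \<in> Obj
        I" for k
    proof -
      have "Cmpt \<sigma> k \<cdot> Cmpt h k = Zero C (OMap (Src h) k) (OMap (Trg \<sigma>) k)"
        using arg_cong[OF h(3), of "\<lambda>x. Cmpt x k"] k by simp
      then show ?thesis
        using kernel_factor[OF assms(4)[OF k], of "Cmpt h k"] H(4-6)[OF k] S(4-6)[OF k] K(4-6)[OF k]
            h(2) by force
    qed
    then obtain w where w: "\<And>k. k \<in> Obj I \<Longrightarrow> w k \<in> Hom C (OMap (Src h) k) (OMap (Src \<kappa>) k)"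
      "\<And>k. k \<in> Obj I \<Longrightarrow> Cmpt \<kappa> k \<cdot> w k = Cmpt h k" by metis
    have mono: "mono_arr C (Cmpt \<kappa> k)" if "k \<in> Obj I" for k by (rule kernel_mono[OF assms(4)[OF
        that]])
    let ?w = "\<lparr>Src = Src h, Trg = Src \<kappa>, Cmpt = (\<lambda>k \<in> Obj I. w k)\<rparr>"
    have nat: "w (Cod I u) \<cdot> AMap (Src h) u = AMap (Src \<kappa>) u \<cdot> w (Dom I u)" if u: "u \<in> Arr I" for u
    proof (rule mono_cancel[OF mono[of "Cod I u"], where a = "OMap (Src h) (Dom I u)"])
      have o: "Dom I u \<in> Obj I" "Cod I u \<in> Obj I" using u by simp_all
      have "Cmpt \<kappa> (Cod I u) \<cdot> (w (Cod I u) \<cdot> AMap (Src h) u) = Cmpt h (Cod I u) \<cdot> AMap (Src h) u"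
        by (rule Cmp_reassoc1[OF w(2)[OF o(2)]]) (use w(1)[OF o(2)] K(4-6)[OF o(2)] X u in simp_all)
      also have "\<dots> = AMap (Trg \<kappa>) u \<cdot> (Cmpt \<kappa> (Dom I u) \<cdot> w (Dom I u))"
        using H(7)[OF u] w(2)[OF o(1)] h(2) assms(3) by simp
      also have "\<dots> = Cmpt \<kappa> (Cod I u) \<cdot> (AMap (Src \<kappa>) u \<cdot> w (Dom I u))"
        by (rule Cmp_reassoc[OF K(7)[OF u], symmetric])
          (use w(1)[OF o(1)] K(4-6)[OF o(1)] K(4-6)[OF o(2)] Y Z u o h(2) assms(3) in simp_all)
      finally show "Cmpt \<kappa> (Cod I u) \<cdot> (w (Cod I u) \<cdot> AMap (Src h) u) = Cmpt \<kappa> (Cod I u) \<cdot> (AMap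
          (Src \<kappa>) u \<cdot> w (Dom I u))" .
    qed (use w(1)[of "Dom I u"] w(1)[of "Cod I u"] K(4-6)[of "Cod I u"] X Y u in simp_all)
    then have wn: "?w \<in> ntr_set I C"
      using w(1) H(1) K(1) by (simp add: ntr_set_def)
    show ?thesis
    proof (rule ex1I[of _ ?w])
      show "?w \<in> Hom (fun_cat I C) (Src h) (Src \<kappa>) \<and> \<kappa> \<cdot>\<^bsub>fun_cat I C\<^esub> ?w = h"
        using wn ntr_eqI[OF Cmp_ntr[OF wn assms(2)] h(1)] w(2) h(2) assms(3) by simp
      fix z assume z: "z \<in> Hom (fun_cat I C) (Src h) (Src \<kappa>) \<and> \<kappa> \<cdot>\<^bsub>fun_cat I C\<^esub> z = h"
      then have zn: "z \<in> ntr_set I C" "Src z = Src h" "Trg z = Src \<kappa>" by simp_all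
      show "z = ?w"
      proof (rule ntr_eqI[OF zn(1) wn])
        fix k assume k: "k \<in> Obj I"
        have "Cmpt \<kappa> k \<cdot> Cmpt z k = Cmpt h k"
          using z k by auto
        then have eq: "Cmpt \<kappa> k \<cdot> Cmpt z k = Cmpt \<kappa> k \<cdot> w k" using w(2)[OF k] by simp
        have "Cmpt z k = w k"
          by (rule mono_cancel[OF mono[OF k] _ _ eq]) (use ntr_setD(4-6)[OF zn(1) k] zn w(1)[OF k]
              K(5)[OF k] in auto)
        then show "Cmpt z k = Cmpt ?w k" using k by simp
      qed (use zn in simp_all)
    qed
  qed
  ultimately show ?thesis
    using assms(1-3) by (simp add: is_kernel_def del: Hom_iff)
qed

lemma is_cokernel_fun_cat:
  assumes "\<sigma> \<in> ntr_set I C" "\<kappa> \<in> ntr_set I C" "Src \<kappa> = Trg \<sigma>"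
    and "\<And>k. k \<in> Obj I \<Longrightarrow> is_cokernel C (Cmpt \<sigma> k) (Cmpt \<kappa> k)"
  shows "is_cokernel (fun_cat I C) \<sigma> \<kappa>"
proof -
  note S = ntr_setD[OF assms(1)] and K = ntr_setD[OF assms(2)]
  have "\<kappa> \<cdot>\<^bsub>fun_cat I C\<^esub> \<sigma> = Zero (fun_cat I C) (Src \<sigma>) (Trg \<kappa>)"
    by (rule ntr_eqI[OF Cmp_ntr[OF assms(1,2) assms(3)[symmetric]] Zero_ntr[OF S(1) K(2)]])
      (use cokernelD(4)[OF assms(4)] S(4-6) K(4-6) in simp_all)
  moreover have "\<exists>!u. u \<in> Hom (fun_cat I C) (Trg \<kappa>) (Trg h) \<and> u \<cdot>\<^bsub>fun_cat I C\<^esub> \<kappa> = h"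
    if h: "h \<in> ntr_set I C" "Src h = Trg \<sigma>" "h \<cdot>\<^bsub>fun_cat I C\<^esub> \<sigma> = Zero (fun_cat I C) (Src \<sigma>) (Trg
        h)" for h
  proof -
    note H = ntr_setD[OF h(1)]
    note X = ftr_setD[OF H(2)] and Y = ftr_setD[OF K(2)] and Z = ftr_setD[OF K(1)]
    have "\<exists>w. w \<in> Hom C (OMap (Trg \<kappa>) k) (OMap (Trg h) k) \<and> w \<cdot> Cmpt \<kappa> k = Cmpt h k" if k: "k \<in> Obj
        I" for k
    proof -
      have "Cmpt h k \<cdot> Cmpt \<sigma> k = Zero C (OMap (Src \<sigma>) k) (OMap (Trg h) k)"
        using arg_cong[OF h(3), of "\<lambda>x. Cmpt x k"] k by simp
      then show ?thesis
        using cokernel_factor[OF assms(4)[OF k], of "Cmpt h k"] H(4-6)[OF k] S(4-6)[OF k] K(4-6)[OF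
            k] h(2) by force
    qed
    then obtain w where w: "\<And>k. k \<in> Obj I \<Longrightarrow> w k \<in> Hom C (OMap (Trg \<kappa>) k) (OMap (Trg h) k)"
      "\<And>k. k \<in> Obj I \<Longrightarrow> w k \<cdot> Cmpt \<kappa> k = Cmpt h k" by metis
    have epi: "epi_arr C (Cmpt \<kappa> k)" if "k \<in> Obj I" for k by (rule cokernel_epi[OF assms(4)[OF
        that]])
    let ?w = "\<lparr>Src = Trg \<kappa>, Trg = Trg h, Cmpt = (\<lambda>k \<in> Obj I. w k)\<rparr>"
    have nat: "w (Cod I u) \<cdot> AMap (Trg \<kappa>) u = AMap (Trg h) u \<cdot> w (Dom I u)" if u: "u \<in> Arr I" for u
    proof (rule epi_cancel[OF epi[of "Dom I u"], where b = "OMap (Trg h) (Cod I u)"])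
      have o: "Dom I u \<in> Obj I" "Cod I u \<in> Obj I" using u by simp_all
      have "w (Cod I u) \<cdot> AMap (Trg \<kappa>) u \<cdot> Cmpt \<kappa> (Dom I u) = w (Cod I u) \<cdot> (Cmpt \<kappa> (Cod I u) \<cdot> AMap
          (Src \<kappa>) u)"
        unfolding K(7)[OF u] by (rule Cmp_assoc') (use w(1)[OF o(2)] K(4-6)[OF o(1)] Y u o in
            simp_all)
      also have "\<dots> = Cmpt h (Cod I u) \<cdot> AMap (Src h) u"
        using Cmp_reassoc1[OF w(2)[OF o(2)], of "AMap (Src \<kappa>) u"] w(1)[OF o(2)] K(4-6)[OF o(2)] Z u
            o h(2) assms(3) by simp
      also have "\<dots> = AMap (Trg h) u \<cdot> w (Dom I u) \<cdot> Cmpt \<kappa> (Dom I u)"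
        using H(7)[OF u] w[OF o(1)] K(4-6)[OF o(1)] X u o by simp
      finally show "w (Cod I u) \<cdot> AMap (Trg \<kappa>) u \<cdot> Cmpt \<kappa> (Dom I u) = AMap (Trg h) u \<cdot> w (Dom I u) \<cdot>
          Cmpt \<kappa> (Dom I u)" .
    qed (use w(1)[of "Dom I u"] w(1)[of "Cod I u"] K(4-6)[of "Dom I u"] X Y u in simp_all)
    then have wn: "?w \<in> ntr_set I C"
      using w(1) H(2) K(2) by (simp add: ntr_set_def)
    show ?thesis
    proof (rule ex1I[of _ ?w])
      show "?w \<in> Hom (fun_cat I C) (Trg \<kappa>) (Trg h) \<and> ?w \<cdot>\<^bsub>fun_cat I C\<^esub> \<kappa> = h"
        using wn ntr_eqI[OF Cmp_ntr[OF assms(2) wn] h(1)] w(2) h(2) assms(3) by simp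
      fix z assume z: "z \<in> Hom (fun_cat I C) (Trg \<kappa>) (Trg h) \<and> z \<cdot>\<^bsub>fun_cat I C\<^esub> \<kappa> = h"
      then have zn: "z \<in> ntr_set I C" "Src z = Trg \<kappa>" "Trg z = Trg h" by simp_all
      show "z = ?w"
      proof (rule ntr_eqI[OF zn(1) wn])
        fix k assume k: "k \<in> Obj I"
        have "Cmpt z k \<cdot> Cmpt \<kappa> k = Cmpt h k"
          using z k by auto
        then have eq: "Cmpt z k \<cdot> Cmpt \<kappa> k = w k \<cdot> Cmpt \<kappa> k" using w(2)[OF k] by simp
        have "Cmpt z k = w k"
          by (rule epi_cancel[OF epi[OF k] _ _ eq]) (use ntr_setD(4-6)[OF zn(1) k] zn w(1)[OF k]
              K(6)[OF k] in auto)
        then show "Cmpt z k = Cmpt ?w k" using k by simp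
      qed (use zn in simp_all)
    qed
  qed
  ultimately show ?thesis
    using assms(1-3) by (simp add: is_cokernel_def del: Hom_iff)
qed

text \<open>Take a pointwise kernel \<open>\<kappa>\<close> of \<open>\<sigma>\<close>. Both
  \<open>\<kappa>\<close> and the zero transformation are sent to zero by \<open>\<sigma>\<close>,
  so they coincide; each component of \<open>\<sigma>\<close> then has zero kernel. The epimorphic
  case is dual.\<close>

lemma mono_fun_cat:
  assumes "mono_arr (fun_cat I C) \<sigma>" "k \<in> Obj I"
  shows "mono_arr C (Cmpt \<sigma> k)"
proof -
  have s: "\<sigma> \<in> ntr_set I C" using assms(1) by (simp add: mono_arr_def)
  note S = ntr_setD[OF s]
  obtain \<kappa> where k: "\<kappa> \<in> ntr_set I C" "Trg \<kappa> = Src \<sigma>" "\<And>k. k \<in> Obj I \<Longrightarrow> is_kernel C (Cmpt \<sigma> k) (Cmpt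
      \<kappa> k)"
    using pointwise_kernel[OF s] by blast
  note K = ntr_setD[OF k(1)] and z = Zero_ntr[OF ntr_setD(1)[OF k(1)] S(1)]
  have "\<sigma> \<cdot>\<^bsub>fun_cat I C\<^esub> \<kappa> = \<sigma> \<cdot>\<^bsub>fun_cat I C\<^esub> Zero (fun_cat I C) (Src \<kappa>) (Src \<sigma>)"
    by (rule ntr_eqI[OF Cmp_ntr[OF k(1) s k(2)] Cmp_ntr[OF z s]])
      (use kernelD(4)[OF k(3)] S(4-6) K(4-6) ftr_setD(1)[OF K(1)] in simp_all)
  then have "\<kappa> = Zero (fun_cat I C) (Src \<kappa>) (Src \<sigma>)"
    using assms(1) k(1,2) z unfolding mono_arr_def by simp
  then have m0: "Cmpt \<kappa> k = Zero C (OMap (Src \<kappa>) k) (OMap (Src \<sigma>) k)"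
    using Cmpt_Zero[OF assms(2)] by metis
  show ?thesis
  proof (rule mono_arrI)
    fix u assume u: "u \<in> Arr C" "Cod C u = Dom C (Cmpt \<sigma> k)" "Cmpt \<sigma> k \<cdot> u = Zero C (Dom C u) (Cod C
        (Cmpt \<sigma> k))"
    obtain w where w: "w \<in> Hom C (Dom C u) (Dom C (Cmpt \<kappa> k))" "Cmpt \<kappa> k \<cdot> w = u"
      using kernel_factor[OF k(3)[OF assms(2)] u] by blast
    have "Cmpt \<kappa> k \<cdot> w = Zero C (Dom C u) (Dom C (Cmpt \<sigma> k))"
      unfolding m0 using w(1) S(4-6)[OF assms(2)] K(4-6)[OF assms(2)] ftr_setD(1)[OF S(1) assms(2)]
          by simp
    then show "u = Zero C (Dom C u) (Dom C (Cmpt \<sigma> k))" using w(2) by metis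
  qed (use S(4)[OF assms(2)] in simp)
qed

lemma epi_fun_cat:
  assumes "epi_arr (fun_cat I C) \<sigma>" "k \<in> Obj I"
  shows "epi_arr C (Cmpt \<sigma> k)"
proof -
  have s: "\<sigma> \<in> ntr_set I C" using assms(1) by (simp add: epi_arr_def)
  note S = ntr_setD[OF s]
  obtain \<kappa> where k: "\<kappa> \<in> ntr_set I C" "Src \<kappa> = Trg \<sigma>" "\<And>k. k \<in> Obj I \<Longrightarrow> is_cokernel C (Cmpt \<sigma> k)
      (Cmpt \<kappa> k)"
    using pointwise_cokernel[OF s] by blast
  note K = ntr_setD[OF k(1)] and z = Zero_ntr[OF S(2) ntr_setD(2)[OF k(1)]]
  have "\<kappa> \<cdot>\<^bsub>fun_cat I C\<^esub> \<sigma> = Zero (fun_cat I C) (Trg \<sigma>) (Trg \<kappa>) \<cdot>\<^bsub>fun_cat I C\<^esub> \<sigma>"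
    by (rule ntr_eqI[OF Cmp_ntr[OF s k(1) k(2)[symmetric]] Cmp_ntr[OF s z]])
      (use cokernelD(4)[OF k(3)] S(4-6) K(4-6) ftr_setD(1)[OF K(2)] in simp_all)
  then have "\<kappa> = Zero (fun_cat I C) (Trg \<sigma>) (Trg \<kappa>)"
    using assms(1) k(1,2) z unfolding epi_arr_def by simp
  then have m0: "Cmpt \<kappa> k = Zero C (OMap (Trg \<sigma>) k) (OMap (Trg \<kappa>) k)"
    using Cmpt_Zero[OF assms(2)] by metis
  show ?thesis
  proof (rule epi_arrI)
    fix u assume u: "u \<in> Arr C" "Dom C u = Cod C (Cmpt \<sigma> k)" "u \<cdot> Cmpt \<sigma> k = Zero C (Dom C (Cmpt \<sigma>
        k)) (Cod C u)"
    obtain w where w: "w \<in> Hom C (Cod C (Cmpt \<kappa> k)) (Cod C u)" "w \<cdot> Cmpt \<kappa> k = u"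
      using cokernel_factor[OF k(3)[OF assms(2)] u] by blast
    have "w \<cdot> Cmpt \<kappa> k = Zero C (Cod C (Cmpt \<sigma> k)) (Cod C u)"
      unfolding m0 using w(1) S(4-6)[OF assms(2)] K(4-6)[OF assms(2)] ftr_setD(1)[OF S(2) assms(2)]
          by simp
    then show "u = Zero C (Cod C (Cmpt \<sigma> k)) (Cod C u)" using w(2) by metis
  qed (use S(4)[OF assms(2)] in simp)
qed

text \<open>The cokernel \<open>c\<close> and kernel \<open>k\<close> that witness exactness are
  universal in the functor category, and nothing is known about their components. The pointwise
  \<open>c'\<close> factors through \<open>c\<close>, the pointwise \<open>k'\<close> through
  \<open>k\<close>, and \<open>f\<close> through \<open>k\<close>. At each object the two conditions
  of \<open>exact_at_iff\<close> for \<open>c'\<close> and \<open>k'\<close> then follow from the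
  vanishing of \<open>c \<cdot> k\<close> and of \<open>g \<cdot> k\<close>.\<close>

lemma exact_fun_cat_pointwise:
  assumes "exact_at (fun_cat I C) f g" "i \<in> Obj I"
  shows "exact_at C (Cmpt f i) (Cmpt g i)"
proof -
  have fg: "f \<in> ntr_set I C" "g \<in> ntr_set I C" "Trg f = Src g"
    using exact_atD[OF assms(1)] by simp_all
  obtain c k where c: "is_cokernel (fun_cat I C) f c" and k: "is_kernel (fun_cat I C) c k"
      "is_kernel (fun_cat I C) g k"
    using assms(1) by (auto simp: exact_at_def)
  have ck: "c \<in> ntr_set I C" "k \<in> ntr_set I C" "Src c = Trg f" "Trg k = Src c"
    "c \<cdot>\<^bsub>fun_cat I C\<^esub> f = Zero (fun_cat I C) (Src f) (Trg c)" "c \<cdot>\<^bsub>fun_cat I C\<^esub> k = Zero (fun_cat I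
        C) (Src k) (Trg c)"
    "g \<cdot>\<^bsub>fun_cat I C\<^esub> k = Zero (fun_cat I C) (Src k) (Trg g)"
    using c k by (auto simp: is_cokernel_def is_kernel_def)
  obtain c' where c': "c' \<in> ntr_set I C" "Src c' = Trg f" "\<And>k. k \<in> Obj I \<Longrightarrow> is_cokernel C (Cmpt f k)
      (Cmpt c' k)"
    using pointwise_cokernel[OF fg(1)] by blast
  obtain k' where k': "k' \<in> ntr_set I C" "Trg k' = Src g" "\<And>k. k \<in> Obj I \<Longrightarrow> is_kernel C (Cmpt g k)
      (Cmpt k' k)"
    using pointwise_kernel[OF fg(2)] by blast
  have "c' \<cdot>\<^bsub>fun_cat I C\<^esub> f = Zero (fun_cat I C) (Src f) (Trg c')"
    using is_cokernel_fun_cat[OF fg(1) c'] by (simp add: is_cokernel_def)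
  then have "\<exists>!u. u \<in> Hom (fun_cat I C) (Cod (fun_cat I C) c) (Cod (fun_cat I C) c') \<and> u \<cdot>\<^bsub>fun_cat I
      C\<^esub> c = c'"
    using c c'(1,2) unfolding is_cokernel_def by (simp del: Hom_iff)
  then obtain v where v: "v \<in> ntr_set I C" "Src v = Trg c" "v \<cdot>\<^bsub>fun_cat I C\<^esub> c = c'" by auto
  have "g \<cdot>\<^bsub>fun_cat I C\<^esub> k' = Zero (fun_cat I C) (Src k') (Trg g)"
    using is_kernel_fun_cat[OF fg(2) k'] by (simp add: is_kernel_def)
  then have "\<exists>!u. u \<in> Hom (fun_cat I C) (Dom (fun_cat I C) k') (Dom (fun_cat I C) k) \<and> k \<cdot>\<^bsub>fun_cat I
      C\<^esub> u = k'"
    using k(2) k'(1,2) unfolding is_kernel_def by (simp del: Hom_iff)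
  then obtain w where w: "w \<in> ntr_set I C" "Trg w = Src k" "k \<cdot>\<^bsub>fun_cat I C\<^esub> w = k'" by auto
  have "\<exists>!u. u \<in> Hom (fun_cat I C) (Dom (fun_cat I C) f) (Dom (fun_cat I C) k) \<and> k \<cdot>\<^bsub>fun_cat I C\<^esub> u
      = f"
    using k(1) ck(5) fg(1) ck(3) unfolding is_kernel_def by (simp del: Hom_iff)
  \<comment> \<open>Besides the comparisons \<open>v\<close> and \<open>w\<close>, the factorisation
    of \<open>f\<close> through \<open>k\<close> is needed: it gives \<open>g \<cdot> f = 0\<close>
    at each object.\<close>
  then obtain t where t: "t \<in> ntr_set I C" "Trg t = Src k" "k \<cdot>\<^bsub>fun_cat I C\<^esub> t = f" by auto
  note T = ntr_setD(4-6)[OF fg(1) assms(2)] ntr_setD(4-6)[OF fg(2) assms(2)] ntr_setD(4-6)[OF ck(1)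
      assms(2)]
    ntr_setD(4-6)[OF ck(2) assms(2)] ntr_setD(4-6)[OF v(1) assms(2)] ntr_setD(4-6)[OF w(1) assms(2)]
        ntr_setD(4-6)[OF t(1) assms(2)]
  have o: "OMap (Src k) i \<in> Obj C" "OMap (Trg c) i \<in> Obj C" "OMap (Trg g) i \<in> Obj C"
    using ftr_setD(1)[OF ntr_setD(1)[OF ck(2)] assms(2)] ftr_setD(1)[OF ntr_setD(2)[OF ck(1)]
        assms(2)]
      ftr_setD(1)[OF ntr_setD(2)[OF fg(2)] assms(2)] by simp_all
  have ci: "Cmpt c i \<cdot> Cmpt k i = Zero C (OMap (Src k) i) (OMap (Trg c) i)"
    using arg_cong[OF ck(6), of "\<lambda>x. Cmpt x i"] assms(2) by simp
  have gi: "Cmpt g i \<cdot> Cmpt k i = Zero C (OMap (Src k) i) (OMap (Trg g) i)"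
    using arg_cong[OF ck(7), of "\<lambda>x. Cmpt x i"] assms(2) by simp
  have eqs: "Cmpt c' i = Cmpt v i \<cdot> Cmpt c i" "Cmpt k' i = Cmpt k i \<cdot> Cmpt w i" "Cmpt f i = Cmpt k i
      \<cdot> Cmpt t i"
    using v(3) w(3) t(3) Cmpt_Cmp[OF assms(2)] by metis+
  have cw: "Cmpt c i \<cdot> (Cmpt k i \<cdot> Cmpt w i) = Zero C (OMap (Src w) i) (OMap (Trg c) i)"
    using Cmp_reassoc1[OF ci, of "Cmpt w i"] T o ck w(2) by simp
  have gt: "Cmpt g i \<cdot> (Cmpt k i \<cdot> Cmpt t i) = Zero C (OMap (Src t) i) (OMap (Trg g) i)"
    using Cmp_reassoc1[OF gi, of "Cmpt t i"] T o ck t(2) fg(3) by simp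
  have ow: "OMap (Src w) i \<in> Obj C" by (rule ftr_setD(1)[OF ntr_setD(1)[OF w(1)] assms(2)])
  have "Cmpt g i \<cdot> Cmpt f i = Zero C (Dom C (Cmpt f i)) (Cod C (Cmpt g i))"
    using gt T ck t(2) fg(3) unfolding eqs(3) by simp
  moreover have "Cmpt c' i \<cdot> Cmpt k' i = Zero C (Dom C (Cmpt k' i)) (Cod C (Cmpt c' i))"
    unfolding eqs(1,2) using cw T ck w(2) v(2) fg(3) ow by simp
  ultimately show ?thesis
    using exact_at_iff[OF c'(3)[OF assms(2)] k'(3)[OF assms(2)]] ntr_setD(6)[OF fg(1) assms(2)] T(5)
        fg(3) by simp
qed

text \<open>The cokernel \<open>c\<close> kills \<open>k\<close> by \<open>exact_at_iff\<close>, and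
  \<open>g\<close> factors through \<open>c\<close>, so \<open>c\<close> and \<open>g\<close> kill
  the same arrows. Thus one chosen pointwise kernel serves both roles in the definition of
  exactness.\<close>

lemma exact_kernel_cokernel:
  assumes "exact_at C f g" "is_cokernel C f c" "is_kernel C g k"
  shows "is_kernel C c k"
proof -
  note D = exact_atD[OF assms(1)] and cD = cokernelD[OF assms(2)] and kD = kernelD[OF assms(3)]
  have z: "c \<cdot> k = Zero C (Dom C k) (Cod C c)"
    using exact_at_iff[OF assms(2,3) D(3)] assms(1) by simp
  show ?thesis
  proof (rule is_kernelI)
    fix h assume h: "h \<in> Arr C" "Cod C h = Dom C c" "c \<cdot> h = Zero C (Dom C h) (Cod C c)"
    obtain v where v: "v \<in> Hom C (Cod C c) (Cod C g)" "v \<cdot> c = g"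
      using cokernel_factor[OF assms(2), of g] D exact_comp[OF assms(1)] by auto
    have "g \<cdot> h = v \<cdot> (c \<cdot> h)"
      by (rule Cmp_reassoc1[OF v(2), symmetric]) (use v h cD in simp_all)
    then have "g \<cdot> h = Zero C (Dom C h) (Cod C g)"
      unfolding h(3) using v h cD by simp
    then show "\<exists>u \<in> Hom C (Dom C h) (Dom C k). k \<cdot> u = h"
      using kernel_factor[OF assms(3), of h] h(1,2) cD D by metis
  qed (use z cD kD D kernel_mono[OF assms(3)] in simp_all)
qed

lemma exact_fun_catI:
  assumes "f \<in> ntr_set I C" "g \<in> ntr_set I C" "Trg f = Src g" "\<And>i. i \<in> Obj I \<Longrightarrow> exact_at C (Cmpt f i)
      (Cmpt g i)"
  shows "exact_at (fun_cat I C) f g"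
proof -
  obtain c where c: "c \<in> ntr_set I C" "Src c = Trg f" "\<And>k. k \<in> Obj I \<Longrightarrow> is_cokernel C (Cmpt f k)
      (Cmpt c k)"
    using pointwise_cokernel[OF assms(1)] by blast
  obtain k where k: "k \<in> ntr_set I C" "Trg k = Src g" "\<And>i. i \<in> Obj I \<Longrightarrow> is_kernel C (Cmpt g i) (Cmpt
      k i)"
    using pointwise_kernel[OF assms(2)] by blast
  have "is_kernel (fun_cat I C) c k"
    by (rule is_kernel_fun_cat[OF c(1) k(1) _ exact_kernel_cokernel[OF assms(4) c(3) k(3)]])
      (use c k assms(3) in simp_all)
  then show ?thesis
    using is_cokernel_fun_cat[OF assms(1) c] is_kernel_fun_cat[OF assms(2) k] assms(1-3)
    unfolding exact_at_def by auto
qed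

lemma comm_square_pointwise:
  assumes "comm_square (fun_cat I C) f u v f'" "k \<in> Obj I"
  shows "comm_square C (Cmpt f k) (Cmpt u k) (Cmpt v k) (Cmpt f' k)"
proof -
  have s: "f \<in> ntr_set I C" "Src f = Src u" "Trg f = Src v" "f' \<in> ntr_set I C" "Src f' = Trg u" "Trg
      f' = Trg v"
    "u \<in> ntr_set I C" "v \<in> ntr_set I C" "v \<cdot>\<^bsub>fun_cat I C\<^esub> f = f' \<cdot>\<^bsub>fun_cat I C\<^esub> u"
    using assms(1) by (simp_all add: comm_square_def)
  have "Cmpt v k \<cdot> Cmpt f k = Cmpt f' k \<cdot> Cmpt u k"
    using arg_cong[OF s(9), of "\<lambda>x. Cmpt x k"] assms(2) by simp
  then show ?thesis
    using ntr_setD(4-6)[OF s(1) assms(2)] ntr_setD(4-6)[OF s(4) assms(2)] ntr_setD(4-6)[OF s(7)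
        assms(2)]
      ntr_setD(4-6)[OF s(8) assms(2)] s(2,3,5,6) by (simp add: comm_square_def)
qed

lemma comm_square_fun_catI:
  assumes "f \<in> ntr_set I C" "Src f = Src u" "Trg f = Src v" "f' \<in> ntr_set I C" "Src f' = Trg u" "Trg
      f' = Trg v"
    "u \<in> ntr_set I C" "v \<in> ntr_set I C" "\<And>k. k \<in> Obj I \<Longrightarrow> Cmpt v k \<cdot> Cmpt f k = Cmpt f' k \<cdot> Cmpt u k"
  shows "comm_square (fun_cat I C) f u v f'"
proof -
  have "v \<cdot>\<^bsub>fun_cat I C\<^esub> f = f' \<cdot>\<^bsub>fun_cat I C\<^esub> u"
    by (rule ntr_eqI[OF Cmp_ntr[OF assms(1,8,3)] Cmp_ntr[OF assms(7,4) assms(5)[symmetric]]]) (use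
        assms in simp_all)
  then show ?thesis using assms by (simp add: comm_square_def)
qed

lemma short_exact_pointwise:
  assumes "short_exact (fun_cat I C) f g" "k \<in> Obj I"
  shows "short_exact C (Cmpt f k) (Cmpt g k)"
  using assms mono_fun_cat epi_fun_cat exact_fun_cat_pointwise by (simp add: short_exact_def)

text \<open>Structure maps along \<open>u\<close> form a morphism between the short exact sequences
  at its two ends. Through this, naturality of connecting morphisms turns their components into a
  natural transformation.\<close>

lemma short_exact_naturality:
  assumes "short_exact (fun_cat I C) f g" "u \<in> Arr I"
  shows "short_exact_map C (Cmpt f (Dom I u)) (Cmpt g (Dom I u)) (Cmpt f (Cod I u)) (Cmpt g (Cod I
      u))
    (AMap (Src f) u) (AMap (Trg f) u) (AMap (Trg g) u)"
proof -
  have "exact_at (fun_cat I C) f g" using assms(1) by (simp add: short_exact_def)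
  from exact_atD[OF this] have fg: "f \<in> ntr_set I C" "g \<in> ntr_set I C" "Trg f = Src g" by simp_all
  have o: "Dom I u \<in> Obj I" "Cod I u \<in> Obj I" using assms(2) by simp_all
  note T = ntr_setD(4-6)[OF fg(1) o(1)] ntr_setD(4-6)[OF fg(1) o(2)] ntr_setD(4-6)[OF fg(2) o(1)]
      ntr_setD(4-6)[OF fg(2) o(2)]
    ftr_setD(3-5)[OF ntr_setD(1)[OF fg(1)] assms(2)] ftr_setD(3-5)[OF ntr_setD(2)[OF fg(1)]
        assms(2)]
    ftr_setD(3-5)[OF ntr_setD(2)[OF fg(2)] assms(2)]
  show ?thesis
    unfolding short_exact_map_def comm_square_def
    using short_exact_pointwise[OF assms(1) o(1)] short_exact_pointwise[OF assms(1) o(2)] T fg(3)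
      ntr_setD(7)[OF fg(1) assms(2)] ntr_setD(7)[OF fg(2) assms(2)] by simp
qed

lemma short_exact_map_pointwise:
  assumes "short_exact_map (fun_cat I C) f g f' g' l m r" "k \<in> Obj I"
  shows "short_exact_map C (Cmpt f k) (Cmpt g k) (Cmpt f' k) (Cmpt g' k) (Cmpt l k) (Cmpt m k) (Cmpt
      r k)"
  using assms short_exact_pointwise comm_square_pointwise by (simp add: short_exact_map_def)

end

lemma prod_category:
  assumes "category I" "category J"
  shows "category (prod_cat I J)"
proof -
  interpret I: category I by fact
  interpret J: category J by fact
  show ?thesis
    by unfold_locales (auto simp: prod_cat_def)
qed

section \<open>Derived bifunctors on functor categories\<close>

lemma prod_cat_simps [simp]:
  "Obj (prod_cat I J) = Obj I \<times> Obj J" "Arr (prod_cat I J) = Arr I \<times> Arr J"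
  "Dom (prod_cat I J) (u, v) = (Dom I u, Dom J v)" "Cod (prod_cat I J) (u, v) = (Cod I u, Cod J v)"
  "Ide (prod_cat I J) (k, i) = (Ide I k, Ide J i)"
  "(u', v') \<cdot>\<^bsub>prod_cat I J\<^esub> (u, v) = (u' \<cdot>\<^bsub>I\<^esub> u, v' \<cdot>\<^bsub>J\<^esub> v)"
  by (simp_all add: prod_cat_def)

lemma left_derived_IJ_simps [simp]:
  "Src (AMap (left_derived_IJ I J C D E F n) (\<sigma>, \<tau>)) = OMap (left_derived_IJ I J C D E F n) (Src \<sigma>,
      Src \<tau>)"
  "Trg (AMap (left_derived_IJ I J C D E F n) (\<sigma>, \<tau>)) = OMap (left_derived_IJ I J C D E F n) (Trg \<sigma>,
      Trg \<tau>)"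
  "\<lbrakk>k \<in> Obj I; i \<in> Obj J\<rbrakk> \<Longrightarrow> Cmpt (AMap (left_derived_IJ I J C D E F n) (\<sigma>, \<tau>)) (k, i) =
    AMap (left_derived C D E F n) (Cmpt \<sigma> k, Cmpt \<tau> i)"
  "\<lbrakk>k \<in> Obj I; i \<in> Obj J\<rbrakk> \<Longrightarrow> OMap (OMap (left_derived_IJ I J C D E F n) (X, Y)) (k, i) =
    OMap (left_derived C D E F n) (OMap X k, OMap Y i)"
  "\<lbrakk>u \<in> Arr I; v \<in> Arr J\<rbrakk> \<Longrightarrow> AMap (OMap (left_derived_IJ I J C D E F n) (X, Y)) (u, v) =
    AMap (left_derived C D E F n) (AMap X u, AMap Y v)"
  by (simp_all add: left_derived_IJ_def pointwise_def Let_def)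

lemma delta1_IJ_simps [simp]:
  "Src (delta1_IJ I J C D E F n f g A) = OMap (left_derived_IJ I J C D E F n) (Trg g, A)"
  "Trg (delta1_IJ I J C D E F n f g A) = OMap (left_derived_IJ I J C D E F (n - 1)) (Src f, A)"
  "\<lbrakk>k \<in> Obj I; i \<in> Obj J\<rbrakk> \<Longrightarrow> Cmpt (delta1_IJ I J C D E F n f g A) (k, i) =
    delta1 C D E F n (Cmpt f k) (Cmpt g k) (OMap A i)"
  by (simp_all add: delta1_IJ_def)

lemma delta2_IJ_simps [simp]:
  "Src (delta2_IJ I J C D E F n A f g) = OMap (left_derived_IJ I J C D E F n) (A, Trg g)"
  "Trg (delta2_IJ I J C D E F n A f g) = OMap (left_derived_IJ I J C D E F (n - 1)) (A, Src f)"
  "\<lbrakk>k \<in> Obj I; i \<in> Obj J\<rbrakk> \<Longrightarrow> Cmpt (delta2_IJ I J C D E F n A f g) (k, i) =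
    delta2 C D E F n (OMap A k) (Cmpt f i) (Cmpt g i)"
  by (simp_all add: delta2_IJ_def)

lemma (in functor_category) long_exact_fun_catI:
  assumes "\<And>n. f n \<in> ntr_set I C" "\<And>n. g n \<in> ntr_set I C" "\<And>n. d n \<in> ntr_set I C"
    and "\<And>n. Trg (f n) = Src (g n)" "\<And>n. Trg (g n) = Src (d n)" "\<And>n. Trg (d n) = Src (f (n - 1))"
    and "\<And>k. k \<in> Obj I \<Longrightarrow> long_exact C (\<lambda>n. Cmpt (f n) k) (\<lambda>n. Cmpt (g n) k) (\<lambda>n. Cmpt (d n) k)"
  shows "long_exact (fun_cat I C) f g d"
  using assms unfolding long_exact_def by (intro allI conjI exact_fun_catI) blast+

locale derived_functor_category = bifunctor C D E F + I: category I + J: category J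
  for C :: "('oc, 'ac, 'xc) addcat_scheme" and D :: "('od, 'ad, 'xd) addcat_scheme"
    and E :: "('oe, 'ae, 'xe) addcat_scheme" (structure)
    and F and I :: "('oi, 'ai, 'xi) cat_scheme" and J :: "('oj, 'aj, 'xj) cat_scheme"
begin

abbreviation "Fn \<equiv> left_derived_IJ I J C D E F"
abbreviation "EIJ \<equiv> fun_cat (prod_cat I J) E"

lemma functor_category_IC: "functor_category I C"
  and functor_category_JD: "functor_category J D"
  by (intro functor_category.intro I.category_axioms J.category_axioms C.abelian_category_axioms
      D.abelian_category_axioms)+

lemma functor_category_EIJ: "functor_category (prod_cat I J) E"
  by (intro functor_category.intro prod_category I.category_axioms J.category_axioms
      E.abelian_category_axioms)

lemma Fn_ftr:
  assumes "X \<in> ftr_set I C" "Y \<in> ftr_set J D"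
  shows "OMap (Fn n) (X, Y) \<in> ftr_set (prod_cat I J) E"
proof -
  note X = ftr_setD[OF assms(1)] and Y = ftr_setD[OF assms(2)]
  have "OMap (OMap (Fn n) (X, Y)) \<in> extensional (Obj I \<times> Obj J)" "AMap (OMap (Fn n) (X, Y)) \<in>
      extensional (Arr I \<times> Arr J)"
    by (simp_all add: left_derived_IJ_def pointwise_def Let_def)
  moreover have "AMap (Der n) (AMap X u, AMap Y v) \<in>
      Hom E (OMap (Der n) (OMap X (Dom I u), OMap Y (Dom J v))) (OMap (Der n) (OMap X (Cod I u),
          OMap Y (Cod J v)))"
    if "u \<in> Arr I" "v \<in> Arr J" for u v
    by (rule Der_Hom) (use X Y that in simp_all)
  moreover have "AMap (Der n) (AMap X u' \<cdot>\<^bsub>C\<^esub> AMap X u, AMap Y v' \<cdot>\<^bsub>D\<^esub> AMap Y v) =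
      AMap (Der n) (AMap X u', AMap Y v') \<cdot> AMap (Der n) (AMap X u, AMap Y v)"
    if "u \<in> Arr I" "v \<in> Arr J" "u' \<in> Arr I" "v' \<in> Arr J" "Cod I u = Dom I u'" "Cod J v = Dom J v'"
        for u v u' v'
    by (rule Der_Cmp) (use X Y that in auto)
  ultimately show ?thesis
    using X Y Der_Obj Der_Ide by (auto simp: ftr_set_def is_functor_def)
qed

lemma Fn_ntr:
  assumes "\<sigma> \<in> ntr_set I C" "\<tau> \<in> ntr_set J D"
  shows "AMap (Fn n) (\<sigma>, \<tau>) \<in> ntr_set (prod_cat I J) E"
proof -
  note S = ntr_setD[OF assms(1)] and T = ntr_setD[OF assms(2)]
  note X = ftr_setD[OF S(1)] ftr_setD[OF S(2)] and Y = ftr_setD[OF T(1)] ftr_setD[OF T(2)]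
  have "Cmpt (AMap (Fn n) (\<sigma>, \<tau>)) \<in> extensional (Obj I \<times> Obj J)"
    by (simp add: left_derived_IJ_def pointwise_def Let_def)
  moreover have "AMap (Der n) (Cmpt \<sigma> k, Cmpt \<tau> i) \<in>
      Hom E (OMap (Der n) (OMap (Src \<sigma>) k, OMap (Src \<tau>) i)) (OMap (Der n) (OMap (Trg \<sigma>) k, OMap (Trg
          \<tau>) i))"
    if "k \<in> Obj I" "i \<in> Obj J" for k i
    by (rule Der_Hom) (use S(4-6) T(4-6) that in simp_all)
  moreover have "AMap (Der n) (Cmpt \<sigma> (Cod I u), Cmpt \<tau> (Cod J v)) \<cdot> AMap (Der n) (AMap (Src \<sigma>) u,
      AMap (Src \<tau>) v) =
      AMap (Der n) (AMap (Trg \<sigma>) u, AMap (Trg \<tau>) v) \<cdot> AMap (Der n) (Cmpt \<sigma> (Dom I u), Cmpt \<tau> (Dom J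
          v))"
    if uv: "u \<in> Arr I" "v \<in> Arr J" for u v
  proof -
    have o: "Dom I u \<in> Obj I" "Cod I u \<in> Obj I" "Dom J v \<in> Obj J" "Cod J v \<in> Obj J" using uv by
        simp_all
    have "AMap (Der n) (Cmpt \<sigma> (Cod I u), Cmpt \<tau> (Cod J v)) \<cdot> AMap (Der n) (AMap (Src \<sigma>) u, AMap
        (Src \<tau>) v) =
        AMap (Der n) (Cmpt \<sigma> (Cod I u) \<cdot>\<^bsub>C\<^esub> AMap (Src \<sigma>) u, Cmpt \<tau> (Cod J v) \<cdot>\<^bsub>D\<^esub> AMap (Src \<tau>) v)"
      by (rule Der_Cmp[symmetric]) (use S(4-6) T(4-6) X Y uv o in auto)
    also have "\<dots> = AMap (Der n) (AMap (Trg \<sigma>) u \<cdot>\<^bsub>C\<^esub> Cmpt \<sigma> (Dom I u), AMap (Trg \<tau>) v \<cdot>\<^bsub>D\<^esub> Cmpt \<tau>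
        (Dom J v))"
      unfolding S(7)[OF uv(1)] T(7)[OF uv(2)] ..
    also have "\<dots> = AMap (Der n) (AMap (Trg \<sigma>) u, AMap (Trg \<tau>) v) \<cdot> AMap (Der n) (Cmpt \<sigma> (Dom I u),
        Cmpt \<tau> (Dom J v))"
      by (rule Der_Cmp) (use S(4-6) T(4-6) X Y uv o in auto)
    finally show ?thesis .
  qed
  ultimately show ?thesis
    using Fn_ftr[OF S(1) T(1)] Fn_ftr[OF S(2) T(2)] by (simp add: ntr_set_def split_paired_all)
qed

text \<open>Takes one commuting square in each functor category, so that the squares of either
  ladder are instances, with a trivial square of identities in the variable that is held fixed along
  the rows.\<close>

lemma Fn_comm_square:
  assumes "f \<in> ntr_set I C" "u \<in> ntr_set I C" "v \<in> ntr_set I C" "f' \<in> ntr_set I C"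
    and "g \<in> ntr_set J D" "s \<in> ntr_set J D" "t \<in> ntr_set J D" "g' \<in> ntr_set J D"
    and "Src f = Src u" "Trg f = Src v" "Src f' = Trg u" "Trg f' = Trg v" "Src g = Src s" "Trg g =
        Src t" "Src g' = Trg s" "Trg g' = Trg t"
    and "\<And>k. k \<in> Obj I \<Longrightarrow> Cmpt v k \<cdot>\<^bsub>C\<^esub> Cmpt f k = Cmpt f' k \<cdot>\<^bsub>C\<^esub> Cmpt u k"
    and "\<And>i. i \<in> Obj J \<Longrightarrow> Cmpt t i \<cdot>\<^bsub>D\<^esub> Cmpt g i = Cmpt g' i \<cdot>\<^bsub>D\<^esub> Cmpt s i"
  shows "comm_square EIJ (AMap (Fn n) (f, g)) (AMap (Fn n) (u, s)) (AMap (Fn n) (v, t)) (AMap (Fn n)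
      (f', g'))"
proof (rule functor_category.comm_square_fun_catI[OF functor_category_EIJ])
  fix ki assume "ki \<in> Obj (prod_cat I J)"
  then obtain k i where ki: "ki = (k, i)" "k \<in> Obj I" "i \<in> Obj J" by auto
  note T = ntr_setD(4-6)[OF assms(1) ki(2)] ntr_setD(4-6)[OF assms(2) ki(2)] ntr_setD(4-6)[OF
      assms(3) ki(2)]
    ntr_setD(4-6)[OF assms(4) ki(2)] ntr_setD(4-6)[OF assms(5) ki(3)] ntr_setD(4-6)[OF assms(6)
        ki(3)]
    ntr_setD(4-6)[OF assms(7) ki(3)] ntr_setD(4-6)[OF assms(8) ki(3)]
  have "AMap (Der n) (Cmpt v k, Cmpt t i) \<cdot> AMap (Der n) (Cmpt f k, Cmpt g i) = AMap (Der n) (Cmpt v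
      k \<cdot>\<^bsub>C\<^esub> Cmpt f k, Cmpt t i \<cdot>\<^bsub>D\<^esub> Cmpt g i)"
    by (rule Der_Cmp[symmetric]) (use T assms(9-16) in auto)
  also have "\<dots> = AMap (Der n) (Cmpt f' k, Cmpt g' i) \<cdot> AMap (Der n) (Cmpt u k, Cmpt s i)"
    unfolding assms(17)[OF ki(2)] assms(18)[OF ki(3)] by (rule Der_Cmp) (use T assms(9-16) in auto)
  finally show "Cmpt (AMap (Fn n) (v, t)) ki \<cdot> Cmpt (AMap (Fn n) (f, g)) ki = Cmpt (AMap (Fn n) (f',
      g')) ki \<cdot> Cmpt (AMap (Fn n) (u, s)) ki"
    using ki by simp
qed (use Fn_ntr assms in simp_all)

lemma short_exact_ntr:
  assumes "short_exact (fun_cat K A) f g"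
  shows "f \<in> ntr_set K A" "g \<in> ntr_set K A" "Trg f = Src g"
proof -
  have "exact_at (fun_cat K A) f g" using assms by (simp add: short_exact_def)
  from exact_atD[OF this] show "f \<in> ntr_set K A" "g \<in> ntr_set K A" "Trg f = Src g" by simp_all
qed

lemma short_exact_map_ntr:
  assumes "short_exact_map (fun_cat K A) f g f' g' l m r"
  shows "short_exact (fun_cat K A) f g" "short_exact (fun_cat K A) f' g'" "l \<in> ntr_set K A" "m \<in>
      ntr_set K A" "r \<in> ntr_set K A"
    "Src f = Src l" "Trg f = Src m" "Src f' = Trg l" "Trg f' = Trg m" "Src g = Src m" "Trg g = Src
        r" "Src g' = Trg m" "Trg g' = Trg r"
  using assms by (auto simp: short_exact_map_def comm_square_def)

text \<open>Naturality along a pair \<open>(u, v)\<close> is \<open>delta1_natural\<close> for the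
  morphism of short exact sequences induced by \<open>u\<close> and the arrow of \<open>D\<close>
  induced by \<open>v\<close>.\<close>

lemma delta1_IJ_ntr:
  assumes "short_exact (fun_cat I C) f g" "A \<in> ftr_set J D"
  shows "delta1_IJ I J C D E F n f g A \<in> ntr_set (prod_cat I J) E"
proof -
  note fg = short_exact_ntr[OF assms(1)] and A = ftr_setD[OF assms(2)]
  have "Cmpt (delta1_IJ I J C D E F n f g A) \<in> extensional (Obj I \<times> Obj J)"
    by (simp add: delta1_IJ_def)
  moreover have "delta1 C D E F n (Cmpt f k) (Cmpt g k) (OMap A i) \<in>
      Hom E (OMap (Der n) (OMap (Trg g) k, OMap A i)) (OMap (Der (n - 1)) (OMap (Src f) k, OMap A
          i))"
    if ki: "k \<in> Obj I" "i \<in> Obj J" for k i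
  proof -
    note T = ntr_setD(4-6)[OF fg(1) ki(1)] ntr_setD(4-6)[OF fg(2) ki(1)]
    \<comment> \<open>Exactness includes that consecutive arrows are composable, so source and
      target of the connecting morphism are read off from its neighbours.\<close>
    have "long_exact E (\<lambda>n. AMap (Der n) (Cmpt f k, Ide D (OMap A i))) (\<lambda>n. AMap (Der n) (Cmpt g k,
        Ide D (OMap A i)))
        (\<lambda>n. delta1 C D E F n (Cmpt f k) (Cmpt g k) (OMap A i))"
      by (rule long_exact_left[OF functor_category.short_exact_pointwise[OF functor_category_IC
          assms(1) ki(1)] A(1)[OF ki(2)]])
    then have "exact_at E (AMap (Der n) (Cmpt g k, Ide D (OMap A i))) (delta1 C D E F n (Cmpt f k)
        (Cmpt g k) (OMap A i))"
      "exact_at E (delta1 C D E F n (Cmpt f k) (Cmpt g k) (OMap A i)) (AMap (Der (n - 1)) (Cmpt f k,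
          Ide D (OMap A i)))"
      unfolding long_exact_def by blast+
    note e = exact_atD[OF this(1)] exact_atD[OF this(2)]
    have "AMap (Der n) (Cmpt g k, Ide D (OMap A i)) \<in> Hom E (OMap (Der n) (OMap (Src g) k, OMap A
        i)) (OMap (Der n) (OMap (Trg g) k, OMap A i))"
      "AMap (Der (n - 1)) (Cmpt f k, Ide D (OMap A i)) \<in> Hom E (OMap (Der (n - 1)) (OMap (Src f) k,
          OMap A i)) (OMap (Der (n - 1)) (OMap (Trg f) k, OMap A i))"
      by (rule Der_Hom; use T A(1)[OF ki(2)] in simp)+
    then show ?thesis using e by simp
  qed
  moreover have "delta1 C D E F n (Cmpt f (Cod I u)) (Cmpt g (Cod I u)) (OMap A (Cod J v)) \<cdot> AMap
      (Der n) (AMap (Trg g) u, AMap A v) =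
      AMap (Der (n - 1)) (AMap (Src f) u, AMap A v) \<cdot> delta1 C D E F n (Cmpt f (Dom I u)) (Cmpt g
          (Dom I u)) (OMap A (Dom J v))"
    if uv: "u \<in> Arr I" "v \<in> Arr J" for u v
    using delta1_natural[OF functor_category.short_exact_naturality[OF functor_category_IC assms(1)
        uv(1)] A(3)[OF uv(2)], of n]
      A(4,5)[OF uv(2)] by simp
  ultimately show ?thesis
    using Fn_ftr[OF ntr_setD(2)[OF fg(2)] assms(2)] Fn_ftr[OF ntr_setD(1)[OF fg(1)] assms(2)]
    by (simp add: ntr_set_def split_paired_all)
qed

lemma delta2_IJ_ntr:
  assumes "short_exact (fun_cat J D) f g" "A \<in> ftr_set I C"
  shows "delta2_IJ I J C D E F n A f g \<in> ntr_set (prod_cat I J) E"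
proof -
  note fg = short_exact_ntr[OF assms(1)] and A = ftr_setD[OF assms(2)]
  have "Cmpt (delta2_IJ I J C D E F n A f g) \<in> extensional (Obj I \<times> Obj J)"
    by (simp add: delta2_IJ_def)
  moreover have "delta2 C D E F n (OMap A k) (Cmpt f i) (Cmpt g i) \<in>
      Hom E (OMap (Der n) (OMap A k, OMap (Trg g) i)) (OMap (Der (n - 1)) (OMap A k, OMap (Src f)
          i))"
    if ki: "k \<in> Obj I" "i \<in> Obj J" for k i
  proof -
    note T = ntr_setD(4-6)[OF fg(1) ki(2)] ntr_setD(4-6)[OF fg(2) ki(2)]
    \<comment> \<open>As for the first variable, the typing of the connecting morphism comes from
      its two neighbours in the exact sequence.\<close>
    have "long_exact E (\<lambda>n. AMap (Der n) (Ide C (OMap A k), Cmpt f i)) (\<lambda>n. AMap (Der n) (Ide C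
        (OMap A k), Cmpt g i))
        (\<lambda>n. delta2 C D E F n (OMap A k) (Cmpt f i) (Cmpt g i))"
      by (rule long_exact_right[OF functor_category.short_exact_pointwise[OF functor_category_JD
          assms(1) ki(2)] A(1)[OF ki(1)]])
    then have "exact_at E (AMap (Der n) (Ide C (OMap A k), Cmpt g i)) (delta2 C D E F n (OMap A k)
        (Cmpt f i) (Cmpt g i))"
      "exact_at E (delta2 C D E F n (OMap A k) (Cmpt f i) (Cmpt g i)) (AMap (Der (n - 1)) (Ide C
          (OMap A k), Cmpt f i))"
      unfolding long_exact_def by blast+
    note e = exact_atD[OF this(1)] exact_atD[OF this(2)]
    have "AMap (Der n) (Ide C (OMap A k), Cmpt g i) \<in> Hom E (OMap (Der n) (OMap A k, OMap (Src g)
        i)) (OMap (Der n) (OMap A k, OMap (Trg g) i))"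
      "AMap (Der (n - 1)) (Ide C (OMap A k), Cmpt f i) \<in> Hom E (OMap (Der (n - 1)) (OMap A k, OMap
          (Src f) i)) (OMap (Der (n - 1)) (OMap A k, OMap (Trg f) i))"
      by (rule Der_Hom; use T A(1)[OF ki(1)] in simp)+
    then show ?thesis using e by simp
  qed
  moreover have "delta2 C D E F n (OMap A (Cod I u)) (Cmpt f (Cod J v)) (Cmpt g (Cod J v)) \<cdot> AMap
      (Der n) (AMap A u, AMap (Trg g) v) =
      AMap (Der (n - 1)) (AMap A u, AMap (Src f) v) \<cdot> delta2 C D E F n (OMap A (Dom I u)) (Cmpt f
          (Dom J v)) (Cmpt g (Dom J v))"
    if uv: "u \<in> Arr I" "v \<in> Arr J" for u v
    using delta2_natural[OF functor_category.short_exact_naturality[OF functor_category_JD assms(1)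
        uv(2)] A(3)[OF uv(1)], of n]
      A(4,5)[OF uv(1)] by simp
  ultimately show ?thesis
    using Fn_ftr[OF assms(2) ntr_setD(2)[OF fg(2)]] Fn_ftr[OF assms(2) ntr_setD(1)[OF fg(1)]]
    by (simp add: ntr_set_def split_paired_all)
qed

lemma long_exact_IJ_left:
  assumes "short_exact (fun_cat I C) f g" "A \<in> ftr_set J D"
  shows "long_exact EIJ (\<lambda>n. AMap (Fn n) (f, Ide (fun_cat J D) A)) (\<lambda>n. AMap (Fn n) (g, Ide (fun_cat
      J D) A))
    (\<lambda>n. delta1_IJ I J C D E F n f g A)"
proof (rule functor_category.long_exact_fun_catI[OF functor_category_EIJ])
  note fg = short_exact_ntr[OF assms(1)] and id = functor_category.Ide_ntr[OF functor_category_JD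
      assms(2)]
  show "AMap (Fn n) (f, Ide (fun_cat J D) A) \<in> ntr_set (prod_cat I J) E" "AMap (Fn n) (g, Ide
      (fun_cat J D) A) \<in> ntr_set (prod_cat I J) E"
    "delta1_IJ I J C D E F n f g A \<in> ntr_set (prod_cat I J) E" for n
    by (rule Fn_ntr[OF fg(1) id] Fn_ntr[OF fg(2) id] delta1_IJ_ntr[OF assms])+
  fix ki assume "ki \<in> Obj (prod_cat I J)"
  then obtain k i where ki: "ki = (k, i)" "k \<in> Obj I" "i \<in> Obj J" by auto
  show "long_exact E (\<lambda>n. Cmpt (AMap (Fn n) (f, Ide (fun_cat J D) A)) ki) (\<lambda>n. Cmpt (AMap (Fn n) (g,
      Ide (fun_cat J D) A)) ki)
      (\<lambda>n. Cmpt (delta1_IJ I J C D E F n f g A) ki)"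
    using long_exact_left[OF functor_category.short_exact_pointwise[OF functor_category_IC assms(1)
        ki(2)] ftr_setD(1)[OF assms(2) ki(3)]] ki
    by simp
qed (use short_exact_ntr[OF assms(1)] in simp_all)

lemma long_exact_IJ_right:
  assumes "short_exact (fun_cat J D) f g" "A \<in> ftr_set I C"
  shows "long_exact EIJ (\<lambda>n. AMap (Fn n) (Ide (fun_cat I C) A, f)) (\<lambda>n. AMap (Fn n) (Ide (fun_cat I
      C) A, g))
    (\<lambda>n. delta2_IJ I J C D E F n A f g)"
proof (rule functor_category.long_exact_fun_catI[OF functor_category_EIJ])
  note fg = short_exact_ntr[OF assms(1)] and id = functor_category.Ide_ntr[OF functor_category_IC
      assms(2)]
  show "AMap (Fn n) (Ide (fun_cat I C) A, f) \<in> ntr_set (prod_cat I J) E" "AMap (Fn n) (Ide (fun_cat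
      I C) A, g) \<in> ntr_set (prod_cat I J) E"
    "delta2_IJ I J C D E F n A f g \<in> ntr_set (prod_cat I J) E" for n
    by (rule Fn_ntr[OF id fg(1)] Fn_ntr[OF id fg(2)] delta2_IJ_ntr[OF assms])+
  fix ki assume "ki \<in> Obj (prod_cat I J)"
  then obtain k i where ki: "ki = (k, i)" "k \<in> Obj I" "i \<in> Obj J" by auto
  show "long_exact E (\<lambda>n. Cmpt (AMap (Fn n) (Ide (fun_cat I C) A, f)) ki) (\<lambda>n. Cmpt (AMap (Fn n)
      (Ide (fun_cat I C) A, g)) ki)
      (\<lambda>n. Cmpt (delta2_IJ I J C D E F n A f g) ki)"
    using long_exact_right[OF functor_category.short_exact_pointwise[OF functor_category_JD assms(1)
        ki(3)] ftr_setD(1)[OF assms(2) ki(2)]] ki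
    by simp
qed (use short_exact_ntr[OF assms(1)] in simp_all)

text \<open>Rows apply the derived functor to the given maps paired with an identity, and columns
  pair them with \<open>a\<close>. Two of the squares are therefore functoriality in both variables
  at once, while the third is \<open>delta1_natural\<close> at each pair of objects.\<close>

lemma ladder_left:
  assumes "short_exact_map (fun_cat I C) f g f' g' l m r" "a \<in> ntr_set J D"
  shows "ladder_commutes EIJ
    (\<lambda>n. AMap (Fn n) (f, Ide (fun_cat J D) (Src a))) (\<lambda>n. AMap (Fn n) (g, Ide (fun_cat J D) (Src
        a))) (\<lambda>n. delta1_IJ I J C D E F n f g (Src a))
    (\<lambda>n. AMap (Fn n) (f', Ide (fun_cat J D) (Trg a))) (\<lambda>n. AMap (Fn n) (g', Ide (fun_cat J D) (Trg
        a))) (\<lambda>n. delta1_IJ I J C D E F n f' g' (Trg a))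
    (\<lambda>n. AMap (Fn n) (l, a)) (\<lambda>n. AMap (Fn n) (m, a)) (\<lambda>n. AMap (Fn n) (r, a))"
proof -
  note M = short_exact_map_ntr[OF assms(1)]
  note fg = short_exact_ntr[OF M(1)] and fg' = short_exact_ntr[OF M(2)] and a = ntr_setD[OF
      assms(2)]
  note id = functor_category.Ide_ntr[OF functor_category_JD a(1)] and id' =
      functor_category.Ide_ntr[OF functor_category_JD a(2)]
  have ida: "Cmpt a i \<cdot>\<^bsub>D\<^esub> Cmpt (Ide (fun_cat J D) (Src a)) i = Cmpt (Ide (fun_cat J D) (Trg a)) i
      \<cdot>\<^bsub>D\<^esub> Cmpt a i" if "i \<in> Obj J" for i
    using a(4-6)[OF that] that by simp
  have sq: "Cmpt m k \<cdot>\<^bsub>C\<^esub> Cmpt f k = Cmpt f' k \<cdot>\<^bsub>C\<^esub> Cmpt l k" "Cmpt r k \<cdot>\<^bsub>C\<^esub> Cmpt g k = Cmpt g' k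
      \<cdot>\<^bsub>C\<^esub> Cmpt m k" if "k \<in> Obj I" for k
    using functor_category.short_exact_map_pointwise[OF functor_category_IC assms(1) that]
    by (simp_all add: short_exact_map_def comm_square_def)
  show ?thesis
    unfolding ladder_commutes_def
  proof (intro allI conjI)
    fix n
    show "comm_square EIJ (AMap (Fn n) (f, Ide (fun_cat J D) (Src a))) (AMap (Fn n) (l, a)) (AMap
        (Fn n) (m, a)) (AMap (Fn n) (f', Ide (fun_cat J D) (Trg a)))"
      by (rule Fn_comm_square[OF fg(1) M(3,4) fg'(1) id assms(2) assms(2) id']) (use M sq ida in
          simp_all)
    show "comm_square EIJ (AMap (Fn n) (g, Ide (fun_cat J D) (Src a))) (AMap (Fn n) (m, a)) (AMap
        (Fn n) (r, a)) (AMap (Fn n) (g', Ide (fun_cat J D) (Trg a)))"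
      by (rule Fn_comm_square[OF fg(2) M(4,5) fg'(2) id assms(2) assms(2) id']) (use M sq ida in
          simp_all)
    show "comm_square EIJ (delta1_IJ I J C D E F n f g (Src a)) (AMap (Fn n) (r, a)) (AMap (Fn (n -
        1)) (l, a)) (delta1_IJ I J C D E F n f' g' (Trg a))"
    proof (rule functor_category.comm_square_fun_catI[OF functor_category_EIJ])
      show "delta1_IJ I J C D E F n f g (Src a) \<in> ntr_set (prod_cat I J) E" "delta1_IJ I J C D E F n
          f' g' (Trg a) \<in> ntr_set (prod_cat I J) E"
        "AMap (Fn n) (r, a) \<in> ntr_set (prod_cat I J) E" "AMap (Fn (n - 1)) (l, a) \<in> ntr_set
            (prod_cat I J) E"
        by (rule delta1_IJ_ntr[OF M(1) a(1)] delta1_IJ_ntr[OF M(2) a(2)] Fn_ntr[OF M(5) assms(2)]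
            Fn_ntr[OF M(3) assms(2)])+
      fix ki assume "ki \<in> Obj (prod_cat I J)"
      then obtain k i where ki: "ki = (k, i)" "k \<in> Obj I" "i \<in> Obj J" by auto
      show "Cmpt (AMap (Fn (n - 1)) (l, a)) ki \<cdot> Cmpt (delta1_IJ I J C D E F n f g (Src a)) ki =
          Cmpt (delta1_IJ I J C D E F n f' g' (Trg a)) ki \<cdot> Cmpt (AMap (Fn n) (r, a)) ki"
        using delta1_natural[OF functor_category.short_exact_map_pointwise[OF functor_category_IC
            assms(1) ki(2)] a(4)[OF ki(3)], of n]
          a(5,6)[OF ki(3)] ki by simp
    qed (use M in simp_all)
  qed
qed

lemma ladder_right:
  assumes "short_exact_map (fun_cat J D) f g f' g' l m r" "a \<in> ntr_set I C"
  shows "ladder_commutes EIJ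
    (\<lambda>n. AMap (Fn n) (Ide (fun_cat I C) (Src a), f)) (\<lambda>n. AMap (Fn n) (Ide (fun_cat I C) (Src a),
        g)) (\<lambda>n. delta2_IJ I J C D E F n (Src a) f g)
    (\<lambda>n. AMap (Fn n) (Ide (fun_cat I C) (Trg a), f')) (\<lambda>n. AMap (Fn n) (Ide (fun_cat I C) (Trg a),
        g')) (\<lambda>n. delta2_IJ I J C D E F n (Trg a) f' g')
    (\<lambda>n. AMap (Fn n) (a, l)) (\<lambda>n. AMap (Fn n) (a, m)) (\<lambda>n. AMap (Fn n) (a, r))"
proof -
  note M = short_exact_map_ntr[OF assms(1)]
  note fg = short_exact_ntr[OF M(1)] and fg' = short_exact_ntr[OF M(2)] and a = ntr_setD[OF
      assms(2)]
  note id = functor_category.Ide_ntr[OF functor_category_IC a(1)] and id' =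
      functor_category.Ide_ntr[OF functor_category_IC a(2)]
  have ida: "Cmpt a k \<cdot>\<^bsub>C\<^esub> Cmpt (Ide (fun_cat I C) (Src a)) k = Cmpt (Ide (fun_cat I C) (Trg a)) k
      \<cdot>\<^bsub>C\<^esub> Cmpt a k" if "k \<in> Obj I" for k
    using a(4-6)[OF that] that by simp
  have sq: "Cmpt m k \<cdot>\<^bsub>D\<^esub> Cmpt f k = Cmpt f' k \<cdot>\<^bsub>D\<^esub> Cmpt l k" "Cmpt r k \<cdot>\<^bsub>D\<^esub> Cmpt g k = Cmpt g' k
      \<cdot>\<^bsub>D\<^esub> Cmpt m k" if "k \<in> Obj J" for k
    using functor_category.short_exact_map_pointwise[OF functor_category_JD assms(1) that]
    by (simp_all add: short_exact_map_def comm_square_def)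
  show ?thesis
    unfolding ladder_commutes_def
  proof (intro allI conjI)
    fix n
    show "comm_square EIJ (AMap (Fn n) (Ide (fun_cat I C) (Src a), f)) (AMap (Fn n) (a, l)) (AMap
        (Fn n) (a, m)) (AMap (Fn n) (Ide (fun_cat I C) (Trg a), f'))"
      by (rule Fn_comm_square[OF id assms(2) assms(2) id' fg(1) M(3,4) fg'(1)]) (use M sq ida in
          simp_all)
    show "comm_square EIJ (AMap (Fn n) (Ide (fun_cat I C) (Src a), g)) (AMap (Fn n) (a, m)) (AMap
        (Fn n) (a, r)) (AMap (Fn n) (Ide (fun_cat I C) (Trg a), g'))"
      by (rule Fn_comm_square[OF id assms(2) assms(2) id' fg(2) M(4,5) fg'(2)]) (use M sq ida in
          simp_all)
    show "comm_square EIJ (delta2_IJ I J C D E F n (Src a) f g) (AMap (Fn n) (a, r)) (AMap (Fn (n -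
        1)) (a, l)) (delta2_IJ I J C D E F n (Trg a) f' g')"
    proof (rule functor_category.comm_square_fun_catI[OF functor_category_EIJ])
      show "delta2_IJ I J C D E F n (Src a) f g \<in> ntr_set (prod_cat I J) E" "delta2_IJ I J C D E F n
          (Trg a) f' g' \<in> ntr_set (prod_cat I J) E"
        "AMap (Fn n) (a, r) \<in> ntr_set (prod_cat I J) E" "AMap (Fn (n - 1)) (a, l) \<in> ntr_set
            (prod_cat I J) E"
        by (rule delta2_IJ_ntr[OF M(1) a(1)] delta2_IJ_ntr[OF M(2) a(2)] Fn_ntr[OF assms(2) M(5)]
            Fn_ntr[OF assms(2) M(3)])+
      fix ki assume "ki \<in> Obj (prod_cat I J)"
      then obtain k i where ki: "ki = (k, i)" "k \<in> Obj I" "i \<in> Obj J" by auto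
      show "Cmpt (AMap (Fn (n - 1)) (a, l)) ki \<cdot> Cmpt (delta2_IJ I J C D E F n (Src a) f g) ki =
          Cmpt (delta2_IJ I J C D E F n (Trg a) f' g') ki \<cdot> Cmpt (AMap (Fn n) (a, r)) ki"
        using delta2_natural[OF functor_category.short_exact_map_pointwise[OF functor_category_JD
            assms(1) ki(3)] a(4)[OF ki(2)], of n]
          a(5,6)[OF ki(2)] ki by simp
    qed (use M in simp_all)
  qed
qed

end

theorem proposition3p3:
  fixes C :: "('oc, 'ac) addcat" and D :: "('od, 'ad) addcat" and E :: "('oe, 'ae) addcat"
    and F :: "('oc \<times> 'od, 'ac \<times> 'ad, 'oe, 'ae) ftr"
    and I :: "('oi, 'ai) cat" and J :: "('oj, 'aj) cat"
  assumes "abelian_category C" and "abelian_category D" and "abelian_category E"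
    and "enough_projectives C" and "enough_projectives D"
    and "additive_bifunctor C D E F" and "right_exact_bifunctor C D E F"
    and "category I" and "category J"
  shows
   "(\<forall>f g f' g' l m r a.
       short_exact_map (fun_cat I C) f g f' g' l m r \<and> a \<in> Arr (fun_cat J D) \<longrightarrow>
       (let EIJ = fun_cat (prod_cat I J) E;
            Fn = left_derived_IJ I J C D E F;
            \<delta> = delta1_IJ I J C D E F;
            A = Dom (fun_cat J D) a; B = Cod (fun_cat J D) a;
            idA = Ide (fun_cat J D) A; idB = Ide (fun_cat J D) B
        in long_exact EIJ (\<lambda>n. AMap (Fn n) (f, idA)) (\<lambda>n. AMap (Fn n) (g, idA)) (\<lambda>n. \<delta> n f g A) \<and>
           long_exact EIJ (\<lambda>n. AMap (Fn n) (f', idB)) (\<lambda>n. AMap (Fn n) (g', idB)) (\<lambda>n. \<delta> n f' g' B) \<and>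
           ladder_commutes EIJ
             (\<lambda>n. AMap (Fn n) (f, idA)) (\<lambda>n. AMap (Fn n) (g, idA)) (\<lambda>n. \<delta> n f g A)
             (\<lambda>n. AMap (Fn n) (f', idB)) (\<lambda>n. AMap (Fn n) (g', idB)) (\<lambda>n. \<delta> n f' g' B)
             (\<lambda>n. AMap (Fn n) (l, a)) (\<lambda>n. AMap (Fn n) (m, a)) (\<lambda>n. AMap (Fn n) (r, a)))) \<and>
    (\<forall>f g f' g' l m r a.
       short_exact_map (fun_cat J D) f g f' g' l m r \<and> a \<in> Arr (fun_cat I C) \<longrightarrow>
       (let EIJ = fun_cat (prod_cat I J) E;
            Fn = left_derived_IJ I J C D E F;
            \<delta> = delta2_IJ I J C D E F;
            A = Dom (fun_cat I C) a; B = Cod (fun_cat I C) a;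
            idA = Ide (fun_cat I C) A; idB = Ide (fun_cat I C) B
        in long_exact EIJ (\<lambda>n. AMap (Fn n) (idA, f)) (\<lambda>n. AMap (Fn n) (idA, g)) (\<lambda>n. \<delta> n A f g) \<and>
           long_exact EIJ (\<lambda>n. AMap (Fn n) (idB, f')) (\<lambda>n. AMap (Fn n) (idB, g')) (\<lambda>n. \<delta> n B f' g') \<and>
           ladder_commutes EIJ
             (\<lambda>n. AMap (Fn n) (idA, f)) (\<lambda>n. AMap (Fn n) (idA, g)) (\<lambda>n. \<delta> n A f g)
             (\<lambda>n. AMap (Fn n) (idB, f')) (\<lambda>n. AMap (Fn n) (idB, g')) (\<lambda>n. \<delta> n B f' g')
             (\<lambda>n. AMap (Fn n) (a, l)) (\<lambda>n. AMap (Fn n) (a, m)) (\<lambda>n. AMap (Fn n) (a, r))))"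
proof -
  interpret derived_functor_category C D E F I J
    by (intro derived_functor_category.intro bifunctor.intro bifunctor_axioms.intro assms)
  \<comment> \<open>Once \<open>Dom\<close> and \<open>Cod\<close> of an arrow in a functor category
    are rewritten to \<open>Src\<close> and \<open>Trg\<close>, each of the six conjuncts is an
    instance of one of the four lemmas on sequences and ladders.\<close>
  show ?thesis
    unfolding Let_def fun_cat_simps
    by (intro conjI allI impI; elim conjE;
        (rule long_exact_IJ_left long_exact_IJ_right ladder_left ladder_right;
         (assumption | erule short_exact_map_ntr(1) | erule short_exact_map_ntr(2) | erule ntr_setD(1) | erule ntr_setD(2))))
qed

end
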